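(* Let $\Omega\subset\mathbb{R}^m$ ($m\ge 2$) be a bounded open set with smooth boundary, let $1<p<m$, and let $\aleph:\Omega\times\mathbb{R}^m\to\mathbb{R}^m$ be a Carathéodory function such that for every $y\in\Omega$ and all $\hbar,\hslash\in\mathbb{R}^m$: (i) $\aleph(y,\hbar)\cdot\hbar\ge \alpha|\hbar|^p$ for some $\alpha>0$; (ii) $|\aleph(y,\hbar)|\le l(y)+\varpi|\hbar|^{p-1}$ for some $\varpi>0$ and some $l\in L^{p'}(\Omega)$, $p'=\frac{p}{p-1}$; (iii) $(\aleph(y,\hbar)-\aleph(y,\hslash))\cdot(\hbar-\hslash)>0$ whenever $\hbar\neq\hslash$. Let $0\le f\in L^{m/p}(\Omega)$, let $\lambda,g$ be nonnegative functions in $L^\infty(\partial\Omega)$, and let $s\ge 1$, $0<\gamma\le 1$, $\eta>0$. Then there exists a weak solution of $$-\mathrm{div}(\aleph(y,\nabla u))=\frac{f}{u^{\gamma}}\ \text{in }\Omega,\qquad \frac{\partial u}{\partial\sigma}+\lambda|u|^{p-2}u+|u|^{s-1}u=\frac{g}{u^{\eta}}\ \text{on }\partial\Omega,$$ i.e. a function $u\in W^{1,p}(\Omega)$ with $\frac{g}{u^\eta}\in L^1(\partial\Omega)$, $|u|^{s-1}u\in L^1(\partial\Omega)$, $\frac{f}{u^\gamma}\in L^1(\Omega)$ and $$\int_\Omega \aleph(y,\nabla u)\cdot\nabla\varphi\,dy+\int_{\partial\Omega}\lambda|u|^{p-2}u\varphi\,d\mathcal{H}^{m-1}+\int_{\partial\Omega}|u|^{s-1}u\varphi\,d\mathcal{H}^{m-1}=\int_\Omega\frac{f}{u^\gamma}\varphi\,dy+\int_{\partial\Omega}\frac{g}{u^\eta}\varphi\,d\mathcal{H}^{m-1}$$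 for all $\varphi\in W^{1,p}(\Omega)\cap L^\infty(\Omega)$.
   Context: $\sigma$ denotes the unit outward normal to $\partial\Omega$, $\mathcal{H}^{m-1}$ the $(m-1)$-dimensional Hausdorff measure; boundary values of Sobolev functions are understood as traces. The boundary condition is understood in the weak sense given by the integral identity in the claim. *)

theory Defs
  imports "HOL-Analysis.Analysis"
begin

fun Ck_on :: "nat \<Rightarrow> ('a::euclidean_space \<Rightarrow> real) \<Rightarrow> 'a set \<Rightarrow> bool" where
  "Ck_on 0 f S = continuous_on S f"
| "Ck_on (Suc k) f S =
     ((\<forall>x\<in>S. f differentiable (at x)) \<and>
      (\<forall>i\<in>Basis. Ck_on k (\<lambda>x. frechet_derivative f (at x) i) S))"

definition smooth_on :: "('a::euclidean_space \<Rightarrow> real) \<Rightarrow> 'a set \<Rightarrow> bool" where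
  "smooth_on f S = (\<forall>k. Ck_on k f S)"

definition grad :: "('a::euclidean_space \<Rightarrow> real) \<Rightarrow> 'a \<Rightarrow> 'a" where
  "grad f x = (\<Sum>i\<in>Basis. frechet_derivative f (at x) i *\<^sub>R i)"

definition smooth_boundary :: "'a::euclidean_space set \<Rightarrow> bool" where
  "smooth_boundary \<Omega> = (\<forall>x\<in>frontier \<Omega>. \<exists>U \<psi>. open U \<and> x \<in> U \<and> smooth_on \<psi> U \<and>
      (\<forall>y\<in>U. frechet_derivative \<psi> (at y) \<noteq> (\<lambda>_. 0)) \<and>
      \<Omega> \<inter> U = {y\<in>U. \<psi> y < 0})"

definition hausdorff_const :: "real \<Rightarrow> real" where
  "hausdorff_const d = pi powr (d / 2) / Gamma (d / 2 + 1)"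

definition hausdorff_pre :: "real \<Rightarrow> real \<Rightarrow> 'a::euclidean_space set \<Rightarrow> ennreal" where
  "hausdorff_pre d \<delta> A =
     (INF C \<in> {C :: nat \<Rightarrow> 'a set. A \<subseteq> (\<Union>i. C i) \<and> (\<forall>i. bounded (C i) \<and> diameter (C i) \<le> \<delta>)}.
        (\<Sum>i. ennreal (hausdorff_const d * (diameter (C i) / 2) powr d)))"

definition hausdorff_outer :: "real \<Rightarrow> 'a::euclidean_space set \<Rightarrow> ennreal" where
  "hausdorff_outer d A = (SUP \<delta>\<in>{0<..}. hausdorff_pre d \<delta> A)"

definition hausdorff_measure :: "real \<Rightarrow> 'a::euclidean_space measure" where
  "hausdorff_measure d = measure_of UNIV (sets borel) (hausdorff_outer d)"

definition boundary_measure :: "'a::euclidean_space set \<Rightarrow> 'a measure" where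
  "boundary_measure \<Omega> = restrict_space (hausdorff_measure (real DIM('a) - 1)) (frontier \<Omega>)"

definition Lp :: "'b measure \<Rightarrow> real \<Rightarrow> ('b \<Rightarrow> real) \<Rightarrow> bool" where
  "Lp M p f = (f \<in> borel_measurable M \<and> integrable M (\<lambda>x. \<bar>f x\<bar> powr p))"

definition Linf :: "'b measure \<Rightarrow> ('b \<Rightarrow> real) \<Rightarrow> bool" where
  "Linf M f = (f \<in> borel_measurable M \<and> (\<exists>C. AE x in M. \<bar>f x\<bar> \<le> C))"

definition test_fun :: "'a::euclidean_space set \<Rightarrow> ('a \<Rightarrow> real) \<Rightarrow> bool" where
  "test_fun \<Omega> \<phi> = (smooth_on \<phi> UNIV \<and> compact (closure {x. \<phi> x \<noteq> 0}) \<and> closure {x. \<phi> x \<noteq> 0} \<subseteq> \<Omega>)"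

definition weak_grad :: "'a::euclidean_space set \<Rightarrow> ('a \<Rightarrow> real) \<Rightarrow> ('a \<Rightarrow> 'a) \<Rightarrow> bool" where
  "weak_grad \<Omega> u G = (\<forall>\<phi>. test_fun \<Omega> \<phi> \<longrightarrow> (\<forall>i\<in>Basis.
      (\<integral>y. u y * (grad \<phi> y \<bullet> i) \<partial>lebesgue_on \<Omega>) = - (\<integral>y. (G y \<bullet> i) * \<phi> y \<partial>lebesgue_on \<Omega>)))"

definition W1p :: "'a::euclidean_space set \<Rightarrow> real \<Rightarrow> ('a \<Rightarrow> real) \<Rightarrow> ('a \<Rightarrow> 'a) \<Rightarrow> bool" where
  "W1p \<Omega> p u G = (Lp (lebesgue_on \<Omega>) p u \<and> G \<in> borel_measurable (lebesgue_on \<Omega>) \<and>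
      integrable (lebesgue_on \<Omega>) (\<lambda>y. norm (G y) powr p) \<and> weak_grad \<Omega> u G)"

text \<open>v is the trace on the boundary of u \<in> W^{1,p}(\<Omega>) (with weak gradient G), defined by
  density of C_c^\<infinity>(R^m) restrictions: v is the L^p(\<partial>\<Omega>)-limit of the boundary values of
  smooth approximants converging to u in W^{1,p}(\<Omega>).\<close>
definition is_trace :: "'a::euclidean_space set \<Rightarrow> real \<Rightarrow> ('a \<Rightarrow> real) \<Rightarrow> ('a \<Rightarrow> 'a) \<Rightarrow> ('a \<Rightarrow> real) \<Rightarrow> bool" where
  "is_trace \<Omega> p u G v = (v \<in> borel_measurable (boundary_measure \<Omega>) \<and>
     (\<exists>w :: nat \<Rightarrow> 'a \<Rightarrow> real.
        (\<forall>k. smooth_on (w k) UNIV \<and> compact (closure {x. w k x \<noteq> 0})) \<and>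
        (\<lambda>k. \<integral>\<^sup>+ y. ennreal (\<bar>w k y - u y\<bar> powr p) \<partial>lebesgue_on \<Omega>) \<longlonglongrightarrow> 0 \<and>
        (\<lambda>k. \<integral>\<^sup>+ y. ennreal (norm (grad (w k) y - G y) powr p) \<partial>lebesgue_on \<Omega>) \<longlonglongrightarrow> 0 \<and>
        (\<lambda>k. \<integral>\<^sup>+ y. ennreal (\<bar>w k y - v y\<bar> powr p) \<partial>boundary_measure \<Omega>) \<longlonglongrightarrow> 0))"

definition caratheodory :: "'a::euclidean_space set \<Rightarrow> ('a \<Rightarrow> 'a \<Rightarrow> 'a) \<Rightarrow> bool" where
  "caratheodory \<Omega> A = ((\<forall>h. (\<lambda>y. A y h) \<in> borel_measurable (lebesgue_on \<Omega>)) \<and>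
      (AE y in lebesgue_on \<Omega>. continuous_on UNIV (A y)))"

definition sing_quot :: "real \<Rightarrow> real \<Rightarrow> real \<Rightarrow> real" where
  "sing_quot c t e = (if c = 0 then 0 else c / (t powr e))"

definition opow :: "real \<Rightarrow> real \<Rightarrow> real" where
  "opow r t = \<bar>t\<bar> powr r * t"

end

theory Submission
  imports Defs
begin

text \<open>
  Compactness (Rellich, weak limits, Brouwer) is avoided altogether. On smooth functions that are
  positive on the closure of the domain the equation is a monotone operator. Approximate solutions of
  the Minty variational inequality on a ball of the energy exist because a matrix game with
  nonnegative symmetric part has nonnegative value, and uniform convexity of the energy makes them a
  Cauchy sequence. In the limit one tests with directions that keep the approximants positive:
  the direction \<open>1 - u\<close> gives an energy bound independent of the ball, the direction 1 gives (by Fatou)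
  integrability of the singular terms and positivity of the solution where the data are positive,
  and \<open>- u damp a u\<close> shows that the gradient vanishes where \<open>u = 0\<close>. Testing with \<open>\<phi>\<close> and with
  \<open>- \<phi> (1 - damp a u)\<close> then yields both inequalities of the weak formulation. The required embedding
  and trace inequalities are proved along segments and cones, locally near the smooth boundary.
\<close>

text \<open>The singular terms enter the operator as -t^(-q), which is increasing, so they preserve
  monotonicity. They are bounded only away from 0, so Minty's inequality is available only at smooth
  functions with a positive lower bound, whereas the limit may vanish. The usual two-sided
  perturbation of the limit is then illegal; only directions that keep the approximants nonnegative
  can be used, and the zero set needs an argument of its own.

  The energy joins the p-th power of the gradient to the boundary power s + 1. Pairing with f needs
  the exponent m/(m-p), which lies strictly below mp/(m-p) because p > 1, so a subcritical embedding
  suffices.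

  The radius of the energy ball lies strictly beyond the a priori bound, which makes the constraint
  inactive for small steps. A function, its gradient and its trace are limits of the same smooth
  functions and are carried together as a triple.\<close>

abbreviation (input) grad_int where
 "grad_int \<Omega> w p \<equiv> \<integral>\<^sup>+z\<in>\<Omega>. ennreal (norm (grad w z) powr p) \<partial>lborel"

abbreviation (input) powr_int where
 "powr_int \<Omega> w p \<equiv> \<integral>\<^sup>+z\<in>\<Omega>. ennreal (\<bar>w z\<bar> powr p) \<partial>lborel"

abbreviation (input) abs_int where
 "abs_int \<Omega> w \<equiv> \<integral>\<^sup>+z\<in>\<Omega>. ennreal \<bar>w z\<bar> \<partial>lborel"

abbreviation (input) seq_tendsto ("((_)/ ----> (_))" [60, 60] 60) where
 "(X :: nat \<Rightarrow> 'a::topological_space) ----> L \<equiv> X \<longlonglongrightarrow> L"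


section \<open>Calculus of C^k and smooth functions on the whole space\<close>

lemma Ck_on_SucD: "Ck_on (Suc k) f UNIV ==> Ck_on k f UNIV"
proof (induction k arbitrary: f)
 case 0
 then show ?case
  by (auto simp: intro!: continuous_at_imp_continuous_on differentiable_imp_continuous_within)
next
 case (Suc k)
 then show ?case by (metis Ck_on.simps(2))
qed

text \<open>Any explicit derivative may stand in for \<open>frechet_derivative\<close>, by
  uniqueness of derivatives. The inductions below can therefore exhibit a formula for the derivative
  instead of computing with an operator defined by choice.\<close>

lemma Ck_on_Suc_iff:
 "Ck_on (Suc k) f UNIV \<longleftrightarrow> (EX f'. (ALL x. (f has_derivative f' x) (at x)) \<and> (\<forall>i\<in>Basis. Ck_on k (%x. f' x i) UNIV))"
proof
 assume "Ck_on (Suc k) f UNIV"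
 then show "EX f'. (ALL x. (f has_derivative f' x) (at x)) \<and> (\<forall>i\<in>Basis. Ck_on k (%x. f' x i) UNIV)"
  by (intro exI[of _ "%x. frechet_derivative f (at x)"]) (auto simp: frechet_derivative_works)
next
 assume "EX f'. (ALL x. (f has_derivative f' x) (at x)) \<and> (\<forall>i\<in>Basis. Ck_on k (%x. f' x i) UNIV)"
 then obtain f' where f': "!!x. (f has_derivative f' x) (at x)" "!!i. i\<in>Basis ==> Ck_on k (%x. f' x i) UNIV"
  by blast
 have "frechet_derivative f (at x) = f' x" for x
  using f'(1)[of x] by (metis frechet_derivative_at)
 with f' show "Ck_on (Suc k) f UNIV" by (auto simp: differentiable_def)
qed

lemma Ck_on_imp_continuous: "Ck_on k f UNIV ==> continuous_on UNIV f"
 by (induction k) (auto dest: Ck_on_SucD simp del: Ck_on.simps(2))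

lemma Ck_on_const: "Ck_on k (%x. c) UNIV"
proof (induction k arbitrary: c)
 case (Suc k)
 then show ?case unfolding Ck_on_Suc_iff by (intro exI[of _ "%x h. 0"]) auto
qed auto

lemma Ck_on_add: "Ck_on k f UNIV ==> Ck_on k g UNIV ==> Ck_on k (%x. f x + g x) UNIV"
proof (induction k arbitrary: f g)
 case (Suc k)
 obtain f' g' where "!!x. (f has_derivative f' x) (at x)" "!!i. i\<in>Basis ==> Ck_on k (%x. f' x i) UNIV"
  "!!x. (g has_derivative g' x) (at x)" "!!i. i\<in>Basis ==> Ck_on k (%x. g' x i) UNIV"
  using Suc.prems unfolding Ck_on_Suc_iff by blast
 then show ?case unfolding Ck_on_Suc_iff
  by (intro exI[of _ "%x h. f' x h + g' x h"]) (auto intro!: derivative_intros Suc.IH)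
qed (auto intro: continuous_intros)

lemma Ck_on_mult: "Ck_on k f UNIV ==> Ck_on k g UNIV ==> Ck_on k (%x. f x * g x) UNIV"
proof (induction k arbitrary: f g)
 case (Suc k)
 obtain f' g' where "!!x. (f has_derivative f' x) (at x)" "!!i. i\<in>Basis ==> Ck_on k (%x. f' x i) UNIV"
  "!!x. (g has_derivative g' x) (at x)" "!!i. i\<in>Basis ==> Ck_on k (%x. g' x i) UNIV"
  using Suc.prems unfolding Ck_on_Suc_iff by blast
 moreover have "Ck_on k f UNIV" "Ck_on k g UNIV" using Suc.prems by (auto dest: Ck_on_SucD simp del: Ck_on.simps(2))
 ultimately show ?case unfolding Ck_on_Suc_iff
  by (intro exI[of _ "%x h. f x * g' x h + f' x h * g x"]) (auto intro!: has_derivative_mult Ck_on_add Suc.IH)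
qed (auto intro: continuous_intros)

lemma Ck_on_inverse:
 assumes "!!x. f x ~= 0"
 shows "Ck_on k f UNIV ==> Ck_on k (%x. inverse (f x)) UNIV"
proof (induction k)
 case 0
 then show ?case using assms by (auto intro!: continuous_intros)
next
 case (Suc k)
 obtain f' where f': "!!x. (f has_derivative f' x) (at x)" "!!i. i\<in>Basis ==> Ck_on k (%x. f' x i) UNIV"
  using Suc.prems unfolding Ck_on_Suc_iff by blast
 have "Ck_on k (%x. inverse (f x)) UNIV" using Suc by (auto dest: Ck_on_SucD simp del: Ck_on.simps(2))
 then have "Ck_on k (%x. (-1) * (inverse (f x) * f' x i * inverse (f x))) UNIV" if "i \<in> Basis" for i
  using f'(2)[OF that] by (intro Ck_on_mult Ck_on_const)
 then show ?case unfolding Ck_on_Suc_iff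
  using f' assms
  by (intro exI[of _ "%x h. - (inverse (f x) * f' x h * inverse (f x))"]) (auto intro!: has_derivative_inverse)
qed

lemma Ck_on_compose:
 fixes th :: "real => real"
 shows "Ck_on k th UNIV ==> Ck_on k w UNIV ==> Ck_on k (%x. th (w x)) UNIV"
proof (induction k arbitrary: th)
 case 0
 then show ?case by (auto intro: continuous_on_compose2)
next
 case (Suc k)
 obtain t' w' where d: "!!x. (th has_derivative t' x) (at x)" "!!i. i\<in>Basis ==> Ck_on k (%x. t' x i) UNIV"
  "!!x. (w has_derivative w' x) (at x)" "!!i. i\<in>Basis ==> Ck_on k (%x. w' x i) UNIV"
  using Suc.prems unfolding Ck_on_Suc_iff by blast
 \<comment> \<open>The derivative of a function of one real variable is multiplication by
   \<open>t' x 1\<close>. The chain rule thus becomes a product of two functions that the induction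
   hypothesis and \<open>Ck_on_mult\<close> can handle.\<close>
 have lin: "t' x h = h * t' x 1" for x h
  using has_derivative_linear[OF d(1)[of x]] linear_scale[of "t' x" h 1] by simp
 have "Ck_on k w UNIV" using Suc.prems by (auto dest: Ck_on_SucD simp del: Ck_on.simps(2))
 then have "Ck_on k (%x. t' (w x) 1) UNIV" using Suc.IH[OF d(2)[of 1]] by simp
 then have "Ck_on k (%x. t' (w x) (w' x i)) UNIV" if "i \<in> Basis" for i
  by (subst lin) (intro Ck_on_mult d that)
 moreover have "((%x. th (w x)) has_derivative (%h. t' (w x) (w' x h))) (at x)" for x
  by (rule has_derivative_compose[OF d(3) d(1), unfolded o_def])
 ultimately show ?case unfolding Ck_on_Suc_iff by (intro exI[of _ "%x h. t' (w x) (w' x h)"]) auto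
qed

lemma smooth_on_simps:
 "smooth_on (%x. c) UNIV"
 "smooth_on f UNIV ==> smooth_on g UNIV ==> smooth_on (%x. f x + g x) UNIV"
 "smooth_on f UNIV ==> smooth_on g UNIV ==> smooth_on (%x. f x * g x) UNIV"
 by (auto simp: smooth_on_def Ck_on_const Ck_on_add Ck_on_mult)

lemma smooth_on_inverse: "(!!x. f x ~= 0) ==> smooth_on f UNIV ==> smooth_on (%x. inverse (f x)) UNIV"
 by (auto simp: smooth_on_def Ck_on_inverse)

lemma smooth_on_compose:
 fixes th :: "real => real"
 shows "smooth_on th UNIV ==> smooth_on w UNIV ==> smooth_on (%x. th (w x)) UNIV"
 by (auto simp: smooth_on_def Ck_on_compose)

lemma smooth_on_inner: "smooth_on (%x::'a::euclidean_space. x \<bullet> i) UNIV"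
 unfolding smooth_on_def
proof
 fix k show "Ck_on k (%x::'a. x \<bullet> i) UNIV"
 proof (cases k)
  case (Suc m)
  show ?thesis unfolding Suc Ck_on_Suc_iff
   by (intro exI[of _ "%x h. h \<bullet> i"]) (auto intro!: derivative_eq_intros Ck_on_const)
 qed (auto intro!: continuous_intros)
qed

lemma smooth_on_sum:
 "(!!i. i \<in> I ==> smooth_on (f i) UNIV) ==> smooth_on (%x. \<Sum>i\<in>I. f i x) UNIV"
 by (induction I rule: infinite_finite_induct) (auto intro: smooth_on_simps)

lemma smooth_on_inner_self: "smooth_on (%x::'a::euclidean_space. x \<bullet> x) UNIV"
proof -
 have "smooth_on (%x::'a. \<Sum>i\<in>Basis. (x \<bullet> i) * (x \<bullet> i)) UNIV"
  by (intro smooth_on_sum smooth_on_simps smooth_on_inner)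
 then show ?thesis by (simp add: euclidean_inner[symmetric])
qed

lemma smooth_on_ident_real: "smooth_on (%t::real. t) UNIV"
 using smooth_on_inner[of "1::real"] by simp

section \<open>Flat functions, a smooth step, cutoffs and truncations\<close>

lemma poly_exp_tendsto_0: "((%x::real. poly P x * exp (- x)) \<longlongrightarrow> 0) at_top"
proof (induction P)
 case (pCons a P)
 have *: "((%x::real. x ^ k * exp (- x)) \<longlongrightarrow> 0) at_top" for k
  using tendsto_power_div_exp_0[of k] by (simp add: exp_minus divide_inverse)
 have "((%x::real. poly Q x * exp (- x)) \<longlongrightarrow> 0) at_top" for Q
 proof -
  have "((%x::real. \<Sum>i\<le>degree Q. coeff Q i * (x ^ i * exp (- x))) \<longlongrightarrow> 0) at_top"
   by (rule tendsto_null_sum) (use * tendsto_mult_right_zero in blast)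
  then show ?thesis by (simp add: poly_altdef sum_distrib_right mult.assoc)
 qed
 then show ?case .
qed auto

text \<open>The polynomial factor makes this family closed under differentiation: with x = 1/t, the
  derivative of P(x) exp(-x) with respect to t is x^2 (P(x) - P'(x)) exp(-x). Smoothness then
  follows by induction on the order, with \<open>P\<close> arbitrary.\<close>

definition flat_exp :: "real poly => real => real" where
 "flat_exp P t = (if t <= 0 then 0 else poly P (1 / t) * exp (- (1 / t)))"

lemma flat_exp_has_derivative:
 "(flat_exp P has_real_derivative flat_exp ([:0, 0, 1:] * (P - pderiv P)) t) (at t)"
proof -
 consider "t < 0" | "t > 0" | "t = 0" by linarith
 then show ?thesis
 proof cases
  case 1
  have "((%t. 0) has_real_derivative 0) (at t)" by simp
  then have "(flat_exp P has_real_derivative 0) (at t)"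
   by (rule has_field_derivative_transform_within_open[where S="{..<0}"])
     (use 1 in "auto simp: flat_exp_def")
  then show ?thesis using 1 by (simp add: flat_exp_def)
 next
  case 2
  have "((%t. poly P (1 / t) * exp (- (1 / t))) has_real_derivative
    poly ([:0, 0, 1:] * (P - pderiv P)) (1/t) * exp (- (1/t))) (at t)"
   using 2 by (auto intro!: derivative_eq_intros DERIV_chain2[of "poly P"] poly_DERIV
     simp: field_simps power2_eq_square)
  then have "(flat_exp P has_real_derivative poly ([:0, 0, 1:] * (P - pderiv P)) (1/t) * exp (- (1/t))) (at t)"
   by (rule has_field_derivative_transform_within_open[where S="{0<..}"])
     (use 2 in "auto simp: flat_exp_def")
  then show ?thesis using 2 by (simp add: flat_exp_def)
 next
  case 3
  \<comment> \<open>The right difference quotient at 0 is x P(x) exp(-x) with x = 1/h, and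
    \<open>pCons 0 P\<close> is the polynomial x P(x).\<close>
  have r: "((%h. poly (pCons 0 P) (inverse h) * exp (- inverse h)) \<longlongrightarrow> 0) (at_right (0::real))"
   by (rule filterlim_compose[OF poly_exp_tendsto_0 filterlim_inverse_at_top_right])
  have "((%h. (flat_exp P (0+h) - flat_exp P 0) / h) \<longlongrightarrow> 0) (at_right 0)"
   by (rule Lim_transform_eventually[OF r])
     (auto simp: eventually_at_right_field flat_exp_def field_simps intro!: exI[of _ 1])
  moreover have "((%h. (flat_exp P (0+h) - flat_exp P 0) / h) \<longlongrightarrow> 0) (at_left 0)"
   by (rule Lim_transform_eventually[OF tendsto_const])
     (auto simp: eventually_at_left_field flat_exp_def intro!: exI[of _ "-1"])
  ultimately have "((%h. (flat_exp P (0+h) - flat_exp P 0) / h) \<longlongrightarrow> 0) (at 0)"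
   by (simp add: filterlim_at_split)
  then show ?thesis using 3 by (simp add: DERIV_def) (simp add: flat_exp_def)
 qed
qed

lemma smooth_on_flat_exp: "smooth_on (flat_exp P) UNIV"
 unfolding smooth_on_def
proof
 fix k show "Ck_on k (flat_exp P) UNIV"
 proof (induction k arbitrary: P)
  case 0
  then show ?case
   by (auto intro!: DERIV_continuous_on has_field_derivative_at_within[OF flat_exp_has_derivative])
 next
  case (Suc k)
  have "Ck_on k (flat_exp ([:0, 0, 1:] * (P - pderiv P))) UNIV"
   by (rule Suc)
  then show ?case unfolding Ck_on_Suc_iff
   using flat_exp_has_derivative[of P]
   by (intro exI[of _ "%x h. flat_exp ([:0, 0, 1:] * (P - pderiv P)) x * h"])
     (auto simp: has_field_derivative_def)
 qed
qed

text \<open>The denominator never vanishes because t and 1 - t cannot both be nonpositive.\<close>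

definition smooth_step :: "real => real" where
 "smooth_step t = flat_exp 1 t * inverse (flat_exp 1 t + flat_exp 1 (1 + (-1) * t))"

lemma flat_exp_1: "flat_exp 1 t >= 0" "t > 0 ==> flat_exp 1 t > 0" "t <= 0 ==> flat_exp 1 t = 0"
 by (auto simp: flat_exp_def)

lemma flat_exp_1_sum_pos: "flat_exp 1 t + flat_exp 1 (1 + (-1) * t) > 0"
 using flat_exp_1[of t] flat_exp_1[of "1 + (-1) * t"] by (cases "t > 0") (auto intro: add_pos_nonneg)

lemma smooth_on_smooth_step: "smooth_on smooth_step UNIV"
 unfolding smooth_step_def[abs_def]
 using flat_exp_1_sum_pos
 by (intro smooth_on_simps smooth_on_inverse smooth_on_flat_exp smooth_on_compose[of "flat_exp 1"] smooth_on_ident_real)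
   (metis less_irrefl)

lemma smooth_step_eq: "t <= 0 ==> smooth_step t = 0" "t >= 1 ==> smooth_step t = 1"
proof -
 show "smooth_step t = 0" if "t <= 0" using that by (simp add: smooth_step_def flat_exp_1)
 show "smooth_step t = 1" if "t >= 1"
  using that flat_exp_1(2)[of t] flat_exp_1(3)[of "1 + (-1) * t"] by (simp add: smooth_step_def)
qed

section \<open>Compactly supported smooth functions and their gradients\<close>

definition cpt_smooth :: "('a::euclidean_space => real) => bool" where
 "cpt_smooth w \<longleftrightarrow> smooth_on w UNIV \<and> compact (closure {x. w x ~= 0})"

lemma differentiable_has_grad:
 assumes "w differentiable (at x)"
 shows "(w has_derivative (%h. grad w x \<bullet> h)) (at x)"
proof -
 have d: "(w has_derivative frechet_derivative w (at x)) (at x)"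
  using assms by (simp add: frechet_derivative_works)
 have "frechet_derivative w (at x) h = grad w x \<bullet> h" for h
 proof -
  have "frechet_derivative w (at x) h = frechet_derivative w (at x) (\<Sum>i\<in>Basis. (h \<bullet> i) *\<^sub>R i)"
   by (simp add: euclidean_representation)
  also have "... = grad w x \<bullet> h"
   using has_derivative_linear[OF d]
   by (simp add: linear_sum linear_scale grad_def inner_sum_left inner_sum_right inner_commute[of _ h] mult.commute)
  finally show ?thesis .
 qed
 then have "frechet_derivative w (at x) = (%h. grad w x \<bullet> h)" by blast
 then show ?thesis using d by simp
qed

lemma smooth_on_has_derivative:
 assumes "smooth_on w UNIV"
 shows "(w has_derivative (%h. grad w x \<bullet> h)) (at x)"
proof -
 have "Ck_on (Suc 0) w UNIV" using assms by (simp add: smooth_on_def del: Ck_on.simps)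
 then show ?thesis by (intro differentiable_has_grad) simp
qed

lemma grad_eqI:
 assumes "(w has_derivative (%h. G \<bullet> h)) (at x)"
 shows "grad w x = G"
proof -
 have "frechet_derivative w (at x) = (%h. G \<bullet> h)" using assms by (metis frechet_derivative_at)
 then show ?thesis by (simp add: grad_def euclidean_representation)
qed

lemma grad_cong_open:
 assumes "open U" "x \<in> U" "!!y. y \<in> U ==> v y = w y" "smooth_on w UNIV"
 shows "grad v x = grad w x"
 by (rule grad_eqI, rule has_derivative_transform_within_open[OF smooth_on_has_derivative[OF assms(4)] assms(1,2)])
   (use assms in auto)

lemma grad_const: "grad (%x. c) x = 0"
 by (rule grad_eqI) auto

lemma grad_add:
 assumes "smooth_on v UNIV" "smooth_on w UNIV"
 shows "grad (%x. v x + w x) x = grad v x + grad w x"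
 by (rule grad_eqI) (auto simp: inner_add_left intro!: has_derivative_add smooth_on_has_derivative assms)

lemma grad_mult:
 assumes "smooth_on v UNIV" "smooth_on w UNIV"
 shows "grad (%x. v x * w x) x = v x *\<^sub>R grad w x + w x *\<^sub>R grad v x"
 by (rule grad_eqI)
   (auto simp: inner_add_left intro!: derivative_eq_intros smooth_on_has_derivative assms)

lemma grad_scale:
 assumes "smooth_on w UNIV"
 shows "grad (%x. c * w x) x = c *\<^sub>R grad w x"
 by (rule grad_eqI) (auto intro!: derivative_eq_intros smooth_on_has_derivative assms)

lemma grad_compose:
 assumes "(th has_real_derivative d) (at (w x))" "smooth_on w UNIV"
 shows "grad (%x. th (w x)) x = d *\<^sub>R grad w x"
 using has_derivative_compose[OF smooth_on_has_derivative[OF assms(2)] assms(1)[unfolded has_field_derivative_def]]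
 by (intro grad_eqI) (simp add: o_def)

lemma smooth_on_continuous: "smooth_on w UNIV ==> continuous_on UNIV w"
 by (auto simp: smooth_on_def dest: Ck_on_imp_continuous)

lemma smooth_on_continuous_grad:
 assumes "smooth_on w UNIV" shows "continuous_on UNIV (grad w)"
proof -
 have "Ck_on (Suc 0) w UNIV" using assms by (simp add: smooth_on_def del: Ck_on.simps)
 then show ?thesis unfolding grad_def[abs_def]
  by (auto intro!: continuous_intros)
qed

lemma closure_support_subset:
 fixes v :: "'a::euclidean_space => real"
 assumes "compact (closure {x. w x ~= 0})" "!!x. w x = 0 ==> v x = 0"
 shows "compact (closure {x. v x ~= 0})"
 using assms by (auto simp: compact_closure intro: bounded_subset)

lemma cpt_smooth_add:
 assumes "cpt_smooth v" "cpt_smooth w" shows "cpt_smooth (%x. v x + w x)"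
proof -
 have "bounded ({x. v x ~= 0} Un {x. w x ~= 0})"
  using assms by (simp add: cpt_smooth_def compact_closure)
 then have "bounded {x. v x + w x ~= 0}" by (rule bounded_subset) auto
 then have "compact (closure {x. v x + w x ~= 0})" by (simp add: compact_closure)
 then show ?thesis using assms by (simp add: cpt_smooth_def smooth_on_simps)
qed

lemma cpt_smooth_mult:
 assumes "smooth_on v UNIV" "cpt_smooth w" shows "cpt_smooth (%x. v x * w x)"
 using assms closure_support_subset[of w "%x. v x * w x"] unfolding cpt_smooth_def by (simp add: smooth_on_simps(3))

lemma cpt_smooth_scale: "cpt_smooth w ==> cpt_smooth (%x. c * w x)"
 by (intro cpt_smooth_mult smooth_on_simps)

lemma cpt_smooth_diff:
 assumes "cpt_smooth v" "cpt_smooth w" shows "cpt_smooth (%x. v x - w x)"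
 using cpt_smooth_add[OF assms(1) cpt_smooth_scale[OF assms(2), of "-1"]] by simp

lemma grad_eq_0_outside:
 assumes "x \<notin> closure {x. w x ~= 0}" shows "grad w x = 0"
proof -
 have "grad w x = grad (%x. 0) x"
  by (rule grad_cong_open[of "- closure {x. w x ~= 0}"])
    (use assms closure_subset[of "{x. w x ~= 0}"] in "auto simp: smooth_on_simps")
 then show ?thesis by (simp add: grad_const)
qed

lemma cpt_smooth_bounded:
 assumes "cpt_smooth w"
 shows "\<exists>C>0. ALL x. \<bar>w x\<bar> <= C \<and> norm (grad w x) <= C"
proof -
 let ?K = "closure {x. w x ~= 0}"
 have s: "smooth_on w UNIV" and K: "compact ?K" using assms by (auto simp: cpt_smooth_def)
 have "compact (w ` ?K)"
  by (rule compact_continuous_image[OF continuous_on_subset[OF smooth_on_continuous[OF s]] K]) simp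
 moreover have "compact (grad w ` ?K)"
  by (rule compact_continuous_image[OF continuous_on_subset[OF smooth_on_continuous_grad[OF s]] K]) simp
 ultimately have "bounded (w ` ?K)" "bounded (grad w ` ?K)" by (simp_all add: compact_imp_bounded)
 then obtain a b where ab: "!!x. x \<in> ?K ==> \<bar>w x\<bar> <= a" "!!x. x \<in> ?K ==> norm (grad w x) <= b"
  unfolding bounded_iff by auto
 have out: "w x = 0" "grad w x = 0" if "x \<notin> ?K" for x
  using that grad_eq_0_outside[OF that] closure_subset[of "{x. w x ~= 0}"] by blast+
 have "\<bar>w x\<bar> <= max 1 (max a b) \<and> norm (grad w x) <= max 1 (max a b)" for x
 proof (cases "x \<in> ?K")
  case True
  with ab[of x] show ?thesis by linarith
 next
  case False
  with out[of x] show ?thesis by simp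
 qed
 then show ?thesis by (intro exI[of _ "max 1 (max a b)"]) auto
qed

text \<open>Supplies a compactly supported stand-in for the constant 1 on a bounded set; constants
  themselves are not admissible approximants.\<close>

lemma smooth_cutoff:
 fixes S :: "'a::euclidean_space set"
 assumes "bounded S"
 shows "EX ct. cpt_smooth ct \<and> (\<forall>x\<in>S. ct x = 1 \<and> grad ct x = 0)"
proof -
 obtain R where R: "R > 0" "S <= ball 0 R" using bounded_subset_ballD[OF assms, of 0] by blast
 \<comment> \<open>The argument 2 - |x|^2/R^2 is at least 1 on the ball of radius R and nonpositive
   once |x|^2 is at least 2 R^2. Using \<open>x \<bullet> x\<close> instead of the norm keeps the
   function smooth at 0.\<close>
 define ct where "ct = (%x::'a. smooth_step (2 + (- inverse (R\<^sup>2)) * (x \<bullet> x)))"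
 have sm: "smooth_on ct UNIV" unfolding ct_def
  by (rule smooth_on_compose[OF smooth_on_smooth_step]) (intro smooth_on_simps smooth_on_inner_self)
 have out: "ct x = 0" if "x \<notin> cball 0 (2 * R)" for x
 proof -
  have "(2 * R)\<^sup>2 <= (norm x)\<^sup>2" using that R(1) by (intro power_mono) (auto simp: dist_norm)
  then have "4 * R\<^sup>2 <= x \<bullet> x" unfolding power2_norm_eq_inner power_mult_distrib by simp
  then have "2 * R\<^sup>2 <= x \<bullet> x" using zero_le_power2[of R] by linarith
  then have "2 <= (x \<bullet> x) / R\<^sup>2" using R(1) by (simp add: pos_le_divide_eq)
  then have "2 <= inverse (R\<^sup>2) * (x \<bullet> x)" by (simp add: divide_inverse mult.commute)
  then show ?thesis unfolding ct_def by (intro smooth_step_eq) simp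
 qed
 have one: "ct x = 1" if "x \<in> ball 0 R" for x
 proof -
  have "(norm x)\<^sup>2 <= R\<^sup>2" using that R(1) by (intro power_mono) (auto simp: dist_norm)
  then have "x \<bullet> x <= R\<^sup>2" unfolding power2_norm_eq_inner .
  then have "inverse (R\<^sup>2) * (x \<bullet> x) <= 1"
   using R(1) by (simp add: field_simps)
  then show ?thesis unfolding ct_def by (intro smooth_step_eq) simp
 qed
 have "{x. ct x ~= 0} <= cball 0 (2 * R)" using out by blast
 then have "compact (closure {x. ct x ~= 0})"
  unfolding compact_closure using bounded_cball bounded_subset by blast
 moreover have "grad ct x = 0" if "x \<in> ball 0 R" for x
  using grad_cong_open[of "ball 0 R" x ct "%x. 1"] that one by (simp add: smooth_on_simps grad_const)
 ultimately show ?thesis using sm one R(2) by (intro exI[of _ ct]) (auto simp: cpt_smooth_def)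
qed

lemma smooth_on_real_deriv:
 fixes th :: "real => real"
 assumes "smooth_on th UNIV"
 shows "(th has_real_derivative deriv th t) (at t)" "continuous_on UNIV (deriv th)" "grad th t = deriv th t"
proof -
 have g: "(th has_real_derivative grad th t) (at t)" for t
  using smooth_on_has_derivative[OF assms, of t] by (simp add: has_field_derivative_def)
 then have "grad th t = deriv th t" for t by (metis DERIV_imp_deriv)
 then have "grad th = deriv th" by (rule ext)
 then show "(th has_real_derivative deriv th t) (at t)" "continuous_on UNIV (deriv th)" "grad th t = deriv th t"
  using g smooth_on_continuous_grad[OF assms] by auto
qed

text \<open>Composing with such a function turns approximants of a bounded function into uniformly
  bounded ones without changing the limit. The cutoff equals 1 on a ball of radius M + 1, so that
  also the derivative is 1 on the closed interval.\<close>

lemma smooth_truncation: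
 fixes M :: real
 assumes "M > 0"
 shows "\<exists>th C. smooth_on th UNIV \<and> th 0 = 0 \<and> (ALL t. \<bar>th t\<bar> <= C \<and> \<bar>deriv th t\<bar> <= C) \<and> 
  (ALL t. \<bar>t\<bar> <= M --> th t = t \<and> deriv th t = 1)"
proof -
 obtain ct where ct: "cpt_smooth ct" "!!t::real. t \<in> ball 0 (M + 1) ==> ct t = 1 \<and> grad ct t = 0"
  using smooth_cutoff[OF bounded_ball] by blast
 define th where "th = (%t. t * ct t)"
 have c: "cpt_smooth th" unfolding th_def by (intro cpt_smooth_mult ct smooth_on_ident_real)
 then have s: "smooth_on th UNIV" by (simp add: cpt_smooth_def)
 obtain C where C: "!!t. \<bar>th t\<bar> <= C" "!!t. \<bar>deriv th t\<bar> <= C"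
  using cpt_smooth_bounded[OF c] smooth_on_real_deriv(3)[OF s] by auto
 have "deriv th t = 1" if "\<bar>t\<bar> <= M" for t
 proof -
  have "grad th t = grad (%t. t) t"
   by (rule grad_cong_open[of "ball 0 (M+1)"]) (use that ct(2) in "auto simp: th_def smooth_on_ident_real")
  also have "... = 1" by (rule grad_eqI) (auto intro!: derivative_eq_intros)
  finally show ?thesis using smooth_on_real_deriv(3)[OF s] by simp
 qed
 then show ?thesis using s C ct(2) by (intro exI[of _ th] exI[of _ C]) (auto simp: th_def)
qed

section \<open>Gradient bound along segments and vanishing integrals of derivatives\<close>

lemma line_segment_gradient_bound:
 fixes w :: "'a::euclidean_space => real"
 assumes "smooth_on w UNIV" "0 <= t"
 shows "ennreal \<bar>w y - w (y + t *\<^sub>R z)\<bar> <= (\<integral>\<^sup>+sg\<in>{0..t}. ennreal (norm (grad w (y + sg *\<^sub>R z)) * norm z) \<partial>lborel)"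
proof -
 let ?g = "%sg. grad w (y + sg *\<^sub>R z) \<bullet> z"
 have d: "((%sg. w (y + sg *\<^sub>R z)) has_vector_derivative ?g sg) (at sg within {0..t})" for sg
 proof -
  have "((%sg. w (y + sg *\<^sub>R z)) has_derivative (%h. grad w (y + sg *\<^sub>R z) \<bullet> (h *\<^sub>R z))) (at sg within {0..t})"
   by (rule has_derivative_compose[OF _ smooth_on_has_derivative[OF assms(1)], of "%sg. y + sg *\<^sub>R z" "%h. h *\<^sub>R z"])
     (auto intro!: derivative_eq_intros)
  then show ?thesis by (simp add: has_vector_derivative_def)
 qed
 have c: "continuous_on {0..t} ?g"
  by (intro continuous_intros continuous_on_compose2[OF smooth_on_continuous_grad[OF assms(1)]]) auto
 have h: "has_bochner_integral lborel (%sg. indicator {0..t} sg *\<^sub>R ?g sg) (w (y + t *\<^sub>R z) - w (y + 0 *\<^sub>R z))"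
  by (rule has_bochner_integral_FTC_Icc[OF assms(2) d c])
 then have "ennreal \<bar>w y - w (y + t *\<^sub>R z)\<bar> = ennreal (norm (LINT sg|lborel. indicator {0..t} sg *\<^sub>R ?g sg))"
  by (simp add: has_bochner_integral_iff abs_minus_commute)
 also have "... <= (\<integral>\<^sup>+sg. ennreal (norm (indicator {0..t} sg *\<^sub>R ?g sg)) \<partial>lborel)"
  using h by (intro integral_norm_bound_ennreal) (simp add: has_bochner_integral_iff)
 also have "... <= (\<integral>\<^sup>+sg\<in>{0..t}. ennreal (norm (grad w (y + sg *\<^sub>R z)) * norm z) \<partial>lborel)"
  by (intro nn_integral_mono) (auto simp: Cauchy_Schwarz_ineq2 split: split_indicator intro!: ennreal_leI)
 finally show ?thesis .
qed

text \<open>By translation invariance of Lebesgue measure the difference quotients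
  \<open>q n\<close> all have integral 0. They are bounded with a common bounded support, so
  dominated convergence passes to the derivative.\<close>

lemma integral_partial_cpt_smooth:
 fixes F :: "'a::euclidean_space => real"
 assumes "cpt_smooth F"
 shows "integrable lborel (%x. grad F x \<bullet> e)" "(LINT x|lborel. grad F x \<bullet> e) = 0"
proof -
 have s: "smooth_on F UNIV" using assms by (simp add: cpt_smooth_def)
 obtain C where C: "C > 0" "!!x. \<bar>F x\<bar> <= C" "!!x. norm (grad F x) <= C"
  using cpt_smooth_bounded[OF assms] by blast
 obtain R where R: "R > 0" "!!x. norm x >= R ==> F x = 0"
 proof -
  have "bounded {x. F x ~= 0}" using assms unfolding cpt_smooth_def
   by (meson bounded_subset closure_subset compact_imp_bounded)
  then obtain R where "R > 0" "{x. F x ~= 0} <= ball 0 R" using bounded_subset_ballD by blast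
  then show ?thesis by (intro that[of R]) (auto simp: subset_eq)
 qed
 have mF[measurable]: "F \<in> borel_measurable borel" "grad F \<in> borel_measurable borel"
  using smooth_on_continuous[OF s] smooth_on_continuous_grad[OF s] by (auto intro: borel_measurable_continuous_onI)
 define q where "q n x = (F (x + (1 / real (Suc n)) *\<^sub>R e) - F x) * real (Suc n)" for n x
 have intF: "integrable lborel F"
  by (rule integrableI_bounded_set[where A="ball 0 R" and B=C])
    (use R C emeasure_bounded_finite[OF bounded_ball, of 0 R] in "auto simp: not_less")
 have q0: "(LINT x|lborel. q n x) = 0" for n
 proof -
  let ?c = "(1 / real (Suc n)) *\<^sub>R e"
  have "integrable (distr lborel borel ((+) ?c)) F" using intF by (simp add: lborel_distr_plus)
  then have "integrable lborel (%x. F (?c + x))" by (simp add: integrable_distr_eq)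
  moreover have "(\<integral>x. F x \<partial>distr lborel borel ((+) ?c)) = (LINT x|lborel. F (?c + x))"
   by (simp add: integral_distr)
  then have "(LINT x|lborel. F (?c + x)) = (LINT x|lborel. F x)" by (simp add: lborel_distr_plus)
  ultimately show ?thesis using intF by (simp add: q_def add.commute)
 qed
 define D where "D = C * norm e"
 have qb: "\<bar>q n x\<bar> <= D" for n x
 proof -
  have "\<bar>F (x + (1 / real (Suc n)) *\<^sub>R e) - F x\<bar> <= C * norm ((x + (1 / real (Suc n)) *\<^sub>R e) - x)"
  proof -
   have "norm (F (x + (1 / real (Suc n)) *\<^sub>R e) - F x) <= C * norm ((x + (1 / real (Suc n)) *\<^sub>R e) - x)"
   proof (rule differentiable_bound[of UNIV F "%x h. grad F x \<bullet> h"])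
    show "onorm (%h. grad F x \<bullet> h) <= C" for x
    proof (rule onorm_le)
     fix h show "norm (grad F x \<bullet> h) <= C * norm h"
      using Cauchy_Schwarz_ineq2[of "grad F x" h] mult_right_mono[OF C(3)[of x] norm_ge_zero[of h]] by simp
    qed
   qed (use smooth_on_has_derivative[OF s] in auto)
   then show ?thesis by simp
  qed
  then show ?thesis 
   using mult_right_mono[of "\<bar>F (x + (1 / real (Suc n)) *\<^sub>R e) - F x\<bar>" "C * norm ((1 / real (Suc n)) *\<^sub>R e)" "real (Suc n)"]
   by (simp add: q_def D_def abs_mult del: of_nat_Suc)
 qed
 have q_out: "q n x = 0" if "norm x >= R + norm e" for n x
 proof -
  have "norm ((1 / real (Suc n)) *\<^sub>R e) <= norm e" by (simp add: divide_le_eq distrib_left)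
  then have "norm (x + (1 / real (Suc n)) *\<^sub>R e) >= R"
   using that norm_diff_ineq[of x "(1 / real (Suc n)) *\<^sub>R e"] by linarith
  then show ?thesis using R(2)[of x] R(2)[of "x + (1 / real (Suc n)) *\<^sub>R e"] that norm_ge_zero[of e]
   by (simp add: q_def del: of_nat_Suc)
 qed
 have ql: "(%n. q n x) ----> grad F x \<bullet> e" for x
 proof -
  have "((%t. F (x + t *\<^sub>R e)) has_derivative (%h. grad F (x + 0 *\<^sub>R e) \<bullet> (h *\<^sub>R e))) (at 0)"
   by (rule has_derivative_compose[OF _ smooth_on_has_derivative[OF s], of "%t. x + t *\<^sub>R e" "%h. h *\<^sub>R e"])
     (auto intro!: derivative_eq_intros)
  then have "((%t. F (x + t *\<^sub>R e)) has_real_derivative grad F x \<bullet> e) (at 0)"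
   by (simp add: has_field_derivative_def mult_commute_abs)
  then have "((%h. (F (x + h *\<^sub>R e) - F x) / h) \<longlongrightarrow> grad F x \<bullet> e) (at 0)" by (simp add: DERIV_def)
  moreover have "filterlim (%n. 1 / real (Suc n)) (at 0) sequentially"
   using LIMSEQ_inverse_real_of_nat by (auto simp: filterlim_at inverse_eq_divide)
  ultimately have "(%n. (F (x + (1 / real (Suc n)) *\<^sub>R e) - F x) / (1 / real (Suc n))) ----> grad F x \<bullet> e"
   by (rule filterlim_compose)
  then show ?thesis by (simp add: q_def)
 qed
 let ?h = "%x. indicator (ball 0 (R + norm e)) x * D"
 have h: "integrable lborel ?h" using emeasure_bounded_finite[OF bounded_ball, of 0 "R + norm e"] by (auto intro!: integrable_mult_left)
 have qd: "norm (q n x) <= ?h x" for n x using qb[of n x] q_out[of x n] by (auto split: split_indicator)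
 have mq[measurable]: "q n \<in> borel_measurable lborel" for n by (simp add: q_def[abs_def])
 show "integrable lborel (%x. grad F x \<bullet> e)"
  by (rule integrable_dominated_convergence[of _ _ q ?h]) (use h qd ql in auto)
 have "(%n. \<integral>x. q n x \<partial>lborel) ----> (LINT x|lborel. grad F x \<bullet> e)"
  by (rule integral_dominated_convergence[where w="?h"]) (use h qd ql in auto)
 then show "(LINT x|lborel. grad F x \<bullet> e) = 0" by (simp add: q0 LIMSEQ_const_iff)
qed

section \<open>Hausdorff measure of the boundary\<close>

definition hausdorff_wt :: "real => 'a::euclidean_space set => ennreal" where
 "hausdorff_wt d C = ennreal (hausdorff_const d * (diameter C / 2) powr d)"

lemma hausdorff_wt_empty [simp]: "hausdorff_wt d {} = 0"
 by (simp add: hausdorff_wt_def)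

definition hausdorff_covers :: "real => 'a::euclidean_space set => (nat => 'a set) set" where
 "hausdorff_covers dl A = {C. A <= (\<Union>i. C i) \<and> (ALL i. bounded (C i) \<and> diameter (C i) <= dl)}"

lemma hausdorff_pre_alt: "hausdorff_pre d dl A = (INF C \<in> hausdorff_covers dl A. \<Sum>i. hausdorff_wt d (C i))"
 by (simp add: hausdorff_pre_def hausdorff_covers_def hausdorff_wt_def)

lemma hausdorff_pre_le: "C \<in> hausdorff_covers dl A ==> hausdorff_pre d dl A <= (\<Sum>i. hausdorff_wt d (C i))"
 unfolding hausdorff_pre_alt by (rule INF_lower)

lemma hausdorff_pre_antimono: "dl <= dl' ==> hausdorff_pre d dl' A <= hausdorff_pre d dl A"
 unfolding hausdorff_pre_alt by (intro INF_superset_mono) (auto simp: hausdorff_covers_def intro: order_trans)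

lemma hausdorff_pre_mono: "A <= B ==> hausdorff_pre d dl A <= hausdorff_pre d dl B"
 unfolding hausdorff_pre_alt by (intro INF_superset_mono) (auto simp: hausdorff_covers_def)

lemma hausdorff_pre_empty: "dl > 0 ==> hausdorff_pre d dl {} = 0"
 using hausdorff_pre_le[of "%i. {}" dl "{}" d] by (simp add: hausdorff_covers_def)

lemma hausdorff_pre_UN:
 assumes "dl > 0"
 shows "hausdorff_pre d dl (\<Union>i. A i) <= (\<Sum>i. hausdorff_pre d dl (A i))"
proof (rule ennreal_le_epsilon)
 fix b and e :: real
 assume fin: "(\<Sum>i. hausdorff_pre d dl (A i)) < top" and e: "0 < e"
 have pe: "\<exists>C\<in>hausdorff_covers dl (A i). (\<Sum>j. hausdorff_wt d (C j)) <= hausdorff_pre d dl (A i) + ennreal (e * (1/2) ^ Suc i)" for i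
 proof -
  have "hausdorff_pre d dl (A i) < top" using fin ennreal_suminf_lessD by blast
  then have "(INF C \<in> hausdorff_covers dl (A i). \<Sum>j. hausdorff_wt d (C j)) < hausdorff_pre d dl (A i) + ennreal (e * (1/2) ^ Suc i)"
   unfolding hausdorff_pre_alt[symmetric] using e
   by (metis add.right_neutral ennreal_add_left_cancel_less ennreal_less_zero_iff mult_pos_pos zero_less_divide_1_iff zero_less_numeral zero_less_power infinity_ennreal_def order_less_irrefl)
  then show ?thesis unfolding INF_less_iff by (auto intro: less_imp_le)
 qed
 then obtain C where C: "!!i. C i \<in> hausdorff_covers dl (A i)" 
  "!!i. (\<Sum>j. hausdorff_wt d (C i j)) <= hausdorff_pre d dl (A i) + ennreal (e * (1/2) ^ Suc i)" by metis
 define D where "D = case_prod C \<circ> prod_decode"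
 have D: "D \<in> hausdorff_covers dl (\<Union>i. A i)"
  unfolding hausdorff_covers_def
 proof (intro CollectI conjI subsetI allI)
  fix x assume "x \<in> (\<Union>i. A i)"
  then obtain i where "x \<in> A i" by blast
  then obtain j where "x \<in> C i j" using C(1)[of i] by (auto simp: hausdorff_covers_def)
  then have "x \<in> D (prod_encode (i, j))" by (simp add: D_def)
  then show "x \<in> (\<Union>i. D i)" by blast
 next
  fix k show "bounded (D k)" "diameter (D k) <= dl"
   using C(1) by (auto simp: D_def hausdorff_covers_def split: prod.split)
 qed
 have "(\<Sum>k. hausdorff_wt d (D k)) = (\<Sum>i j. hausdorff_wt d (C i j))"
  using suminf_ennreal_2dimen[where f="%(i, j). hausdorff_wt d (C i j)" and g="%i. (\<Sum>j. hausdorff_wt d (C i j))"]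
  by (simp add: D_def comp_def split_beta)
 also have "... <= (\<Sum>i. hausdorff_pre d dl (A i) + ennreal (e * (1/2) ^ Suc i))"
  by (intro suminf_le C(2)) auto
 also have "... = (\<Sum>i. hausdorff_pre d dl (A i)) + (\<Sum>i. ennreal (e * (1/2) ^ Suc i))"
  by (intro suminf_add[symmetric]) auto
 also have "(\<Sum>i. ennreal (e * (1/2) ^ Suc i)) = ennreal e"
 proof -
  have "(%i. e * (1/2) ^ Suc i) sums e" using sums_mult[OF power_half_series, of e] by simp
  then show ?thesis using e by (intro suminf_ennreal_eq) auto
 qed
 finally show "hausdorff_pre d dl (\<Union>i. A i) <= (\<Sum>i. hausdorff_pre d dl (A i)) + ennreal e"
  using hausdorff_pre_le[OF D, of d] by order
qed

lemma hausdorff_outer_UN: "hausdorff_outer d (\<Union>i. A i) <= (\<Sum>i. hausdorff_outer d (A i :: 'a::euclidean_space set))"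
 unfolding hausdorff_outer_def[of d "\<Union>(range A)"]
proof (rule SUP_least)
 fix dl :: real assume "dl \<in> {0<..}"
 then have "hausdorff_pre d dl (\<Union>(range A)) <= (\<Sum>i. hausdorff_pre d dl (A i))" by (intro hausdorff_pre_UN) auto
 also have "... <= (\<Sum>i. hausdorff_outer d (A i))"
  unfolding hausdorff_outer_def using \<open>dl \<in> _\<close> by (intro suminf_le SUP_upper) auto
 finally show "hausdorff_pre d dl (\<Union>(range A)) <= (\<Sum>i. hausdorff_outer d (A i))" .
qed

lemma hausdorff_outer_mono: "A <= B ==> hausdorff_outer d A <= hausdorff_outer d B"
 unfolding hausdorff_outer_def by (intro SUP_mono) (auto intro: hausdorff_pre_mono)

lemma hausdorff_outer_empty: "hausdorff_outer d {} = 0"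
 by (simp add: hausdorff_outer_def hausdorff_pre_empty cong: SUP_cong_simp)

lemma hausdorff_outer_space: "outer_measure_space (Pow UNIV) (hausdorff_outer d)"
 unfolding outer_measure_space_def positive_def increasing_def countably_subadditive_def
 by (auto simp: hausdorff_outer_empty hausdorff_outer_UN intro: hausdorff_outer_mono)

lemma hausdorff_outer_Un: "hausdorff_outer d (A Un B) <= hausdorff_outer d A + hausdorff_outer d (B :: 'a::euclidean_space set)"
proof -
 have "hausdorff_outer d (A Un B) <= (\<Sum>i. hausdorff_outer d ((%i::nat. if i = 0 then A else if i = 1 then B else {}) i))"
  by (rule order_trans[OF hausdorff_outer_mono hausdorff_outer_UN]) (auto split: if_splits intro: exI[of _ 0] exI[of _ 1])
 also have "... = (\<Sum>i<2. hausdorff_outer d ((%i::nat. if i = 0 then A else if i = 1 then B else {}) i))"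
  by (rule suminf_finite) (auto simp: hausdorff_outer_empty)
 finally show ?thesis by (simp add: numeral_2_eq_2)
qed

text \<open>A set of diameter below the gap cannot meet both A and B, so a fine cover of the union
  splits into a cover of A and one of B. This makes the outer measure metric.\<close>

lemma hausdorff_outer_metric:
 assumes "\<eta> > 0" "!!x y. x \<in> A ==> y \<in> B ==> dist x y >= \<eta>"
 shows "hausdorff_outer d A + hausdorff_outer d B <= hausdorff_outer d (A Un B)"
proof -
 have *: "hausdorff_pre d dl A + hausdorff_pre d dl B <= hausdorff_pre d dl (A Un B)" if "dl < \<eta>" "dl > 0" for dl
  unfolding hausdorff_pre_alt[of d dl "A Un B"]
 proof (rule INF_greatest)
  fix C assume C: "C \<in> hausdorff_covers dl (A Un B)"
  \<comment> \<open>Covers are sequences, so members that miss A are replaced by the empty set,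
    whose weight is 0.\<close>
  define CA where "CA i = (if C i Int A = {} then {} else C i)" for i
  define CB where "CB i = (if C i Int B = {} then {} else C i)" for i
  have "CA \<in> hausdorff_covers dl A" "CB \<in> hausdorff_covers dl B"
   using C that by (auto simp: hausdorff_covers_def CA_def CB_def subset_eq) blast+
  then have "hausdorff_pre d dl A + hausdorff_pre d dl B <= (\<Sum>i. hausdorff_wt d (CA i)) + (\<Sum>i. hausdorff_wt d (CB i))"
   by (intro add_mono hausdorff_pre_le)
  also have "... = (\<Sum>i. hausdorff_wt d (CA i) + hausdorff_wt d (CB i))" by (rule suminf_add) auto
  also have "... <= (\<Sum>i. hausdorff_wt d (C i))"
  proof (intro suminf_le)
   fix i
   have "C i Int A = {} \<or> C i Int B = {}"
   proof (rule ccontr)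
    assume "\<not> ?thesis"
    then obtain x y where xy: "x \<in> C i" "x \<in> A" "y \<in> C i" "y \<in> B" by blast
    have "dist x y <= diameter (C i)" using C xy by (intro diameter_bounded_bound) (auto simp: hausdorff_covers_def)
    then show False using assms(2)[OF xy(2,4)] C that by (auto simp: hausdorff_covers_def dest!: spec[of _ i])
   qed
   then show "hausdorff_wt d (CA i) + hausdorff_wt d (CB i) <= hausdorff_wt d (C i)"
    by (auto simp: CA_def CB_def)
  qed auto
  finally show "hausdorff_pre d dl A + hausdorff_pre d dl B <= (\<Sum>i. hausdorff_wt d (C i))" .
 qed
 have **: "hausdorff_pre d dl A + hausdorff_pre d dl' B <= hausdorff_outer d (A Un B)" if "dl > 0" "dl' > 0" for dl dl'
 proof -
  define m where "m = min (min dl dl') (\<eta>/2)"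
  have m: "m > 0" "m < \<eta>" "m <= dl" "m <= dl'" using assms(1) that by (auto simp: m_def)
  have "hausdorff_pre d dl A + hausdorff_pre d dl' B <= hausdorff_pre d m A + hausdorff_pre d m B"
   using m by (intro add_mono hausdorff_pre_antimono)
  also have "... <= hausdorff_pre d m (A Un B)" using m by (intro *)
  also have "... <= hausdorff_outer d (A Un B)" unfolding hausdorff_outer_def using m by (intro SUP_upper) auto
  finally show ?thesis .
 qed
 have "hausdorff_outer d A + hausdorff_pre d dl' B <= hausdorff_outer d (A Un B)" if "dl' > 0" for dl'
  unfolding hausdorff_outer_def[of d A] using **[OF _ that]
  by (subst ennreal_SUP_add_left[symmetric]) (auto intro!: SUP_least)
 then show ?thesis
  unfolding hausdorff_outer_def[of d B]
  by (subst ennreal_SUP_add_right) (auto intro!: SUP_least)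
qed


lemma ennreal_suminf_tail:
 fixes f :: "nat => ennreal"
 assumes "(\<Sum>k. f k) < top"
 shows "(%n. \<Sum>k. f (k + n)) ----> 0"
proof -
 define r where "r k = enn2real (f k)" for k
 have fr: "f k = ennreal (r k)" "r k >= 0" for k
  using ennreal_suminf_lessD[OF assms, of k] by (auto simp: r_def)
 have s: "summable r" using assms fr by (intro summable_suminf_not_top) auto
 have "(\<Sum>k. f (k + n)) = ennreal (\<Sum>k. r (k + n))" for n
  unfolding fr(1) using s fr(2) by (intro suminf_ennreal2) (auto simp: summable_iff_shift)
 moreover have "(%n. ennreal (\<Sum>k. r (k + n))) ----> ennreal 0"
  using suminf_exist_split2[OF s] by (intro tendsto_ennrealI)
 ultimately show ?thesis by simp
qed

text \<open>Caratheodory's criterion for metric outer measures. X - F is exhausted by the sets of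
  points at distance at least 1/(n+1) from F, each separated from F; the remainder is covered by
  shells whose outer measures are summable, so its contribution tends to 0.\<close>

lemma closed_in_hausdorff_lambda_system:
 fixes F :: "'a::euclidean_space set"
 assumes "closed F"
 shows "F \<in> lambda_system UNIV (Pow UNIV) (hausdorff_outer d)"
proof (cases "F = {}")
 case True
 then show ?thesis by (simp add: lambda_system_def hausdorff_outer_empty)
next
 case False
 let ?mu = "hausdorff_outer d"
 have "?mu (X Int F) + ?mu (X - F) <= ?mu X" for X
 proof (cases "?mu X = top")
  case fin: False
  define A where "A n = {x \<in> X. infdist x F >= 1 / real (Suc n)}" for n
  define D where "D n = A (Suc n) - A n" for n
  have A_mono: "A m <= A n" if "m <= n" for m n
  proof -
   have "1 / real (Suc n) <= 1 / real (Suc m)" using that by (intro frac_le) auto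
   then show ?thesis unfolding A_def by (auto simp del: of_nat_Suc)
  qed
  have gap: "1 / real (m + 2) - 1 / real (n + 1) <= dist x y" if "x \<in> A (Suc m)" "y \<in> D n" for m n x y
  proof -
   have "infdist x F >= 1 / real (m + 2)" using that by (simp add: A_def)
   moreover have "infdist y F < 1 / real (n + 1)" using that by (auto simp: A_def D_def)
   moreover have "infdist x F <= infdist y F + dist x y" by (rule infdist_triangle)
   ultimately show ?thesis by linarith
  qed
  \<comment> \<open>Neighbouring shells may touch, but shells whose indices differ by at least 2 are
    a positive distance apart. Even and odd indices are therefore summed separately, each sum being
    bounded by the measure of X.\<close>
  have sumD: "(\<Sum>k<n. ?mu (D (2 * k + j))) <= ?mu (\<Union>k<n. D (2 * k + j))" for n j
  proof (induction n)
   case (Suc n)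
   have "(\<Sum>k<Suc n. ?mu (D (2 * k + j))) <= ?mu (\<Union>k<n. D (2 * k + j)) + ?mu (D (2 * n + j))"
    using Suc by (simp add: add_mono)
   also have "... <= ?mu ((\<Union>k<n. D (2 * k + j)) Un D (2 * n + j))"
   proof (rule hausdorff_outer_metric)
    \<comment> \<open>For n = 0 the union on the left is empty and any positive gap will do; the
      formula itself could contain a division by zero there.\<close>
    show "0 < (if n = 0 then 1 else 1 / real (2 * n + j) - 1 / real (2 * n + j + 1))"
     by (auto intro!: frac_less2)
    fix x y assume x: "x \<in> (\<Union>k<n. D (2 * k + j))" and y: "y \<in> D (2 * n + j)"
    then obtain k where k: "k < n" "x \<in> D (2 * k + j)" by blast
    then have "x \<in> A (Suc (2 * k + j))" by (simp add: D_def)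
    moreover have "Suc (2 * k + j) <= Suc (2 * n + j - 2)" using k(1) by linarith
    ultimately have "x \<in> A (Suc (2 * n + j - 2))" using A_mono by blast
    from gap[OF this y] k show "(if n = 0 then 1 else 1 / real (2 * n + j) - 1 / real (2 * n + j + 1)) <= dist x y"
     by (simp add: of_nat_diff)
   qed
   also have "... = ?mu (\<Union>k<Suc n. D (2 * k + j))" by (intro arg_cong[of _ _ ?mu]) (auto simp: less_Suc_eq)
   finally show ?case .
  qed simp
  have tail_fin: "(\<Sum>k. ?mu (D k)) < top"
  proof -
   have "(\<Sum>k<n. ?mu (D k)) <= 2 * ?mu X" for n
   proof -
    have "(\<Sum>k<n. ?mu (D k)) <= (\<Sum>k<2 * n. ?mu (D k))" by (intro sum_mono2) auto
    also have "... = (\<Sum>k<n. ?mu (D (2 * k + 0))) + (\<Sum>k<n. ?mu (D (2 * k + 1)))"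
     by (induction n) (auto simp: algebra_simps)
    also have "... <= ?mu X + ?mu X"
     by (intro add_mono order_trans[OF sumD] hausdorff_outer_mono) (auto simp: D_def A_def)
    finally show ?thesis by (simp add: mult_2)
   qed
   then have "(\<Sum>k. ?mu (D k)) <= 2 * ?mu X" by (intro suminf_le_const) auto
   also have "... < top" using fin by (simp add: ennreal_mult_less_top less_top)
   finally show ?thesis .
  qed
  have XF: "X - F = A n Un (\<Union>k. D (k + n))" for n
  proof
   show "X - F <= A n Un (\<Union>k. D (k + n))"
   proof
    fix x assume x: "x \<in> X - F"
    then have "infdist x F > 0" using assms False in_closed_iff_infdist_zero[of F x] infdist_nonneg[of x F] by force
    then obtain N where "1 / real (Suc N) < infdist x F" using nat_approx_posE by blast
    then have ex: "x \<in> A N" using x by (simp add: A_def)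
    \<comment> \<open>The first index whose set contains x; if it exceeds n, then x lies in the
      shell just before it.\<close>
    define M where "M = (LEAST M. x \<in> A M)"
    have M: "x \<in> A M" unfolding M_def by (rule LeastI[of _ N]) (rule ex)
    show "x \<in> A n Un (\<Union>k. D (k + n))"
    proof (cases "M <= n")
     case True
     then show ?thesis using M A_mono by blast
    next
     case False
     then have "x \<notin> A (M - 1)" unfolding M_def[symmetric] using not_less_Least[of "M - 1" "%M. x \<in> A M"] by (simp add: M_def)
     then have "x \<in> D ((M - 1 - n) + n)" using M False by (auto simp: D_def)
     then show ?thesis by blast
    qed
   qed
   show "A n Un (\<Union>k. D (k + n)) <= X - F" by (auto simp: A_def D_def field_simps)
  qed
  have "?mu (X Int F) + ?mu (X - F) <= ?mu X + (\<Sum>k. ?mu (D (k + n)))" for n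
  proof -
   have "?mu (X - F) <= ?mu (A n) + ?mu (\<Union>k. D (k + n))" unfolding XF[of n] by (rule hausdorff_outer_Un)
   also have "... <= ?mu (A n) + (\<Sum>k. ?mu (D (k + n)))" by (intro add_left_mono hausdorff_outer_UN)
   finally have "?mu (X Int F) + ?mu (X - F) <= ?mu (X Int F) + (?mu (A n) + (\<Sum>k. ?mu (D (k + n))))" by (rule add_left_mono)
   also have "... = (?mu (X Int F) + ?mu (A n)) + (\<Sum>k. ?mu (D (k + n)))" by (simp add: add.assoc)
   also have "?mu (X Int F) + ?mu (A n) <= ?mu (X Int F Un A n)"
   proof (rule hausdorff_outer_metric)
    show "0 < 1 / real (Suc n)" by simp
    fix x y assume "x \<in> X Int F" "y \<in> A n"
    then show "1 / real (Suc n) <= dist x y" using infdist_le[of x F y] by (auto simp: A_def dist_commute)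
   qed
   also have "?mu (X Int F Un A n) <= ?mu X" by (rule hausdorff_outer_mono) (auto simp: A_def)
   finally show ?thesis by (simp add: add_right_mono)
  qed
  moreover have "(%n. ?mu X + (\<Sum>k. ?mu (D (k + n)))) ----> ?mu X + 0"
   using tail_fin by (intro tendsto_add tendsto_const ennreal_suminf_tail) auto
  ultimately show ?thesis using LIMSEQ_le_const[of _ "?mu X + 0"] by fastforce
 qed simp
 moreover have "?mu X <= ?mu (F Int X) + ?mu (X - F)" for X
 proof -
  have "F Int X Un (X - F) = X" by blast
  then show ?thesis using hausdorff_outer_Un[of d "F Int X" "X - F"] by simp
 qed
 moreover have "F Int X = X Int F" "(UNIV - F) Int X = X - F" for X by auto
 ultimately show ?thesis unfolding lambda_system_def by (auto intro!: antisym)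
qed

text \<open>\<open>measure_of\<close> reproduces a set function only if it is a measure on the given
  sets. The Caratheodory-measurable sets form a sigma-algebra on which the outer measure is a
  measure; containing the closed sets, it contains all Borel sets.\<close>

lemma emeasure_hausdorff_measure:
 assumes "A \<in> sets borel"
 shows "emeasure (hausdorff_measure d) A = hausdorff_outer d (A :: 'a::euclidean_space set)"
proof -
 let ?L = "lambda_system UNIV (Pow UNIV) (hausdorff_outer d :: 'a set => _)"
 have L: "measure_space UNIV ?L (hausdorff_outer d)"
  using sigma_algebra.caratheodory_lemma[OF sigma_algebra_Pow hausdorff_outer_space] .
 have "Collect closed <= ?L" using closed_in_hausdorff_lambda_system by blast
 moreover have "sigma_algebra UNIV ?L" using L by (simp add: measure_space_def)
 ultimately have "sigma_sets UNIV (Collect closed) <= ?L" by (intro sigma_algebra.sigma_sets_subset)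
 then have "sets borel <= ?L" unfolding borel_eq_closed by (subst sets_measure_of) simp_all
 then have "measure_space UNIV (sets borel) (hausdorff_outer d :: 'a set => _)"
  using measure_down[OF L] sets.sigma_algebra_axioms[of borel] by (metis space_borel)
 then show ?thesis unfolding hausdorff_measure_def using assms
  by (intro emeasure_measure_of_sigma) (auto simp: measure_space_def)
qed

lemma sets_hausdorff_measure [simp, measurable_cong]: "sets (hausdorff_measure d) = sets borel"
 using sets.sigma_sets_eq[of borel] by (simp add: hausdorff_measure_def)

lemma space_hausdorff_measure [simp]: "space (hausdorff_measure d) = UNIV"
 by (simp add: hausdorff_measure_def)

section \<open>Tangent and Jensen inequalities for powers\<close>

lemma powr_tangent:
 fixes b h p :: real
 assumes "p >= 1" "b >= 0" "h >= 0"
 shows "p * (b powr (p - 1) * h) <= h powr p + (p - 1) * b powr p"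
proof (cases "p = 1")
 case True
 then show ?thesis using assms by auto
next
 case False
 define q where "q = p / (p - 1)"
 have p: "p > 1" using False assms by simp
 have "1 / p + 1 / q = 1" using p by (simp add: q_def field_simps)
 moreover have "q > 1" using p by (simp add: q_def field_simps)
 ultimately have "h * b powr (p - 1) <= h powr p / p + (b powr (p - 1)) powr q / q"
  using Youngs_inequality[of p q h "b powr (p - 1)"] assms p by simp
 also have "(b powr (p - 1)) powr q = b powr p" using p by (simp add: powr_powr q_def)
 finally have "p * (h * b powr (p - 1)) <= p * (h powr p / p + b powr p / q)"
  using p by (intro mult_left_mono) auto
 also have "... = h powr p + (p - 1) * b powr p" using p by (simp add: q_def field_simps)
 finally show ?thesis by (simp add: mult.commute mult.left_commute)
qed

text \<open>Integrates \<open>powr_tangent\<close>, which says that the graph of the p-th power lies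
  above its tangent at b. Stating it with upper bounds for the mass and a lower bound for the
  integral spares normalising the measure.\<close>

lemma jensen_powr:
 fixes h :: "'x => real"
 assumes [measurable]: "h \<in> borel_measurable M" and h: "!!x. h x >= 0" and p: "p >= 1" and a: "a >= 0"
  and c: "c > 0" "emeasure M (space M) <= ennreal c" and le: "ennreal a <= (\<integral>\<^sup>+x. ennreal (h x) \<partial>M)"
 shows "ennreal (a powr p) <= ennreal (c powr (p - 1)) * (\<integral>\<^sup>+x. ennreal (h x powr p) \<partial>M)"
proof (cases "(\<integral>\<^sup>+x. ennreal (h x powr p) \<partial>M) = top")
 case True
 then show ?thesis using c(1) by (simp add: ennreal_mult_top)
next
 case False
 then obtain I where I: "(\<integral>\<^sup>+x. ennreal (h x powr p) \<partial>M) = ennreal I" "I >= 0" by (cases rule: ennreal_cases) auto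
 \<comment> \<open>The mean value, at which the tangent inequality is sharp.\<close>
 define b where "b = a / c"
 have b: "b >= 0" using a c by (simp add: b_def)
 have "ennreal (p * b powr (p - 1)) * ennreal a <= ennreal (p * b powr (p - 1)) * (\<integral>\<^sup>+x. ennreal (h x) \<partial>M)"
  by (intro mult_left_mono le) auto
 also have "... = (\<integral>\<^sup>+x. ennreal (p * (b powr (p - 1) * h x)) \<partial>M)"
  using h b p by (subst nn_integral_cmult[symmetric]) (auto simp: ennreal_mult'[symmetric] mult.assoc)
 also have "... <= (\<integral>\<^sup>+x. ennreal (h x powr p) + ennreal ((p - 1) * b powr p) \<partial>M)"
 proof (rule nn_integral_mono)
  fix x
  have "p * (b powr (p - 1) * h x) <= h x powr p + (p - 1) * b powr p" using p b h by (rule powr_tangent)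
  then show "ennreal (p * (b powr (p - 1) * h x)) <= ennreal (h x powr p) + ennreal ((p - 1) * b powr p)"
   using p by (subst ennreal_plus[symmetric]) (simp_all add: ennreal_leI del: ennreal_plus)
 qed
 also have "... = ennreal I + ennreal ((p - 1) * b powr p) * emeasure M (space M)"
  by (subst nn_integral_add) (auto simp: I)
 also have "... <= ennreal I + ennreal ((p - 1) * b powr p) * ennreal c"
  by (intro add_left_mono mult_left_mono c) auto
 finally have "ennreal (p * b powr (p - 1) * a) <= ennreal (I + (p - 1) * b powr p * c)"
  using p b a c I by (simp add: ennreal_mult'[symmetric] ennreal_plus[symmetric] del: ennreal_plus)
 then have "p * b powr (p - 1) * a <= I + (p - 1) * b powr p * c"
  using I p c by (subst (asm) ennreal_le_iff) auto
 moreover have ba: "b powr (p - 1) * a = b powr p * c"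
 proof (cases "a = 0")
  case False
  then have "b > 0" using a c by (simp add: b_def)
  then have "b powr p = b powr (p - 1) * b" by (simp add: powr_diff)
  then show ?thesis using c by (simp add: b_def)
 qed (simp add: b_def)
 moreover have "p * b powr (p - 1) * a = p * (b powr p * c)" by (simp add: ba mult.assoc)
 moreover have "(p - 1) * b powr p * c = p * (b powr p * c) - b powr p * c" by (simp add: algebra_simps)
 ultimately have "b powr p * c <= I" by linarith
 then have "c powr (p - 1) * (b powr p * c) <= c powr (p - 1) * I" using c by (intro mult_left_mono) auto
 moreover have "c powr (p - 1) * (b powr p * c) = a powr p"
  using a c by (simp add: b_def powr_divide powr_diff field_simps)
 ultimately have "ennreal (a powr p) <= ennreal (c powr (p - 1) * I)" by (simp add: ennreal_leI)
 then show ?thesis by (simp add: I ennreal_mult)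
qed

section \<open>Exit times and exit points along a fixed direction\<close>

lemma nn_integral_lborel_translate:
 assumes [measurable]: "f \<in> borel_measurable borel"
 shows "(\<integral>\<^sup>+z. f (z + c) \<partial>lborel) = (\<integral>\<^sup>+z. f z \<partial>(lborel :: 'a::euclidean_space measure))"
proof -
 have "(\<integral>\<^sup>+z. f z \<partial>lborel) = (\<integral>\<^sup>+z. f z \<partial>distr lborel borel ((+) c))" by (simp add: lborel_distr_plus)
 also have "... = (\<integral>\<^sup>+z. f (c + z) \<partial>lborel)" by (rule nn_integral_distr) auto
 finally show ?thesis by (simp add: add.commute)
qed

definition exit_time :: "'a::euclidean_space set => 'a => 'a => real" where
 "exit_time \<Omega> e z = (if z \<in> \<Omega> then Inf {t. 0 <= t \<and> z + t *\<^sub>R e \<notin> \<Omega>} else 0)"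

definition exit_point :: "'a::euclidean_space set => 'a => 'a => 'a" where
 "exit_point \<Omega> e z = z + exit_time \<Omega> e z *\<^sub>R e"

context
 fixes \<Omega> :: "'a::euclidean_space set" and e :: 'a and D :: real
 assumes op: "open \<Omega>" and e: "norm e = 1" and D: "D > 0" "!!x y. x \<in> \<Omega> ==> y \<in> \<Omega> ==> dist x y < D"
begin

lemma exit_facts:
 assumes z: "z \<in> \<Omega>"
 shows "exit_point \<Omega> e z \<notin> \<Omega>" "0 <= t ==> t < exit_time \<Omega> e z ==> z + t *\<^sub>R e \<in> \<Omega>" 
  "0 <= exit_time \<Omega> e z" "exit_time \<Omega> e z <= D" "0 <= t ==> z + t *\<^sub>R e \<notin> \<Omega> ==> exit_time \<Omega> e z <= t"
proof -
 let ?S = "{t. 0 <= t \<and> z + t *\<^sub>R e \<notin> \<Omega>}"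
 have tau: "exit_time \<Omega> e z = Inf ?S" using z by (simp add: exit_time_def)
 have "z + D *\<^sub>R e \<notin> \<Omega>" using D(2)[OF z, of "z + D *\<^sub>R e"] D(1) e by (auto simp: dist_norm)
 then have DS: "D \<in> ?S" using D by simp
 have bb: "bdd_below ?S" by (auto intro: bdd_belowI)
 have "?S = {0..} Int (%t. z + t *\<^sub>R e) -` (- \<Omega>)" by auto
 moreover have "closed ((%t. z + t *\<^sub>R e) -` (- \<Omega>))"
  using op by (intro closed_vimage continuous_intros) auto
 ultimately have "closed ?S" by (metis closed_Int closed_atLeast)
 then have "Inf ?S \<in> ?S" using DS bb by (intro closed_contains_Inf) auto
 then show "exit_point \<Omega> e z \<notin> \<Omega>" "0 <= exit_time \<Omega> e z" by (auto simp: exit_point_def tau)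
 show "exit_time \<Omega> e z <= D" unfolding tau by (rule cInf_lower[OF DS bb])
 show *: "exit_time \<Omega> e z <= t" if "0 <= t" "z + t *\<^sub>R e \<notin> \<Omega>" for t
  unfolding tau by (rule cInf_lower[OF _ bb]) (use that in auto)
 show "0 <= t ==> t < exit_time \<Omega> e z ==> z + t *\<^sub>R e \<in> \<Omega>" using *[of t] by force
qed

lemma exit_time_pos: assumes z: "z \<in> \<Omega>" shows "exit_time \<Omega> e z > 0"
 using exit_facts(1,3)[OF z] z by (cases "exit_time \<Omega> e z = 0") (auto simp: exit_point_def)

lemma exit_point_frontier: assumes z: "z \<in> \<Omega>" shows "exit_point \<Omega> e z \<in> frontier \<Omega>"
proof -
 let ?t = "exit_time \<Omega> e z"
 have "(%n. ?t / real (Suc n)) ----> 0" by (rule LIMSEQ_Suc[OF lim_const_over_n])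
 then have "(%n. z + (?t - ?t / real (Suc n)) *\<^sub>R e) ----> z + (?t - 0) *\<^sub>R e"
  by (intro tendsto_intros)
 moreover have "z + (?t - ?t / real (Suc n)) *\<^sub>R e \<in> \<Omega>" for n
  using exit_time_pos[OF z] by (intro exit_facts(2)[OF z]) (auto simp: field_simps)
 ultimately have "exit_point \<Omega> e z \<in> closure \<Omega>"
  unfolding closure_sequential exit_point_def by (intro exI[of _ "%n. z + (?t - ?t / real (Suc n)) *\<^sub>R e"]) simp
 then show ?thesis using exit_facts(1)[OF z] op by (simp add: frontier_def interior_open)
qed

text \<open>For nonnegative c, the points with exit time at most c are the complement of the domain
  minus the segment of the vectors t e with t between 0 and c. That is a closed set minus a compact
  one, hence closed.\<close>

lemma exit_time_measurable: "exit_time \<Omega> e \<in> borel_measurable borel"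
proof (rule borel_measurableI_greater)
 fix c :: real
 have "{z. exit_time \<Omega> e z > c} \<in> sets borel"
 proof (cases "c < 0")
  case True
  have "exit_time \<Omega> e z >= 0" for z using exit_facts(3)[of z] by (cases "z \<in> \<Omega>") (auto simp: exit_time_def)
  then have "{z. exit_time \<Omega> e z > c} = UNIV" using True by (auto intro: less_le_trans)
  then show ?thesis by simp
 next
  case False
  have "- {z. exit_time \<Omega> e z > c} = (\<Union>x\<in>- \<Omega>. \<Union>y\<in>(%t. t *\<^sub>R e) ` {0..c}. {x - y})" (is "_ = ?R")
  proof (intro set_eqI iffI)
   fix z assume z: "z \<in> - {z. exit_time \<Omega> e z > c}"
   show "z \<in> ?R"
   proof (cases "z \<in> \<Omega>")
    case True
    then have "exit_time \<Omega> e z \<in> {0..c}" using z exit_facts(3)[OF True] by auto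
    moreover have "z + exit_time \<Omega> e z *\<^sub>R e \<in> - \<Omega>" using exit_facts(1)[OF True] by (simp add: exit_point_def)
    moreover have "z = (z + exit_time \<Omega> e z *\<^sub>R e) - exit_time \<Omega> e z *\<^sub>R e" by simp
    ultimately show ?thesis by blast
   next
    case False
    moreover have "z = z - 0 *\<^sub>R e" "0 \<in> {0..c}" using \<open>\<not> c < 0\<close> by auto
    ultimately show ?thesis by blast
   qed
  next
   fix z assume "z \<in> ?R"
   then obtain x t where x: "x \<notin> \<Omega>" "0 <= t" "t <= c" "z = x - t *\<^sub>R e" by auto
   show "z \<in> - {z. exit_time \<Omega> e z > c}"
   proof (cases "z \<in> \<Omega>")
    case True
    then show ?thesis using exit_facts(5)[OF True, of t] x by auto
   qed (use False in "simp add: exit_time_def")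
  qed
  moreover have "closed ?R"
   by (intro closed_compact_differences compact_continuous_image continuous_intros) (use op in auto)
  ultimately have "closed (- {z. exit_time \<Omega> e z > c})" by simp
  then show ?thesis by (metis borel_closed borel_comp double_compl)
 qed
 then show "{z \<in> space borel. exit_time \<Omega> e z > c} \<in> sets borel" by simp
qed

lemma exit_point_measurable: "exit_point \<Omega> e \<in> borel_measurable borel"
 unfolding exit_point_def[abs_def] using exit_time_measurable by measurable

lemma exit_line_bound:
 assumes w: "smooth_on w UNIV" and z: "z \<in> \<Omega>" "exit_time \<Omega> e z <= L"
 shows "ennreal \<bar>w z - w (exit_point \<Omega> e z)\<bar> <= (\<integral>\<^sup>+sg\<in>{0..L}. ennreal (indicator \<Omega> (z + sg *\<^sub>R e) * norm (grad w (z + sg *\<^sub>R e))) \<partial>lborel)"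
proof -
 let ?t = "exit_time \<Omega> e z"
 have "ennreal \<bar>w z - w (exit_point \<Omega> e z)\<bar> <= (\<integral>\<^sup>+sg\<in>{0..?t}. ennreal (norm (grad w (z + sg *\<^sub>R e)) * norm e) \<partial>lborel)"
  unfolding exit_point_def by (rule line_segment_gradient_bound[OF w exit_facts(3)[OF z(1)]])
 also have "... <= (\<integral>\<^sup>+sg\<in>{0..L}. ennreal (indicator \<Omega> (z + sg *\<^sub>R e) * norm (grad w (z + sg *\<^sub>R e))) \<partial>lborel)"
 proof (rule nn_integral_mono_AE)
  \<comment> \<open>The exit point is outside the domain, so the indicator vanishes at the single
    parameter sg equal to the exit time; that null set is discarded.\<close>
  have "AE sg in lborel. sg ~= ?t" by (rule AE_lborel_singleton)
  then show "AE sg in lborel. ennreal (norm (grad w (z + sg *\<^sub>R e)) * norm e) * indicator {0..?t} sg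
    <= ennreal (indicator \<Omega> (z + sg *\<^sub>R e) * norm (grad w (z + sg *\<^sub>R e))) * indicator {0..L} sg"
  proof eventually_elim
   case (elim sg)
   then show ?case using exit_facts(2)[OF z(1), of sg] e z(2) by (auto split: split_indicator)
  qed
 qed
 finally show ?thesis .
qed

text \<open>Jensen on a segment of length L costs L^(p-1). Fubini and translation in z turn the line
  integral into L copies of the gradient integral, which gives L^p altogether.\<close>

lemma exit_line_bound_Lp:
 assumes w: "smooth_on w UNIV" and p: "p >= 1" and L: "L > 0"
  and [measurable]: "Z \<in> sets borel" and Z: "Z <= \<Omega>" "!!z. z \<in> Z ==> exit_time \<Omega> e z <= L"
 shows "(\<integral>\<^sup>+z\<in>Z. ennreal (\<bar>w z - w (exit_point \<Omega> e z)\<bar> powr p) \<partial>lborel)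
   <= ennreal (L powr p) * (grad_int \<Omega> w p)"
proof -
 note exit_point_measurable [measurable]
 have [measurable]: "\<Omega> \<in> sets borel" using op by simp
 have [measurable]: "w \<in> borel_measurable borel" "grad w \<in> borel_measurable borel"
  using smooth_on_continuous[OF w] smooth_on_continuous_grad[OF w] by (auto intro: borel_measurable_continuous_onI)
 let ?h = "%z. indicator \<Omega> z * norm (grad w z)"
 let ?H = "%z. ennreal (?h z powr p)"
 have 1: "ennreal (\<bar>w z - w (exit_point \<Omega> e z)\<bar> powr p) <= ennreal (L powr (p - 1)) * (\<integral>\<^sup>+sg\<in>{0..L}. ?H (z + sg *\<^sub>R e) \<partial>lborel)"
  if z: "z \<in> Z" for z
 proof -
  let ?M = "restrict_space lborel {0..L}"
  have "ennreal (\<bar>w z - w (exit_point \<Omega> e z)\<bar> powr p) <= ennreal (L powr (p - 1)) * (\<integral>\<^sup>+sg. ennreal (?h (z + sg *\<^sub>R e) powr p) \<partial>?M)"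
  proof (rule jensen_powr)
   show "(%sg. ?h (z + sg *\<^sub>R e)) \<in> borel_measurable ?M"
    by (rule measurable_restrict_space1) measurable
   show "emeasure ?M (space ?M) <= ennreal L" using L by (simp add: emeasure_restrict_space space_restrict_space)
   show "ennreal \<bar>w z - w (exit_point \<Omega> e z)\<bar> <= (\<integral>\<^sup>+sg. ennreal (?h (z + sg *\<^sub>R e)) \<partial>?M)"
    using exit_line_bound[OF w, of z L] Z z by (subst nn_integral_restrict_space) (auto simp: mult.commute)
  qed (use p L in auto)
  then show ?thesis by (subst (asm) nn_integral_restrict_space) auto
 qed
 have "(\<integral>\<^sup>+z\<in>Z. ennreal (\<bar>w z - w (exit_point \<Omega> e z)\<bar> powr p) \<partial>lborel)
   <= (\<integral>\<^sup>+z. ennreal (L powr (p - 1)) * (\<integral>\<^sup>+sg\<in>{0..L}. ?H (z + sg *\<^sub>R e) \<partial>lborel) \<partial>lborel)"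
  using 1 by (intro nn_integral_mono) (auto split: split_indicator)
 also have "... = ennreal (L powr (p - 1)) * (\<integral>\<^sup>+z. (\<integral>\<^sup>+sg\<in>{0..L}. ?H (z + sg *\<^sub>R e) \<partial>lborel) \<partial>lborel)"
  by (rule nn_integral_cmult) measurable
 also have "(\<integral>\<^sup>+z. (\<integral>\<^sup>+sg\<in>{0..L}. ?H (z + sg *\<^sub>R e) \<partial>lborel) \<partial>lborel) = (\<integral>\<^sup>+sg. (\<integral>\<^sup>+z. ?H (z + sg *\<^sub>R e) * indicator {0..L} sg \<partial>lborel) \<partial>lborel)"
  by (rule lborel_pair.Fubini'[symmetric]) measurable
 also have "... = (\<integral>\<^sup>+sg\<in>{0..L}. (\<integral>\<^sup>+z. ?H z \<partial>lborel) \<partial>lborel)"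
  by (subst nn_integral_multc) (auto simp: nn_integral_lborel_translate[of ?H])
 also have "... = ennreal L * (\<integral>\<^sup>+z. ?H z \<partial>lborel)"
  using L by (subst nn_integral_cmult) (auto simp: mult.commute)
 also have "(\<integral>\<^sup>+z. ?H z \<partial>lborel) = (grad_int \<Omega> w p)"
  using p by (intro nn_integral_cong) (auto split: split_indicator)
 also have "ennreal (L powr (p - 1)) * (ennreal L * (grad_int \<Omega> w p))
  = ennreal (L powr p) * (grad_int \<Omega> w p)"
  using L by (simp add: mult.assoc[symmetric] ennreal_mult'[symmetric] powr_diff)
 finally show ?thesis .
qed

end

section \<open>Boundary, trace and embedding inequalities\<close>

lemma ennreal_le_mult_INF:
 fixes x :: ennreal
 assumes "0 <= c" "!!i. i \<in> I ==> x <= ennreal c * f i" "I ~= {}"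
 shows "x <= ennreal c * (INF i\<in>I. f i)"
proof (cases "c = 0")
 case True
 then show ?thesis using assms by auto
next
 case False
 then have c: "c > 0" using assms by simp
 have eq: "ennreal c * (ennreal (1 / c) * y) = y" for y
  using c by (simp add: mult.assoc[symmetric] ennreal_mult[symmetric])
 have "ennreal (1 / c) * x <= f i" if "i \<in> I" for i
 proof -
  have "ennreal (1 / c) * x <= ennreal (1 / c) * (ennreal c * f i)" by (intro mult_left_mono assms that) auto
  also have "... = f i" using c by (simp add: mult.assoc[symmetric] ennreal_mult[symmetric])
  finally show ?thesis .
 qed
 then have "ennreal (1 / c) * x <= (INF i\<in>I. f i)" by (rule INF_greatest)
 then have "ennreal c * (ennreal (1 / c) * x) <= ennreal c * (INF i\<in>I. f i)" by (rule mult_left_mono) auto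
 then show ?thesis by (simp add: eq)
qed

lemma hausdorff_const_pos: "d > 0 ==> hausdorff_const d > 0"
 by (simp add: hausdorff_const_def Gamma_real_pos)

text \<open>Mass distribution principle: summing the hypothesis over a cover bounds the measure by a
  multiple of the total weight of the cover. Only sets up to the fixed size \<open>dl\<close> have
  to be tested, because the Hausdorff measure is the supremum over finer scales.\<close>

lemma hausdorff_outer_dominates:
 fixes mu :: "'a::euclidean_space measure"
 assumes d: "d > 0" and K: "K > 0" and sets: "sets mu = sets borel" and "dl > 0"
  and tube: "!!S. bounded S ==> diameter S <= dl ==> \<exists>B\<in>sets borel. S <= B \<and> emeasure mu B <= ennreal (K * diameter S powr d)"
 shows "\<exists>C\<ge>0. \<forall>E\<in>sets borel. emeasure mu E <= ennreal C * hausdorff_outer d E"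
proof -
 \<comment> \<open>Converts the bound by the d-th power of the diameter into the normalised
   Hausdorff weight, which uses half the diameter.\<close>
 define C where "C = K * 2 powr d / hausdorff_const d"
 have hc: "hausdorff_const d > 0" by (rule hausdorff_const_pos[OF d])
 have C0: "C > 0" using K hc by (simp add: C_def)
 have wt: "ennreal (K * diameter S powr d) = ennreal C * hausdorff_wt d S" if "bounded S" for S :: "'a set"
 proof -
  have "C * (hausdorff_const d * (diameter S / 2) powr d) = K * diameter S powr d"
   using hc diameter_ge_0[OF that] by (simp add: C_def powr_divide)
  then show ?thesis using C0 hc by (simp add: hausdorff_wt_def ennreal_mult'[symmetric])
 qed
 have "emeasure mu E <= ennreal C * hausdorff_outer d E" if E: "E \<in> sets borel" for E
 proof -
  have "emeasure mu E <= ennreal C * hausdorff_pre d dl E"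
  proof (cases "hausdorff_covers dl E = {}")
   case True
   then have pre: "hausdorff_pre d dl E = top" by (simp add: hausdorff_pre_alt)
   show ?thesis using pre C0 by (simp add: ennreal_mult_top)
  next
   case False
   have "emeasure mu E <= ennreal C * (\<Sum>i. hausdorff_wt d (S i))" if S: "S \<in> hausdorff_covers dl E" for S
   proof -
    have "\<exists>B\<in>sets borel. S i <= B \<and> emeasure mu B <= ennreal (K * diameter (S i) powr d)" for i
     using S by (intro tube) (auto simp: hausdorff_covers_def)
    then obtain B where B: "!!i. B i \<in> sets borel" "!!i. S i <= B i" "!!i. emeasure mu (B i) <= ennreal (K * diameter (S i) powr d)"
     by metis
    have "emeasure mu E <= emeasure mu (\<Union>i. B i)"
    proof (rule emeasure_mono)
     have "E <= (\<Union>i. S i)" using S by (simp add: hausdorff_covers_def)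
     also have "... <= (\<Union>i. B i)" using B(2) by blast
     finally show "E <= (\<Union>i. B i)" .
    qed (use B sets in auto)
    also have "... <= (\<Sum>i. emeasure mu (B i))" using B sets by (intro emeasure_subadditive_countably) auto
    also have "... <= (\<Sum>i. ennreal C * hausdorff_wt d (S i))"
     using B(3) S by (intro suminf_le) (auto simp: wt[symmetric] hausdorff_covers_def)
    also have "... = ennreal C * (\<Sum>i. hausdorff_wt d (S i))" by simp
    finally show ?thesis .
   qed
   then show ?thesis unfolding hausdorff_pre_alt using C0 False by (intro ennreal_le_mult_INF) auto
  qed
  also have "... <= ennreal C * hausdorff_outer d E"
   unfolding hausdorff_outer_def using \<open>dl > 0\<close> by (intro mult_left_mono SUP_upper) auto
  finally show ?thesis .
 qed
 then show ?thesis using C0 by (intro exI[of _ C]) auto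
qed

text \<open>About D/r balls of radius 3r, centred at spacing r along the segment, cover the tube;
  each has volume of order r^m, so the total is of order r^(m-1).\<close>

lemma segment_tube_volume:
 fixes a e :: "'a::euclidean_space"
 assumes e: "norm e = 1" and D: "D >= 0"
 shows "\<exists>K>0. ALL a r. 0 < r \<and> r <= 1 --> (\<exists>B\<in>sets borel. {z. \<exists>t\<in>{0..D}. dist (z + t *\<^sub>R e) a <= r} <= B \<and>
   emeasure lborel B <= ennreal (K * r powr (real DIM('a) - 1)))"
proof -
 let ?m = "real DIM('a)"
 define v where "v = unit_ball_vol ?m"
 have v: "v >= 0" by (simp add: v_def)
 \<comment> \<open>The factor D + 1 bounds (N + 1) r for r at most 1, and 3^m comes from the tripled
   radius. The final 1 only secures positivity.\<close>
 define K where "K = (D + 1) * v * 3 ^ DIM('a) + 1"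
 have "\<exists>B\<in>sets borel. {z. \<exists>t\<in>{0..D}. dist (z + t *\<^sub>R e) a <= r} <= B \<and>
   emeasure lborel B <= ennreal (K * r powr (?m - 1))" if r: "0 < r" "r <= 1" for a r
 proof -
  define N where "N = nat \<lfloor>D / r\<rfloor>"
  define B where "B = (\<Union>k\<in>{..N}. ball (a - (real k * r) *\<^sub>R e) (3 * r))"
  have sub: "{z. \<exists>t\<in>{0..D}. dist (z + t *\<^sub>R e) a <= r} <= B"
  proof
   fix z assume "z \<in> {z. \<exists>t\<in>{0..D}. dist (z + t *\<^sub>R e) a <= r}"
   then obtain t where t: "0 <= t" "t <= D" "dist (z + t *\<^sub>R e) a <= r" by auto
   define k where "k = nat \<lfloor>t / r\<rfloor>"
   have kN: "k <= N" unfolding k_def N_def using t r by (intro nat_mono floor_mono divide_right_mono) auto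
   have k: "real k <= t / r" "t / r < real k + 1" using t r by (auto simp: k_def)
   have "\<bar>t - real k * r\<bar> <= r" using k r by (simp add: field_simps)
   moreover have "z - (a - (real k * r) *\<^sub>R e) = (z + t *\<^sub>R e - a) - (t - real k * r) *\<^sub>R e"
    by (simp add: algebra_simps)
   then have "norm (z - (a - (real k * r) *\<^sub>R e)) <= norm (z + t *\<^sub>R e - a) + norm ((t - real k * r) *\<^sub>R e)"
    by (metis norm_triangle_ineq4)
   ultimately have "norm (z - (a - (real k * r) *\<^sub>R e)) <= r + r" using t(3) e by (simp add: dist_norm)
   then have "z \<in> ball (a - (real k * r) *\<^sub>R e) (3 * r)" using r by (simp add: dist_norm norm_minus_commute)
   then show "z \<in> B" using kN by (auto simp: B_def)
  qed
  have "emeasure lborel B <= (\<Sum>k\<in>{..N}. emeasure lborel (ball (a - (real k * r) *\<^sub>R e) (3 * r)))"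
   unfolding B_def by (intro emeasure_subadditive_finite) auto
  also have "... = (\<Sum>k\<in>{..N}. ennreal (v * (3 * r) ^ DIM('a)))" using r by (simp add: emeasure_ball v_def)
  also have "... = ennreal (real (N + 1) * (v * (3 * r) ^ DIM('a)))"
   using v r by (simp add: ennreal_of_nat_eq_real_of_nat ennreal_mult[symmetric] del: of_nat_Suc)
  also have "... <= ennreal (K * r powr (?m - 1))"
  proof (rule ennreal_leI)
   have "real N <= D / r" using D r by (simp add: N_def)
   then have "real (N + 1) <= (D + 1) / r" using r by (simp add: field_simps)
   then have "real (N + 1) * (v * (3 * r) ^ DIM('a)) <= (D + 1) / r * (v * (3 * r) ^ DIM('a))"
    using v r by (intro mult_right_mono) auto
   also have "... = (K - 1) * (r powr ?m / r)" using r by (simp add: K_def powr_realpow power_mult_distrib)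
   also have "... <= K * (r powr ?m / r)" using r by (intro mult_right_mono) auto
   also have "r powr ?m / r = r powr (?m - 1)" using r by (simp add: powr_diff)
   finally show "real (N + 1) * (v * (3 * r) ^ DIM('a)) <= K * r powr (?m - 1)" .
  qed
  finally show ?thesis using sub by (intro bexI[of _ B]) (auto simp: B_def)
 qed
 moreover have "K > 0" using D v by (simp add: K_def add_nonneg_pos)
 ultimately show ?thesis by blast
qed

context
 fixes \<Omega> :: "'a::euclidean_space set" and e :: 'a and D :: real
 assumes op: "open \<Omega>" and e: "norm e = 1" and D: "D > 0" "!!x y. x \<in> \<Omega> ==> y \<in> \<Omega> ==> dist x y < D"
  and dim: "DIM('a) >= 2"
begin

text \<open>Points that leave through a small set S lie in a tube of length D around S, whose volume
  is of order (diameter S)^(m-1). The mass distribution principle then compares the image of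
  Lebesgue measure under the exit map with surface measure.\<close>

lemma exit_push_dominated:
 "\<exists>C\<ge>0. \<forall>E\<in>sets borel. emeasure lborel {z\<in>\<Omega>. exit_point \<Omega> e z \<in> E} <= ennreal C * hausdorff_outer (real DIM('a) - 1) E"
proof -
 let ?d = "real DIM('a) - 1"
 have [measurable]: "\<Omega> \<in> sets borel" "exit_point \<Omega> e \<in> borel_measurable borel"
  using op exit_point_measurable[OF op e D] by auto
 obtain K where K0: "K > 0" and K1: "ALL a r. 0 < r \<and> r <= 1 --> (\<exists>B\<in>sets borel. {z. \<exists>t\<in>{0..D}. dist (z + t *\<^sub>R e) (a::'a) <= r} <= B \<and>
   emeasure lborel B <= ennreal (K * r powr ?d))"
  using segment_tube_volume[OF e less_imp_le[OF D(1)]] by blast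
 define mu where "mu = distr (restrict_space lborel \<Omega>) borel (exit_point \<Omega> e)"
 have [measurable]: "exit_point \<Omega> e \<in> borel_measurable (restrict_space lborel \<Omega>)"
  by (rule measurable_restrict_space1) simp
 have mu: "emeasure mu E = emeasure lborel {z\<in>\<Omega>. exit_point \<Omega> e z \<in> E}" if [measurable]: "E \<in> sets borel" for E
  unfolding mu_def
  by (subst emeasure_distr) (auto simp: emeasure_restrict_space space_restrict_space intro!: arg_cong[of _ _ "emeasure lborel"])
 have tube: "\<exists>B\<in>sets borel. S <= B \<and> emeasure mu B <= ennreal (K * diameter S powr ?d)"
  if S: "bounded S" "diameter S <= 1/2" for S
 proof (cases "S = {}")
  case False
  then obtain a where a: "a \<in> S" by blast
  have d0: "diameter S >= 0" by (rule diameter_ge_0[OF S(1)])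
  \<comment> \<open>The tube estimate needs a positive radius while the diameter may be 0, so the
    radius is enlarged by 1/(2(n+1)) and n tends to infinity. Starting from diameter at most 1/2
    keeps the radius at most 1.\<close>
  have "emeasure mu (cball a (diameter S)) <= ennreal (K * (diameter S + (1/2) / real (Suc n)) powr ?d)" for n
  proof -
   let ?r = "diameter S + (1/2) / real (Suc n)"
   have "(1/2) / real (Suc n) <= 1/2" by (simp add: field_simps)
   moreover have "(1/2) / real (Suc n) > 0" by simp
   ultimately have r: "0 < ?r" "?r <= 1" using d0 S(2) by linarith+
   obtain B where B: "B \<in> sets borel" "{z. \<exists>t\<in>{0..D}. dist (z + t *\<^sub>R e) a <= ?r} <= B"
    "emeasure lborel B <= ennreal (K * ?r powr ?d)" using K1 r by meson
   have "{z\<in>\<Omega>. exit_point \<Omega> e z \<in> cball a (diameter S)} <= B"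
   proof
    fix z assume z: "z \<in> {z\<in>\<Omega>. exit_point \<Omega> e z \<in> cball a (diameter S)}"
    then have "exit_time \<Omega> e z \<in> {0..D}" using exit_facts(3,4)[OF op e D, of z] by auto
    moreover have "dist (exit_point \<Omega> e z) a <= ?r" using z by (simp add: dist_commute add_increasing2)
    ultimately show "z \<in> B" using B(2) unfolding exit_point_def by blast
   qed
   then show ?thesis using B by (subst mu) (auto intro: order_trans[OF emeasure_mono])
  qed
  moreover have "(%n. ennreal (K * (diameter S + (1/2) / real (Suc n)) powr ?d)) ----> ennreal (K * (diameter S + 0) powr ?d)"
   using dim d0 by (intro tendsto_ennrealI tendsto_intros LIMSEQ_Suc[OF lim_const_over_n]) (auto intro!: always_eventually add_nonneg_nonneg)
  ultimately have "emeasure mu (cball a (diameter S)) <= ennreal (K * diameter S powr ?d)"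
   using LIMSEQ_le_const[of _ "ennreal (K * (diameter S + 0) powr ?d)" "emeasure mu (cball a (diameter S))"] by auto
  moreover have "S <= cball a (diameter S)" using a diameter_bounded_bound[OF S(1) a] by auto
  ultimately show ?thesis by (intro bexI[of _ "cball a (diameter S)"]) auto
 qed (auto intro: bexI[of _ "{}"])
 have "\<exists>C\<ge>0. \<forall>E\<in>sets borel. emeasure mu E <= ennreal C * hausdorff_outer ?d E"
  using dim by (intro hausdorff_outer_dominates[where dl="1/2", OF _ K0 _ _ tube]) (auto simp: mu_def)
 then show ?thesis by (simp add: mu)
qed

end

section \<open>Controlling a function by its boundary values and its gradient\<close>

lemma nn_integral_boundary_measure:
 fixes \<Omega> :: "'a::euclidean_space set"
 shows "(\<integral>\<^sup>+y. h y \<partial>boundary_measure \<Omega>) = (\<integral>\<^sup>+y\<in>frontier \<Omega>. h y \<partial>hausdorff_measure (real DIM('a) - 1))"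
 unfolding boundary_measure_def by (rule nn_integral_restrict_space) simp

text \<open>Each point is compared with its exit point in a fixed direction. The difference is a
  line integral of the gradient, and the values at exit points are integrated against a measure
  dominated by surface measure. No connectedness or regularity of the domain enters.\<close>

lemma poincare_boundary:
 fixes \<Omega> :: "'a::euclidean_space set"
 assumes op: "open \<Omega>" and bd: "bounded \<Omega>" and dim: "DIM('a) >= 2"
 shows "\<exists>C\<ge>0. ALL w. smooth_on w UNIV --> (abs_int \<Omega> w) \<le>
   ennreal C * ((\<integral>\<^sup>+y. ennreal \<bar>w y\<bar> \<partial>boundary_measure \<Omega>) + (\<integral>\<^sup>+z\<in>\<Omega>. ennreal (norm (grad w z)) \<partial>lborel))"
proof -
 let ?H = "hausdorff_measure (real DIM('a) - 1) :: 'a measure"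
 obtain e :: 'a where "e \<in> Basis" using nonempty_Basis by blast
 then have e: "norm e = 1" by simp
 obtain R where R: "R > 0" "\<Omega> <= ball 0 R" using bounded_subset_ballD[OF bd, of 0] by blast
 define D where "D = 2 * R"
 have D: "D > 0" "!!x y. x \<in> \<Omega> ==> y \<in> \<Omega> ==> dist x y < D"
 proof -
  fix x y assume "x \<in> \<Omega>" "y \<in> \<Omega>"
  then have "norm x < R" "norm y < R" using R by auto
  then show "dist x y < D" unfolding D_def dist_norm using norm_triangle_ineq4[of x y] by linarith
 qed (use R in "simp add: D_def")
 obtain C where C: "C >= 0" "!!E. E\<in>sets borel ==> emeasure lborel {z\<in>\<Omega>. exit_point \<Omega> e z \<in> E} <= ennreal C * hausdorff_outer (real DIM('a) - 1) E"
  using exit_push_dominated[OF op e D dim] by blast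
 have [measurable]: "\<Omega> \<in> sets borel" "exit_point \<Omega> e \<in> borel_measurable borel"
  using op exit_point_measurable[OF op e D] by auto
 have [measurable]: "exit_point \<Omega> e \<in> borel_measurable (restrict_space lborel \<Omega>)"
  by (rule measurable_restrict_space1) simp
 define mu where "mu = distr (restrict_space lborel \<Omega>) borel (exit_point \<Omega> e)"
 have le: "mu <= scale_measure (ennreal C) ?H"
 proof (rule le_measure[THEN iffD2])
  show "sets mu = sets (scale_measure (ennreal C) ?H)" by (simp add: mu_def)
  show "\<forall>A\<in>sets mu. emeasure mu A <= emeasure (scale_measure (ennreal C) ?H) A"
  proof
   fix E assume "E \<in> sets mu"
   then have [measurable]: "E \<in> sets borel" by (simp add: mu_def)
   have "emeasure mu E = emeasure lborel {z\<in>\<Omega>. exit_point \<Omega> e z \<in> E}"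
    unfolding mu_def
    by (subst emeasure_distr) (auto simp: emeasure_restrict_space space_restrict_space intro!: arg_cong[of _ _ "emeasure lborel"])
   then show "emeasure mu E <= emeasure (scale_measure (ennreal C) ?H) E"
    using C(2)[of E] by (simp add: emeasure_hausdorff_measure)
  qed
 qed
 have main: "(abs_int \<Omega> w) <= ennreal (C + D) *
   ((\<integral>\<^sup>+y. ennreal \<bar>w y\<bar> \<partial>boundary_measure \<Omega>) + (\<integral>\<^sup>+z\<in>\<Omega>. ennreal (norm (grad w z)) \<partial>lborel))"
  if w: "smooth_on w UNIV" for w
 proof -
  have [measurable]: "w \<in> borel_measurable borel"
   using smooth_on_continuous[OF w] by (auto intro: borel_measurable_continuous_onI)
  have cl[measurable]: "frontier \<Omega> \<in> sets borel" by simp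
  let ?f = "%y. ennreal \<bar>w y\<bar> * indicator (frontier \<Omega>) y"
  let ?A = "\<integral>\<^sup>+y. ennreal \<bar>w y\<bar> \<partial>boundary_measure \<Omega>" and ?B = "\<integral>\<^sup>+z\<in>\<Omega>. ennreal (norm (grad w z)) \<partial>lborel"
  have "(abs_int \<Omega> w) <= (\<integral>\<^sup>+z. ?f (exit_point \<Omega> e z) * indicator \<Omega> z + ennreal (\<bar>w z - w (exit_point \<Omega> e z)\<bar> powr 1) * indicator \<Omega> z \<partial>lborel)"
   using exit_point_frontier[OF op e D]
   by (intro nn_integral_mono) (auto split: split_indicator simp: ennreal_plus[symmetric] simp del: ennreal_plus intro!: ennreal_leI)
  also have "... = (\<integral>\<^sup>+z\<in>\<Omega>. ?f (exit_point \<Omega> e z) \<partial>lborel) + (\<integral>\<^sup>+z\<in>\<Omega>. ennreal (\<bar>w z - w (exit_point \<Omega> e z)\<bar> powr 1) \<partial>lborel)"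
   by (rule nn_integral_add) measurable
  also have "(\<integral>\<^sup>+z\<in>\<Omega>. ?f (exit_point \<Omega> e z) \<partial>lborel) = (\<integral>\<^sup>+y. ?f y \<partial>mu)"
   unfolding mu_def using cl by (subst nn_integral_distr) (auto simp: nn_integral_restrict_space)
  also have "... <= (\<integral>\<^sup>+y. ?f y \<partial>scale_measure (ennreal C) ?H)"
   by (intro nn_integral_mono_measure le) (simp add: mu_def)
  also have "... = ennreal C * ?A" using cl by (subst nn_integral_scale_measure) (auto simp: nn_integral_boundary_measure)
  also have "(\<integral>\<^sup>+z\<in>\<Omega>. ennreal (\<bar>w z - w (exit_point \<Omega> e z)\<bar> powr 1) \<partial>lborel) <= ennreal (D powr 1) * (grad_int \<Omega> w 1)"
   using exit_facts(4)[OF op e D] by (intro exit_line_bound_Lp[OF op e D w _ D(1)]) auto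
  also have "... = ennreal D * ?B" using D(1) by simp
  also have "ennreal C * ?A + ennreal D * ?B <= ennreal (C + D) * ?A + ennreal (C + D) * ?B"
   using C(1) D(1) by (intro add_mono mult_right_mono ennreal_leI) auto
  finally show ?thesis by (simp add: distrib_left add_left_mono)
 qed
 show ?thesis using main C(1) D(1) by (intro exI[of _ "C + D"]) auto
qed

section \<open>The uniform interior cone condition near a point of the closure\<close>

definition inner_cone :: "'a::euclidean_space set => 'a => 'a => real => real => real => bool" where
 "inner_cone \<Omega> x0 nu kp h r \<longleftrightarrow> norm nu = 1 \<and> 0 < kp \<and> kp <= 1 \<and> 0 < h \<and> 0 < r \<and>
   (\<forall>y ze sg. y \<in> closure \<Omega> \<and> dist y x0 < r \<and> dist ze nu <= kp \<and> 0 < sg \<and> sg <= h --> y + sg *\<^sub>R ze \<in> \<Omega>)"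

lemma inner_cone_interior:
 fixes \<Omega> :: "'a::euclidean_space set"
 assumes "open \<Omega>" "x0 \<in> \<Omega>"
 shows "\<exists>nu kp h r. inner_cone \<Omega> x0 nu kp h r"
proof -
 obtain \<rho> where \<rho>: "\<rho> > 0" "ball x0 \<rho> <= \<Omega>" using assms by (meson open_contains_ball)
 obtain e :: 'a where "e \<in> Basis" using nonempty_Basis by blast
 then have e: "norm e = 1" by simp
 have "y + sg *\<^sub>R ze \<in> \<Omega>" if "dist y x0 < \<rho> / 2" "dist ze e <= 1" "0 < sg" "sg <= \<rho> / 8" for y ze sg
 proof -
  have "norm ze <= 2" using that(2) e norm_triangle_sub[of ze e] by (simp add: dist_norm)
  then have "norm (sg *\<^sub>R ze) <= \<rho> / 8 * 2" using mult_mono[OF that(4), of "norm ze" 2] that(3) \<rho>(1) by simp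
  then have "norm (y + sg *\<^sub>R ze - x0) < \<rho>" using that(1) norm_triangle_ineq[of "y - x0" "sg *\<^sub>R ze"] \<rho>(1)
   by (simp add: dist_norm algebra_simps)
  then show ?thesis using \<rho>(2) by (auto simp: dist_norm norm_minus_commute)
 qed
 then have "inner_cone \<Omega> x0 e 1 (\<rho>/8) (\<rho>/2)" using e \<rho>(1) by (auto simp: inner_cone_def)
 then show ?thesis by blast
qed

text \<open>The axis is the inner unit normal at x0. Near x0 the defining function has negative
  derivative in all directions close to the axis, and it is nonpositive on the closure, so it
  becomes strictly negative along the cone.\<close>

lemma inner_cone_frontier:
 fixes \<Omega> :: "'a::euclidean_space set"
 assumes "open \<Omega>" "smooth_boundary \<Omega>" "x0 \<in> frontier \<Omega>"
 shows "\<exists>nu kp h r. inner_cone \<Omega> x0 nu kp h r"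
proof -
 obtain U ps where U: "open U" "x0 \<in> U" "smooth_on ps U" "!!y. y \<in> U ==> frechet_derivative ps (at y) ~= (%_. 0)"
  "\<Omega> Int U = {y\<in>U. ps y < 0}"
  using assms(2,3) unfolding smooth_boundary_def by meson
 have "Ck_on (Suc 0) ps U" using U(3) by (simp add: smooth_on_def del: Ck_on.simps)
 then have diff: "ps differentiable (at y)" if "y \<in> U" for y using that by simp
 have gc: "continuous_on U (grad ps)" using \<open>Ck_on (Suc 0) ps U\<close>
  unfolding grad_def[abs_def] by (auto intro!: continuous_intros)
 have der: "(ps has_derivative (%h. grad ps y \<bullet> h)) (at y)" if "y \<in> U" for y
  by (rule differentiable_has_grad[OF diff[OF that]])
 define n where "n = grad ps x0"
 have "frechet_derivative ps (at x0) = (%h. n \<bullet> h)"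
  using der[OF U(2)] unfolding n_def by (metis frechet_derivative_at)
 then have "n ~= 0" using U(4)[OF U(2)] by auto
 then have n: "norm n > 0" by simp
 define nu where "nu = - (n /\<^sub>R norm n)"
 have nu: "norm nu = 1" using n by (simp add: nu_def)
 have nnu: "n \<bullet> nu = - norm n" using n by (simp add: nu_def dot_square_norm power2_eq_square)
 have "isCont (grad ps) x0" using gc U(1,2) by (simp add: continuous_on_eq_continuous_at)
 then obtain r1 where r1: "r1 > 0" "!!y. dist y x0 < r1 ==> dist (grad ps y) n < norm n / 4"
  using n unfolding continuous_at_eps_delta n_def[symmetric] by (metis divide_pos_pos zero_less_numeral)
 obtain r2 where r2: "r2 > 0" "ball x0 r2 <= U" using U(1,2) by (meson open_contains_ball)
 define r0 where "r0 = min r1 r2"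
 have r0: "r0 > 0" "!!y. dist y x0 < r0 ==> dist (grad ps y) n < norm n / 4" "!!y. dist y x0 < r0 ==> y \<in> U"
  using r1 r2 by (auto simp: r0_def dist_commute subset_eq)
 \<comment> \<open>With |n| factored out, the main term is -1, changing the direction costs at most
   1/4, and changing the base point costs at most (1/4)(5/4) = 5/16.\<close>
 have neg: "grad ps y \<bullet> ze < 0" if "dist y x0 < r0" "dist ze nu <= 1/4" for y ze
 proof -
  have "norm ze <= 5/4" using that(2) nu norm_triangle_sub[of ze nu] by (simp add: dist_norm)
  have "n \<bullet> (ze - nu) <= norm n * norm (ze - nu)" by (rule norm_cauchy_schwarz)
  also have "... <= norm n * (1/4)" using that(2) by (intro mult_left_mono) (auto simp: dist_norm)
  finally have 1: "n \<bullet> (ze - nu) <= norm n / 4" by simp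
  have "(grad ps y - n) \<bullet> ze <= norm (grad ps y - n) * norm ze" by (rule norm_cauchy_schwarz)
  also have "... <= (norm n / 4) * (5/4)" using r0(2)[OF that(1)] \<open>norm ze <= 5/4\<close> by (intro mult_mono) (auto simp: dist_norm)
  finally have 2: "(grad ps y - n) \<bullet> ze <= norm n * (5/16)" by simp
  have "grad ps y \<bullet> ze = n \<bullet> nu + n \<bullet> (ze - nu) + (grad ps y - n) \<bullet> ze" by (simp add: inner_diff_left inner_diff_right)
  then show ?thesis using 1 2 n nnu by linarith
 qed
 have le0: "ps y <= 0" if "y \<in> closure \<Omega>" "y \<in> U" for y
 proof (rule ccontr)
  assume "\<not> ps y <= 0"
  have "continuous_on U ps" using U(3) unfolding smooth_on_def by (metis Ck_on.simps(1))
  then have "open (U Int ps -` {0<..})" by (intro continuous_open_preimage U(1)) auto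
  moreover have "(U Int ps -` {0<..}) Int closure \<Omega> ~= {}" using \<open>\<not> ps y <= 0\<close> that by auto
  ultimately have "(U Int ps -` {0<..}) Int \<Omega> ~= {}" by (simp add: open_Int_closure_eq_empty)
  then obtain x where "x \<in> \<Omega>" "x \<in> U Int ps -` {0<..}" by blast
  then show False using U(5) by force
 qed
 \<comment> \<open>The radii keep the whole segment where the derivative is controlled: r0/2 +
   (r0/4)(5/4) is 13 r0/16.\<close>
 have "y + sg *\<^sub>R ze \<in> \<Omega>" if y: "y \<in> closure \<Omega>" "dist y x0 < r0 / 2" and ze: "dist ze nu <= 1/4" and sg: "0 < sg" "sg <= r0 / 4" for y ze sg
 proof -
  have "norm ze <= 5/4" using ze nu norm_triangle_sub[of ze nu] by (simp add: dist_norm)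
  have near: "dist (y + t *\<^sub>R ze) x0 < r0" if "0 <= t" "t <= sg" for t
  proof -
   have "norm (t *\<^sub>R ze) <= r0 / 4 * (5/4)"
    using that sg \<open>norm ze <= 5/4\<close> mult_mono[of t "r0/4" "norm ze" "5/4"] by simp
   then show ?thesis using y(2) r0(1) norm_triangle_ineq[of "y - x0" "t *\<^sub>R ze"]
    by (simp add: dist_norm algebra_simps)
  qed
  have "ps (y + sg *\<^sub>R ze) < ps (y + 0 *\<^sub>R ze)"
  proof (rule DERIV_neg_imp_decreasing[OF sg(1)])
   fix t assume t: "0 <= t" "t <= sg"
   have "((%t. ps (y + t *\<^sub>R ze)) has_derivative (%h. grad ps (y + t *\<^sub>R ze) \<bullet> (h *\<^sub>R ze))) (at t)"
    by (rule has_derivative_compose[of "%t. y + t *\<^sub>R ze" "%h. h *\<^sub>R ze" t UNIV ps "%h. grad ps (y + t *\<^sub>R ze) \<bullet> h"])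
      (auto intro!: derivative_eq_intros der[OF r0(3)[OF near[OF t]]])
   then have "((%t. ps (y + t *\<^sub>R ze)) has_real_derivative (grad ps (y + t *\<^sub>R ze) \<bullet> ze)) (at t)"
    by (simp add: has_field_derivative_def mult_commute_abs)
   then show "EX d. ((%t. ps (y + t *\<^sub>R ze)) has_real_derivative d) (at t) \<and> d < 0"
    using neg[OF near[OF t] ze] by blast
  qed
  moreover have "y \<in> U" "y + sg *\<^sub>R ze \<in> U" using r0(3)[OF near[of 0]] r0(3)[OF near[of sg]] sg by auto
  ultimately show ?thesis using le0[OF y(1)] U(5) by fastforce
 qed
 then have "inner_cone \<Omega> x0 nu (1/4) (r0/4) (r0/2)" using nu r0(1) by (auto simp: inner_cone_def)
 then show ?thesis by blast
qed

lemma inner_cone_exists: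
 fixes \<Omega> :: "'a::euclidean_space set"
 assumes "open \<Omega>" "smooth_boundary \<Omega>" "x0 \<in> closure \<Omega>"
 shows "\<exists>nu kp h r. inner_cone \<Omega> x0 nu kp h r"
 using inner_cone_interior inner_cone_frontier assms by (metis Diff_iff frontier_def interior_open)

section \<open>Surface measure against volume in a collar, and the trace inequality\<close>

lemma bounded_strict_diameter:
 fixes \<Omega> :: "'a::euclidean_space set"
 assumes "bounded \<Omega>"
 obtains D where "D > 0" "!!x y. x \<in> \<Omega> ==> y \<in> \<Omega> ==> dist x y < D"
proof -
 obtain R where R: "R > 0" "\<Omega> <= ball 0 R" using bounded_subset_ballD[OF assms, of 0] by blast
 have "dist x y < 2 * R" if "x \<in> \<Omega>" "y \<in> \<Omega>" for x y
 proof -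
  have "norm x < R" "norm y < R" using R that by auto
  then show ?thesis unfolding dist_norm using norm_triangle_ineq4[of x y] by linarith
 qed
 then show ?thesis using that[of "2 * R"] R(1) by simp
qed

definition collar :: "'a::euclidean_space set => 'a => real => 'a set" where
 "collar \<Omega> e h = {z\<in>\<Omega>. exit_time \<Omega> e z <= h}"

text \<open>Above the boundary point y, along the inner axis, sits a stack of about h/(4a) disjoint
  balls of radius \<open>kp * a\<close>, all of whose points leave the domain within 2a of y. Their
  total volume is of order a^(m-1), the reverse of the tube estimate.\<close>

lemma collar_ball_volume:
 fixes \<Omega> :: "'a::euclidean_space set"
 assumes op: "open \<Omega>" and bd: "bounded \<Omega>" and cone: "inner_cone \<Omega> x0 nu kp h r"
  and y: "y \<in> frontier \<Omega>" "dist y x0 < r / 2" and a: "0 < a" "a <= h / 4" "a <= r / 8"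
 shows "ennreal (h * unit_ball_vol (real DIM('a)) * kp ^ DIM('a) / 8 * a powr (real DIM('a) - 1))
  <= emeasure lborel {z \<in> collar \<Omega> (- nu) h. exit_point \<Omega> (- nu) z \<in> cball y (2 * a)}"
proof -
 let ?m = "real DIM('a)"
 define v where "v = unit_ball_vol ?m"
 have v: "v >= 0" by (simp add: v_def)
 have nu: "norm nu = 1" and kp: "0 < kp" "kp <= 1" and h: "0 < h" and r: "0 < r"
  and C: "!!y ze sg. y \<in> closure \<Omega> ==> dist y x0 < r ==> dist ze nu <= kp ==> 0 < sg ==> sg <= h ==> y + sg *\<^sub>R ze \<in> \<Omega>"
  using cone by (auto simp: inner_cone_def)
 have e: "norm (- nu) = 1" using nu by simp
 obtain D where D: "D > 0" "!!x y. x \<in> \<Omega> ==> y \<in> \<Omega> ==> dist x y < D" using bounded_strict_diameter[OF bd] by blast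
 have yc: "y \<in> closure \<Omega>" "y \<notin> \<Omega>" using y op by (auto simp: frontier_def interior_open)
 note [measurable] = exit_time_measurable[OF op e D] exit_point_measurable[OF op e D]
 have [measurable]: "\<Omega> \<in> sets borel" using op by simp
 let ?T = "{z \<in> collar \<Omega> (- nu) h. exit_point \<Omega> (- nu) z \<in> cball y (2 * a)}"
 have [measurable]: "cball y (2 * a) \<in> sets borel" by simp
 have Tm: "?T \<in> sets borel" unfolding collar_def by measurable
 \<comment> \<open>The line through such a point stays inside down to height a above y and is
   outside at height -a. The exit height is thus within a of y, and the sideways offset adds at most
   another a.\<close>
 have inT: "y + sg *\<^sub>R nu + x \<in> ?T" if sg: "a <= sg" "sg <= h / 2" and x: "norm x <= kp * a" for sg x
 proof -
  let ?z = "y + sg *\<^sub>R nu + x"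
  have inn: "y + t *\<^sub>R nu + x \<in> \<Omega>" if t: "a <= t" "t <= h" for t
  proof -
   have t0: "t > 0" using t a by simp
   have "norm x <= kp * t" using x t kp by (meson mult_left_mono less_imp_le order_trans)
   then have "dist (nu + x /\<^sub>R t) nu <= kp" using t0 by (simp add: dist_norm field_simps)
   then have "y + t *\<^sub>R (nu + x /\<^sub>R t) \<in> \<Omega>" using C yc y t t0 r by (intro C) auto
   then show ?thesis using t0 by (simp add: algebra_simps)
  qed
  \<comment> \<open>If this point were in the domain, its own inner cone would contain y, which is
    impossible for a frontier point of an open set.\<close>
  have out: "y - a *\<^sub>R nu + x \<notin> \<Omega>"
  proof
   assume *: "y - a *\<^sub>R nu + x \<in> \<Omega>"
   have "norm (y - a *\<^sub>R nu + x - x0) <= norm (y - x0) + norm (a *\<^sub>R nu) + norm x"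
    using norm_triangle_ineq4[of "y - x0" "a *\<^sub>R nu"] norm_triangle_ineq[of "y - x0 - a *\<^sub>R nu" x] by (simp add: algebra_simps)
   also have "... < r / 2 + a + 1 * a"
    using y(2) nu a x kp by (intro add_less_le_mono) (auto simp: dist_norm intro: order_trans[OF x] mult_right_mono)
   also have "... <= r" using a by simp
   finally have d: "dist (y - a *\<^sub>R nu + x) x0 < r" by (simp add: dist_norm)
   have "dist (nu - x /\<^sub>R a) nu <= kp" using x a by (simp add: dist_norm field_simps)
   then have "(y - a *\<^sub>R nu + x) + a *\<^sub>R (nu - x /\<^sub>R a) \<in> \<Omega>"
    using * d a h closure_subset[of \<Omega>] by (intro C) auto
   then show False using a yc by (simp add: algebra_simps)
  qed
  have z: "?z \<in> \<Omega>" using inn[of sg] sg h a by simp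
  let ?t = "exit_time \<Omega> (- nu) ?z"
  have zq: "?z + (sg + a) *\<^sub>R (- nu) = y - a *\<^sub>R nu + x" by (simp add: algebra_simps)
  have "?z + (sg + a) *\<^sub>R (- nu) \<notin> \<Omega>" by (subst zq) (rule out)
  moreover have "0 <= sg + a" using sg a by simp
  ultimately have t1: "?t <= sg + a" using exit_facts(5)[OF op e D z] by blast
  have t2: "?t >= sg - a"
  proof (rule ccontr)
   assume "\<not> ?thesis"
   then have "y + (sg - ?t) *\<^sub>R nu + x \<in> \<Omega>" using exit_facts(3)[OF op e D z] sg h by (intro inn) auto
   moreover have "exit_point \<Omega> (- nu) ?z = y + (sg - ?t) *\<^sub>R nu + x" by (simp add: exit_point_def algebra_simps)
   ultimately show False using exit_facts(1)[OF op e D z] by simp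
  qed
  have "exit_point \<Omega> (- nu) ?z - y = (sg - ?t) *\<^sub>R nu + x" by (simp add: exit_point_def algebra_simps)
  then have "norm (exit_point \<Omega> (- nu) ?z - y) <= \<bar>sg - ?t\<bar> + norm x"
   using norm_triangle_ineq[of "(sg - ?t) *\<^sub>R nu" x] nu by simp
  also have "... <= a + 1 * a" using t1 t2 x kp a by (intro add_mono) (auto intro: order_trans[OF x] mult_right_mono)
  finally have "exit_point \<Omega> (- nu) ?z \<in> cball y (2 * a)" by (simp add: dist_norm norm_minus_commute)
  moreover have "?t <= h" using t1 sg a by simp
  ultimately show ?thesis using z by (simp add: collar_def)
 qed
 \<comment> \<open>The balls are centred at the heights a(2i+1), and N is the largest i for which
   this is at most h/2. Spacing 2a makes them disjoint because kp is at most 1, and N + 1 is at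
   least h/(8a) because h/(2a) is at least 2.\<close>
 define N where "N = nat \<lfloor>(h / (2 * a) - 1) / 2\<rfloor>"
 have ha: "h / (2 * a) >= 2" using a by (simp add: field_simps)
 have "0 <= \<lfloor>(h / (2 * a) - 1) / 2\<rfloor>" using ha by simp
 then have "real N = real_of_int \<lfloor>(h / (2 * a) - 1) / 2\<rfloor>" unfolding N_def by (rule of_nat_nat)
 then have N: "real N <= (h / (2 * a) - 1) / 2" "(h / (2 * a) - 1) / 2 < real N + 1" by linarith+
 define c where "c i = y + (a * (2 * real i + 1)) *\<^sub>R nu" for i :: nat
 have sub: "(\<Union>i\<in>{..N}. ball (c i) (kp * a)) <= ?T"
 proof
  fix z assume "z \<in> (\<Union>i\<in>{..N}. ball (c i) (kp * a))"
  then obtain i where i: "i <= N" "dist (c i) z < kp * a" by auto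
  have "2 * real i + 1 <= h / (2 * a)" using i(1) N(1) by simp
  then have "a * (2 * real i + 1) <= h / 2" using a by (simp add: field_simps)
  moreover have "a <= a * (2 * real i + 1)" using a by simp
  ultimately have "y + (a * (2 * real i + 1)) *\<^sub>R nu + (z - c i) \<in> ?T"
   using i(2) by (intro inT) (auto simp: dist_norm norm_minus_commute)
  then show "z \<in> ?T" by (simp add: c_def)
 qed
 have disj: "disjoint_family_on (%i. ball (c i) (kp * a)) {..N}"
  unfolding disjoint_family_on_def
 proof (intro ballI impI)
  fix i j :: nat assume "i ~= j"
  have "dist (c i) (c j) = \<bar>a * (2 * real i + 1) - a * (2 * real j + 1)\<bar>"
   using nu by (simp add: c_def dist_norm scaleR_diff_left[symmetric])
  also have "a * (2 * real i + 1) - a * (2 * real j + 1) = 2 * a * (real i - real j)" by (simp add: algebra_simps)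
  also have "\<bar>2 * a * (real i - real j)\<bar> = 2 * a * \<bar>real i - real j\<bar>" using a by (simp add: abs_mult)
  finally have "dist (c i) (c j) = 2 * a * \<bar>real i - real j\<bar>" .
  moreover have "2 * a * 1 <= 2 * a * \<bar>real i - real j\<bar>" using \<open>i ~= j\<close> a by (intro mult_left_mono) auto
  ultimately have "dist (c i) (c j) >= 2 * (kp * a)" using kp a mult_right_mono[of kp 1 a] by linarith
  moreover have "dist (c i) (c j) < 2 * (kp * a)" if "x \<in> ball (c i) (kp * a)" "x \<in> ball (c j) (kp * a)" for x
   using that dist_triangle2[of "c i" "c j" x] by simp
  ultimately show "ball (c i) (kp * a) Int ball (c j) (kp * a) = {}" by fastforce
 qed
 have "emeasure lborel (\<Union>i\<in>{..N}. ball (c i) (kp * a)) = (\<Sum>i\<in>{..N}. emeasure lborel (ball (c i) (kp * a)))"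
  using disj by (intro sum_emeasure[symmetric]) auto
 also have "... = ennreal (real (N + 1) * (v * (kp * a) ^ DIM('a)))"
  using v kp a by (simp add: emeasure_ball v_def ennreal_of_nat_eq_real_of_nat ennreal_mult[symmetric] del: of_nat_Suc)
 finally have "ennreal (real (N + 1) * (v * (kp * a) ^ DIM('a))) <= emeasure lborel ?T"
  using emeasure_mono[OF sub, of lborel] Tm by simp
 moreover have "h * v * kp ^ DIM('a) / 8 * a powr (?m - 1) <= real (N + 1) * (v * (kp * a) ^ DIM('a))"
 proof -
  have "h / (8 * a) <= (h / (2 * a) - 1) / 2" using ha by (simp add: field_simps)
  then have "h / (8 * a) <= real (N + 1)" using N(2) by simp
  then have "h / (8 * a) * (v * (kp * a) ^ DIM('a)) <= real (N + 1) * (v * (kp * a) ^ DIM('a))"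
   using v kp a by (intro mult_right_mono) auto
  moreover have "a powr (?m - 1) = a ^ DIM('a) / a" using a by (simp add: powr_diff powr_realpow)
  ultimately show ?thesis by (simp add: power_mult_distrib)
 qed
 ultimately show ?thesis unfolding v_def[symmetric] by (meson ennreal_leI order_trans)
qed

text \<open>A Vitali covering: disjoint small balls centred in E carry mass at least c a^(m-1) each,
  and their fivefold enlargements cover E. This bounds the Hausdorff measure of E by the mass of any
  open neighbourhood, and outer regularity shrinks the neighbourhood to E.\<close>

lemma hausdorff_upper_collar:
 fixes \<Omega> :: "'a::euclidean_space set"
 assumes op: "open \<Omega>" and bd: "bounded \<Omega>" and cone: "inner_cone \<Omega> x0 nu kp h r" and dim: "DIM('a) >= 2"
 shows "\<exists>C\<ge>0. \<forall>E\<in>sets borel. E <= frontier \<Omega> Int ball x0 (r/2) -->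
   hausdorff_outer (real DIM('a) - 1) E <= ennreal C * emeasure lborel {z \<in> collar \<Omega> (- nu) h. exit_point \<Omega> (- nu) z \<in> E}"
proof -
 let ?d = "real DIM('a) - 1"
 have d: "?d > 0" using dim by simp
 have nu: "norm nu = 1" and kp: "0 < kp" "kp <= 1" and h: "0 < h" and r: "0 < r" using cone by (auto simp: inner_cone_def)
 have e: "norm (- nu) = 1" using nu by simp
 obtain D where D: "D > 0" "!!x y. x \<in> \<Omega> ==> y \<in> \<Omega> ==> dist x y < D" using bounded_strict_diameter[OF bd] by blast
 note [measurable] = exit_time_measurable[OF op e D] exit_point_measurable[OF op e D]
 have [measurable]: "\<Omega> \<in> sets borel" using op by simp
 have cm[measurable]: "collar \<Omega> (- nu) h \<in> sets borel" unfolding collar_def by measurable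
 have [measurable]: "exit_point \<Omega> (- nu) \<in> borel_measurable (restrict_space lborel (collar \<Omega> (- nu) h))"
  by (rule measurable_restrict_space1) simp
 define mu where "mu = distr (restrict_space lborel (collar \<Omega> (- nu) h)) borel (exit_point \<Omega> (- nu))"
 have sm[simp]: "sets mu = sets borel" "space mu = UNIV" by (simp_all add: mu_def)
 have mu: "emeasure mu E = emeasure lborel {z \<in> collar \<Omega> (- nu) h. exit_point \<Omega> (- nu) z \<in> E}" if [measurable]: "E \<in> sets borel" for E
  unfolding mu_def
  by (subst emeasure_distr) (auto simp: emeasure_restrict_space space_restrict_space intro!: arg_cong[of _ _ "emeasure lborel"])
 have fin: "emeasure mu (space mu) ~= \<infinity>"
 proof -
  have "emeasure mu UNIV <= emeasure lborel \<Omega>" by (subst mu) (auto intro!: emeasure_mono simp: collar_def)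
  also have "... < \<infinity>" using emeasure_bounded_finite[OF bd] by simp
  finally show ?thesis by simp
 qed
 define c where "c = h * unit_ball_vol (real DIM('a)) * kp ^ DIM('a) / 8"
 have c: "c > 0" using h kp by (simp add: c_def)
 define a0 where "a0 = min (h/4) (r/8)"
 have a0: "a0 > 0" using h r by (simp add: a0_def)
 have low: "ennreal (c * a powr ?d) <= emeasure mu (cball y (2 * a))"
  if "y \<in> frontier \<Omega>" "dist y x0 < r / 2" "0 < a" "a <= a0" for y a
  using collar_ball_volume[OF op bd cone that(1,2,3)] that(4) by (simp add: mu a0_def c_def)
 \<comment> \<open>An enlarged ball has radius 5(2a) = 10a, which explains the factor 10.\<close>
 define C where "C = hausdorff_const ?d * 10 powr ?d / c"
 have C: "C > 0" using hausdorff_const_pos[OF d] c by (simp add: C_def)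
 have "hausdorff_outer ?d E <= ennreal C * emeasure mu E" if E: "E \<in> sets borel" "E <= frontier \<Omega> Int ball x0 (r/2)" for E
 proof -
  have 1: "hausdorff_pre ?d dl E <= ennreal C * emeasure mu V" if V: "open V" "E <= V" and dl: "dl > 0" for V dl
  proof -
   \<comment> \<open>The enlarged balls have diameter 20a and must be fine at scale
     \<open>dl\<close>; the small balls must stay inside V.\<close>
   have "EX a. 0 < a \<and> a <= a0 \<and> 20 * a <= dl \<and> cball y (2 * a) <= V" if "y \<in> E" for y
   proof -
    have "y \<in> V" using V(2) that by blast
    then obtain \<rho> where \<rho>: "\<rho> > 0" "cball y \<rho> <= V" using V(1) unfolding open_contains_cball by blast
    define a where "a = min (\<rho>/2) (min a0 (dl/20))"
    have "0 < a" "a <= a0" "20 * a <= dl" "2 * a <= \<rho>" using \<rho>(1) a0 dl by (auto simp: a_def)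
    moreover from \<open>2 * a <= \<rho>\<close> have "cball y (2 * a) <= V" using \<rho>(2) subset_cball[of "2 * a" \<rho> y] by blast
    ultimately show ?thesis by blast
   qed
   then obtain a where a: "!!y. y \<in> E ==> 0 < a y \<and> a y <= a0 \<and> 20 * a y <= dl \<and> cball y (2 * a y) <= V" by metis
   obtain K where K: "countable K" "K <= E" "pairwise (%i j. disjnt (cball i (2 * a i)) (cball j (2 * a j))) K"
    "E <= (\<Union>i\<in>K. cball i (5 * (2 * a i)))"
   proof (rule Vitali_covering_lemma_cballs[where S=E and K=E and a="%y. y" and r="%y. 2 * a y" and B="2 * a0"])
    show "E <= (\<Union>i\<in>E. cball i (2 * a i))"
    proof
     fix y assume "y \<in> E"
     then have "y \<in> cball y (2 * a y)" using a[of y] by simp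
     then show "y \<in> (\<Union>i\<in>E. cball i (2 * a i))" using \<open>y \<in> E\<close> by blast
    qed
   qed (use a in auto)
   define I where "I = to_nat_on K ` K"
   define F where "F n = from_nat_into K n" for n
   have F: "F n \<in> K" "to_nat_on K (F n) = n" if "n \<in> I" for n using that K(1) by (auto simp: I_def F_def)
   have FI: "\<exists>n\<in>I. F n = y" if "y \<in> K" for y using that K(1) by (auto simp: I_def F_def)
   define S where "S n = (if n \<in> I then cball (F n) (5 * (2 * a (F n))) else {})" for n
   define B where "B n = (if n \<in> I then cball (F n) (2 * a (F n)) else {})" for n
   have "S \<in> hausdorff_covers dl E"
    unfolding hausdorff_covers_def
   proof (intro CollectI conjI allI)
    show "E <= (\<Union>i. S i)"
    proof
     fix x assume "x \<in> E"
     then obtain y where y: "y \<in> K" "x \<in> cball y (5 * (2 * a y))" using K(4) by blast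
     obtain n where "n \<in> I" "F n = y" using FI[OF y(1)] by blast
     then have "x \<in> S n" using y(2) by (simp add: S_def)
     then show "x \<in> (\<Union>i. S i)" by blast
    qed
    fix n
    show "bounded (S n)" by (simp add: S_def)
    show "diameter (S n) <= dl"
    proof (cases "n \<in> I")
     case True
     then show ?thesis using a[of "F n"] F(1)[OF True] K(2) by (auto simp: S_def diameter_cball)
    qed (use dl in "simp add: S_def")
   qed
   then have "hausdorff_pre ?d dl E <= (\<Sum>n. hausdorff_wt ?d (S n))" by (rule hausdorff_pre_le)
   also have "... <= (\<Sum>n. ennreal C * emeasure mu (B n))"
   proof (intro suminf_le)
    fix n show "hausdorff_wt ?d (S n) <= ennreal C * emeasure mu (B n)"
    proof (cases "n \<in> I")
     case True
     then have y: "F n \<in> E" using F K(2) by blast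
     let ?a = "a (F n)"
     have "hausdorff_wt ?d (S n) = ennreal (hausdorff_const ?d * (10 * ?a) powr ?d)"
      using True a[OF y] by (simp add: hausdorff_wt_def S_def diameter_cball)
     also have "... = ennreal C * ennreal (c * ?a powr ?d)"
      using c C a[OF y] by (simp add: ennreal_mult'[symmetric] C_def powr_mult)
     also have "... <= ennreal C * emeasure mu (B n)"
      using True y E(2) a[OF y] by (intro mult_left_mono) (auto simp: B_def dist_commute intro!: low)
     finally show ?thesis .
    qed (simp add: S_def)
   qed auto
   also have "... = ennreal C * (\<Sum>n. emeasure mu (B n))" by simp
   also have "(\<Sum>n. emeasure mu (B n)) = emeasure mu (\<Union>n. B n)"
   proof (rule suminf_emeasure)
    show "disjoint_family B"
     unfolding disjoint_family_on_def
    proof (intro ballI impI)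
     fix m n :: nat assume "m ~= n"
     show "B m Int B n = {}"
     proof (cases "m \<in> I \<and> n \<in> I")
      case True
      then have "F m ~= F n" using F(2) \<open>m ~= n\<close> by metis
      then show ?thesis using K(3) F(1) True by (auto simp: pairwise_def disjnt_def B_def)
     qed (auto simp: B_def)
    qed
   qed (auto simp: B_def)
   also have "... <= emeasure mu V"
   proof (rule emeasure_mono)
    show "(\<Union>n. B n) <= V"
    proof
     fix x assume "x \<in> (\<Union>n. B n)"
     then obtain n where n: "n \<in> I" "x \<in> cball (F n) (2 * a (F n))" by (auto simp: B_def split: if_splits)
     then show "x \<in> V" using a[of "F n"] F(1)[OF n(1)] K(2) by blast
    qed
   qed (use V in simp)
   finally show ?thesis by (simp add: mult_left_mono)
  qed
  have "hausdorff_pre ?d dl E <= ennreal C * emeasure mu E" if "dl > 0" for dl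
  proof -
   \<comment> \<open>Outer regularity is available because the collar has finite volume.\<close>
   have "emeasure mu E = (INF U \<in> {U. E <= U \<and> open U}. emeasure mu U)"
    using fin E(1) by (intro outer_regular) auto
   then show ?thesis using 1[OF _ _ that] C by (auto intro!: ennreal_le_mult_INF)
  qed
  then show ?thesis unfolding hausdorff_outer_def by (intro SUP_least) auto
 qed
 then show ?thesis using C by (intro exI[of _ C]) (auto simp: mu)
qed

text \<open>Surface measure is bounded by the image of the collar under the exit map, so the surface
  integral becomes a volume integral of w at exit points. There w is replaced by its value in the
  collar, at the price of a line integral of the gradient.\<close>

lemma trace_inequality_local:
 fixes \<Omega> :: "'a::euclidean_space set"
 assumes op: "open \<Omega>" and bd: "bounded \<Omega>" and cone: "inner_cone \<Omega> x0 nu kp h r" and dim: "DIM('a) >= 2" and p: "p >= 1"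
 shows "\<exists>C\<ge>0. ALL w. smooth_on w UNIV -->
   (\<integral>\<^sup>+y\<in>frontier \<Omega> Int ball x0 (r/2). ennreal (\<bar>w y\<bar> powr p) \<partial>hausdorff_measure (real DIM('a) - 1)) \<le>
   ennreal C * ((powr_int \<Omega> w p) + (grad_int \<Omega> w p))"
proof -
 let ?d = "real DIM('a) - 1"
 let ?H = "hausdorff_measure ?d :: 'a measure"
 let ?\<Gamma> = "frontier \<Omega> Int ball x0 (r/2)"
 have nu: "norm nu = 1" and h: "0 < h" using cone by (auto simp: inner_cone_def)
 have e: "norm (- nu) = 1" using nu by simp
 obtain D where D: "D > 0" "!!x y. x \<in> \<Omega> ==> y \<in> \<Omega> ==> dist x y < D" using bounded_strict_diameter[OF bd] by blast
 note [measurable] = exit_time_measurable[OF op e D] exit_point_measurable[OF op e D]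
 have [measurable]: "\<Omega> \<in> sets borel" using op by simp
 define Z where "Z = collar \<Omega> (- nu) h"
 have cm[measurable]: "Z \<in> sets borel" unfolding Z_def collar_def by measurable
 have Z: "Z <= \<Omega>" "!!z. z \<in> Z ==> exit_time \<Omega> (- nu) z <= h" by (auto simp: Z_def collar_def)
 have [measurable]: "exit_point \<Omega> (- nu) \<in> borel_measurable (restrict_space lborel Z)"
  by (rule measurable_restrict_space1) simp
 have gm[measurable]: "?\<Gamma> \<in> sets borel" by simp
 obtain C where C: "C >= 0" "!!E. E\<in>sets borel ==> E <= ?\<Gamma> ==>
   hausdorff_outer ?d E <= ennreal C * emeasure lborel {z \<in> Z. exit_point \<Omega> (- nu) z \<in> E}"
  using hausdorff_upper_collar[OF op bd cone dim] unfolding Z_def by blast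
 define mu where "mu = distr (restrict_space lborel Z) borel (exit_point \<Omega> (- nu))"
 have mu: "emeasure mu E = emeasure lborel {z \<in> Z. exit_point \<Omega> (- nu) z \<in> E}" if [measurable]: "E \<in> sets borel" for E
  unfolding mu_def
  by (subst emeasure_distr) (auto simp: emeasure_restrict_space space_restrict_space intro!: arg_cong[of _ _ "emeasure lborel"])
 have le: "density ?H (indicator ?\<Gamma>) <= scale_measure (ennreal C) mu"
 proof (rule le_measure[THEN iffD2])
  show "\<forall>A\<in>sets (density ?H (indicator ?\<Gamma>)). emeasure (density ?H (indicator ?\<Gamma>)) A <= emeasure (scale_measure (ennreal C) mu) A"
  proof
   fix E assume "E \<in> sets (density ?H (indicator ?\<Gamma>))"
   then have E[measurable]: "E \<in> sets borel" by simp
   have "emeasure (density ?H (indicator ?\<Gamma>)) E = emeasure ?H (?\<Gamma> Int E)"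
    using E gm by (subst emeasure_density) (auto simp: indicator_inter_arith[symmetric])
   also have "... = hausdorff_outer ?d (?\<Gamma> Int E)" by (rule emeasure_hausdorff_measure) measurable
   also have "... <= ennreal C * emeasure lborel {z \<in> Z. exit_point \<Omega> (- nu) z \<in> ?\<Gamma> Int E}"
    by (intro C(2)) auto
   also have "... <= ennreal C * emeasure lborel {z \<in> Z. exit_point \<Omega> (- nu) z \<in> E}"
    by (intro mult_left_mono emeasure_mono) auto
   finally show "emeasure (density ?H (indicator ?\<Gamma>)) E <= emeasure (scale_measure (ennreal C) mu) E"
    by (simp add: mu)
  qed
 qed (simp add: mu_def)
 define C' where "C' = C * 2 powr p * (1 + h powr p)"
 have "(\<integral>\<^sup>+y\<in>?\<Gamma>. ennreal (\<bar>w y\<bar> powr p) \<partial>?H) \<le>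
   ennreal C' * ((powr_int \<Omega> w p) + (grad_int \<Omega> w p))"
  if w: "smooth_on w UNIV" for w
 proof -
  have [measurable]: "w \<in> borel_measurable borel"
   using smooth_on_continuous[OF w] by (auto intro: borel_measurable_continuous_onI)
  let ?A = "\<integral>\<^sup>+z\<in>\<Omega>. ennreal (\<bar>w z\<bar> powr p) \<partial>lborel" and ?B = "\<integral>\<^sup>+z\<in>\<Omega>. ennreal (norm (grad w z) powr p) \<partial>lborel"
  have "(\<integral>\<^sup>+y\<in>?\<Gamma>. ennreal (\<bar>w y\<bar> powr p) \<partial>?H) = (\<integral>\<^sup>+y. ennreal (\<bar>w y\<bar> powr p) \<partial>density ?H (indicator ?\<Gamma>))"
   using gm by (subst nn_integral_density) (auto simp: mult.commute)
  also have "... <= (\<integral>\<^sup>+y. ennreal (\<bar>w y\<bar> powr p) \<partial>scale_measure (ennreal C) mu)"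
   by (intro nn_integral_mono_measure le) (simp add: mu_def)
  also have "... = ennreal C * (\<integral>\<^sup>+y. ennreal (\<bar>w y\<bar> powr p) \<partial>mu)" by (rule nn_integral_scale_measure) (simp add: mu_def)
  also have "(\<integral>\<^sup>+y. ennreal (\<bar>w y\<bar> powr p) \<partial>mu) = (\<integral>\<^sup>+z\<in>Z. ennreal (\<bar>w (exit_point \<Omega> (- nu) z)\<bar> powr p) \<partial>lborel)"
   unfolding mu_def by (subst nn_integral_distr) (auto simp: nn_integral_restrict_space)
  also have "... <= (\<integral>\<^sup>+z. ennreal (2 powr p) * (ennreal (\<bar>w z\<bar> powr p) * indicator Z z + ennreal (\<bar>w z - w (exit_point \<Omega> (- nu) z)\<bar> powr p) * indicator Z z) \<partial>lborel)"
  proof (rule nn_integral_mono)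
   fix z
   have "\<bar>a\<bar> powr p <= 2 powr p * (\<bar>b\<bar> powr p + \<bar>b - a\<bar> powr p)" for a b :: real
   proof -
    have "\<bar>a\<bar> <= \<bar>b\<bar> + \<bar>b - a\<bar>" by arith
    then have "\<bar>a\<bar> <= 2 * max \<bar>b\<bar> \<bar>b - a\<bar>"
     using max.cobounded1[of "\<bar>b\<bar>" "\<bar>b - a\<bar>"] max.cobounded2[of "\<bar>b - a\<bar>" "\<bar>b\<bar>"] by linarith
    then have "\<bar>a\<bar> powr p <= (2 * max \<bar>b\<bar> \<bar>b - a\<bar>) powr p" using p by (intro powr_mono2) auto
    also have "... = 2 powr p * (max \<bar>b\<bar> \<bar>b - a\<bar>) powr p" by (simp add: powr_mult)
    also have "(max \<bar>b\<bar> \<bar>b - a\<bar>) powr p <= \<bar>b\<bar> powr p + \<bar>b - a\<bar> powr p" by (auto simp: max_def)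
    finally show ?thesis by simp
   qed
   then show "ennreal (\<bar>w (exit_point \<Omega> (- nu) z)\<bar> powr p) * indicator Z z
     <= ennreal (2 powr p) * (ennreal (\<bar>w z\<bar> powr p) * indicator Z z + ennreal (\<bar>w z - w (exit_point \<Omega> (- nu) z)\<bar> powr p) * indicator Z z)"
    by (auto split: split_indicator simp: ennreal_plus[symmetric] ennreal_mult[symmetric] simp del: ennreal_plus intro!: ennreal_leI)
  qed
  also have "... = ennreal (2 powr p) * ((\<integral>\<^sup>+z\<in>Z. ennreal (\<bar>w z\<bar> powr p) \<partial>lborel) + (\<integral>\<^sup>+z\<in>Z. ennreal (\<bar>w z - w (exit_point \<Omega> (- nu) z)\<bar> powr p) \<partial>lborel))"
   by (subst nn_integral_cmult) (auto simp: nn_integral_add)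
  also have "... <= ennreal (2 powr p) * (?A + ennreal (h powr p) * ?B)"
   using Z(1) by (intro mult_left_mono add_mono exit_line_bound_Lp[OF op e D w p h cm Z] nn_integral_mono) (auto split: split_indicator)
  also have "... <= ennreal (2 powr p) * (ennreal (1 + h powr p) * ?A + ennreal (1 + h powr p) * ?B)"
  proof (intro mult_left_mono add_mono)
   have "ennreal 1 * ?A <= ennreal (1 + h powr p) * ?A" by (intro mult_right_mono ennreal_leI) auto
   then show "?A <= ennreal (1 + h powr p) * ?A" by simp
   show "ennreal (h powr p) * ?B <= ennreal (1 + h powr p) * ?B" by (intro mult_right_mono ennreal_leI) auto
  qed auto
  also have "ennreal C * \<dots> = ennreal C' * (?A + ?B)"
  proof -
   have "ennreal C' = ennreal C * (ennreal (2 powr p) * ennreal (1 + h powr p))"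
    using C(1) by (simp add: C'_def ennreal_mult[symmetric] mult.assoc del: ennreal_plus)
   then show ?thesis by (simp only: distrib_left mult.assoc)
  qed
  finally show ?thesis using C(1) by (simp add: mult_left_mono)
 qed
 moreover have "C' >= 0" using C by (simp add: C'_def)
 ultimately show ?thesis by blast
qed

text \<open>Radius and constant may depend on the point but not on w. A finite subcover therefore
  gives one constant for the whole class of functions.\<close>

lemma nn_integral_compact_local:
 fixes K :: "'a::euclidean_space set" and ph :: "'w => 'a => ennreal"
 assumes K: "compact K" and sets: "sets M = sets borel" and Q: "Q \<in> sets borel" "Q <= K"
  and m: "!!w. w \<in> W ==> ph w \<in> borel_measurable borel"
  and loc: "!!x. x \<in> K ==> \<exists>r>0. \<exists>C\<ge>0. \<forall>w\<in>W. (\<integral>\<^sup>+y\<in>Q Int ball x r. ph w y \<partial>M) <= ennreal C * R w"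
 shows "\<exists>C\<ge>0. \<forall>w\<in>W. (\<integral>\<^sup>+y\<in>Q. ph w y \<partial>M) <= ennreal C * R w"
proof -
 obtain r C where rC: "!!x. x \<in> K ==> r x > 0" "!!x. x \<in> K ==> C x >= (0::real)"
  "!!x w. x \<in> K ==> w \<in> W ==> (\<integral>\<^sup>+y\<in>Q Int ball x (r x). ph w y \<partial>M) <= ennreal (C x) * R w"
  using loc by metis
 have "K <= (\<Union>x\<in>K. ball x (r x))"
 proof
  fix x assume "x \<in> K"
  then have "x \<in> ball x (r x)" using rC(1) by simp
  then show "x \<in> (\<Union>x\<in>K. ball x (r x))" using \<open>x \<in> K\<close> by blast
 qed
 then obtain F where F: "F <= K" "finite F" "K <= (\<Union>x\<in>F. ball x (r x))"
  using compactE_image[OF K, of K "%x. ball x (r x)"] by auto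
 have "(\<integral>\<^sup>+y\<in>Q. ph w y \<partial>M) <= ennreal (\<Sum>x\<in>F. C x) * R w" if w: "w \<in> W" for w
 proof -
  have [measurable]: "ph w \<in> borel_measurable M" using m[OF w] by (simp cong: measurable_cong_sets add: sets)
  have "(\<integral>\<^sup>+y\<in>Q. ph w y \<partial>M) <= (\<integral>\<^sup>+y. (\<Sum>x\<in>F. ph w y * indicator (Q Int ball x (r x)) y) \<partial>M)"
  proof (rule nn_integral_mono)
   fix y
   show "ph w y * indicator Q y <= (\<Sum>x\<in>F. ph w y * indicator (Q Int ball x (r x)) y)"
   proof (cases "y \<in> Q")
    case True
    then obtain x where x: "x \<in> F" "y \<in> ball x (r x)" using F(3) Q(2) by blast
    have "ph w y * indicator Q y = ph w y * indicator (Q Int ball x (r x)) y" using x True by simp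
    also have "... <= (\<Sum>x\<in>F. ph w y * indicator (Q Int ball x (r x)) y)"
     by (rule sum_nonneg_leq_bound[OF F(2), of "%x. ph w y * indicator (Q Int ball x (r x)) y"]) (use x in auto)
    finally show ?thesis .
   qed simp
  qed
  also have "... = (\<Sum>x\<in>F. \<integral>\<^sup>+y\<in>Q Int ball x (r x). ph w y \<partial>M)"
  proof (rule nn_integral_sum)
   fix x
   have [measurable]: "Q Int ball x (r x) \<in> sets M" using Q(1) sets by simp
   show "(%y. ph w y * indicator (Q Int ball x (r x)) y) \<in> borel_measurable M" by measurable
  qed
  also have "... <= (\<Sum>x\<in>F. ennreal (C x) * R w)" using rC(3) F(1) w by (intro sum_mono) auto
  also have "... = ennreal (\<Sum>x\<in>F. C x) * R w"
   using rC(2) F(1) by (subst sum_ennreal[symmetric]) (auto simp: sum_distrib_right)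
  finally show ?thesis .
 qed
 moreover have "(\<Sum>x\<in>F. C x) >= 0" using rC(2) F(1) by (intro sum_nonneg) auto
 ultimately show ?thesis by blast
qed

lemma smooth_on_measurable:
 assumes "smooth_on w UNIV"
 shows "w \<in> borel_measurable borel" "grad w \<in> borel_measurable borel"
 by (rule borel_measurable_continuous_onI[OF smooth_on_continuous[OF assms]])
   (rule borel_measurable_continuous_onI[OF smooth_on_continuous_grad[OF assms]])

lemma trace_inequality:
 fixes \<Omega> :: "'a::euclidean_space set"
 assumes op: "open \<Omega>" and bd: "bounded \<Omega>" and sm: "smooth_boundary \<Omega>" and dim: "DIM('a) >= 2" and p: "p >= 1"
 shows "\<exists>C\<ge>0. \<forall>w\<in>{w. smooth_on w UNIV}. (\<integral>\<^sup>+y. ennreal (\<bar>w y\<bar> powr p) \<partial>boundary_measure \<Omega>) \<le>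
   ennreal C * ((powr_int \<Omega> w p) + (grad_int \<Omega> w p))"
 unfolding nn_integral_boundary_measure
proof (rule nn_integral_compact_local)
 show "compact (frontier \<Omega>)" using bd by (rule compact_frontier_bounded)
 show "(%y. ennreal (\<bar>w y\<bar> powr p)) \<in> borel_measurable borel" if "w \<in> {w. smooth_on w UNIV}" for w
 proof -
  have [measurable]: "w \<in> borel_measurable borel" using that smooth_on_measurable(1)[of w] by simp
  show ?thesis by measurable
 qed
 fix x0 assume x0: "x0 \<in> frontier \<Omega>"
 obtain nu kp h r where cone: "inner_cone \<Omega> x0 nu kp h r" using inner_cone_frontier[OF op sm x0] by blast
 then have r: "r / 2 > 0" by (simp add: inner_cone_def)
 from trace_inequality_local[OF op bd cone dim p] obtain C where C: "C >= 0" "ALL w. smooth_on w UNIV -->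
   (\<integral>\<^sup>+y\<in>frontier \<Omega> Int ball x0 (r/2). ennreal (\<bar>w y\<bar> powr p) \<partial>hausdorff_measure (real DIM('a) - 1)) \<le>
   ennreal C * ((powr_int \<Omega> w p) + (grad_int \<Omega> w p))"
  by blast
 show "\<exists>r>0. \<exists>C\<ge>0. \<forall>w\<in>{w. smooth_on w UNIV}.
   (\<integral>\<^sup>+y\<in>frontier \<Omega> Int ball x0 r. ennreal (\<bar>w y\<bar> powr p) \<partial>hausdorff_measure (real DIM('a) - 1)) \<le>
   ennreal C * ((powr_int \<Omega> w p) + (grad_int \<Omega> w p))"
  by (rule exI[of _ "r / 2"], rule conjI, rule r, rule exI[of _ C]) (use C in auto)
qed auto

lemma boundary_measure_facts:
 shows space_boundary_measure: "space (boundary_measure \<Omega>) = frontier \<Omega>"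
  and measurable_boundary_measure: "f \<in> borel_measurable borel ==> f \<in> borel_measurable (boundary_measure \<Omega>)"
proof -
 show "space (boundary_measure \<Omega>) = frontier \<Omega>" by (simp add: boundary_measure_def space_restrict_space)
 show "f \<in> borel_measurable borel ==> f \<in> borel_measurable (boundary_measure \<Omega>)"
  unfolding boundary_measure_def
  by (intro measurable_restrict_space1) (simp cong: measurable_cong_sets)
qed

text \<open>The trace inequality applied to a cutoff equal to 1 on the closure bounds the surface
  measure by the volume of the domain.\<close>

lemma finite_boundary_measure:
 fixes \<Omega> :: "'a::euclidean_space set"
 assumes op: "open \<Omega>" and bd: "bounded \<Omega>" and sm: "smooth_boundary \<Omega>" and dim: "DIM('a) >= 2"
 shows "finite_measure (boundary_measure \<Omega>)"
proof
 obtain ct :: "'a => real" where ct: "cpt_smooth ct" "!!x. x \<in> closure \<Omega> ==> ct x = 1 \<and> grad ct x = 0"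
  using smooth_cutoff[of "closure \<Omega>"] bd by auto
 have s: "smooth_on ct UNIV" using ct by (simp add: cpt_smooth_def)
 obtain C where C: "C >= 0" "(\<integral>\<^sup>+y. ennreal (\<bar>ct y\<bar> powr 1) \<partial>boundary_measure \<Omega>) \<le>
   ennreal C * ((powr_int \<Omega> ct 1) + (grad_int \<Omega> ct 1))"
  using trace_inequality[OF op bd sm dim, of 1] s by auto
 have cl: "!!x. x \<in> \<Omega> ==> x \<in> closure \<Omega>" "!!x. x \<in> frontier \<Omega> ==> x \<in> closure \<Omega>"
  using closure_subset[of \<Omega>] by (auto simp: frontier_def)
 have "emeasure (boundary_measure \<Omega>) (space (boundary_measure \<Omega>)) = (\<integral>\<^sup>+y. 1 \<partial>boundary_measure \<Omega>)" by simp
 also have "... = (\<integral>\<^sup>+y. ennreal (\<bar>ct y\<bar> powr 1) \<partial>boundary_measure \<Omega>)"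
  using ct(2) cl by (intro nn_integral_cong) (auto simp: space_boundary_measure)
 also have "... <= ennreal C * ((powr_int \<Omega> ct 1) + (grad_int \<Omega> ct 1))" by (rule C)
 also have "(powr_int \<Omega> ct 1) = (\<integral>\<^sup>+z. indicator \<Omega> z \<partial>lborel)"
  using ct(2) cl by (intro nn_integral_cong) (auto split: split_indicator)
 also have "... = emeasure lborel \<Omega>" using op by simp
 also have "(grad_int \<Omega> ct 1) = (\<integral>\<^sup>+z. 0 \<partial>(lborel :: 'a measure))"
  using ct(2) cl by (intro nn_integral_cong) (auto split: split_indicator)
 finally have "emeasure (boundary_measure \<Omega>) (space (boundary_measure \<Omega>)) <= ennreal C * emeasure lborel \<Omega>" by simp
 also have "... < top" using emeasure_bounded_finite[OF bd] by (simp add: ennreal_mult_less_top)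
 finally show "emeasure (boundary_measure \<Omega>) (space (boundary_measure \<Omega>)) ~= \<infinity>" by simp
qed

section \<open>A subcritical embedding by averaging over cones\<close>

lemma nn_integral_powr_0:
 fixes b h :: real
 assumes "b > -1" "h > 0"
 shows "(\<integral>\<^sup>+x\<in>{0..h}. ennreal (x powr b) \<partial>lborel) = ennreal (h powr (b + 1) / (b + 1))"
proof -
 have "((%x. x powr b) has_integral (h powr (b + 1) / (b + 1))) {0..h}"
  using has_integral_powr_from_0[of b h] assms by simp
 then have "((%x. if x \<in> {0..h} then x powr b else 0) has_integral (h powr (b + 1) / (b + 1))) UNIV"
  by (subst has_integral_restrict_UNIV)
 moreover have "(%x. if x \<in> {0..h} then x powr b else 0) = (%x. x powr b * indicator {0..h} x)"
  by (auto simp: indicator_def)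
 ultimately have "((%x. x powr b * indicator {0..h} x) has_integral (h powr (b + 1) / (b + 1))) UNIV" by simp
 then have "(\<integral>\<^sup>+x. ennreal (x powr b * indicator {0..h} x) \<partial>lborel) = ennreal (h powr (b + 1) / (b + 1))"
  by (intro nn_integral_has_integral_lborel) auto
 then show ?thesis by (simp add: ennreal_mult' ennreal_indicator)
qed

lemma nn_integral_lborel_affine:
 assumes [measurable]: "f \<in> borel_measurable borel" and c: "c > 0"
 shows "(\<integral>\<^sup>+z. f (t + c *\<^sub>R z) \<partial>lborel) = ennreal (1 / c ^ DIM('a)) * (\<integral>\<^sup>+z. f z \<partial>(lborel :: 'a::euclidean_space measure))"
proof -
 have "(\<integral>\<^sup>+z. f z \<partial>lborel) = (\<integral>\<^sup>+z. f z \<partial>density (distr lborel borel (%x. t + c *\<^sub>R x)) (%_. ennreal (\<bar>c\<bar> ^ DIM('a))))"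
  using lborel_affine[of c t] c by simp
 also have "... = ennreal (c ^ DIM('a)) * (\<integral>\<^sup>+z. f (t + c *\<^sub>R z) \<partial>lborel)"
  using c by (subst nn_integral_density) (auto simp: nn_integral_cmult nn_integral_distr)
 finally show ?thesis using c by (simp add: mult.assoc[symmetric] ennreal_mult[symmetric])
qed

text \<open>Here the integrability of \<open>sg powr (- m (q - p) / p)\<close>, after the weight \<open>sg powr (- th)\<close> is split off,
 is exactly the subcriticality of \<open>q\<close>.\<close>

lemma subcritical_weight:
 fixes m p q :: real
 assumes "1 < p" "p <= q" "m * (q - p) < p * q"
 obtains th where "0 < th" "th < 1" "th * (q - 1) - m * (q - p) / p > -1"
proof -
 define t0 where "t0 = max 0 ((m * (q - p) / p - 1) / (q - 1))"
 have "m * (q - p) / p < q" using assms by (simp add: field_simps)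
 then have "(m * (q - p) / p - 1) / (q - 1) < 1" using assms by (simp add: field_simps)
 then have t0: "0 <= t0" "t0 < 1" by (auto simp: t0_def)
 define th where "th = (1 + t0) / 2"
 have th: "0 < th" "th < 1" "t0 < th" using t0 by (auto simp: th_def)
 have "(m * (q - p) / p - 1) / (q - 1) < th" using th(3) by (simp add: t0_def)
 then have "m * (q - p) / p - 1 < th * (q - 1)" using assms by (simp add: pos_divide_less_eq)
 then show ?thesis using that[OF th(1,2)] by linarith
qed

lemma nn_integral_affine_bound:
 fixes u v :: "'a::euclidean_space => real"
 assumes v[measurable]: "v \<in> borel_measurable borel" and Q[measurable]: "Q \<in> sets borel" "S \<in> sets borel" and sub: "Q <= S"
  and le: "!!y. u y <= k * (c + l * v y)" and nn: "k >= 0" "c >= 0" "l >= 0" "K >= 0" "m >= 0" "!!y. v y >= 0"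
  and int: "(\<integral>\<^sup>+y\<in>Q. ennreal (v y) \<partial>lborel) <= ennreal K" and m: "emeasure lborel S = ennreal m"
 shows "(\<integral>\<^sup>+y\<in>Q. ennreal (u y) \<partial>lborel) <= ennreal (k * (c * m + l * K))"
proof -
 have "(\<integral>\<^sup>+y\<in>Q. ennreal (u y) \<partial>lborel)
   <= (\<integral>\<^sup>+y. ennreal k * (ennreal c * indicator S y + ennreal l * (ennreal (v y) * indicator Q y)) \<partial>lborel)"
 proof (rule nn_integral_mono)
  fix y
  show "ennreal (u y) * indicator Q y <= ennreal k * (ennreal c * indicator S y + ennreal l * (ennreal (v y) * indicator Q y))"
  proof (cases "y \<in> Q")
   case True
   have "ennreal (u y) <= ennreal (k * (c + l * v y))" by (rule ennreal_leI[OF le])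
   also have "... = ennreal k * (ennreal c + ennreal l * ennreal (v y))" using nn by (simp add: ennreal_mult)
   finally show ?thesis using True sub by auto
  qed simp
 qed
 also have "... = ennreal k * (\<integral>\<^sup>+y. ennreal c * indicator S y + ennreal l * (ennreal (v y) * indicator Q y) \<partial>lborel)"
  by (rule nn_integral_cmult) measurable
 also have "(\<integral>\<^sup>+y. ennreal c * indicator S y + ennreal l * (ennreal (v y) * indicator Q y) \<partial>lborel)
  = (\<integral>\<^sup>+y. ennreal c * indicator S y \<partial>lborel) + (\<integral>\<^sup>+y. ennreal l * (ennreal (v y) * indicator Q y) \<partial>lborel)"
  by (rule nn_integral_add) measurable
 also have "(\<integral>\<^sup>+y. ennreal c * indicator S y \<partial>lborel) = ennreal c * emeasure lborel S"
  by (rule nn_integral_cmult_indicator) simp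
 also have "(\<integral>\<^sup>+y. ennreal l * (ennreal (v y) * indicator Q y) \<partial>lborel) = ennreal l * (\<integral>\<^sup>+y\<in>Q. ennreal (v y) \<partial>lborel)"
  by (rule nn_integral_cmult) measurable
 also have "ennreal k * (ennreal c * emeasure lborel S + \<dots>) <= ennreal k * (ennreal c * ennreal m + ennreal l * ennreal K)"
  unfolding m by (intro mult_left_mono add_left_mono int) auto
 also have "... = ennreal (k * (c * m + l * K))" using nn by (simp add: ennreal_mult)
 finally show ?thesis .
qed

text \<open>The segment bound from y to y + h ze is averaged over directions ze in a ball Z around
  the cone axis. The average of the gradient at distance sg, raised to the power q, is split as (q -
  p) + p: a scaling bound of order sg^(-m) controls the first factor, and integration in y controls
  the second. Subcriticality makes the remaining power of sg integrable at 0.\<close>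

lemma cone_embedding_local:
 fixes \<Omega> :: "'a::euclidean_space set"
 assumes op: "open \<Omega>" and bd: "bounded \<Omega>" and cone: "inner_cone \<Omega> x0 nu kp h r"
  and pq: "1 < p" "p <= q" "real DIM('a) * (q - p) < p * q" and A0: "A0 >= 0"
 shows "\<exists>C\<ge>0. ALL w. cpt_smooth w --> (abs_int \<Omega> w) <= ennreal A0 -->
   (grad_int \<Omega> w p) <= 1 -->
   (\<integral>\<^sup>+y\<in>\<Omega> Int ball x0 r. ennreal (\<bar>w y\<bar> powr q) \<partial>lborel) <= ennreal C"
proof -
 let ?m = "real DIM('a)"
 have nu: "norm nu = 1" and kp: "0 < kp" "kp <= 1" and h: "0 < h" 
  and cn: "!!y ze sg. y \<in> closure \<Omega> ==> dist y x0 < r ==> dist ze nu <= kp ==> 0 < sg ==> sg <= h ==> y + sg *\<^sub>R ze \<in> \<Omega>"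
  using cone by (auto simp: inner_cone_def)
 define Z where "Z = cball nu kp"
 define V where "V = measure lborel Z"
 have V: "V > 0" "emeasure lborel Z = ennreal V"
  using kp by (auto simp: V_def Z_def content_cball emeasure_cball)
 have [measurable]: "Z \<in> sets borel" "\<Omega> \<in> sets borel" using op by (auto simp: Z_def)
 obtain th where th: "0 < th" "th < 1" "th * (q - 1) - ?m * (q - p) / p > -1" using subcritical_weight[OF pq] by blast
 define b where "b = th * (q - 1) - ?m * (q - p) / p"
 define K1 where "K1 = (V powr (p - 1)) * (V powr (p - 1)) powr ((q - p) / p)"
 define cth where "cth = h powr (1 - th) / (1 - th)"
 have cth: "cth > 0" using h th by (simp add: cth_def)
 define K2 where "K2 = cth powr (q - 1) * (K1 * V * (h powr (b + 1) / (b + 1)))"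
 have K1: "K1 >= 0" by (simp add: K1_def)
 have K2: "K2 >= 0" using th(3) K1 V h unfolding K2_def b_def[symmetric] by (intro mult_nonneg_nonneg) auto
 define a1 where "a1 = A0 / h ^ DIM('a)"
 have a1: "a1 >= 0" using A0 h by (simp add: a1_def)
 define C where "C = (2 / V) powr q * (a1 powr q * measure lborel \<Omega> + 2 powr q * K2)"
 have C: "C >= 0" using K2 by (simp add: C_def)
 have \<Omega>fin: "emeasure lborel \<Omega> = ennreal (measure lborel \<Omega>)"
  using emeasure_bounded_finite[OF bd] by (intro emeasure_eq_ennreal_measure) auto
 have "(\<integral>\<^sup>+y\<in>\<Omega> Int ball x0 r. ennreal (\<bar>w y\<bar> powr q) \<partial>lborel) <= ennreal C"
  if w: "cpt_smooth w" and wA: "(abs_int \<Omega> w) <= ennreal A0"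
   and wp: "(grad_int \<Omega> w p) <= 1" for w
 proof -
  have s: "smooth_on w UNIV" using w by (simp add: cpt_smooth_def)
  note [measurable] = smooth_on_measurable[OF s]
  obtain G where G: "G > 0" "!!x. norm (grad w x) <= G" using cpt_smooth_bounded[OF w] by blast
  define g where "g z = indicator \<Omega> z * norm (grad w z)" for z
  have [measurable]: "g \<in> borel_measurable borel" unfolding g_def[abs_def] by measurable
  have g: "0 <= g z" "g z <= G" for z using G by (auto simp: g_def split: split_indicator)
  have gp: "(\<integral>\<^sup>+z. ennreal (g z powr p) \<partial>lborel) <= 1"
  proof -
   have "(\<integral>\<^sup>+z. ennreal (g z powr p) \<partial>lborel) = (grad_int \<Omega> w p)"
    using pq by (intro nn_integral_cong) (auto simp: g_def split: split_indicator)
   then show ?thesis using wp by simp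
  qed
  define M where "M sg y = (\<integral>\<^sup>+ze\<in>Z. ennreal (g (y + sg *\<^sub>R ze)) \<partial>lborel)" for sg and y :: 'a
  have [measurable]: "(%(sg, y). M sg y) \<in> borel_measurable (borel \<Otimes>\<^sub>M borel)" unfolding M_def[abs_def] split_beta by measurable
  have Mfin: "M sg y <= ennreal (G * V)" for sg y
  proof -
   have "M sg y <= (\<integral>\<^sup>+ze\<in>Z. ennreal G \<partial>lborel)"
    unfolding M_def using g by (intro nn_integral_mono) (auto split: split_indicator intro!: ennreal_leI)
   also have "... = ennreal (G * V)" using G V by (simp add: nn_integral_cmult_indicator ennreal_mult)
   finally show ?thesis .
  qed
  define mu where "mu sg y = enn2real (M sg y)" for sg y
  have [measurable]: "(%(sg, y). mu sg y) \<in> borel_measurable (borel \<Otimes>\<^sub>M borel)" unfolding mu_def[abs_def] by measurable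
  have [measurable]: "(%sg. mu sg y) \<in> borel_measurable borel" for y
  proof -
   have "(%sg. (%(sg, y). mu sg y) (sg, y)) \<in> borel_measurable borel" by measurable
   then show ?thesis by simp
  qed
  have Mmu: "M sg y = ennreal (mu sg y)" "mu sg y >= 0" for sg y
   using le_less_trans[OF Mfin[of sg y], of top] by (auto simp: mu_def)
  define P where "P sg y = (\<integral>\<^sup>+ze\<in>Z. ennreal (g (y + sg *\<^sub>R ze) powr p) \<partial>lborel)" for sg and y :: 'a
  have [measurable]: "(%(sg, y). P sg y) \<in> borel_measurable (borel \<Otimes>\<^sub>M borel)" unfolding P_def[abs_def] split_beta by measurable
  have mup: "ennreal (mu sg y powr p) <= ennreal (V powr (p - 1)) * P sg y" for sg y
  proof -
   let ?R = "restrict_space lborel Z"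
   have "ennreal (mu sg y powr p) <= ennreal (V powr (p - 1)) * (\<integral>\<^sup>+ze. ennreal (g (y + sg *\<^sub>R ze) powr p) \<partial>?R)"
   proof (rule jensen_powr)
    show "(%ze. g (y + sg *\<^sub>R ze)) \<in> borel_measurable ?R" by (rule measurable_restrict_space1) measurable
    show "emeasure ?R (space ?R) <= ennreal V" using V by (simp add: emeasure_restrict_space space_restrict_space)
    show "ennreal (mu sg y) <= (\<integral>\<^sup>+ze. ennreal (g (y + sg *\<^sub>R ze)) \<partial>?R)"
     unfolding Mmu(1)[symmetric] M_def by (subst nn_integral_restrict_space) auto
   qed (use pq V g Mmu in auto)
   then show ?thesis unfolding P_def by (subst (asm) nn_integral_restrict_space) auto
  qed
  \<comment> \<open>Substituting z = y + sg ze gains the Jacobian sg^(-m); the p-th powers of the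
    gradient integrate to at most 1 by assumption.\<close>
  have Ple: "P sg y <= ennreal (sg powr (- ?m))" if "sg > 0" for sg y
  proof -
   have "P sg y <= (\<integral>\<^sup>+ze. ennreal (g (y + sg *\<^sub>R ze) powr p) \<partial>lborel)"
    unfolding P_def by (intro nn_integral_mono) (auto split: split_indicator)
   also have "... = ennreal (1 / sg ^ DIM('a)) * (\<integral>\<^sup>+z. ennreal (g z powr p) \<partial>lborel)"
    using that by (intro nn_integral_lborel_affine) auto
   also have "... <= ennreal (1 / sg ^ DIM('a)) * 1" by (intro mult_left_mono gp) auto
   also have "1 / sg ^ DIM('a) = sg powr (- ?m)" using that by (simp add: powr_minus powr_realpow inverse_eq_divide)
   finally show ?thesis by simp
  qed
  \<comment> \<open>Only the factor with exponent q - p receives the pointwise bound. The factor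
    with exponent p stays linear in \<open>P\<close>, so that the integral over y can still be
    used.\<close>
  have muq: "ennreal (mu sg y powr q) <= ennreal (K1 * sg powr (- ?m * (q - p) / p)) * P sg y" if sg: "sg > 0" for sg y
  proof -
   have "ennreal (mu sg y powr p) <= ennreal (V powr (p - 1)) * ennreal (sg powr (- ?m))"
    by (rule order_trans[OF mup]) (intro mult_left_mono Ple sg, simp)
   then have 1: "mu sg y powr p <= V powr (p - 1) * sg powr (- ?m)"
    by (simp add: ennreal_mult[symmetric] del: ennreal_mult)
   have "(mu sg y powr p) powr ((q - p) / p) <= (V powr (p - 1) * sg powr (- ?m)) powr ((q - p) / p)"
    using 1 pq by (intro powr_mono2) auto
   also have "... = (V powr (p - 1)) powr ((q - p) / p) * sg powr (- ?m * (q - p) / p)"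
    by (simp add: powr_mult powr_powr)
   finally have 2: "mu sg y powr (q - p) <= (V powr (p - 1)) powr ((q - p) / p) * sg powr (- ?m * (q - p) / p)"
    using pq by (simp add: powr_powr)
   have "ennreal (mu sg y powr q) = ennreal (mu sg y powr (q - p)) * ennreal (mu sg y powr p)"
    by (simp add: ennreal_mult[symmetric] powr_add[symmetric])
   also have "... <= ennreal ((V powr (p - 1)) powr ((q - p) / p) * sg powr (- ?m * (q - p) / p)) * (ennreal (V powr (p - 1)) * P sg y)"
    by (intro mult_mono ennreal_leI 2 mup) auto
   also have "... = ennreal (K1 * sg powr (- ?m * (q - p) / p)) * P sg y"
    by (simp add: K1_def ennreal_mult mult_ac)
   finally show ?thesis .
  qed
  have intP: "(\<integral>\<^sup>+y. P sg y \<partial>lborel) <= ennreal V" for sg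
  proof -
   have "(\<integral>\<^sup>+y. P sg y \<partial>lborel) = (\<integral>\<^sup>+ze. (\<integral>\<^sup>+y. ennreal (g (y + sg *\<^sub>R ze) powr p) * indicator Z ze \<partial>lborel) \<partial>lborel)"
    unfolding P_def by (rule lborel_pair.Fubini'[symmetric]) measurable
   also have "... = (\<integral>\<^sup>+ze\<in>Z. (\<integral>\<^sup>+y. ennreal (g y powr p) \<partial>lborel) \<partial>lborel)"
    by (subst nn_integral_multc) (auto simp: nn_integral_lborel_translate[of "%y. ennreal (g y powr p)"])
   also have "... <= (\<integral>\<^sup>+ze\<in>Z. 1 \<partial>lborel)" by (intro nn_integral_mono mult_right_mono gp) auto
   also have "... = ennreal V" using V by simp
   finally show ?thesis .
  qed
  \<comment> \<open>What remains of V |w(y)| after removing the contribution of the far endpoints,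
    bounded by \<open>a1\<close>. The halving accounts for direction vectors of norm up to
    2.\<close>
  define a where "a y = max 0 (V * \<bar>w y\<bar> - a1) / 2" for y
  have a0: "a y >= 0" for y by (simp add: a_def)
  have [measurable]: "a \<in> borel_measurable borel" unfolding a_def[abs_def] by measurable
  have aI: "ennreal (a y) <= (\<integral>\<^sup>+sg\<in>{0..h}. M sg y \<partial>lborel)" if y: "y \<in> \<Omega> Int ball x0 r" for y
  proof -
   have "ennreal (V * \<bar>w y\<bar>) = (\<integral>\<^sup>+ze\<in>Z. ennreal \<bar>w y\<bar> \<partial>lborel)"
    using V by (simp add: nn_integral_cmult_indicator ennreal_mult' mult.commute[of "ennreal V"])
   also have "... <= (\<integral>\<^sup>+ze. ennreal \<bar>w (y + h *\<^sub>R ze)\<bar> * indicator \<Omega> (y + h *\<^sub>R ze) + 2 * (\<integral>\<^sup>+sg. ennreal (g (y + sg *\<^sub>R ze)) * indicator Z ze * indicator {0..h} sg \<partial>lborel) \<partial>lborel)"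
   proof (rule nn_integral_mono)
    fix ze
    show "ennreal \<bar>w y\<bar> * indicator Z ze <= ennreal \<bar>w (y + h *\<^sub>R ze)\<bar> * indicator \<Omega> (y + h *\<^sub>R ze) + 2 * (\<integral>\<^sup>+sg. ennreal (g (y + sg *\<^sub>R ze)) * indicator Z ze * indicator {0..h} sg \<partial>lborel)"
    proof (cases "ze \<in> Z")
     case True
     then have ze: "dist ze nu <= kp" by (simp add: Z_def dist_commute)
     have yc: "y \<in> closure \<Omega>" "dist y x0 < r" "y \<in> \<Omega>" using y closure_subset[of \<Omega>] by (auto simp: dist_commute)
     have inn: "y + sg *\<^sub>R ze \<in> \<Omega>" if "0 <= sg" "sg <= h" for sg
      using cn[OF yc(1,2) ze, of sg] that yc(3) by (cases "sg = 0") auto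
     have n2: "norm ze <= 2" using ze nu kp norm_triangle_sub[of ze nu] by (simp add: dist_norm)
     have "ennreal \<bar>w y\<bar> <= ennreal (\<bar>w (y + h *\<^sub>R ze)\<bar> + \<bar>w y - w (y + h *\<^sub>R ze)\<bar>)" by (rule ennreal_leI) arith
     also have "... = ennreal \<bar>w (y + h *\<^sub>R ze)\<bar> + ennreal \<bar>w y - w (y + h *\<^sub>R ze)\<bar>" by (rule ennreal_plus) auto
     also have "ennreal \<bar>w y - w (y + h *\<^sub>R ze)\<bar> <= (\<integral>\<^sup>+sg\<in>{0..h}. ennreal (norm (grad w (y + sg *\<^sub>R ze)) * norm ze) \<partial>lborel)"
      using h by (intro line_segment_gradient_bound s) auto
     also have "... <= (\<integral>\<^sup>+sg. 2 * (ennreal (g (y + sg *\<^sub>R ze)) * indicator {0..h} sg) \<partial>lborel)"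
     proof (rule nn_integral_mono)
      fix sg
      show "ennreal (norm (grad w (y + sg *\<^sub>R ze)) * norm ze) * indicator {0..h} sg <= 2 * (ennreal (g (y + sg *\<^sub>R ze)) * indicator {0..h} sg)"
      proof (cases "sg \<in> {0..h}")
       case True
       have "norm (grad w (y + sg *\<^sub>R ze)) * norm ze <= g (y + sg *\<^sub>R ze) * 2"
        using inn[of sg] True n2 by (intro mult_mono) (auto simp: g_def)
       then have "ennreal (norm (grad w (y + sg *\<^sub>R ze)) * norm ze) <= ennreal (g (y + sg *\<^sub>R ze) * 2)" by (rule ennreal_leI)
       also have "... = 2 * ennreal (g (y + sg *\<^sub>R ze))" using g by (simp add: ennreal_mult' mult.commute)
       finally show ?thesis using True by simp
      qed simp
     qed
     also have "... = 2 * (\<integral>\<^sup>+sg. ennreal (g (y + sg *\<^sub>R ze)) * indicator {0..h} sg \<partial>lborel)"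
      by (rule nn_integral_cmult) measurable
     finally show ?thesis using True inn[of h] h by (simp add: add_left_mono)
    qed simp
   qed
   also have "... = (\<integral>\<^sup>+ze. ennreal \<bar>w (y + h *\<^sub>R ze)\<bar> * indicator \<Omega> (y + h *\<^sub>R ze) \<partial>lborel)
     + 2 * (\<integral>\<^sup>+ze. (\<integral>\<^sup>+sg. ennreal (g (y + sg *\<^sub>R ze)) * indicator Z ze * indicator {0..h} sg \<partial>lborel) \<partial>lborel)"
    by (subst nn_integral_add, measurable, subst nn_integral_cmult, measurable)
   also have "(\<integral>\<^sup>+ze. ennreal \<bar>w (y + h *\<^sub>R ze)\<bar> * indicator \<Omega> (y + h *\<^sub>R ze) \<partial>lborel)
     = ennreal (1 / h ^ DIM('a)) * (abs_int \<Omega> w)"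
    using h by (intro nn_integral_lborel_affine[of "%z. ennreal \<bar>w z\<bar> * indicator \<Omega> z"]) auto
   also have "... <= ennreal (1 / h ^ DIM('a)) * ennreal A0" by (intro mult_left_mono wA) auto
   also have "... = ennreal a1" using h A0 by (simp add: a1_def ennreal_mult[symmetric])
   also have "(\<integral>\<^sup>+ze. (\<integral>\<^sup>+sg. ennreal (g (y + sg *\<^sub>R ze)) * indicator Z ze * indicator {0..h} sg \<partial>lborel) \<partial>lborel)
     = (\<integral>\<^sup>+sg. (\<integral>\<^sup>+ze. ennreal (g (y + sg *\<^sub>R ze)) * indicator Z ze * indicator {0..h} sg \<partial>lborel) \<partial>lborel)"
    by (rule lborel_pair.Fubini') measurable
   also have "... = (\<integral>\<^sup>+sg\<in>{0..h}. M sg y \<partial>lborel)"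
    unfolding M_def by (intro nn_integral_cong nn_integral_multc) measurable
   finally have main: "ennreal (V * \<bar>w y\<bar>) <= ennreal a1 + 2 * (\<integral>\<^sup>+sg\<in>{0..h}. M sg y \<partial>lborel)" by (simp add: add_left_mono)
   show ?thesis
   proof (cases "(\<integral>\<^sup>+sg\<in>{0..h}. M sg y \<partial>lborel)" rule: ennreal_cases)
    case (real t)
    then have "ennreal (V * \<bar>w y\<bar>) <= ennreal (a1 + 2 * t)" using main a1 by (simp add: ennreal_mult')
    then have "V * \<bar>w y\<bar> <= a1 + 2 * t" using a1 real by (subst (asm) ennreal_le_iff) auto
    then have "a y <= t" using real by (auto simp: a_def max_def)
    then show ?thesis using real by (simp add: ennreal_leI)
   qed simp
  qed
  have aq: "ennreal (a y powr q) <= ennreal (cth powr (q - 1) * K1) * (\<integral>\<^sup>+sg. ennreal (sg powr b) * P sg y * indicator {0..h} sg \<partial>lborel)"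
   if y: "y \<in> \<Omega> Int ball x0 r" for y
  proof -
   \<comment> \<open>Jensen is applied with the weight sg^(-th), of total mass \<open>cth\<close>,
     and the integrand is multiplied by sg^th to compensate. An unweighted Jensen inequality would
     give a singularity at 0 that need not be integrable.\<close>
   let ?W = "density lborel (%sg. ennreal (sg powr (- th)) * indicator {0..h} sg)"
   have "ennreal (a y powr q) <= ennreal (cth powr (q - 1)) * (\<integral>\<^sup>+sg. ennreal ((\<bar>sg\<bar> powr th * mu sg y) powr q) \<partial>?W)"
   proof (rule jensen_powr)
    show "emeasure ?W (space ?W) <= ennreal cth"
     using nn_integral_powr_0[of "-th" h] th h by (subst emeasure_density) (auto simp: cth_def)
    have "(\<integral>\<^sup>+sg. ennreal (\<bar>sg\<bar> powr th * mu sg y) \<partial>?W) = (\<integral>\<^sup>+sg. ennreal (sg powr (- th)) * indicator {0..h} sg * ennreal (\<bar>sg\<bar> powr th * mu sg y) \<partial>lborel)"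
     by (rule nn_integral_density) measurable
    also have "... = (\<integral>\<^sup>+sg\<in>{0..h}. M sg y \<partial>lborel)"
    proof (rule nn_integral_cong_AE)
     have "AE sg in lborel. sg ~= (0::real)" by (rule AE_lborel_singleton)
     then show "AE sg in lborel. ennreal (sg powr (- th)) * indicator {0..h} sg * ennreal (\<bar>sg\<bar> powr th * mu sg y) = M sg y * indicator {0..h} sg"
     proof eventually_elim
      case (elim sg)
      have "sg powr (- th) * (\<bar>sg\<bar> powr th * mu sg y) = mu sg y" if "sg > 0" using that by (simp add: powr_minus)
      then show ?case using elim by (auto simp: Mmu ennreal_mult'[symmetric] split: split_indicator)
     qed
    qed
    finally show "ennreal (a y) <= (\<integral>\<^sup>+sg. ennreal (\<bar>sg\<bar> powr th * mu sg y) \<partial>?W)" using aI[OF y] by simp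
   qed (use pq cth a0 Mmu in auto)
   also have "(\<integral>\<^sup>+sg. ennreal ((\<bar>sg\<bar> powr th * mu sg y) powr q) \<partial>?W)
     = (\<integral>\<^sup>+sg. ennreal (sg powr (- th)) * indicator {0..h} sg * ennreal ((\<bar>sg\<bar> powr th * mu sg y) powr q) \<partial>lborel)"
    by (rule nn_integral_density) measurable
   also have "... <= (\<integral>\<^sup>+sg. ennreal K1 * (ennreal (sg powr b) * P sg y * indicator {0..h} sg) \<partial>lborel)"
   proof (rule nn_integral_mono_AE)
    have "AE sg in lborel. sg ~= (0::real)" by (rule AE_lborel_singleton)
    then show "AE sg in lborel. ennreal (sg powr (- th)) * indicator {0..h} sg * ennreal ((\<bar>sg\<bar> powr th * mu sg y) powr q) <= ennreal K1 * (ennreal (sg powr b) * P sg y * indicator {0..h} sg)"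
    proof eventually_elim
     case (elim sg)
     show ?case
     proof (cases "sg \<in> {0..h}")
      case True
      then have sg: "sg > 0" using elim by simp
      have "ennreal (sg powr (- th)) * ennreal ((\<bar>sg\<bar> powr th * mu sg y) powr q) = ennreal (sg powr (th * (q - 1))) * ennreal (mu sg y powr q)"
       using sg Mmu by (simp add: ennreal_mult[symmetric] powr_mult powr_powr powr_add[symmetric] mult.assoc[symmetric] algebra_simps)
      also have "... <= ennreal (sg powr (th * (q - 1))) * (ennreal (K1 * sg powr (- ?m * (q - p) / p)) * P sg y)"
       by (intro mult_left_mono muq sg) auto
      also have "... = ennreal (sg powr (th * (q - 1)) * (K1 * sg powr (- ?m * (q - p) / p))) * P sg y"
       using K1 by (simp add: ennreal_mult mult.assoc)
      also have "sg powr (th * (q - 1)) * (K1 * sg powr (- ?m * (q - p) / p)) = K1 * sg powr b"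
       by (simp add: b_def powr_add[symmetric])
      finally show ?thesis using True K1 by (simp add: ennreal_mult mult.assoc)
     qed simp
    qed
   qed
   also have "... = ennreal K1 * (\<integral>\<^sup>+sg. ennreal (sg powr b) * P sg y * indicator {0..h} sg \<partial>lborel)"
    by (rule nn_integral_cmult) measurable
   finally show ?thesis by (simp add: ennreal_mult' mult.assoc mult_left_mono)
  qed
  have "(\<integral>\<^sup>+y\<in>\<Omega> Int ball x0 r. ennreal (a y powr q) \<partial>lborel)
   <= (\<integral>\<^sup>+y. ennreal (cth powr (q - 1) * K1) * (\<integral>\<^sup>+sg. ennreal (sg powr b) * P sg y * indicator {0..h} sg \<partial>lborel) \<partial>lborel)"
   using aq by (intro nn_integral_mono) (auto split: split_indicator)
  also have "... = ennreal (cth powr (q - 1) * K1) * (\<integral>\<^sup>+y. (\<integral>\<^sup>+sg. ennreal (sg powr b) * P sg y * indicator {0..h} sg \<partial>lborel) \<partial>lborel)"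
   by (rule nn_integral_cmult) measurable
  also have "(\<integral>\<^sup>+y. (\<integral>\<^sup>+sg. ennreal (sg powr b) * P sg y * indicator {0..h} sg \<partial>lborel) \<partial>lborel)
    = (\<integral>\<^sup>+sg. (\<integral>\<^sup>+y. ennreal (sg powr b) * indicator {0..h} sg * P sg y \<partial>lborel) \<partial>lborel)"
   by (subst lborel_pair.Fubini'[symmetric]) (measurable, auto simp: mult_ac)
  also have "... <= (\<integral>\<^sup>+sg. ennreal (sg powr b) * indicator {0..h} sg * ennreal V \<partial>lborel)"
   by (intro nn_integral_mono, subst nn_integral_cmult, measurable) (intro mult_left_mono intP, simp)
  also have "... = ennreal (h powr (b + 1) / (b + 1)) * ennreal V"
   using nn_integral_powr_0[of b h] th(3) h by (subst nn_integral_multc) (auto simp: b_def)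
  also have "ennreal (cth powr (q - 1) * K1) * (ennreal (h powr (b + 1) / (b + 1)) * ennreal V) = ennreal K2"
  proof -
   define J where "J = h powr (b + 1) / (b + 1)"
   have J: "J >= 0" using th(3) by (simp add: J_def b_def)
   have "ennreal (cth powr (q - 1) * K1) * (ennreal J * ennreal V) = ennreal (cth powr (q - 1) * K1 * (J * V))"
    using K1 V J by (simp add: ennreal_mult)
   also have "cth powr (q - 1) * K1 * (J * V) = K2" by (simp add: K2_def J_def mult_ac)
   finally show ?thesis by (simp only: J_def)
  qed
  finally have aint: "(\<integral>\<^sup>+y\<in>\<Omega> Int ball x0 r. ennreal (a y powr q) \<partial>lborel) <= ennreal K2" by (simp add: mult_left_mono)
  have wa: "\<bar>w y\<bar> powr q <= (2 / V) powr q * (a1 powr q + 2 powr q * a y powr q)" for y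
  proof -
   have "V * \<bar>w y\<bar> <= a1 + 2 * a y" by (simp add: a_def max_def)
   also have "... <= 2 * max a1 (2 * a y)" by (simp add: max_def)
   finally have "\<bar>w y\<bar> <= (2 / V) * max a1 (2 * a y)" using V by (simp add: field_simps)
   then have "\<bar>w y\<bar> powr q <= ((2 / V) * max a1 (2 * a y)) powr q" using pq by (intro powr_mono2) auto
   also have "... = (2 / V) powr q * (max a1 (2 * a y)) powr q" by (rule powr_mult)
   also have "(max a1 (2 * a y)) powr q <= a1 powr q + (2 * a y) powr q" by (auto simp: max_def)
   also have "(2 * a y) powr q = 2 powr q * a y powr q" by (simp add: powr_mult)
   finally show ?thesis by (simp add: mult_left_mono)
  qed
  show ?thesis unfolding C_def
  proof (rule nn_integral_affine_bound[where v = "%y. a y powr q"])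
   show "(%y. a y powr q) \<in> borel_measurable borel" by measurable
  qed (use aint wa \<Omega>fin K2 in auto)
 qed
 then show ?thesis using C by blast
qed

text \<open>The factor \<open>(%_. 1) w\<close> only gives the bound the shape
  \<open>ennreal C * R w\<close> required by \<open>nn_integral_compact_local\<close>.\<close>

lemma cone_embedding:
 fixes \<Omega> :: "'a::euclidean_space set"
 assumes op: "open \<Omega>" and bd: "bounded \<Omega>" and sm: "smooth_boundary \<Omega>"
  and pq: "1 < p" "p <= q" "real DIM('a) * (q - p) < p * q" and A0: "A0 >= 0"
 shows "\<exists>C\<ge>0. \<forall>w\<in>{w. cpt_smooth w \<and> (abs_int \<Omega> w) <= ennreal A0 \<and>
   (grad_int \<Omega> w p) <= 1}.
   (\<integral>\<^sup>+y\<in>\<Omega>. ennreal (\<bar>w y\<bar> powr q) \<partial>lborel) <= ennreal C * (%_. 1) w"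
  (is "\<exists>C\<ge>0. \<forall>w\<in>?W. _")
proof (rule nn_integral_compact_local)
 show "compact (closure \<Omega>)" "\<Omega> <= closure \<Omega>" using bd closure_subset by auto
 show "(%y. ennreal (\<bar>w y\<bar> powr q)) \<in> borel_measurable borel" if "w \<in> ?W" for w
 proof -
  have [measurable]: "w \<in> borel_measurable borel" using that smooth_on_measurable(1)[of w] by (simp add: cpt_smooth_def)
  show ?thesis by measurable
 qed
 fix x0 assume x0: "x0 \<in> closure \<Omega>"
 obtain nu kp h r where cone: "inner_cone \<Omega> x0 nu kp h r" using inner_cone_exists[OF op sm x0] by blast
 then have r: "r > 0" by (simp add: inner_cone_def)
 obtain C where C: "C >= 0" "ALL w. cpt_smooth w --> (abs_int \<Omega> w) <= ennreal A0 -->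
   (grad_int \<Omega> w p) <= 1 -->
   (\<integral>\<^sup>+y\<in>\<Omega> Int ball x0 r. ennreal (\<bar>w y\<bar> powr q) \<partial>lborel) <= ennreal C"
  using cone_embedding_local[OF op bd cone pq A0] by blast
 show "\<exists>r>0. \<exists>C\<ge>0. \<forall>w\<in>?W. (\<integral>\<^sup>+y\<in>\<Omega> Int ball x0 r. ennreal (\<bar>w y\<bar> powr q) \<partial>lborel) <= ennreal C * (%_. 1) w"
  by (rule exI[of _ r], rule conjI, rule r, rule exI[of _ C]) (use C in auto)
qed (use op in auto)

section \<open>The energy and the quantities it controls\<close>

lemma powr_le_one_add:
 fixes x a b :: real
 assumes "0 <= x" "0 < a" "a <= b"
 shows "x powr a <= 1 + x powr b"
proof (cases "x <= 1")
 case True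
 then have "x powr a <= 1" using assms by (simp add: powr_le1)
 then show ?thesis by (simp add: add_increasing2)
next
 case False
 then have "x powr a <= x powr b" using assms by (intro powr_mono) auto
 then show ?thesis by simp
qed

lemma young_sum:
 fixes x y a b :: real
 assumes "0 <= x" "0 <= y" "a > 1" "b > 1" "1 / a + 1 / b = 1"
 shows "x * y <= x powr a + y powr b"
proof -
 have "x * y <= x powr a / a + y powr b / b" using Youngs_inequality[of a b x y] assms by simp
 also have "... <= x powr a + y powr b" using assms by (intro add_mono) (auto simp: divide_le_eq mult_le_cancel_left1)
 finally show ?thesis .
qed

locale domain =
 fixes \<Omega> :: "'a::euclidean_space set" and p s :: real
 assumes dim: "DIM('a) >= 2" and op: "open \<Omega>" and bd: "bounded \<Omega>" and smb: "smooth_boundary \<Omega>"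
  and p1: "1 < p" and pm: "p < real DIM('a)" and s1: "s >= 1"
begin

abbreviation "M \<equiv> lebesgue_on \<Omega>"
abbreviation "B \<equiv> boundary_measure \<Omega>"

lemma Omega_sets [measurable, simp]: "\<Omega> \<in> sets borel" "\<Omega> \<in> sets lebesgue"
 using op by auto

sublocale B: finite_measure B
 by (rule finite_boundary_measure[OF op bd smb dim])

sublocale M: finite_measure M
 using emeasure_bounded_finite[OF bd] by (intro finite_measureI) (simp add: emeasure_restrict_space space_restrict_space emeasure_completion)

lemma space_M [simp]: "space M = \<Omega>" by (simp add: space_restrict_space)
lemma space_B [simp]: "space B = frontier \<Omega>" by (rule space_boundary_measure)

lemma borel_measurable_M: "f \<in> borel_measurable borel ==> f \<in> borel_measurable M"
 by (intro measurable_restrict_space1 measurable_completion) simp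

lemma nn_integral_M: "f \<in> borel_measurable borel ==> (\<integral>\<^sup>+y. f y \<partial>M) = (\<integral>\<^sup>+y\<in>\<Omega>. f y \<partial>lborel)"
 by (subst nn_integral_restrict_space) (auto simp: nn_integral_completion)

lemma cpt_measurable [measurable_dest]:
 assumes "cpt_smooth w"
 shows "w \<in> borel_measurable M" "grad w \<in> borel_measurable M" "w \<in> borel_measurable B" "grad w \<in> borel_measurable B"
 using smooth_on_measurable[of w] assms
 by (auto simp: cpt_smooth_def intro!: borel_measurable_M measurable_boundary_measure)

lemma cpt_integrable:
 assumes w: "cpt_smooth w" and q: "q >= 0"
 shows "integrable M (%y. \<bar>w y\<bar> powr q)" "integrable M (%y. norm (grad w y) powr q)" "integrable B (%y. \<bar>w y\<bar> powr q)"
proof -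
 note [measurable] = cpt_measurable[OF w]
 obtain C where C: "C > 0" "!!x. \<bar>w x\<bar> <= C" "!!x. norm (grad w x) <= C" using cpt_smooth_bounded[OF w] by blast
 have 1: "norm (\<bar>w y\<bar> powr q) <= C powr q" "norm (norm (grad w y) powr q) <= C powr q" for y
  using C q by (auto intro!: powr_mono2)
 show "integrable M (%y. \<bar>w y\<bar> powr q)" by (rule M.integrable_const_bound[of _ "C powr q"]) (use 1 in auto)
 show "integrable M (%y. norm (grad w y) powr q)" by (rule M.integrable_const_bound[of _ "C powr q"]) (use 1 in auto)
 show "integrable B (%y. \<bar>w y\<bar> powr q)" by (rule B.integrable_const_bound[of _ "C powr q"]) (use 1 in auto)
qed

text \<open>The exponent s + 1 is the one whose derivative is the boundary nonlinearity. No
  zero-order term in the interior is needed, since boundary values and gradient control the function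
  by \<open>poincare_boundary\<close>.\<close>

definition energy :: "('a => real) => real" where
 "energy w = (LINT y|M. norm (grad w y) powr p) + (LINT y|B. \<bar>w y\<bar> powr (s + 1))"

lemma energy_nonneg: "energy w >= 0" by (simp add: energy_def)

text \<open>Unit energy bounds the boundary values and the gradient in L^1, hence w in L^1 by the
  Poincare inequality, hence in L^q by the embedding. The choice of q covers both the exponent p and
  the conjugate exponent of m/p needed for the pairing with f; the trace inequality yields the
  boundary norm.\<close>

lemma unit_energy_bounds:
 assumes f: "Lp M (real DIM('a) / p) f"
 shows "\<exists>C>0. ALL w. cpt_smooth w --> energy w <= 1 -->
   (LINT y|M. \<bar>w y\<bar> powr p) <= C \<and> (LINT y|B. \<bar>w y\<bar> powr p) <= C \<and> integrable M (%y. \<bar>f y\<bar> * \<bar>w y\<bar>) \<and> (LINT y|M. \<bar>f y\<bar> * \<bar>w y\<bar>) <= C"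
proof -
 let ?m = "real DIM('a)"
 define b where "b = ?m / p"
 define a' where "a' = ?m / (?m - p)"
 define q where "q = max p a'"
 have b: "b > 1" using p1 pm by (simp add: b_def)
 have a': "a' > 1" using p1 pm by (simp add: a'_def)
 have conj: "1 / b + 1 / a' = 1" using p1 pm by (simp add: b_def a'_def field_simps)
 have pq: "p <= q" by (simp add: q_def)
 \<comment> \<open>If q is a' = m/(m-p), the claim reads a'(m - p) < m p, that is m < m p.\<close>
 have qm: "?m * (q - p) < p * q"
 proof (cases "p >= a'")
  case True
  then show ?thesis using p1 by (simp add: q_def)
 next
  case False
  have "a' * (?m - p) = ?m" using pm by (simp add: a'_def)
  moreover have "?m * 1 < ?m * p" using p1 pm by (intro mult_strict_left_mono) auto
  ultimately have "?m * (a' - p) < p * a'" by (simp add: algebra_simps)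
  then show ?thesis using False by (simp add: q_def)
 qed
 have fm[measurable]: "f \<in> borel_measurable M" and fi: "integrable M (%x. \<bar>f x\<bar> powr b)" using f by (auto simp: Lp_def b_def)
 obtain C1 where C1: "C1 >= 0" "ALL w. smooth_on w UNIV --> (abs_int \<Omega> w) \<le>
   ennreal C1 * ((\<integral>\<^sup>+y. ennreal \<bar>w y\<bar> \<partial>boundary_measure \<Omega>) + (\<integral>\<^sup>+z\<in>\<Omega>. ennreal (norm (grad w z)) \<partial>lborel))"
  using poincare_boundary[OF op bd dim] by blast
 define mB where "mB = measure B (space B)"
 define mM where "mM = measure M (space M)"
 \<comment> \<open>The estimate x \<le> 1 + x^r turns the unit bounds on the powers p and s + 1 into
   L^1 bounds by 1 plus the total mass.\<close>
 define A0 where "A0 = C1 * ((mB + 1) + (mM + 1))"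
 have A0: "A0 >= 0" using C1 by (simp add: A0_def mB_def mM_def)
 obtain C2 where C2: "C2 >= 0" "\<forall>w\<in>{w. cpt_smooth w \<and> (abs_int \<Omega> w) <= ennreal A0 \<and>
   (grad_int \<Omega> w p) <= 1}.
   (\<integral>\<^sup>+y\<in>\<Omega>. ennreal (\<bar>w y\<bar> powr q) \<partial>lborel) <= ennreal C2 * (%_. 1) w"
  using cone_embedding[OF op bd smb p1 pq qm A0] by blast
 obtain C3 where C3: "C3 >= 0" "\<forall>w\<in>{w. smooth_on w UNIV}. (\<integral>\<^sup>+y. ennreal (\<bar>w y\<bar> powr p) \<partial>boundary_measure \<Omega>) \<le>
   ennreal C3 * ((powr_int \<Omega> w p) + (grad_int \<Omega> w p))"
  using trace_inequality[OF op bd smb dim less_imp_le[OF p1]] by blast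
 define C where "C = 1 + (mM + C2) + C3 * ((mM + C2) + 1) + ((LINT x|M. \<bar>f x\<bar> powr b) + (mM + C2))"
 have m0: "mM >= 0" "mB >= 0" by (auto simp: mM_def mB_def)
 have fi0: "(LINT x|M. \<bar>f x\<bar> powr b) >= 0" by simp
 have Cpos: "C > 0" using m0 fi0 C2(1) C3(1) unfolding C_def by (intro add_pos_nonneg add_nonneg_nonneg mult_nonneg_nonneg) auto
 have main: "(LINT y|M. \<bar>w y\<bar> powr p) <= C \<and> (LINT y|B. \<bar>w y\<bar> powr p) <= C \<and> integrable M (%y. \<bar>f y\<bar> * \<bar>w y\<bar>) \<and> (LINT y|M. \<bar>f y\<bar> * \<bar>w y\<bar>) <= C"
  if w: "cpt_smooth w" and E: "energy w <= 1" for w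
 proof -
  have s: "smooth_on w UNIV" using w by (simp add: cpt_smooth_def)
  note [measurable] = cpt_measurable[OF w] smooth_on_measurable[OF s]
  have E1: "(LINT y|M. norm (grad w y) powr p) <= 1" and E2: "(LINT y|B. \<bar>w y\<bar> powr (s + 1)) <= 1"
  proof -
   have "0 <= (LINT y|M. norm (grad w y) powr p)" "0 <= (LINT y|B. \<bar>w y\<bar> powr (s + 1))" by auto
   then show "(LINT y|M. norm (grad w y) powr p) <= 1" "(LINT y|B. \<bar>w y\<bar> powr (s + 1)) <= 1"
    using E unfolding energy_def by linarith+
  qed
  have nnM: "(\<integral>\<^sup>+z\<in>\<Omega>. ennreal (h z) \<partial>lborel) = ennreal (LINT z|M. h z)" if "h \<in> borel_measurable borel" "integrable M h" "!!z. h z >= 0" for h :: "'a => real"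
   using that by (subst nn_integral_M[symmetric]) (auto intro!: nn_integral_eq_integral)
  have g1: "(LINT y|M. norm (grad w y)) <= mM + 1"
  proof -
   have "(LINT y|M. norm (grad w y)) <= (LINT y|M. 1 + norm (grad w y) powr p)"
    using cpt_integrable(2)[OF w, of p] cpt_integrable(2)[OF w, of 1] p1 powr_le_one_add[of _ 1 p]
    by (intro integral_mono) auto
   also have "... = mM + (LINT y|M. norm (grad w y) powr p)"
    using cpt_integrable(2)[OF w, of p] p1 by (simp add: mM_def)
   finally show ?thesis using E1 by simp
  qed
  have b1: "(LINT y|B. \<bar>w y\<bar>) <= mB + 1"
  proof -
   have "(LINT y|B. \<bar>w y\<bar>) <= (LINT y|B. 1 + \<bar>w y\<bar> powr (s + 1))"
    using cpt_integrable(3)[OF w, of "s + 1"] cpt_integrable(3)[OF w, of 1] s1 powr_le_one_add[of _ 1 "s + 1"]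
    by (intro integral_mono) auto
   also have "... = mB + (LINT y|B. \<bar>w y\<bar> powr (s + 1))"
    using cpt_integrable(3)[OF w, of "s + 1"] s1 by (simp add: mB_def)
   finally show ?thesis using E2 by simp
  qed
  have "(abs_int \<Omega> w) <= ennreal C1 * (ennreal (LINT y|B. \<bar>w y\<bar>) + ennreal (LINT y|M. norm (grad w y)))"
  proof -
   have e1: "(\<integral>\<^sup>+z\<in>\<Omega>. ennreal (norm (grad w z)) \<partial>lborel) = ennreal (LINT z|M. norm (grad w z))"
    using cpt_integrable(2)[OF w, of 1] by (intro nnM) auto
   have e2: "(\<integral>\<^sup>+y. ennreal \<bar>w y\<bar> \<partial>B) = ennreal (LINT y|B. \<bar>w y\<bar>)"
    using cpt_integrable(3)[OF w, of 1] by (intro nn_integral_eq_integral) auto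
   show ?thesis using C1(2)[rule_format, OF s] unfolding e1 e2 .
  qed
  also have "... <= ennreal C1 * (ennreal (mB + 1) + ennreal (mM + 1))"
   using b1 g1 by (intro mult_left_mono add_mono ennreal_leI) auto
  also have "... = ennreal A0" 
  proof -
   have "ennreal (mB + 1) + ennreal (mM + 1) = ennreal ((mB + 1) + (mM + 1))"
    using m0 by (intro ennreal_plus[symmetric]) auto
   then show ?thesis using C1(1) m0 by (simp only: A0_def) (intro ennreal_mult[symmetric], auto)
  qed
  finally have wA: "(abs_int \<Omega> w) <= ennreal A0" .
  have wG: "(grad_int \<Omega> w p) = ennreal (LINT y|M. norm (grad w y) powr p)"
   using cpt_integrable(2)[OF w, of p] p1 by (intro nnM) auto
  then have wG1: "(grad_int \<Omega> w p) <= 1" using E1 by (simp add: ennreal_le_1)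
  have "(\<integral>\<^sup>+y\<in>\<Omega>. ennreal (\<bar>w y\<bar> powr q) \<partial>lborel) <= ennreal C2" using C2(2) w wA wG1 by auto
  then have wq: "(LINT y|M. \<bar>w y\<bar> powr q) <= C2" using cpt_integrable(1)[OF w, of q] p1 pq C2(1) by (subst (asm) nnM) auto
  have lower: "(LINT y|M. \<bar>w y\<bar> powr t) <= mM + C2" if t: "0 < t" "t <= q" for t
  proof -
   have "(LINT y|M. \<bar>w y\<bar> powr t) <= (LINT y|M. 1 + \<bar>w y\<bar> powr q)"
    using cpt_integrable(1)[OF w, of q] cpt_integrable(1)[OF w, of t] t powr_le_one_add[of _ t q]
    by (intro integral_mono) auto
   also have "... = mM + (LINT y|M. \<bar>w y\<bar> powr q)" using cpt_integrable(1)[OF w, of q] t by (simp add: mM_def)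
   finally show ?thesis using wq by simp
  qed
  have 1: "(LINT y|M. \<bar>w y\<bar> powr p) <= mM + C2" using p1 pq by (intro lower) auto
  have "ennreal (LINT y|B. \<bar>w y\<bar> powr p) = (\<integral>\<^sup>+y. ennreal (\<bar>w y\<bar> powr p) \<partial>B)"
   using cpt_integrable(3)[OF w, of p] p1 by (simp add: nn_integral_eq_integral)
  also have "... <= ennreal C3 * ((powr_int \<Omega> w p) + (grad_int \<Omega> w p))"
   using C3(2) s by simp
  also have "... <= ennreal C3 * (ennreal (mM + C2) + 1)"
  proof (intro mult_left_mono add_mono wG1)
   show "(powr_int \<Omega> w p) <= ennreal (mM + C2)"
    using 1 cpt_integrable(1)[OF w, of p] p1 by (subst nnM) (auto intro: ennreal_leI)
  qed auto
  also have "... = ennreal (C3 * ((mM + C2) + 1))" using C3(1) m0 C2(1) by (simp add: ennreal_mult)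
  finally have 2: "(LINT y|B. \<bar>w y\<bar> powr p) <= C3 * ((mM + C2) + 1)"
   using C3(1) m0 C2(1) by (subst (asm) ennreal_le_iff) auto
  have yng: "\<bar>f y\<bar> * \<bar>w y\<bar> <= \<bar>f y\<bar> powr b + \<bar>w y\<bar> powr a'" for y using b a' conj by (intro young_sum) auto
  have ia: "integrable M (%y. \<bar>f y\<bar> powr b + \<bar>w y\<bar> powr a')" using fi cpt_integrable(1)[OF w, of a'] a' by auto
  have 3: "integrable M (%y. \<bar>f y\<bar> * \<bar>w y\<bar>)"
   by (rule Bochner_Integration.integrable_bound[OF ia]) (use yng in auto)
  have "(LINT y|M. \<bar>f y\<bar> * \<bar>w y\<bar>) <= (LINT y|M. \<bar>f y\<bar> powr b + \<bar>w y\<bar> powr a')" by (intro integral_mono 3 ia yng)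
  also have "... = (LINT y|M. \<bar>f y\<bar> powr b) + (LINT y|M. \<bar>w y\<bar> powr a')"
   using fi cpt_integrable(1)[OF w, of a'] a' by simp
  also have "(LINT y|M. \<bar>w y\<bar> powr a') <= mM + C2" using a' by (intro lower) (auto simp: q_def)
  finally have 4: "(LINT y|M. \<bar>f y\<bar> * \<bar>w y\<bar>) <= (LINT y|M. \<bar>f y\<bar> powr b) + (mM + C2)" by simp
  have nn: "0 <= C3 * ((mM + C2) + 1)" "0 <= mM + C2" using m0 C2(1) C3(1) by auto
  show ?thesis
  proof (intro conjI 3)
   show "(LINT y|M. \<bar>w y\<bar> powr p) <= C" "(LINT y|B. \<bar>w y\<bar> powr p) <= C" "(LINT y|M. \<bar>f y\<bar> * \<bar>w y\<bar>) <= C"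
    using 1 2 4 nn fi0 unfolding C_def by linarith+
  qed
 qed
 then show ?thesis using Cpos by blast
qed

end

section \<open>Rapidly convergent sequences in L^p\<close>

lemma summable_half_ennreal: "(\<Sum>k. ennreal ((1/2) ^ k)) = 2"
proof -
 have "(%k. (1/2::real) ^ k) sums (1 / (1 - 1/2))" by (rule geometric_sums) simp
 then have "(\<Sum>k. ennreal ((1/2) ^ k)) = ennreal (1 / (1 - 1/2))" by (intro suminf_ennreal_eq) auto
 then show ?thesis by simp
qed

text \<open>The sum of all \<open>d k\<close> has finite integral. It serves as a common integrable
  bound, and its finiteness almost everywhere forces the terms to 0.\<close>

lemma AE_suminf_bound:
 fixes d :: "nat => 'x => real"
 assumes [measurable]: "!!k. d k \<in> borel_measurable M" and nn: "!!k x. d k x >= 0"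
  and le: "!!k. (\<integral>\<^sup>+x. ennreal (d k x) \<partial>M) <= ennreal ((1/2) ^ k)"
 shows "EX H. integrable M H \<and> (AE x in M. (ALL k. d k x <= H x) \<and> (%k. d k x) ----> 0)"
proof -
 define S where "S x = (\<Sum>k. ennreal (d k x))" for x
 have [measurable]: "S \<in> borel_measurable M" unfolding S_def[abs_def] by measurable
 have "(\<integral>\<^sup>+x. S x \<partial>M) = (\<Sum>k. \<integral>\<^sup>+x. ennreal (d k x) \<partial>M)"
  unfolding S_def by (rule nn_integral_suminf) measurable
 also have "... <= (\<Sum>k. ennreal ((1/2) ^ k))" by (intro suminf_le le) auto
 finally have S2: "(\<integral>\<^sup>+x. S x \<partial>M) <= 2" by (simp add: summable_half_ennreal)
 then have Sfin: "(\<integral>\<^sup>+x. S x \<partial>M) ~= \<infinity>" 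
 proof -
  have "(\<integral>\<^sup>+x. S x \<partial>M) < top" using S2 by (rule le_less_trans) simp
  then show ?thesis by simp
 qed
 then have AE: "AE x in M. S x ~= \<infinity>" by (intro nn_integral_PInf_AE) auto
 define H where "H x = enn2real (S x)" for x
 have "integrable M H"
 proof (rule integrableI_nonneg)
  have "(\<integral>\<^sup>+x. ennreal (H x) \<partial>M) = (\<integral>\<^sup>+x. S x \<partial>M)"
   using AE by (intro nn_integral_cong_AE) (auto simp: H_def less_top)
  then show "(\<integral>\<^sup>+x. ennreal (H x) \<partial>M) < \<infinity>" using Sfin by (simp add: less_top)
 qed (auto simp: H_def[abs_def])
 moreover have "AE x in M. (ALL k. d k x <= H x) \<and> (%k. d k x) ----> 0"
  using AE
 proof eventually_elim
  case (elim x)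
  then have SH: "S x = ennreal (H x)" by (simp add: H_def less_top)
  have H0: "H x >= 0" by (simp add: H_def)
  have "d k x <= H x" for k
  proof -
   have "ennreal (d k x) = (\<Sum>i\<in>{k}. ennreal (d i x))" by simp
   also have "... <= S x" unfolding S_def by (rule sum_le_suminf) auto
   finally show ?thesis using H0 by (simp add: SH)
  qed
  moreover have "summable (%k. d k x)"
   by (rule summable_suminf_not_top) (use nn elim in "auto simp: S_def")
  ultimately show ?case using summable_LIMSEQ_zero by blast
 qed
 ultimately show ?thesis by blast
qed

lemma tendsto_powr_zero_iff:
 fixes f :: "nat => real"
 assumes "q > 0" "!!k. f k >= 0" "(%k. f k powr q) ----> 0"
 shows "f ----> 0"
proof -
 have "(%k. (f k powr q) powr (1 / q)) ----> 0 powr (1 / q)"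
  using assms by (intro tendsto_powr' tendsto_const) auto
 then show ?thesis using assms by (simp add: powr_powr)
qed

lemma Lp_fast_convergence:
 fixes f :: "nat => 'x => 'b::euclidean_space"
 assumes q: "q > 0" and [measurable]: "!!k. f k \<in> borel_measurable M" "g \<in> borel_measurable M"
  and le: "!!k. (\<integral>\<^sup>+x. ennreal (norm (f k x - g x) powr q) \<partial>M) <= ennreal ((1/2) ^ k)"
 shows "EX H. integrable M H \<and> (AE x in M. (ALL k. norm (f k x - g x) powr q <= H x) \<and> (%k. f k x) ----> g x)"
proof -
 obtain H where H: "integrable M H" "AE x in M. (ALL k. norm (f k x - g x) powr q <= H x) \<and> (%k. norm (f k x - g x) powr q) ----> 0"
  using AE_suminf_bound[of "%k x. norm (f k x - g x) powr q" M] le by auto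
 have "AE x in M. (ALL k. norm (f k x - g x) powr q <= H x) \<and> (%k. f k x) ----> g x"
  using H(2)
 proof eventually_elim
  case (elim x)
  have "(%k. norm (f k x - g x)) ----> 0" by (rule tendsto_powr_zero_iff[OF q]) (use elim in auto)
  then have "(%k. f k x) ----> g x" by (rule LIM_zero_cancel[OF tendsto_norm_zero_cancel])
  then show ?case using elim by blast
 qed
 with H(1) show ?thesis by blast
qed

text \<open>The rate is (1/2)^(q+1) for a reason: the part 2^(-q) pays for a weight 2^(qk), which
  makes the increments at almost every point at most a constant times 2^(-k), and the remaining 1/2
  makes the weighted increments summable in integral. The distance to the pointwise limit is then
  estimated by Fatou.\<close>

lemma Lp_fast_cauchy_limit:
 fixes f :: "nat => 'x => 'b::euclidean_space"
 assumes q: "q > 0" and [measurable]: "!!k. f k \<in> borel_measurable M"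
  and le: "!!k l. k <= l ==> (\<integral>\<^sup>+x. ennreal (norm (f k x - f l x) powr q) \<partial>M) <= ennreal (((1/2) powr (q + 1)) ^ k)"
 shows "\<exists>g\<in>borel_measurable M. ALL k. (\<integral>\<^sup>+x. ennreal (norm (f k x - g x) powr q) \<partial>M) <= ennreal ((1/2) ^ k)"
proof -
 have "(\<integral>\<^sup>+x. ennreal ((2 powr q) ^ k * norm (f k x - f (Suc k) x) powr q) \<partial>M) <= ennreal ((1/2) ^ k)" for k
 proof -
  have "(\<integral>\<^sup>+x. ennreal ((2 powr q) ^ k * norm (f k x - f (Suc k) x) powr q) \<partial>M)
   = ennreal ((2 powr q) ^ k) * (\<integral>\<^sup>+x. ennreal (norm (f k x - f (Suc k) x) powr q) \<partial>M)"
   by (subst nn_integral_cmult[symmetric]) (auto simp: ennreal_mult')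
  also have "... <= ennreal ((2 powr q) ^ k) * ennreal (((1/2) powr (q + 1)) ^ k)" by (intro mult_left_mono le) auto
  also have "... = ennreal ((2 powr q * (1/2) powr (q + 1)) ^ k)" by (simp add: ennreal_mult'[symmetric] power_mult_distrib)
  also have "2 powr q * (1/2) powr (q + 1) = (1/2::real)" by (simp add: powr_add powr_divide)
  finally show ?thesis .
 qed
 then obtain H where H: "AE x in M. (ALL k. (2 powr q) ^ k * norm (f k x - f (Suc k) x) powr q <= H x)"
  using AE_suminf_bound[of "%k x. (2 powr q) ^ k * norm (f k x - f (Suc k) x) powr q" M] by auto
 have conv: "AE x in M. convergent (%k. f k x)"
  using H
 proof eventually_elim
  case (elim x)
  have "norm (f (Suc k) x - f k x) <= H x powr (1 / q) * (1/2) ^ k" for k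
  proof -
   have "(norm (f (Suc k) x - f k x) * 2 ^ k) powr q <= H x"
    using elim[rule_format, of k] by (simp add: powr_mult powr_power powr_realpow[symmetric] powr_powr mult.commute norm_minus_commute)
   then have "((norm (f (Suc k) x - f k x) * 2 ^ k) powr q) powr (1 / q) <= H x powr (1 / q)"
    using q by (intro powr_mono2) auto
   then have "norm (f (Suc k) x - f k x) * 2 ^ k <= H x powr (1 / q)" using q by (simp add: powr_powr)
   then show ?thesis by (simp add: power_one_over field_simps)
  qed
  moreover have "summable (%k. H x powr (1 / q) * (1/2) ^ k)" by (rule summable_mult[OF summable_geometric]) simp
  ultimately have "summable (%k. f (Suc k) x - f k x)" by (rule summable_comparison_test'[where N=0, rotated])
  then have "convergent (%n. \<Sum>k<n. f (Suc k) x - f k x)" by (simp add: summable_iff_convergent)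
  moreover have "(%n. \<Sum>k<n. f (Suc k) x - f k x) = (%n. f n x - f 0 x)"
   by (rule ext) (rule sum_lessThan_telescope)
  ultimately have "convergent (%n. f n x - f 0 x)" by simp
  then obtain L where "(%n. f n x - f 0 x) ----> L" by (auto simp: convergent_def)
  then have "(%n. f n x - f 0 x + f 0 x) ----> L + f 0 x" by (intro tendsto_intros)
  then show ?case by (auto simp: convergent_def)
 qed
 define g where "g x = lim (%k. f k x)" for x
 have [measurable]: "g \<in> borel_measurable M" unfolding g_def[abs_def] by measurable
 have "(\<integral>\<^sup>+x. ennreal (norm (f k x - g x) powr q) \<partial>M) <= ennreal ((1/2) ^ k)" for k
 proof -
  have "(\<integral>\<^sup>+x. ennreal (norm (f k x - g x) powr q) \<partial>M) <= (\<integral>\<^sup>+x. liminf (%l. ennreal (norm (f k x - f l x) powr q)) \<partial>M)"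
  proof (rule nn_integral_mono_AE)
   show "AE x in M. ennreal (norm (f k x - g x) powr q) <= liminf (%l. ennreal (norm (f k x - f l x) powr q))"
    using conv
   proof eventually_elim
    case (elim x)
    then have "(%l. f l x) ----> g x" unfolding g_def by (simp add: convergent_LIMSEQ_iff)
    then have "(%l. ennreal (norm (f k x - f l x) powr q)) ----> ennreal (norm (f k x - g x) powr q)"
     using q by (intro tendsto_ennrealI tendsto_powr' tendsto_intros) auto
    then show ?case by (subst lim_imp_Liminf[OF sequentially_bot]) auto
   qed
  qed
  also have "... <= liminf (%l. \<integral>\<^sup>+x. ennreal (norm (f k x - f l x) powr q) \<partial>M)" by (rule nn_integral_liminf) measurable
  also have "... <= liminf (%l::nat. ennreal (((1/2) powr (q + 1)) ^ k))"
   by (intro Liminf_mono) (auto intro!: le simp: eventually_at_top_linorder exI[of _ k])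
  also have "... = ennreal (((1/2) powr (q + 1)) ^ k)" by (simp add: Liminf_const)
  also have "... <= ennreal ((1/2) ^ k)"
  proof (intro ennreal_leI power_mono)
   have "(1/2::real) powr (q + 1) <= (1/2) powr 1" using q by (intro powr_mono') auto
   then show "(1/2::real) powr (q + 1) <= 1/2" by simp
  qed auto
  finally show ?thesis .
 qed
 then show ?thesis by (intro bexI[of _ g]) auto
qed

section \<open>Uniform convexity of powers of the norm\<close>

lemma powr_strict_midpoint:
 fixes x y p :: real
 assumes p: "p > 1" and xy: "0 <= x" "x < y"
 shows "2 * ((x + y) / 2) powr p < x powr p + y powr p"
proof -
 define m where "m = (x + y) / 2"
 have m: "x < m" "m < y" "m - x = y - m" "m > 0" using xy by (auto simp: m_def field_simps)
 have mvt: "EX z. a < z \<and> z < b \<and> b powr p - a powr p = (b - a) * (p * z powr (p - 1))" if "0 <= a" "a < b" for a b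
 proof -
  have "EX l z. a < z \<and> z < b \<and> ((%t. t powr p) has_real_derivative l) (at z) \<and> b powr p - a powr p = (b - a) * l"
  proof (rule MVT)
   show "continuous_on {a..b} (%t. t powr p)"
    by (rule continuous_on_powr'[OF continuous_on_id continuous_on_const]) (use that p in auto)
   show "(%t. t powr p) differentiable (at x)" if "a < x" for x
    by (rule differentiableI[OF has_real_derivative_powr[unfolded has_field_derivative_def]]) (use \<open>0 <= a\<close> that in auto)
  qed (use that in auto)
  then obtain l z where z: "a < z" "z < b" "((%t. t powr p) has_real_derivative l) (at z)" "b powr p - a powr p = (b - a) * l" by blast
  have "((%t. t powr p) has_real_derivative p * z powr (p - 1)) (at z)" using that z by (intro has_real_derivative_powr) auto
  then have "l = p * z powr (p - 1)" using z(3) DERIV_unique by blast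
  then show ?thesis using z by blast
 qed
 obtain z1 where z1: "x < z1" "z1 < m" "m powr p - x powr p = (m - x) * (p * z1 powr (p - 1))" using mvt[OF xy(1) m(1)] by blast
 obtain z2 where z2: "m < z2" "z2 < y" "y powr p - m powr p = (y - m) * (p * z2 powr (p - 1))" using mvt[OF less_imp_le[OF m(4)] m(2)] by blast
 have "z1 powr (p - 1) < z2 powr (p - 1)" using z1 z2 xy p by (intro powr_less_mono2) auto
 then have "(m - x) * (p * z1 powr (p - 1)) < (y - m) * (p * z2 powr (p - 1))" 
  unfolding m(3)[symmetric] using m p by (intro mult_strict_left_mono) auto
 then show ?thesis using z1(3) z2(3) unfolding m_def[symmetric] by linarith
qed

lemma norm_powr_strict_midpoint:
 fixes a b :: "'b::euclidean_space"
 assumes p: "p > 1" and ab: "a ~= b"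
 shows "2 * norm ((1/2) *\<^sub>R (a + b)) powr p < norm a powr p + norm b powr p"
proof -
 have le: "norm ((1/2) *\<^sub>R (a + b)) <= (norm a + norm b) / 2" using norm_triangle_ineq[of a b] by simp
 consider "norm a < norm b" | "norm b < norm a" | "norm a = norm b" by linarith
 then show ?thesis
 proof cases
  case 1
  have "2 * norm ((1/2) *\<^sub>R (a + b)) powr p <= 2 * ((norm a + norm b) / 2) powr p"
   using le p by (intro mult_left_mono powr_mono2) auto
  then show ?thesis using powr_strict_midpoint[OF p _ 1] by simp
 next
  case 2
  have "2 * norm ((1/2) *\<^sub>R (a + b)) powr p <= 2 * ((norm b + norm a) / 2) powr p"
   using le p by (intro mult_left_mono powr_mono2) (auto simp: add.commute)
  then show ?thesis using powr_strict_midpoint[OF p _ 2] by simp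
 next
  case 3
  \<comment> \<open>For equal norms, equality in the triangle inequality would force a = b; this is
    strict convexity of the Euclidean norm.\<close>
  have "norm (a + b) ~= norm a + norm b"
  proof
   assume "norm (a + b) = norm a + norm b"
   then have "norm a *\<^sub>R b = norm b *\<^sub>R a" by (simp add: norm_triangle_eq)
   then show False using 3 ab by auto
  qed
  then have "norm ((1/2) *\<^sub>R (a + b)) < norm a" using 3 norm_triangle_ineq[of a b] by simp
  then have "norm ((1/2) *\<^sub>R (a + b)) powr p < norm a powr p" using p by (intro powr_less_mono2) auto
  then show ?thesis using 3 by simp
 qed
qed

lemma powr_le_1D: "0 <= x ==> 0 < p ==> x powr p <= 1 ==> x <= (1::real)"
proof (rule ccontr)
 assume *: "0 < p" "x powr p <= 1" "\<not> x <= 1"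
 then have "1 powr p < x powr p" by (intro powr_less_mono2) auto
 then show False using * unfolding powr_one_eq_one by linarith
qed

text \<open>By homogeneity it suffices to treat pairs whose p-th powers sum to 1. Among those at
  distance at least the given threshold, compactness and strict convexity bound the midpoint defect
  below by some k > 0; for the others the first term is enough. The linear form in the energies
  allows integration.\<close>

lemma norm_powr_uniform_convexity:
 fixes p ep :: real
 assumes p: "p > 1" and e: "ep > 0"
 shows "\<exists>C>0. \<forall>a b::'b::euclidean_space. norm (a - b) powr p \<le>
   ep * (norm a powr p + norm b powr p) + C * (norm a powr p + norm b powr p - 2 * norm ((1/2) *\<^sub>R (a + b)) powr p)"
proof -
 define T where "T = {x::'b \<times> 'b. norm (fst x) powr p + norm (snd x) powr p = 1 \<and> ep <= norm (fst x - snd x) powr p}"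
 define dd where "dd x = norm (fst x) powr p + norm (snd x) powr p - 2 * norm ((1/2) *\<^sub>R (fst x + snd x)) powr p" for x :: "'b \<times> 'b"
 have cont: "continuous_on UNIV dd" "continuous_on UNIV (%x::'b\<times>'b. norm (fst x) powr p + norm (snd x) powr p)"
  "continuous_on UNIV (%x::'b\<times>'b. norm (fst x - snd x) powr p)"
  unfolding dd_def[abs_def] using p by (auto intro!: continuous_intros continuous_on_powr')
 have "T = {x. norm (fst x) powr p + norm (snd x) powr p = 1} Int {x. ep <= norm (fst x - snd x) powr p}" by (auto simp: T_def)
 then have "closed T" using closed_Collect_eq[OF cont(2) continuous_on_const] closed_Collect_le[OF continuous_on_const cont(3)] by (simp add: closed_Int)
 moreover have "bounded T"
 proof -
  have "norm x <= 2" if "x \<in> T" for x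
  proof -
   have "norm (fst x) powr p <= 1 powr p" "norm (snd x) powr p <= 1 powr p" using that powr_ge_zero[of "norm (fst x)" p] powr_ge_zero[of "norm (snd x)" p]
    unfolding T_def mem_Collect_eq powr_one_eq_one by linarith+
   then have "norm (fst x) <= 1" "norm (snd x) <= 1" using p powr_le_1D[of "norm (fst x)" p] powr_le_1D[of "norm (snd x)" p] by auto
   then show ?thesis using norm_Pair_le[of "fst x" "snd x"] by simp
  qed
  then show ?thesis unfolding bounded_iff by blast
 qed
 ultimately have cT: "compact T" by (simp add: compact_eq_bounded_closed)
 have pos: "dd x > 0" if "x \<in> T" for x
 proof -
  have "fst x ~= snd x" using that e by (auto simp: T_def)
  then show ?thesis using norm_powr_strict_midpoint[OF p] by (simp add: dd_def)
 qed
 have "\<exists>k>0. \<forall>x\<in>T. k <= dd x"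
 proof (cases "T = {}")
  case False
  then obtain x where "x \<in> T" "\<forall>y\<in>T. dd x <= dd y" using continuous_attains_inf[OF cT False continuous_on_subset[OF cont(1)]] by auto
  then show ?thesis using pos by blast
 qed (auto intro: exI[of _ 1])
 then obtain k where k: "k > 0" "!!x. x \<in> T ==> k <= dd x" by blast
 \<comment> \<open>Normalised pairs satisfy |a - b| \<le> 2, so C times the least defect k covers
   the largest possible left side.\<close>
 define C where "C = 2 powr p / k"
 have C: "C > 0" using k by (simp add: C_def)
 have dd0: "dd x >= 0" for x
  using norm_powr_strict_midpoint[OF p, of "fst x" "snd x"] by (cases "fst x = snd x") (auto simp: dd_def scaleR_2[symmetric])
 have unit: "norm (a - b) powr p <= ep + C * dd (a, b)" if n: "norm a powr p + norm b powr p = 1" for a b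
 proof (cases "(a, b) \<in> T")
  case True
  have "norm a powr p <= 1 powr p" "norm b powr p <= 1 powr p" using n powr_ge_zero[of "norm a" p] powr_ge_zero[of "norm b" p] unfolding powr_one_eq_one by linarith+
  then have "norm a <= 1" "norm b <= 1" using p powr_le_1D[of "norm a" p] powr_le_1D[of "norm b" p] by auto
  then have "norm (a - b) <= 2" using norm_triangle_ineq4[of a b] by linarith
  then have "norm (a - b) powr p <= 2 powr p" using p by (intro powr_mono2) auto
  also have "... = C * k" using k by (simp add: C_def)
  also have "... <= C * dd (a, b)" using k(2)[OF True] C by (intro mult_left_mono) auto
  finally show ?thesis using e by simp
 next
  case False
  then have "norm (a - b) powr p <= ep" using n by (auto simp: T_def)
  then show ?thesis using mult_nonneg_nonneg[OF less_imp_le[OF C] dd0[of "(a, b)"]] by linarith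
 qed
 have "norm (a - b) powr p <= ep * (norm a powr p + norm b powr p) + C * dd (a, b)" for a b :: 'b
 proof -
  define N where "N = norm a powr p + norm b powr p"
  have N0: "N >= 0" by (simp add: N_def)
  show ?thesis
  proof (cases "N = 0")
   case True
   then have "norm a powr p = 0" "norm b powr p = 0"
    using powr_ge_zero[of "norm a" p] powr_ge_zero[of "norm b" p] unfolding N_def by linarith+
   then have "a = 0" "b = 0" by auto
   then show ?thesis by (simp add: dd_def)
  next
   case False
   define t where "t = N powr (- (1 / p))"
   have t: "t > 0" using False N0 by (simp add: t_def)
   have "t powr p = N powr (- 1)" unfolding t_def powr_powr using p by simp
   then have tp: "t powr p = 1 / N" using False N0 by (simp add: powr_minus_divide)
   have sc: "norm (t *\<^sub>R x) powr p = norm x powr p / N" for x :: 'b using t by (simp add: powr_mult tp)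
   have "norm (t *\<^sub>R a) powr p + norm (t *\<^sub>R b) powr p = 1" 
    unfolding sc add_divide_distrib[symmetric] N_def[symmetric] using False by simp
   from unit[OF this] have "norm (t *\<^sub>R (a - b)) powr p <= ep + C * dd (t *\<^sub>R a, t *\<^sub>R b)" by (simp add: scaleR_diff_right)
   moreover have "dd (t *\<^sub>R a, t *\<^sub>R b) = dd (a, b) / N"
   proof -
    have "(1/2) *\<^sub>R (t *\<^sub>R a + t *\<^sub>R b) = t *\<^sub>R ((1/2) *\<^sub>R (a + b))" by (simp add: scaleR_add_right mult.commute)
    then show ?thesis unfolding dd_def fst_conv snd_conv by (simp only: sc) (simp add: field_simps False)
   qed
   ultimately have "norm (a - b) powr p / N <= ep + C * (dd (a, b) / N)" by (simp only: sc)
   then have "norm (a - b) powr p / N * N <= (ep + C * (dd (a, b) / N)) * N" using N0 by (rule mult_right_mono)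
   then show ?thesis using False by (simp add: N_def[symmetric] distrib_right)
  qed
 qed
 then show ?thesis using C unfolding dd_def by (intro exI[of _ C]) auto
qed

section \<open>Approximate Minty solutions\<close>

text \<open>Replaces the squared negative part after a displacement by a quadratic polynomial in the
  displacement, so that the payoff can be expanded along a segment despite the kink.\<close>

lemma neg_part_sq:
 fixes a d :: real
 shows "(max 0 (- (a + d)))\<^sup>2 <= (max 0 (- a) - d)\<^sup>2"
proof -
 have "max 0 (- (a + d)) <= \<bar>max 0 (- a) - d\<bar>" by (auto simp: max_def)
 then show ?thesis by (metis abs_ge_zero abs_le_square_iff abs_of_nonneg max.cobounded1)
qed

text \<open>A matrix game whose symmetric part is nonnegative has value at least 0. The proof minimises the
 squared negative part of the payoff vector over the simplex; approximate minimisers suffice, so no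
 compactness is needed.\<close>

lemma monotone_matrix_game:
 fixes a :: "'i => 'i => real"
 assumes F: "finite F" "F ~= {}" and mono: "!!i j. i \<in> F ==> j \<in> F ==> a i j + a j i >= 0" and eps: "ep > 0"
 shows "EX r. (\<forall>i\<in>F. r i >= 0) \<and> (\<Sum>i\<in>F. r i) = 1 \<and> (\<forall>i\<in>F. (\<Sum>j\<in>F. a i j * r j) >= - ep)"
proof (rule ccontr)
 assume neg: "\<not> ?thesis"
 define \<Delta> where "\<Delta> = {r. (\<forall>i\<in>F. r i >= (0::real)) \<and> (\<Sum>i\<in>F. r i) = 1}"
 define L where "L i r = (\<Sum>j\<in>F. a i j * r j)" for i r
 define n where "n i r = max 0 (- L i r)" for i r
 define ph where "ph r = (\<Sum>i\<in>F. (n i r)\<^sup>2)" for r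
 have n0: "n i r >= 0" for i r by (simp add: n_def)
 have ph0: "ph r >= 0" for r by (simp add: ph_def sum_nonneg)
 have phe: "ph r >= ep\<^sup>2" if "r \<in> \<Delta>" for r
 proof -
  obtain i where i: "i \<in> F" "L i r < - ep" using neg \<open>r \<in> \<Delta>\<close> by (force simp: \<Delta>_def L_def not_le)
  have "ep <= n i r" using i by (simp add: n_def)
  then have "ep\<^sup>2 <= (n i r)\<^sup>2" using eps by (intro power_mono) auto
  also have "... <= ph r" unfolding ph_def using F i by (intro member_le_sum) auto
  finally show ?thesis .
 qed
 obtain i0 where i0: "i0 \<in> F" using F by blast
 have "(%i. if i = i0 then 1 else 0) \<in> \<Delta>" using F i0 by (auto simp: \<Delta>_def)
 then have ne: "\<Delta> ~= {}" by blast
 define d where "d = Inf (ph ` \<Delta>)"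
 have bb: "bdd_below (ph ` \<Delta>)" using ph0 by (intro bdd_belowI[of _ 0]) auto
 have "d >= ep\<^sup>2" unfolding d_def using ne phe by (intro cInf_greatest) auto
 then have d: "d > 0" using eps by (meson less_le_trans zero_less_power)
 have dle: "d <= ph r" if "r \<in> \<Delta>" for r unfolding d_def using that bb by (intro cInf_lower) auto
 define A where "A = (\<Sum>i\<in>F. \<Sum>j\<in>F. \<bar>a i j\<bar>)"
 have LA: "\<bar>L i r\<bar> <= A" if "i \<in> F" "r \<in> \<Delta>" for i r
 proof -
  have r1: "r j <= 1" if "j \<in> F" for j
   using member_le_sum[of j F r] \<open>r \<in> \<Delta>\<close> F that by (auto simp: \<Delta>_def)
  have "\<bar>L i r\<bar> <= (\<Sum>j\<in>F. \<bar>a i j * r j\<bar>)" unfolding L_def by (rule sum_abs)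
  also have "... <= (\<Sum>j\<in>F. \<bar>a i j\<bar>)"
   using r1 \<open>r \<in> \<Delta>\<close> by (intro sum_mono) (auto simp: abs_mult \<Delta>_def intro: mult_left_le)
  also have "... <= A" unfolding A_def using F that by (intro member_le_sum[of i F "%i. \<Sum>j\<in>F. \<bar>a i j\<bar>"]) (auto intro: sum_nonneg)
  finally show ?thesis .
 qed
 define K where "K = real (card F) * (2 * A)\<^sup>2"
 have K0: "K >= 0" by (simp add: K_def)
 \<comment> \<open>The step length is small enough for the quadratic error th^2 K to be at most th
   d, which is less than the first-order gain of 2 th d.\<close>
 define th where "th = min (1/2) (d / (K + 1))"
 have th: "0 < th" "th <= 1/2" "th * K <= d"
 proof -
  show "0 < th" using d K0 by (auto simp: th_def)
  show "th <= 1/2" unfolding th_def by (rule min.cobounded1)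
  have "th * K <= d / (K + 1) * K" using K0 by (intro mult_right_mono) (auto simp: th_def)
  also have "... <= d" using d K0 by (simp add: field_simps)
  finally show "th * K <= d" .
 qed
 have "d < d + th * d / 2" using d th by simp
 then obtain t where t: "t \<in> \<Delta>" "ph t < d + th * d / 2"
  unfolding d_def by (subst (asm) (1) cInf_less_iff) (use ne bb in auto)
 define T where "T = (\<Sum>i\<in>F. n i t)"
 have T: "T > 0"
 proof (rule ccontr)
  assume "\<not> T > 0"
  then have "T = 0" using n0 unfolding T_def by (metis antisym_conv not_le sum_nonneg)
  then have "\<forall>i\<in>F. n i t = 0" unfolding T_def using F n0 by (subst (asm) sum_nonneg_eq_0_iff) auto
  then have "ph t = 0" by (simp add: ph_def)
  then show False using dle[OF t(1)] d by simp
 qed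
 \<comment> \<open>The normalised negative part is itself a mixed strategy. Against it the cross
   term of the expansion is a positive multiple of the quadratic form in u, which is nonnegative by
   the symmetry condition, so moving towards u decreases \<open>ph\<close>.\<close>
 define u where "u i = n i t / T" for i
 have u: "u \<in> \<Delta>" using T n0 by (auto simp: \<Delta>_def u_def sum_divide_distrib[symmetric] T_def[symmetric])
 have sym: "(\<Sum>i\<in>F. u i * L i u) >= 0"
 proof -
  have "(\<Sum>i\<in>F. u i * L i u) = (\<Sum>i\<in>F. \<Sum>j\<in>F. u i * u j * a i j)" by (simp add: L_def sum_distrib_left mult_ac)
  moreover have "(\<Sum>i\<in>F. \<Sum>j\<in>F. u i * u j * a i j) = (\<Sum>i\<in>F. \<Sum>j\<in>F. u i * u j * a j i)"
   by (subst sum.swap) (simp add: mult_ac)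
  ultimately have "2 * (\<Sum>i\<in>F. u i * L i u) = (\<Sum>i\<in>F. \<Sum>j\<in>F. u i * u j * (a i j + a j i))"
   by (simp add: distrib_left sum.distrib)
  also have "... >= 0" using u mono by (intro sum_nonneg mult_nonneg_nonneg) (auto simp: \<Delta>_def)
  finally show ?thesis by simp
 qed
 define x where "x i = (1 - th) * t i + th * u i" for i
 have x: "x \<in> \<Delta>" using t(1) u th by (auto simp: \<Delta>_def x_def sum.distrib sum_distrib_left[symmetric])
 have Lx: "L i x = L i t + th * (L i u - L i t)" for i
  by (simp add: L_def x_def distrib_left sum.distrib sum_distrib_left algebra_simps sum_subtractf)
 have "ph x <= (\<Sum>i\<in>F. (n i t - th * (L i u - L i t))\<^sup>2)"
  unfolding ph_def n_def Lx by (intro sum_mono neg_part_sq)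
 also have "... = (\<Sum>i\<in>F. (n i t)\<^sup>2 - 2 * th * (n i t * L i u) + 2 * th * (n i t * L i t) + th\<^sup>2 * (L i u - L i t)\<^sup>2)"
  by (intro sum.cong) (auto simp: power2_eq_square algebra_simps)
 also have "... = ph t - 2 * th * (\<Sum>i\<in>F. n i t * L i u) + 2 * th * (\<Sum>i\<in>F. n i t * L i t) + th\<^sup>2 * (\<Sum>i\<in>F. (L i u - L i t)\<^sup>2)"
  by (simp add: ph_def sum.distrib sum_subtractf sum_distrib_left)
 also have "(\<Sum>i\<in>F. n i t * L i t) = - ph t"
  unfolding ph_def sum_negf[symmetric] by (intro sum.cong) (auto simp: n_def max_def power2_eq_square)
 also have "(\<Sum>i\<in>F. n i t * L i u) = T * (\<Sum>i\<in>F. u i * L i u)"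
  using T by (simp add: u_def sum_distrib_left mult.assoc)
 finally have le: "ph x <= ph t - 2 * th * (T * (\<Sum>i\<in>F. u i * L i u)) + 2 * th * (- ph t) + th\<^sup>2 * (\<Sum>i\<in>F. (L i u - L i t)\<^sup>2)" .
 have "0 <= 2 * th * (T * (\<Sum>i\<in>F. u i * L i u))" using th T sym by (intro mult_nonneg_nonneg) auto
 moreover have "(\<Sum>i\<in>F. (L i u - L i t)\<^sup>2) <= K"
 proof -
  have "(L i u - L i t)\<^sup>2 <= (2 * A)\<^sup>2" if "i \<in> F" for i
  proof -
   have "\<bar>L i u - L i t\<bar> <= 2 * A" using LA[OF that u] LA[OF that t(1)] by linarith
   then have "\<bar>L i u - L i t\<bar>\<^sup>2 <= (2 * A)\<^sup>2" by (intro power_mono) auto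
   then show ?thesis by simp
  qed
  then have "(\<Sum>i\<in>F. (L i u - L i t)\<^sup>2) <= real (card F) * (2 * A)\<^sup>2" by (intro sum_bounded_above)
  then show ?thesis by (simp add: K_def)
 qed
 then have "th\<^sup>2 * (\<Sum>i\<in>F. (L i u - L i t)\<^sup>2) <= th\<^sup>2 * K" by (intro mult_left_mono) auto
 moreover have "th\<^sup>2 * K <= th * d" using th by (simp add: power2_eq_square mult.assoc mult_left_mono)
 moreover have "2 * (th * d) <= 2 * (th * ph t)" using dle[OF t(1)] th by (simp add: mult_left_mono)
 moreover have "d <= ph x" by (rule dle[OF x])
 moreover have "2 * th * (- ph t) = - (2 * (th * ph t))" by simp
 moreover have "th * d > 0" using th d by simp
 ultimately show False using le t(2) by linarith
qed

definition cmb :: "real => ('x => real) => ('x => real) => 'x => real" where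
 "cmb t u v = (%x. (1 - t) * u x + t * v x)"

text \<open>Here \<open>L z u\<close> plays the part of the operator at z applied to z - u: affine
  in u for frozen z, while \<open>mono\<close> is monotonicity of the operator.\<close>

locale minty_setup =
 fixes C :: "('x => real) set" and L :: "('x => real) => ('x => real) => real"
 assumes conv: "!!u v t. u \<in> C ==> v \<in> C ==> 0 <= t ==> t <= 1 ==> cmb t u v \<in> C"
  and aff: "!!z u v t. z \<in> C ==> u \<in> C ==> v \<in> C ==> 0 <= t ==> t <= 1 ==> L z (cmb t u v) = (1 - t) * L z u + t * L z v"
  and mono: "!!u v. u \<in> C ==> v \<in> C ==> L u v + L v u >= 0"
begin

text \<open>Barycentres are built from the two-point operation \<open>cmb\<close> alone. Only the
  values \<open>L z u\<close> of the result matter, so nothing is said about the function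
  itself.\<close>

lemma convex_combination:
 "finite F ==> F ~= {} ==> F <= C ==> (\<forall>v\<in>F. r v >= 0) ==> (\<Sum>v\<in>F. r v) = 1 ==>
  \<exists>u\<in>C. \<forall>z\<in>C. L z u = (\<Sum>v\<in>F. L z v * r v)"
proof (induction F arbitrary: r rule: finite_ne_induct)
 case (singleton x)
 then show ?case by (intro bexI[of _ x]) auto
next
 case (insert x F)
 have sum: "r x + (\<Sum>v\<in>F. r v) = 1" using insert by simp
 have F0: "(\<Sum>v\<in>F. r v) >= 0" using insert by (intro sum_nonneg) auto
 show ?case
 proof (cases "(\<Sum>v\<in>F. r v) = 0")
  case True
  then have "\<forall>v\<in>F. r v = 0" using insert by (subst (asm) sum_nonneg_eq_0_iff) auto
  then show ?thesis using insert sum True by (intro bexI[of _ x]) auto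
 next
  case False
  define R where "R = (\<Sum>v\<in>F. r v)"
  have R: "R > 0" "r x = 1 - R" using False F0 sum by (auto simp: R_def)
  have "\<exists>u\<in>C. \<forall>z\<in>C. L z u = (\<Sum>v\<in>F. L z v * (r v / R))"
   using insert.prems R by (intro insert.IH) (auto simp: sum_divide_distrib[symmetric] R_def[symmetric])
  then obtain u where u: "u \<in> C" "!!z. z \<in> C ==> L z u = (\<Sum>v\<in>F. L z v * (r v / R))" by blast
  have x: "x \<in> C" "r x >= 0" "r x <= 1" using insert.prems R by auto
  have "L z (cmb (r x) u x) = (\<Sum>v\<in>insert x F. L z v * r v)" if z: "z \<in> C" for z
  proof -
   have "L z (cmb (r x) u x) = R * (\<Sum>v\<in>F. L z v * (r v / R)) + r x * L z x"
    using aff[OF z u(1) x] u(2)[OF z] R by simp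
   also have "R * (\<Sum>v\<in>F. L z v * (r v / R)) = (\<Sum>v\<in>F. L z v * r v)" using R by (simp add: sum_distrib_left)
   finally show ?thesis using insert by (simp add: mult.commute)
  qed
  then show ?thesis using conv[OF u(1) x] by blast
 qed
qed

lemma finite_minty:
 assumes F: "finite F" "F <= C" and C: "C ~= {}" and e: "ep > 0"
 shows "\<exists>u\<in>C. \<forall>v\<in>F. L v u >= - ep"
proof (cases "F = {}")
 case True
 then show ?thesis using C by auto
next
 case False
 obtain r where r: "\<forall>i\<in>F. r i >= 0" "(\<Sum>i\<in>F. r i) = 1" "\<forall>i\<in>F. (\<Sum>j\<in>F. L i j * r j) >= - ep"
  using monotone_matrix_game[OF F(1) False, of L ep] mono F(2) e by blast
 obtain u where u: "u \<in> C" "\<forall>z\<in>C. L z u = (\<Sum>v\<in>F. L z v * r v)" using convex_combination[OF F(1) False F(2) r(1,2)] by blast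
 then show ?thesis using r(3) F(2) by (intro bexI[of _ u]) auto
qed

text \<open>Uniform convexity of \<open>J\<close> replaces weak compactness: almost minimisers of \<open>J\<close> over the shrinking
 convex sets of approximate solutions form a Cauchy sequence.\<close>

lemma minty_limit:
 fixes J :: "('x => real) => real" and N :: "('x => real) => ('x => real) => real"
 assumes C: "C ~= {}" and J: "!!u. u \<in> C ==> 0 <= J u" "!!u. u \<in> C ==> J u <= R"
  and UC: "!!ep. ep > 0 ==> \<exists>dl>0. \<forall>u\<in>C. \<forall>v\<in>C. J u + J v - 2 * J (cmb (1/2) u v) <= dl --> N u v <= ep"
  and CT: "!!z ep. z \<in> C ==> ep > 0 ==> \<exists>dl>0. \<forall>u\<in>C. \<forall>v\<in>C. N u v <= dl --> \<bar>L z u - L z v\<bar> <= ep"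
 shows "\<exists>x::nat => 'x => real. (ALL k. x k \<in> C) \<and> (\<forall>ep>0. EX K. \<forall>k\<ge>K. \<forall>l\<ge>k. N (x k) (x l) <= ep) \<and>
   (\<forall>z\<in>C. \<forall>ep>0. EX K. \<forall>k\<ge>K. L z (x k) >= - ep)"
proof -
 \<comment> \<open>An index is a finite set of test elements together with a tolerance.
   \<open>Q x\<close> collects the elements of C satisfying the Minty inequalities for that index;
   it is convex and shrinks as the index grows.\<close>
 define P where "P = {x. finite (fst x) \<and> fst x <= C \<and> snd x > (0::real)}"
 define Q where "Q x = {u\<in>C. \<forall>v\<in>fst x Int C. L v u >= - (snd x::real)}" for x
 define d where "d x = Inf (J ` Q x)" for x
 have Qne: "Q x ~= {}" if "x \<in> P" for x
 proof -
  have "\<exists>u\<in>C. \<forall>v\<in>fst x. L v u >= - snd x" using that by (intro finite_minty[OF _ _ C]) (auto simp: P_def)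
  then show ?thesis by (auto simp: Q_def)
 qed
 have QC: "Q x <= C" for x by (auto simp: Q_def)
 have bb: "bdd_below (J ` Q x)" for x using QC[of x] J(1) by (intro bdd_belowI[of _ 0]) auto
 have dle: "d x <= J u" if "u \<in> Q x" for x u unfolding d_def using that bb by (intro cInf_lower) auto
 have dR: "d x <= R" if "x \<in> P" for x
 proof -
  obtain u where "u \<in> Q x" using Qne[OF \<open>x \<in> P\<close>] by blast
  then show ?thesis using dle[of u x] J(2)[of u] QC[of x] by force
 qed
 have Qconv: "cmb (1/2) u v \<in> Q x" if "u \<in> Q x" "v \<in> Q x" for x u v
 proof -
  have C': "u \<in> C" "v \<in> C" using that QC[of x] by blast+
  have "- snd x <= L z (cmb (1/2) u v)" if z: "z \<in> fst x Int C" for z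
  proof -
   have "L z (cmb (1/2) u v) = (1 - 1/2) * L z u + 1/2 * L z v" by (rule aff) (use C' z in auto)
   then have "L z (cmb (1/2) u v) = (L z u + L z v) / 2" by simp
   moreover have "- snd x <= L z u" "- snd x <= L z v" using \<open>u \<in> Q x\<close> \<open>v \<in> Q x\<close> z unfolding Q_def by blast+
   ultimately show ?thesis by simp
  qed
  moreover have "cmb (1/2) u v \<in> C" using C' by (intro conv) auto
  ultimately show ?thesis unfolding Q_def by blast
 qed
 have Qmono: "Q y <= Q x" if "fst x <= fst y" "snd y <= snd x" for x y
 proof
  fix u assume u: "u \<in> Q y"
  have "- snd x <= L z u" if "z \<in> fst x Int C" for z
  proof -
   have "- snd y <= L z u" using u that \<open>fst x <= fst y\<close> unfolding Q_def by blast
   then show ?thesis using \<open>snd y <= snd x\<close> by linarith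
  qed
  then show "u \<in> Q x" using u unfolding Q_def by blast
 qed
 have dmono: "d x <= d y" if "fst x <= fst y" "snd y <= snd x" "y \<in> P" for x y
  unfolding d_def[of y]
 proof (rule cInf_greatest)
  show "J ` Q y ~= {}" using Qne[OF that(3)] by simp
  fix a assume "a \<in> J ` Q y"
  then obtain u where "u \<in> Q y" "a = J u" by blast
  then show "d x <= a" using dle[of u x] Qmono[OF that(1,2)] by blast
 qed
 \<comment> \<open>The supremum over all indices of the infimum of J; it is finite because J is
   bounded by R on C.\<close>
 define DD where "DD = Sup (d ` P)"
 have "({}, 1) \<in> P" by (simp add: P_def)
 then have Pne: "P ~= {}" by blast
 have ba: "bdd_above (d ` P)" using dR by (intro bdd_aboveI[of _ R]) auto
 have dD: "d x <= DD" if "x \<in> P" for x unfolding DD_def using that ba by (intro cSup_upper) auto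
 have "\<exists>x\<in>P. d x > DD - 1 / real (Suc n)" for n
 proof -
  have "DD - 1 / real (Suc n) < Sup (d ` P)" by (simp add: DD_def)
  then show ?thesis using Pne ba by (subst (asm) less_cSup_iff) auto
 qed
 then obtain X where X: "!!n. X n \<in> P" "!!n. d (X n) > DD - 1 / real (Suc n)" by metis
 \<comment> \<open>Merging the first n nearly optimal indices gives an increasing chain, along which
   the infima still come within 1/(n+1) of \<open>DD\<close>.\<close>
 define G where "G n = (\<Union>i\<le>n. fst (X i))" for n :: nat
 define e where "e n = min (1 / real (Suc n)) (Min ((%i. snd (X i)) ` {..n}))" for n :: nat
 have G: "finite (G n)" "G n <= C" "fst (X n) <= G n" for n using X(1) by (auto simp: G_def P_def)
 have e: "e n > 0" "e n <= snd (X n)" "e n <= 1 / real (Suc n)" for n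
 proof -
  have "Min ((%i. snd (X i)) ` {..n}) > 0" using X(1) by (subst Min_gr_iff) (auto simp: P_def)
  then show "e n > 0" by (simp add: e_def)
  have "Min ((%i. snd (X i)) ` {..n}) <= snd (X n)" by (rule Min_le) auto
  then show "e n <= snd (X n)" unfolding e_def by (rule min.coboundedI2)
  show "e n <= 1 / real (Suc n)" unfolding e_def by (rule min.cobounded1)
 qed
 have eG: "G k <= G l" "e l <= e k" if "k <= l" for k l
 proof -
  show "G k <= G l" using that by (auto simp: G_def intro: order_trans)
  have "Min ((%i. snd (X i)) ` {..l}) <= Min ((%i. snd (X i)) ` {..k})" using that by (intro Min_antimono) auto
  moreover have "1 / real (Suc l) <= 1 / real (Suc k)" using that by (intro frac_le) auto
  ultimately show "e l <= e k" unfolding e_def by (intro min.mono)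
 qed
 have GP: "(G n, e n) \<in> P" for n using G e by (simp add: P_def)
 have dG: "d (G n, e n) >= DD - 1 / real (Suc n)" for n
  using dmono[of "X n" "(G n, e n)"] GP[of n] G(3)[of n] e(2)[of n] X(2)[of n] by simp
 have pick: "\<exists>u\<in>Q x. J u <= DD + 1 / real (Suc n)" if "x \<in> P" for x n
 proof -
  have "Inf (J ` Q x) < DD + 1 / real (Suc n)" using dD[OF that] unfolding d_def by (rule le_less_trans) simp
  then show ?thesis using Qne[OF that] bb by (subst (asm) cInf_less_iff) (auto intro: less_imp_le)
 qed
 then have "ALL n. EX u. u \<in> Q (G n, e n) \<and> J u <= DD + 1 / real (Suc n)" using GP by blast
 then obtain x where x: "!!n. x n \<in> Q (G n, e n)" "!!n. J (x n) <= DD + 1 / real (Suc n)" by metis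
 have xC: "x n \<in> C" for n using x(1) QC by blast
 \<comment> \<open>Each of the two values is at most \<open>DD\<close> + 1/(k+1), and the midpoint,
   lying in the same convex set, has value at least \<open>DD\<close> - 1/(k+1). The defect is
   therefore at most 4/(k+1).\<close>
 have close: "J u + J v - 2 * J (cmb (1/2) u v) <= 4 / real (Suc k)"
  if "u \<in> Q (G k, e k)" "v \<in> Q (G k, e k)" "J u <= DD + 1 / real (Suc k)" "J v <= DD + 1 / real (Suc k)" for u v k
  using dle[OF Qconv[OF that(1,2)]] dG[of k] that(3,4) by (simp del: of_nat_Suc)
 have large: "EX K. \<forall>k\<ge>K. 4 / real (Suc k) <= dl" if "dl > 0" for dl
 proof -
  obtain K where "1 / real (Suc K) < dl / 4" using nat_approx_posE[of "dl / 4"] \<open>dl > 0\<close> by auto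
  then have "4 / real (Suc k) <= dl" if "k >= K" for k
   using that frac_le[of 1 1 "real (Suc K)" "real (Suc k)"] by (simp del: of_nat_Suc)
  then show ?thesis by blast
 qed
 have inQ: "x l \<in> Q (G k, e k)" "J (x l) <= DD + 1 / real (Suc k)" if "k <= l" for k l
 proof -
  show "x l \<in> Q (G k, e k)" using Qmono[of "(G k, e k)" "(G l, e l)"] eG[OF that] x(1)[of l] by auto
  have "1 / real (Suc l) <= 1 / real (Suc k)" using that by (intro frac_le) auto
  then show "J (x l) <= DD + 1 / real (Suc k)" using x(2)[of l] by linarith
 qed
 have cauchy: "EX K. \<forall>k\<ge>K. \<forall>l\<ge>k. N (x k) (x l) <= ep" if "ep > 0" for ep
 proof -
  obtain dl where dl: "dl > 0" "\<forall>u\<in>C. \<forall>v\<in>C. J u + J v - 2 * J (cmb (1/2) u v) <= dl --> N u v <= ep" using UC[OF \<open>ep > 0\<close>] by blast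
  obtain K where K: "\<forall>k\<ge>K. 4 / real (Suc k) <= dl" using large[OF dl(1)] by blast
  have "N (x k) (x l) <= ep" if "k >= K" "l >= k" for k l
   using dl(2) xC close[OF x(1)[of k] inQ(1)[OF that(2)] x(2)[of k] inQ(2)[OF that(2)]] K that by (meson order_trans)
  then show ?thesis by blast
 qed
 \<comment> \<open>The chain uses countably many tests only. For an arbitrary z one compares with
   near-minimisers y n that satisfy the test z in addition: the same convexity estimate makes them
   close to x n, so x n satisfies the test up to a small error.\<close>
 have lim: "EX K. \<forall>k\<ge>K. L z (x k) >= - ep" if z: "z \<in> C" and eps: "ep > 0" for z ep
 proof -
  have zP: "(insert z (G n), e n) \<in> P" for n using G e z by (simp add: P_def)
  have "ALL n. EX u. u \<in> Q (insert z (G n), e n) \<and> J u <= DD + 1 / real (Suc n)" using pick[OF zP] by blast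
  then obtain y where y: "!!n. y n \<in> Q (insert z (G n), e n)" "!!n. J (y n) <= DD + 1 / real (Suc n)" by metis
  have yQ: "y n \<in> Q (G n, e n)" for n using Qmono[of "(G n, e n)" "(insert z (G n), e n)"] y(1)[of n] by auto
  have yC: "y n \<in> C" for n using y(1) QC by blast
  have Lzy: "L z (y n) >= - e n" for n using y(1)[of n] z by (simp add: Q_def)
  obtain dl1 where dl1: "dl1 > 0" "\<forall>u\<in>C. \<forall>v\<in>C. N u v <= dl1 --> \<bar>L z u - L z v\<bar> <= ep / 2"
   using CT[OF z, of "ep / 2"] eps by auto
  obtain dl where dl: "dl > 0" "\<forall>u\<in>C. \<forall>v\<in>C. J u + J v - 2 * J (cmb (1/2) u v) <= dl --> N u v <= dl1" using UC[OF dl1(1)] by blast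
  obtain K where K: "\<forall>k\<ge>K. 4 / real (Suc k) <= min dl (ep / 2)" using large[of "min dl (ep / 2)"] dl(1) eps by auto
  have "L z (x k) >= - ep" if "k >= K" for k
  proof -
   have 4: "4 / real (Suc k) <= dl" "4 / real (Suc k) <= ep / 2" using K that by auto
   have "J (x k) + J (y k) - 2 * J (cmb (1/2) (x k) (y k)) <= dl" using close[OF x(1) yQ x(2) y(2), of k] 4(1) by linarith
   then have "N (x k) (y k) <= dl1" using dl(2) xC yC by blast
   then have "\<bar>L z (x k) - L z (y k)\<bar> <= ep / 2" using dl1(2) xC yC by blast
   moreover have "1 / real (Suc k) <= 4 / real (Suc k)" by (intro divide_right_mono) auto
   ultimately show ?thesis using Lzy[of k] e(3)[of k] 4(2) by linarith
  qed
  then show ?thesis by blast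
 qed
 show ?thesis using xC cauchy lim by (intro exI[of _ x]) blast
qed

end

section \<open>Odd powers, elementary power inequalities and dominated convergence\<close>

lemma opow_abs: "r > -1 ==> \<bar>opow r t\<bar> = \<bar>t\<bar> powr (r + 1)"
 by (cases "t = 0") (auto simp: opow_def abs_mult powr_add)

lemma opow_nonneg: "t >= 0 ==> opow r t = t powr (r + 1)"
 by (cases "t = 0") (auto simp: opow_def powr_add)

text \<open>The exponent r = p - 2 may be negative, so continuity at 0 cannot be read off from the
  factors; it follows from the absolute value, which is a power with positive exponent r +
  1.\<close>

lemma opow_continuous:
 assumes "r > -1" shows "isCont (opow r) t"
proof (cases "t = 0")
 case True
 have "((%x. \<bar>x\<bar> powr (r + 1)) \<longlongrightarrow> \<bar>0::real\<bar> powr (r + 1)) (at 0)"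
  using assms by (intro tendsto_powr' tendsto_intros) auto
 then have "((%x. \<bar>opow r x\<bar>) \<longlongrightarrow> 0) (at 0)" using assms by (simp add: opow_abs)
 then have "(opow r \<longlongrightarrow> 0) (at 0)" by (rule tendsto_rabs_zero_cancel)
 then show ?thesis using True by (simp add: isCont_def opow_def)
next
 case False
 then show ?thesis unfolding opow_def[abs_def] by (intro continuous_intros) auto
qed

lemma opow_mono:
 assumes "r > -1" "x <= y" shows "opow r x <= opow r y"
proof -
 have *: "opow r a <= opow r b" if "0 <= a" "a <= b" for a b
  using that assms(1) by (simp add: opow_nonneg powr_mono2)
 have m: "opow r (- a) = - opow r a" for a by (simp add: opow_def)
 consider "0 <= x" | "x < 0" "0 <= y" | "x < 0" "y < 0" by linarith
 then show ?thesis
 proof cases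
  case 2
  have "0 <= opow r (- x)" "0 <= opow r y" using 2 by (auto simp: opow_nonneg)
  then show ?thesis using m[of x] by linarith
 next
  case 3
  then have "opow r (- y) <= opow r (- x)" using assms(2) by (intro *) auto
  then show ?thesis by (simp add: m)
 qed (use * assms in auto)
qed

lemma opow_measurable [measurable]: "opow r \<in> borel_measurable borel"
 unfolding opow_def[abs_def] by measurable

lemma powr_mult_le_sum:
 fixes x y :: real
 assumes "x >= 0" "y >= 0" "q > 1"
 shows "x powr (q - 1) * y <= x powr q + y powr q"
proof (cases "x <= y")
 case True
 have "x powr (q - 1) * y <= y powr (q - 1) * y" using assms True by (intro mult_right_mono powr_mono2) auto
 also have "... = y powr q" using assms by (cases "y = 0") (auto simp: powr_diff)
 finally show ?thesis by (simp add: add_increasing)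
next
 case False
 have "x powr (q - 1) * y <= x powr (q - 1) * x" using assms False by (intro mult_left_mono) auto
 also have "... = x powr q" using assms by (cases "x = 0") (auto simp: powr_diff)
 finally show ?thesis by (simp add: add_increasing2)
qed

lemma powr_add_le:
 fixes x y :: real
 assumes "x >= 0" "y >= 0" "q > 0"
 shows "(x + y) powr q <= 2 powr q * (x powr q + y powr q)"
proof -
 have "x + y <= 2 * max x y" by (simp add: max_def)
 then have "(x + y) powr q <= (2 * max x y) powr q" using assms by (intro powr_mono2) auto
 also have "... = 2 powr q * max x y powr q" by (rule powr_mult)
 also have "max x y powr q <= x powr q + y powr q" by (auto simp: max_def)
 finally show ?thesis by (simp add: mult_left_mono)
qed

lemma norm_combination_powr_le:
 fixes x y :: "'b::real_normed_vector"
 assumes "q > 0" "norm x powr q <= a" "norm y powr q <= b"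
 shows "norm (c *\<^sub>R x + d *\<^sub>R y) powr q <= 2 powr q * (\<bar>c\<bar> powr q * a + \<bar>d\<bar> powr q * b)"
proof -
 have "norm (c *\<^sub>R x + d *\<^sub>R y) powr q <= (\<bar>c\<bar> * norm x + \<bar>d\<bar> * norm y) powr q"
  using assms(1) norm_triangle_ineq[of "c *\<^sub>R x" "d *\<^sub>R y"] by (intro powr_mono2) auto
 also have "... <= 2 powr q * ((\<bar>c\<bar> * norm x) powr q + (\<bar>d\<bar> * norm y) powr q)" using assms by (intro powr_add_le) auto
 also have "... = 2 powr q * (\<bar>c\<bar> powr q * norm x powr q + \<bar>d\<bar> powr q * norm y powr q)" by (simp add: powr_mult)
 also have "... <= 2 powr q * (\<bar>c\<bar> powr q * a + \<bar>d\<bar> powr q * b)" using assms by (intro mult_left_mono add_mono) auto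
 finally show ?thesis .
qed

lemma dominated_tendsto:
 fixes u :: "nat => 'x => real"
 assumes m: "!!k. u k \<in> borel_measurable M" "v \<in> borel_measurable M" and H: "integrable M H"
  and AE: "AE y in M. (ALL k. \<bar>u k y\<bar> <= H y) \<and> (%k. u k y) ----> v y"
 shows "integrable M v" "!!k. integrable M (u k)" "(%k. integral\<^sup>L M (u k)) ----> integral\<^sup>L M v"
proof -
 have a: "AE y in M. (%k. u k y) ----> v y" "!!k. AE y in M. norm (u k y) <= H y" using AE by (auto elim!: eventually_mono)
 show "integrable M v" by (rule integrable_dominated_convergence[OF m(2,1) H a])
 show "integrable M (u k)" for k by (rule integrable_dominated_convergence2[OF m(2,1) H a])
 show "(%k. integral\<^sup>L M (u k)) ----> integral\<^sup>L M v" by (rule integral_dominated_convergence[OF m(2,1) H a])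
qed

lemma dominated_powr_tendsto:
 fixes f :: "nat => 'x => 'b::euclidean_space"
 assumes q: "q > 0" and [measurable]: "!!k. f k \<in> borel_measurable M" "g \<in> borel_measurable M" and H: "integrable M H"
  and AE: "AE x in M. (ALL k. norm (f k x) powr q <= H x) \<and> (%k. f k x) ----> g x"
 shows "integrable M (%x. norm (g x) powr q)" "!!k. integrable M (%x. norm (f k x) powr q)"
  "(%k. \<integral>x. norm (f k x) powr q \<partial>M) ----> (LINT x|M. norm (g x) powr q)"
proof -
 have AE': "AE x in M. (ALL k. \<bar>norm (f k x) powr q\<bar> <= H x) \<and> (%k. norm (f k x) powr q) ----> norm (g x) powr q"
  using AE
 proof eventually_elim
  case (elim x)
  have "(%k. norm (f k x) powr q) ----> norm (g x) powr q" using elim q by (intro tendsto_powr' tendsto_norm tendsto_const) auto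
  then show ?case using elim by simp
 qed
 show "integrable M (%x. norm (g x) powr q)" by (rule dominated_tendsto(1)[OF _ _ H AE']) measurable
 show "integrable M (%x. norm (f k x) powr q)" for k by (rule dominated_tendsto(2)[OF _ _ H AE']) measurable
 show "(%k. \<integral>x. norm (f k x) powr q \<partial>M) ----> (LINT x|M. norm (g x) powr q)" by (rule dominated_tendsto(3)[OF _ _ H AE']) measurable
qed

text \<open>Completeness of Lebesgue measure lets measurability pass through equality almost
  everywhere. This matters because \<open>caratheodory\<close> grants continuity only for almost
  every y.\<close>

lemma complete_lebesgue_on: 
 fixes f h :: "'a::euclidean_space => 'b::euclidean_space"
 assumes S: "S \<in> sets lebesgue" and f: "f \<in> borel_measurable (lebesgue_on S)" and AE: "AE y in lebesgue_on S. f y = h y"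
 shows "h \<in> borel_measurable (lebesgue_on S)"
proof -
 have "AE y in lebesgue. (if y \<in> S then f y else 0) = (if y \<in> S then h y else 0)"
  using AE S by (auto simp: AE_restrict_space_iff elim!: eventually_mono)
 moreover have "(%y. if y \<in> S then f y else 0) \<in> borel_measurable lebesgue" using f S by (simp add: borel_measurable_if)
 ultimately have "(%y. if y \<in> S then h y else 0) \<in> borel_measurable lebesgue" by (rule borel_measurable_AE[rotated])
 then show ?thesis using S by (simp add: borel_measurable_if)
qed

section \<open>The operator of the singular problem\<close>

locale singular_problem = domain \<Omega> p s for \<Omega> :: "'a::euclidean_space set" and p s +
 fixes A :: "'a => 'a => 'a" and l f lam g :: "'a => real" and \<gamma> \<eta> \<alpha> \<omega> :: real
 assumes cara: "caratheodory \<Omega> A"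
  and coerc: "\<alpha> > 0" "!!y h. y \<in> \<Omega> ==> A y h \<bullet> h >= \<alpha> * norm h powr p"
  and growth: "\<omega> > 0" "Lp (lebesgue_on \<Omega>) (p / (p - 1)) l"
   "!!y h. y \<in> \<Omega> ==> norm (A y h) <= l y + \<omega> * norm h powr (p - 1)"
  and mono: "!!y h k. y \<in> \<Omega> ==> h ~= k ==> (A y h - A y k) \<bullet> (h - k) > 0"
  and f: "Lp (lebesgue_on \<Omega>) (real DIM('a) / p) f" "AE y in lebesgue_on \<Omega>. f y >= 0"
  and lam: "Linf (boundary_measure \<Omega>) lam" "AE y in boundary_measure \<Omega>. lam y >= 0"
  and g: "Linf (boundary_measure \<Omega>) g" "AE y in boundary_measure \<Omega>. g y >= 0"
  and \<gamma>: "0 < \<gamma>" and \<eta>: "\<eta> > 0"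
begin

lemma meas [measurable]: "f \<in> borel_measurable M" "l \<in> borel_measurable M" "lam \<in> borel_measurable B" "g \<in> borel_measurable B"
 using f lam g growth by (auto simp: Lp_def Linf_def)

lemma f_integrable: "integrable M f"
proof (rule Bochner_Integration.integrable_bound)
 show "integrable M (%y. 1 + \<bar>f y\<bar> powr (real DIM('a) / p))" using f by (simp add: Lp_def)
 have "real DIM('a) / p >= 1" using p1 pm by (simp add: field_simps)
 then have "\<bar>f y\<bar> <= 1 + \<bar>f y\<bar> powr (real DIM('a) / p)" for y using powr_le_one_add[of "\<bar>f y\<bar>" 1] by simp
 then show "AE y in M. norm (f y) <= norm (1 + \<bar>f y\<bar> powr (real DIM('a) / p))" by auto
qed simp

lemma bounded_coefficients: "\<exists>\<Lambda>\<ge>0. AE y in B. \<bar>lam y\<bar> <= \<Lambda> \<and> \<bar>g y\<bar> <= \<Lambda>"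
proof -
 obtain a b where "AE y in B. \<bar>lam y\<bar> <= a" "AE y in B. \<bar>g y\<bar> <= b" using lam g by (auto simp: Linf_def)
 then have "AE y in B. \<bar>lam y\<bar> <= max 0 (max a b) \<and> \<bar>g y\<bar> <= max 0 (max a b)" by eventually_elim auto
 then show ?thesis by (intro exI[of _ "max 0 (max a b)"]) auto
qed

definition \<Lambda> where "\<Lambda> = (SOME \<Lambda>. \<Lambda> >= 0 \<and> (AE y in B. \<bar>lam y\<bar> <= \<Lambda> \<and> \<bar>g y\<bar> <= \<Lambda>))"

lemma Lambda: "\<Lambda> >= 0" "AE y in B. \<bar>lam y\<bar> <= \<Lambda> \<and> \<bar>g y\<bar> <= \<Lambda>"
 using someI_ex[OF bounded_coefficients] by (auto simp: \<Lambda>_def)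

lemma A_continuous: "AE y in M. continuous_on UNIV (A y)" using cara by (simp add: caratheodory_def)

text \<open>For simple G the composition is a finite sum of measurable pieces. In general G is a
  limit of simple functions, and continuity in the second argument passes to the limit almost
  everywhere.\<close>

lemma A_measurable [measurable (raw)]:
 assumes G[measurable]: "G \<in> borel_measurable M"
 shows "(%y. A y (G y)) \<in> borel_measurable M"
proof -
 obtain F where F: "!!i. simple_function M (F i)" "!!x. x \<in> space M ==> (%i. F i x) ----> G x"
  using borel_measurable_implies_sequence_metric[OF G, of 0] by blast
 have Fm: "(%y. A y (F i y)) \<in> borel_measurable M" for i
 proof -
  have fin: "finite (F i ` space M)" using F(1) by (simp add: simple_function_def)
  have [measurable]: "(%y. A y h) \<in> borel_measurable M" for h using cara by (simp add: caratheodory_def)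
  have [measurable]: "F i -` {h} Int space M \<in> sets M" for h using simple_functionD(2)[OF F(1)[of i]] .
  have "(%y. \<Sum>h\<in>F i ` space M. indicator (F i -` {h} Int space M) y *\<^sub>R A y h) \<in> borel_measurable M" by measurable
  moreover have "(\<Sum>h\<in>F i ` space M. indicator (F i -` {h} Int space M) y *\<^sub>R A y h) = A y (F i y)" if y: "y \<in> space M" for y
  proof -
   have "(\<Sum>h\<in>F i ` space M. indicator (F i -` {h} Int space M) y *\<^sub>R A y h) = (\<Sum>h\<in>F i ` space M. if h = F i y then A y h else 0)"
    using y by (intro sum.cong) (auto simp: indicator_def)
   then show ?thesis using fin y by (simp add: sum.delta)
  qed
  ultimately show ?thesis by (rule measurable_cong[THEN iffD1, rotated]) simp
 qed
 define L where "L y = lim (%i. A y (F i y))" for y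
 have "L \<in> borel_measurable M" unfolding L_def[abs_def] using Fm by measurable
 moreover have "AE y in M. L y = A y (G y)"
  using A_continuous AE_space
 proof eventually_elim
  case (elim y)
  then have "isCont (A y) (G y)" by (simp add: continuous_on_eq_continuous_at)
  then have "(%i. A y (F i y)) ----> A y (G y)" by (rule isCont_tendsto_compose) (use F(2) elim in auto)
  then show ?case unfolding L_def by (rule limI)
 qed
 ultimately show ?thesis by (rule complete_lebesgue_on[OF Omega_sets(2)])
qed

lemma A_bound:
 assumes y: "y \<in> \<Omega>"
 shows "\<bar>A y h \<bullet> k\<bar> <= \<bar>l y\<bar> powr (p / (p - 1)) + \<omega> * norm h powr p + (1 + \<omega>) * norm k powr p"
proof -
 have pp: "p / (p - 1) > 1" "1 / (p / (p - 1)) + 1 / p = 1" using p1 by (auto simp: field_simps)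
 have "\<bar>A y h \<bullet> k\<bar> <= norm (A y h) * norm k" by (rule Cauchy_Schwarz_ineq2)
 also have "... <= (\<bar>l y\<bar> + \<omega> * norm h powr (p - 1)) * norm k"
  using growth(3)[OF y, of h] by (intro mult_right_mono) auto
 also have "... = \<bar>l y\<bar> * norm k + \<omega> * (norm h powr (p - 1) * norm k)" by (simp add: algebra_simps)
 also have "... <= (\<bar>l y\<bar> powr (p / (p - 1)) + norm k powr p) + \<omega> * (norm h powr p + norm k powr p)"
  using growth(1) p1 pp by (intro add_mono young_sum mult_left_mono powr_mult_le_sum) auto
 finally show ?thesis by (simp add: algebra_simps)
qed

text \<open>Put e = A(y,0). Coercivity at -t e gives A(y,-te) \<bullet> e \<le> 0 for t > 0, and
  continuity as t tends to 0 gives |e|^2 \<le> 0. This is used on the zero set of the solution,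
  where the gradient vanishes.\<close>

lemma A_zero: "AE y in M. A y 0 = 0"
 using A_continuous AE_space
proof eventually_elim
 case (elim y)
 show "A y 0 = 0"
 proof (rule ccontr)
  assume "A y 0 ~= 0"
  define e where "e = A y 0"
  have "isCont (A y) 0" using elim by (simp add: continuous_on_eq_continuous_at)
  then have "((%t::real. A y ((- t) *\<^sub>R e) \<bullet> e) \<longlongrightarrow> A y 0 \<bullet> e) (at_right 0)"
   by (intro tendsto_intros isCont_tendsto_compose[of 0 "A y"]) (auto intro!: tendsto_eq_intros)
  moreover have "eventually (%t. A y ((- t) *\<^sub>R e) \<bullet> e <= 0) (at_right 0)"
  proof (intro eventually_at_right_less[THEN eventually_mono])
   fix t :: real assume t: "0 < t"
   have "0 <= A y ((- t) *\<^sub>R e) \<bullet> ((- t) *\<^sub>R e)" using coerc elim by (intro order_trans[OF _ coerc(2)]) auto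
   then show "A y ((- t) *\<^sub>R e) \<bullet> e <= 0" using t by (simp add: zero_le_mult_iff mult_le_0_iff)
  qed
  ultimately have "A y 0 \<bullet> e <= 0" by (intro tendsto_upperbound) auto
  then have "(norm (A y 0))\<^sup>2 <= 0" by (simp add: e_def dot_square_norm)
  then show False using \<open>A y 0 ~= 0\<close> by simp
 qed
qed

text \<open>Convergence of triples consisting of a function, its gradient and its boundary values:
  almost everywhere, with common integrable bounds on the p-th powers. Every passage to the limit
  thereby becomes dominated convergence. With constant sequences it expresses membership of a single
  triple in the right spaces.\<close>

definition pdom :: "(nat => 'a => real) => (nat => 'a => 'a) => (nat => 'a => real) => ('a => real) => ('a => 'a) => ('a => real) => bool" where
 "pdom ph D ta ph' D' ta' \<longleftrightarrow> (ALL k. ph k \<in> borel_measurable M \<and> D k \<in> borel_measurable M \<and> ta k \<in> borel_measurable B) \<and>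
   ph' \<in> borel_measurable M \<and> D' \<in> borel_measurable M \<and> ta' \<in> borel_measurable B \<and>
   (EX H K. integrable M H \<and> integrable B K \<and>
    (AE y in M. (ALL k. \<bar>ph k y\<bar> powr p <= H y \<and> norm (D k y) powr p <= H y) \<and> (%k. ph k y) ----> ph' y \<and> (%k. D k y) ----> D' y) \<and>
    (AE y in B. (ALL k. \<bar>ta k y\<bar> powr p <= K y) \<and> (%k. ta k y) ----> ta' y))"

text \<open>Adds the two bounds that p-th powers do not supply: for the pairing with f, and for the
  power s + 1 on the boundary.\<close>

definition qdom :: "(nat => 'a => real) => (nat => 'a => real) => bool" where
 "qdom ph ta \<longleftrightarrow> (EX H K. integrable M H \<and> integrable B K \<and>
    (AE y in M. ALL k. \<bar>f y\<bar> * \<bar>ph k y\<bar> <= H y) \<and> (AE y in B. ALL k. \<bar>ta k y\<bar> powr (s + 1) <= K y))"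

definition tdom where "tdom ph D ta ph' D' ta' \<longleftrightarrow> pdom ph D ta ph' D' ta' \<and> qdom ph ta"

definition bdry where "bdry y t = lam y * opow (p - 2) t + opow (s - 1) t"

abbreviation (input) dominated_M where
 "dominated_M H ph D ph' D' \<equiv> (AE y in M. (ALL k. \<bar>ph k y\<bar> powr p <= H y \<and> norm (D k y) powr p <= H y) \<and>
  (%k. ph k y) ----> ph' y \<and> (%k. D k y) ----> D' y)"

abbreviation (input) dominated_B where
 "dominated_B K ta ta' \<equiv> (AE y in B. (ALL k. \<bar>ta k y\<bar> powr p <= K y) \<and> (%k. ta k y) ----> ta' y)"

lemma pdom_measurable:
 assumes "pdom ph D ta ph' D' ta'"
 shows "ph k \<in> borel_measurable M" "D k \<in> borel_measurable M" "ta k \<in> borel_measurable B"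
  "ph' \<in> borel_measurable M" "D' \<in> borel_measurable M" "ta' \<in> borel_measurable B"
 using assms by (auto simp: pdom_def)

lemma pdom_M:
 assumes "pdom ph D ta ph' D' ta'"
 obtains H where "integrable M H" "dominated_M H ph D ph' D'"
 using assms unfolding pdom_def by blast

lemma pdom_B:
 assumes "pdom ph D ta ph' D' ta'"
 obtains K where "integrable B K" "dominated_B K ta ta'"
 using assms unfolding pdom_def by blast

lemma A_tendsto:
 assumes v: "pdom v V sg v' V' sg'" and ph: "pdom ph D ta ph' D' ta'"
 shows "integrable M (%y. A y (V' y) \<bullet> D' y)" "integrable M (%y. A y (V k y) \<bullet> D k y)"
  "(%k. \<integral>y. A y (V k y) \<bullet> D k y \<partial>M) ----> (LINT y|M. A y (V' y) \<bullet> D' y)"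
proof -
 note [measurable] = pdom_measurable[OF v] pdom_measurable[OF ph]
 obtain H1 where H1: "integrable M H1" "dominated_M H1 v V v' V'" by (rule pdom_M[OF v])
 obtain H2 where H2: "integrable M H2" "dominated_M H2 ph D ph' D'" by (rule pdom_M[OF ph])
 let ?H = "%y. \<bar>l y\<bar> powr (p / (p - 1)) + \<omega> * H1 y + (1 + \<omega>) * H2 y"
 have H: "integrable M ?H" using H1(1) H2(1) growth(2) by (auto simp: Lp_def)
 have AE: "AE y in M. (ALL k. \<bar>A y (V k y) \<bullet> D k y\<bar> <= ?H y) \<and> (%k. A y (V k y) \<bullet> D k y) ----> A y (V' y) \<bullet> D' y"
  using H1(2) H2(2) A_continuous AE_space
 proof eventually_elim
  case (elim y)
  have "\<bar>A y (V k y) \<bullet> D k y\<bar> <= ?H y" for k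
  proof -
   have "y \<in> \<Omega>" using elim by simp
   then have "\<bar>A y (V k y) \<bullet> D k y\<bar> <= \<bar>l y\<bar> powr (p / (p - 1)) + \<omega> * norm (V k y) powr p + (1 + \<omega>) * norm (D k y) powr p" by (rule A_bound)
   also have "... <= ?H y" using elim growth(1) by (intro add_mono mult_left_mono) auto
   finally show ?thesis .
  qed
  moreover have "isCont (A y) (V' y)" using elim by (simp add: continuous_on_eq_continuous_at)
  then have "(%k. A y (V k y) \<bullet> D k y) ----> A y (V' y) \<bullet> D' y"
   using elim by (intro tendsto_inner isCont_tendsto_compose[of "V' y" "A y"]) auto
  ultimately show ?case by blast
 qed
 show "integrable M (%y. A y (V' y) \<bullet> D' y)" by (rule dominated_tendsto(1)[OF _ _ H AE]) measurable
 show "integrable M (%y. A y (V k y) \<bullet> D k y)" by (rule dominated_tendsto(2)[OF _ _ H AE]) measurable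
 show "(%k. \<integral>y. A y (V k y) \<bullet> D k y \<partial>M) ----> (LINT y|M. A y (V' y) \<bullet> D' y)" by (rule dominated_tendsto(3)[OF _ _ H AE]) measurable
qed

lemma bdry_measurable [measurable (raw)]: "t \<in> borel_measurable B ==> (%y. bdry y (t y)) \<in> borel_measurable B"
proof -
 assume [measurable]: "t \<in> borel_measurable B"
 have "(%y. opow r (t y)) \<in> borel_measurable B" for r by (rule measurable_compose[OF _ opow_measurable]) measurable
 then show ?thesis unfolding bdry_def by measurable
qed

lemma bdry_isCont: "isCont (bdry y) t"
proof -
 have "isCont (opow (p - 2)) t" "isCont (opow (s - 1)) t" using p1 s1 by (auto intro: opow_continuous)
 then show ?thesis unfolding bdry_def[abs_def] by (intro continuous_intros)
qed

lemma bdry_bound: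
 assumes "\<bar>lam y\<bar> <= \<Lambda>"
 shows "\<bar>bdry y t * k\<bar> <= \<Lambda> * (\<bar>t\<bar> powr p + \<bar>k\<bar> powr p) + (\<bar>t\<bar> powr (s + 1) + \<bar>k\<bar> powr (s + 1))"
proof -
 have "\<bar>bdry y t * k\<bar> = \<bar>lam y * (opow (p - 2) t * k) + opow (s - 1) t * k\<bar>" by (simp add: bdry_def algebra_simps)
 also have "... <= \<bar>lam y\<bar> * (\<bar>opow (p - 2) t\<bar> * \<bar>k\<bar>) + \<bar>opow (s - 1) t\<bar> * \<bar>k\<bar>"
  using abs_triangle_ineq[of "lam y * (opow (p - 2) t * k)" "opow (s - 1) t * k"] by (simp add: abs_mult)
 also have "... = \<bar>lam y\<bar> * (\<bar>t\<bar> powr (p - 1) * \<bar>k\<bar>) + \<bar>t\<bar> powr ((s + 1) - 1) * \<bar>k\<bar>" using p1 s1 by (simp add: opow_abs)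
 also have "... <= \<Lambda> * (\<bar>t\<bar> powr p + \<bar>k\<bar> powr p) + (\<bar>t\<bar> powr (s + 1) + \<bar>k\<bar> powr (s + 1))"
  using assms p1 s1 Lambda(1) by (intro add_mono mult_mono powr_mult_le_sum) auto
 finally show ?thesis .
qed

lemma bdry_tendsto:
 assumes v: "tdom v V sg v' V' sg'" and ph: "tdom ph D ta ph' D' ta'"
 shows "integrable B (%y. bdry y (sg' y) * ta' y)" "integrable B (%y. bdry y (sg k y) * ta k y)"
  "(%k. \<integral>y. bdry y (sg k y) * ta k y \<partial>B) ----> (LINT y|B. bdry y (sg' y) * ta' y)"
proof -
 have vp: "pdom v V sg v' V' sg'" "qdom v sg" and php: "pdom ph D ta ph' D' ta'" "qdom ph ta" using v ph by (auto simp: tdom_def)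
 note [measurable] = pdom_measurable[OF vp(1)] pdom_measurable[OF php(1)]
 obtain K1 where K1: "integrable B K1" "dominated_B K1 sg sg'"
  by (rule pdom_B[OF vp(1)])
 obtain K2 where K2: "integrable B K2" "dominated_B K2 ta ta'"
  by (rule pdom_B[OF php(1)])
 obtain K3 where K3: "integrable B K3" "AE y in B. ALL k. \<bar>sg k y\<bar> powr (s + 1) <= K3 y" using vp(2) unfolding qdom_def by blast
 obtain K4 where K4: "integrable B K4" "AE y in B. ALL k. \<bar>ta k y\<bar> powr (s + 1) <= K4 y" using php(2) unfolding qdom_def by blast
 let ?H = "%y. \<Lambda> * (K1 y + K2 y) + (K3 y + K4 y)"
 have H: "integrable B ?H" using K1(1) K2(1) K3(1) K4(1) by auto
 have AE: "AE y in B. (ALL k. \<bar>bdry y (sg k y) * ta k y\<bar> <= ?H y) \<and> (%k. bdry y (sg k y) * ta k y) ----> bdry y (sg' y) * ta' y"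
  using K1(2) K2(2) K3(2) K4(2) Lambda(2)
 proof eventually_elim
  case (elim y)
  have "\<bar>bdry y (sg k y) * ta k y\<bar> <= ?H y" for k
  proof -
   have "\<bar>bdry y (sg k y) * ta k y\<bar> <= \<Lambda> * (\<bar>sg k y\<bar> powr p + \<bar>ta k y\<bar> powr p) + (\<bar>sg k y\<bar> powr (s + 1) + \<bar>ta k y\<bar> powr (s + 1))"
    using elim by (intro bdry_bound) auto
   also have "... <= ?H y" using elim Lambda(1) by (intro add_mono mult_left_mono) auto
   finally show ?thesis .
  qed
  moreover have "(%k. bdry y (sg k y) * ta k y) ----> bdry y (sg' y) * ta' y"
   using elim by (intro tendsto_mult isCont_tendsto_compose[OF bdry_isCont]) auto
  ultimately show ?case by blast
 qed
 show "integrable B (%y. bdry y (sg' y) * ta' y)" by (rule dominated_tendsto(1)[OF _ _ H AE]) measurable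
 show "integrable B (%y. bdry y (sg k y) * ta k y)" by (rule dominated_tendsto(2)[OF _ _ H AE]) measurable
 show "(%k. \<integral>y. bdry y (sg k y) * ta k y \<partial>B) ----> (LINT y|B. bdry y (sg' y) * ta' y)" by (rule dominated_tendsto(3)[OF _ _ H AE]) measurable
qed

text \<open>The positive lower bound on the base points bounds the singular factor by a constant, so
  the bound on the product of f with the directions dominates everything.\<close>

lemma f_tendsto:
 assumes v: "tdom v V sg v' V' sg'" and ph: "tdom ph D ta ph' D' ta'" and c: "c > 0" "AE y in M. ALL k. v k y >= c"
 shows "integrable M (%y. f y * v' y powr (- \<gamma>) * ph' y)" "integrable M (%y. f y * v k y powr (- \<gamma>) * ph k y)"
  "(%k. \<integral>y. f y * v k y powr (- \<gamma>) * ph k y \<partial>M) ----> (LINT y|M. f y * v' y powr (- \<gamma>) * ph' y)"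
proof -
 have vp: "pdom v V sg v' V' sg'" and php: "pdom ph D ta ph' D' ta'" "qdom ph ta" using v ph by (auto simp: tdom_def)
 note [measurable] = pdom_measurable[OF vp] pdom_measurable[OF php(1)]
 have 1: "AE y in M. (%k. v k y) ----> v' y" by (rule pdom_M[OF vp]) (auto elim!: eventually_mono)
 have 2: "AE y in M. (%k. ph k y) ----> ph' y" by (rule pdom_M[OF php(1)]) (auto elim!: eventually_mono)
 obtain H1 where H1: "integrable M H1" "AE y in M. ALL k. \<bar>f y\<bar> * \<bar>ph k y\<bar> <= H1 y" using php(2) unfolding qdom_def by blast
 let ?H = "%y. c powr (- \<gamma>) * H1 y"
 have H: "integrable M ?H" using H1(1) by auto
 have AE: "AE y in M. (ALL k. \<bar>f y * v k y powr (- \<gamma>) * ph k y\<bar> <= ?H y) \<and> (%k. f y * v k y powr (- \<gamma>) * ph k y) ----> f y * v' y powr (- \<gamma>) * ph' y"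
  using 1 2 H1(2) c(2)
 proof eventually_elim
  case (elim y)
  have "\<bar>f y * v k y powr (- \<gamma>) * ph k y\<bar> <= ?H y" for k
  proof -
   have "v k y powr (- \<gamma>) <= c powr (- \<gamma>)" using elim c(1) \<gamma> by (intro powr_mono2') auto
   then have "v k y powr (- \<gamma>) * (\<bar>f y\<bar> * \<bar>ph k y\<bar>) <= c powr (- \<gamma>) * H1 y" using elim by (intro mult_mono) auto
   then show ?thesis by (simp add: abs_mult mult_ac)
  qed
  moreover have "v' y >= c" using elim by (intro LIMSEQ_le_const[of "%k. v k y"]) auto
  then have "(%k. f y * v k y powr (- \<gamma>) * ph k y) ----> f y * v' y powr (- \<gamma>) * ph' y"
   using elim c(1) by (intro tendsto_mult tendsto_powr tendsto_const) auto
  ultimately show ?case by blast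
 qed
 show "integrable M (%y. f y * v' y powr (- \<gamma>) * ph' y)" by (rule dominated_tendsto(1)[OF _ _ H AE]) measurable
 show "integrable M (%y. f y * v k y powr (- \<gamma>) * ph k y)" by (rule dominated_tendsto(2)[OF _ _ H AE]) measurable
 show "(%k. \<integral>y. f y * v k y powr (- \<gamma>) * ph k y \<partial>M) ----> (LINT y|M. f y * v' y powr (- \<gamma>) * ph' y)" by (rule dominated_tendsto(3)[OF _ _ H AE]) measurable
qed

lemma g_tendsto:
 assumes v: "tdom v V sg v' V' sg'" and ph: "tdom ph D ta ph' D' ta'" and c: "c > 0" "AE y in B. ALL k. sg k y >= c"
 shows "integrable B (%y. g y * sg' y powr (- \<eta>) * ta' y)" "integrable B (%y. g y * sg k y powr (- \<eta>) * ta k y)"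
  "(%k. \<integral>y. g y * sg k y powr (- \<eta>) * ta k y \<partial>B) ----> (LINT y|B. g y * sg' y powr (- \<eta>) * ta' y)"
proof -
 have vp: "pdom v V sg v' V' sg'" and php: "pdom ph D ta ph' D' ta'" using v ph by (auto simp: tdom_def)
 note [measurable] = pdom_measurable[OF vp] pdom_measurable[OF php]
 have 1: "AE y in B. (%k. sg k y) ----> sg' y" by (rule pdom_B[OF vp]) (auto elim!: eventually_mono)
 obtain K2 where K2: "integrable B K2" "dominated_B K2 ta ta'"
  by (rule pdom_B[OF php])
 let ?H = "%y. c powr (- \<eta>) * (\<Lambda> * (1 + K2 y))"
 have H: "integrable B ?H" using K2(1) by auto
 have AE: "AE y in B. (ALL k. \<bar>g y * sg k y powr (- \<eta>) * ta k y\<bar> <= ?H y) \<and> (%k. g y * sg k y powr (- \<eta>) * ta k y) ----> g y * sg' y powr (- \<eta>) * ta' y"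
  using 1 K2(2) c(2) Lambda(2)
 proof eventually_elim
  case (elim y)
  have "\<bar>g y * sg k y powr (- \<eta>) * ta k y\<bar> <= ?H y" for k
  proof -
   have "sg k y powr (- \<eta>) <= c powr (- \<eta>)" using elim c(1) \<eta> by (intro powr_mono2') auto
   moreover have "\<bar>ta k y\<bar> <= 1 + K2 y" using powr_le_one_add[of "\<bar>ta k y\<bar>" 1 p] p1 elim by (auto intro: order_trans)
   ultimately have "sg k y powr (- \<eta>) * (\<bar>g y\<bar> * \<bar>ta k y\<bar>) <= c powr (- \<eta>) * (\<Lambda> * (1 + K2 y))"
    using elim Lambda(1) by (intro mult_mono) auto
   then show ?thesis by (simp add: abs_mult mult_ac)
  qed
  moreover have "sg' y >= c" using elim by (intro LIMSEQ_le_const[of "%k. sg k y"]) auto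
  then have "(%k. g y * sg k y powr (- \<eta>) * ta k y) ----> g y * sg' y powr (- \<eta>) * ta' y"
   using elim c(1) by (intro tendsto_mult tendsto_powr tendsto_const) auto
  ultimately show ?case by blast
 qed
 show "integrable B (%y. g y * sg' y powr (- \<eta>) * ta' y)" by (rule dominated_tendsto(1)[OF _ _ H AE]) measurable
 show "integrable B (%y. g y * sg k y powr (- \<eta>) * ta k y)" by (rule dominated_tendsto(2)[OF _ _ H AE]) measurable
 show "(%k. \<integral>y. g y * sg k y powr (- \<eta>) * ta k y \<partial>B) ----> (LINT y|B. g y * sg' y powr (- \<eta>) * ta' y)" by (rule dominated_tendsto(3)[OF _ _ H AE]) measurable
qed

end

lemma norm_powr_limit_le:
 fixes x :: "nat => 'b::real_normed_vector"
 assumes "q > 0" "ALL k. norm (x k) powr q <= h" "x ----> x'"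
 shows "norm x' powr q <= h"
proof (rule LIMSEQ_le_const2)
 show "(%k. norm (x k) powr q) ----> norm x' powr q" using assms by (intro tendsto_powr' tendsto_intros) auto
qed (use assms in auto)

context singular_problem
begin

lemma pdomI:
 assumes "!!k. ph k \<in> borel_measurable M" "!!k. D k \<in> borel_measurable M" "!!k. ta k \<in> borel_measurable B"
  "ph' \<in> borel_measurable M" "D' \<in> borel_measurable M" "ta' \<in> borel_measurable B"
  "integrable M H" "integrable B K"
  "dominated_M H ph D ph' D'"
  "dominated_B K ta ta'"
 shows "pdom ph D ta ph' D' ta'"
 unfolding pdom_def using assms by blast

abbreviation (input) tdom_const where
 "tdom_const ph D ta \<equiv> tdom (%_. ph) (%_. D) (%_. ta) ph D ta"

lemma pdom_lin:
 assumes a: "pdom ph D ta ph' D' ta'" and b: "pdom ps E sg ps' E' sg'"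
 shows "pdom (%k y. c * ph k y + d * ps k y) (%k y. c *\<^sub>R D k y + d *\<^sub>R E k y) (%k y. c * ta k y + d * sg k y)
   (%y. c * ph' y + d * ps' y) (%y. c *\<^sub>R D' y + d *\<^sub>R E' y) (%y. c * ta' y + d * sg' y)"
proof -
 note [measurable] = pdom_measurable[OF a] pdom_measurable[OF b]
 obtain H1 where H1: "integrable M H1" "dominated_M H1 ph D ph' D'" by (rule pdom_M[OF a])
 obtain H2 where H2: "integrable M H2" "dominated_M H2 ps E ps' E'" by (rule pdom_M[OF b])
 obtain K1 where K1: "integrable B K1" "dominated_B K1 ta ta'" by (rule pdom_B[OF a])
 obtain K2 where K2: "integrable B K2" "dominated_B K2 sg sg'" by (rule pdom_B[OF b])
 let ?H = "%y. 2 powr p * (\<bar>c\<bar> powr p * H1 y + \<bar>d\<bar> powr p * H2 y)"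
 let ?K = "%y. 2 powr p * (\<bar>c\<bar> powr p * K1 y + \<bar>d\<bar> powr p * K2 y)"
 have real: "\<bar>c * x + d * z\<bar> powr p <= 2 powr p * (\<bar>c\<bar> powr p * a + \<bar>d\<bar> powr p * b)" if "\<bar>x\<bar> powr p <= a" "\<bar>z\<bar> powr p <= b" for x z a b :: real
  using norm_combination_powr_le[of p x a z b c d] p1 that by simp
 have "integrable M ?H" "integrable B ?K" using H1(1) H2(1) K1(1) K2(1) by auto
 moreover have "AE y in M. (ALL k. \<bar>c * ph k y + d * ps k y\<bar> powr p <= ?H y \<and> norm (c *\<^sub>R D k y + d *\<^sub>R E k y) powr p <= ?H y) \<and>
   (%k. c * ph k y + d * ps k y) ----> c * ph' y + d * ps' y \<and> (%k. c *\<^sub>R D k y + d *\<^sub>R E k y) ----> c *\<^sub>R D' y + d *\<^sub>R E' y"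
  using H1(2) H2(2)
 proof eventually_elim
  case (elim y)
  have "\<bar>c * ph k y + d * ps k y\<bar> powr p <= ?H y" for k using elim by (intro real) auto
  moreover have "norm (c *\<^sub>R D k y + d *\<^sub>R E k y) powr p <= ?H y" for k using elim p1 by (intro norm_combination_powr_le) auto
  ultimately show ?case using elim by (auto intro!: tendsto_intros)
 qed
 moreover have "AE y in B. (ALL k. \<bar>c * ta k y + d * sg k y\<bar> powr p <= ?K y) \<and> (%k. c * ta k y + d * sg k y) ----> c * ta' y + d * sg' y"
  using K1(2) K2(2)
 proof eventually_elim
  case (elim y)
  have "\<bar>c * ta k y + d * sg k y\<bar> powr p <= ?K y" for k using elim by (intro real) auto
  then show ?case using elim by (auto intro!: tendsto_intros)
 qed
 moreover have "(%y. c * ph k y + d * ps k y) \<in> borel_measurable M" "(%y. c *\<^sub>R D k y + d *\<^sub>R E k y) \<in> borel_measurable M"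
  "(%y. c * ta k y + d * sg k y) \<in> borel_measurable B" for k by measurable
 moreover have "(%y. c * ph' y + d * ps' y) \<in> borel_measurable M" "(%y. c *\<^sub>R D' y + d *\<^sub>R E' y) \<in> borel_measurable M"
  "(%y. c * ta' y + d * sg' y) \<in> borel_measurable B" by measurable
 ultimately show ?thesis by (intro pdomI[of _ _ _ _ _ _ ?H ?K])
qed

lemma qdom_lin:
 assumes a: "qdom ph ta" and b: "qdom ps sg"
 shows "qdom (%k y. c * ph k y + d * ps k y) (%k y. c * ta k y + d * sg k y)"
proof -
 obtain H1 K1 where 1: "integrable M H1" "integrable B K1" "AE y in M. ALL k. \<bar>f y\<bar> * \<bar>ph k y\<bar> <= H1 y" "AE y in B. ALL k. \<bar>ta k y\<bar> powr (s + 1) <= K1 y"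
  using a unfolding qdom_def by blast
 obtain H2 K2 where 2: "integrable M H2" "integrable B K2" "AE y in M. ALL k. \<bar>f y\<bar> * \<bar>ps k y\<bar> <= H2 y" "AE y in B. ALL k. \<bar>sg k y\<bar> powr (s + 1) <= K2 y"
  using b unfolding qdom_def by blast
 let ?H = "%y. \<bar>c\<bar> * H1 y + \<bar>d\<bar> * H2 y"
 let ?K = "%y. 2 powr (s + 1) * (\<bar>c\<bar> powr (s + 1) * K1 y + \<bar>d\<bar> powr (s + 1) * K2 y)"
 have "integrable M ?H" "integrable B ?K" using 1 2 by auto
 moreover have "AE y in M. ALL k. \<bar>f y\<bar> * \<bar>c * ph k y + d * ps k y\<bar> <= ?H y"
  using 1(3) 2(3)
 proof eventually_elim
  case (elim y)
  have "\<bar>f y\<bar> * \<bar>c * ph k y + d * ps k y\<bar> <= ?H y" for k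
  proof -
   have "\<bar>f y\<bar> * \<bar>c * ph k y + d * ps k y\<bar> <= \<bar>f y\<bar> * (\<bar>c\<bar> * \<bar>ph k y\<bar> + \<bar>d\<bar> * \<bar>ps k y\<bar>)"
    by (intro mult_left_mono) (auto simp: abs_mult[symmetric] intro: abs_triangle_ineq)
   also have "... = \<bar>c\<bar> * (\<bar>f y\<bar> * \<bar>ph k y\<bar>) + \<bar>d\<bar> * (\<bar>f y\<bar> * \<bar>ps k y\<bar>)" by (simp add: algebra_simps)
   also have "... <= ?H y" using elim by (intro add_mono mult_left_mono) auto
   finally show ?thesis .
  qed
  then show ?case by blast
 qed
 moreover have "AE y in B. ALL k. \<bar>c * ta k y + d * sg k y\<bar> powr (s + 1) <= ?K y"
  using 1(4) 2(4)
 proof eventually_elim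
  case (elim y)
  then show ?case using norm_combination_powr_le[of "s + 1" "ta _ y" "K1 y" "sg _ y" "K2 y" c d] s1 by simp
 qed
 ultimately show ?thesis unfolding qdom_def by blast
qed

lemma tdom_lin:
 assumes a: "tdom ph D ta ph' D' ta'" and b: "tdom ps E sg ps' E' sg'"
 shows "tdom (%k y. c * ph k y + d * ps k y) (%k y. c *\<^sub>R D k y + d *\<^sub>R E k y) (%k y. c * ta k y + d * sg k y)
   (%y. c * ph' y + d * ps' y) (%y. c *\<^sub>R D' y + d *\<^sub>R E' y) (%y. c * ta' y + d * sg' y)"
 using assms unfolding tdom_def by (intro conjI pdom_lin qdom_lin) auto

lemma pdom_limit_bounds:
 assumes "pdom ph D ta ph' D' ta'"
 shows "pdom (%k. ph') (%k. D') (%k. ta') ph' D' ta'"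
proof -
 obtain H1 where H1: "integrable M H1" "dominated_M H1 ph D ph' D'" by (rule pdom_M[OF assms])
 obtain K1 where K1: "integrable B K1" "dominated_B K1 ta ta'" by (rule pdom_B[OF assms])
 have "AE y in M. \<bar>ph' y\<bar> powr p <= H1 y \<and> norm (D' y) powr p <= H1 y"
  using H1(2)
 proof eventually_elim
  case (elim y)
  then show ?case using norm_powr_limit_le[of p "%k. ph k y" "H1 y" "ph' y"] norm_powr_limit_le[of p "%k. D k y" "H1 y" "D' y"] p1 by simp
 qed
 moreover have "AE y in B. \<bar>ta' y\<bar> powr p <= K1 y"
  using K1(2)
 proof eventually_elim
  case (elim y)
  then show ?case using norm_powr_limit_le[of p "%k. ta k y" "K1 y" "ta' y"] p1 by simp
 qed
 ultimately show ?thesis using H1(1) K1(1) pdom_measurable[OF assms]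
  by (intro pdomI[of _ _ _ _ _ _ H1 K1]) auto
qed

lemma tdom_limit:
 assumes "tdom ph D ta ph' D' ta'"
 shows "tdom (%k. ph') (%k. D') (%k. ta') ph' D' ta'"
proof -
 have a: "pdom ph D ta ph' D' ta'" using assms by (simp add: tdom_def)
 obtain H K where 1: "integrable M H" "integrable B K" "AE y in M. ALL k. \<bar>f y\<bar> * \<bar>ph k y\<bar> <= H y" "AE y in B. ALL k. \<bar>ta k y\<bar> powr (s + 1) <= K y"
  using assms unfolding tdom_def qdom_def by blast
 have c1: "AE y in M. (%k. ph k y) ----> ph' y" by (rule pdom_M[OF a]) (auto elim!: eventually_mono)
 have c2: "AE y in B. (%k. ta k y) ----> ta' y" by (rule pdom_B[OF a]) (auto elim!: eventually_mono)
 have "AE y in M. \<bar>f y\<bar> * \<bar>ph' y\<bar> <= H y"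
  using 1(3) c1
 proof eventually_elim
  case (elim y)
  then have "(%k. \<bar>f y\<bar> * \<bar>ph k y\<bar>) ----> \<bar>f y\<bar> * \<bar>ph' y\<bar>" by (intro tendsto_intros)
  then show ?case by (rule LIMSEQ_le_const2) (use elim in auto)
 qed
 moreover have "AE y in B. \<bar>ta' y\<bar> powr (s + 1) <= K y"
  using 1(4) c2
 proof eventually_elim
  case (elim y)
  then have "(%k. \<bar>ta k y\<bar> powr (s + 1)) ----> \<bar>ta' y\<bar> powr (s + 1)" using s1 by (intro tendsto_powr' tendsto_intros) auto
  then show ?case by (rule LIMSEQ_le_const2) (use elim in auto)
 qed
 ultimately have "qdom (%k. ph') (%k. ta')" unfolding qdom_def using 1(1,2) by (intro exI[of _ H] exI[of _ K]) auto
 then show ?thesis using pdom_limit_bounds[OF a] by (simp add: tdom_def)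
qed

lemma bounded_qdom:
 assumes "AE y in M. ALL k. \<bar>ph k y\<bar> <= m" "AE y in B. ALL k. \<bar>ta k y\<bar> <= m"
 shows "qdom ph ta"
 unfolding qdom_def
proof (intro exI conjI)
 show "integrable M (%y. \<bar>f y\<bar> * m)" using f_integrable by auto
 show "integrable B (%y. m powr (s + 1))" by simp
 show "AE y in M. ALL k. \<bar>f y\<bar> * \<bar>ph k y\<bar> <= \<bar>f y\<bar> * m" using assms(1) by eventually_elim (auto intro: mult_left_mono)
 show "AE y in B. ALL k. \<bar>ta k y\<bar> powr (s + 1) <= m powr (s + 1)"
  using assms(2) by eventually_elim (use s1 in "auto intro: powr_mono2")
qed

lemma cpt_tdom:
 assumes z: "cpt_smooth z"
 shows "tdom (%k. z) (%k. grad z) (%k. z) z (grad z) z"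
proof -
 obtain C where C: "C > 0" "!!x. \<bar>z x\<bar> <= C" "!!x. norm (grad z x) <= C" using cpt_smooth_bounded[OF z] by blast
 have p: "\<bar>z x\<bar> powr p <= C powr p" "norm (grad z x) powr p <= C powr p" for x using C p1 by (auto intro: powr_mono2)
 have "pdom (%k. z) (%k. grad z) (%k. z) z (grad z) z"
  using cpt_measurable[OF z] p by (intro pdomI[of _ _ _ _ _ _ "%_. C powr p" "%_. C powr p"]) auto
 moreover have "qdom (%k. z) (%k. z)" by (rule bounded_qdom[of _ C]) (use C in auto)
 ultimately show ?thesis by (simp add: tdom_def)
qed

text \<open>Limits of compactly supported smooth functions in the above sense. Such a limit comes
  with a weak gradient and a trace, because the same sequence serves in the interior and on the
  boundary.\<close>

definition good where
 "good w u G t \<longleftrightarrow> (ALL k. cpt_smooth (w k)) \<and> tdom w (%k. grad (w k)) w u G t"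

lemma closure_points: "y \<in> \<Omega> ==> y \<in> closure \<Omega>" "y \<in> frontier \<Omega> ==> y \<in> closure \<Omega>"
 using closure_subset[of \<Omega>] by (auto simp: frontier_def)

text \<open>Product and chain rule survive the limit if the factor is bounded on the closure and
  \<open>th\<close> is bounded with bounded derivative. This produces test directions built from the
  solution itself, together with their traces.\<close>

lemma good_prod_compose:
 assumes ph: "!!k. cpt_smooth (ph k)" "pdom ph (%k. grad (ph k)) ph ph' D' ta'" "!!k y. y \<in> closure \<Omega> ==> \<bar>ph k y\<bar> <= m"
  and w: "!!k. cpt_smooth (w k)" "pdom w (%k. grad (w k)) w u G t"
  and th: "smooth_on th UNIV" "!!t. \<bar>th t\<bar> <= C" "!!t. \<bar>deriv th t\<bar> <= C"
 shows "good (%k x. ph k x * th (w k x)) (%y. ph' y * th (u y))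
   (%y. th (u y) *\<^sub>R D' y + (ph' y * deriv th (u y)) *\<^sub>R G y) (%y. ta' y * th (t y))"
proof -
 have s: "smooth_on (ph k) UNIV" "smooth_on (w k) UNIV" for k using ph(1) w(1) by (auto simp: cpt_smooth_def)
 have sc: "smooth_on (%x. th (w k x)) UNIV" for k by (rule smooth_on_compose[OF th(1) s(2)])
 have cs: "cpt_smooth (%x. ph k x * th (w k x))" for k
  using cpt_smooth_mult[OF sc ph(1), of k k] by (simp add: mult.commute)
 have gr: "grad (%x. ph k x * th (w k x)) x = th (w k x) *\<^sub>R grad (ph k) x + (ph k x * deriv th (w k x)) *\<^sub>R grad (w k) x" for k x
  by (simp add: grad_mult[OF s(1) sc] grad_compose[OF smooth_on_real_deriv(1)[OF th(1)] s(2)])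
 have cth: "isCont th x" "isCont (deriv th) x" for x
  using smooth_on_continuous[OF th(1)] smooth_on_real_deriv(2)[OF th(1)] by (auto simp: continuous_on_eq_continuous_at)
 have [measurable]: "th \<in> borel_measurable borel" "deriv th \<in> borel_measurable borel"
  using smooth_on_continuous[OF th(1)] smooth_on_real_deriv(2)[OF th(1)] by (auto intro: borel_measurable_continuous_onI)
 note [measurable] = pdom_measurable[OF ph(2)] pdom_measurable[OF w(2)]
 have meas1: "(%y. ph' y * th (u y)) \<in> borel_measurable M"
  "(%y. th (u y) *\<^sub>R D' y + (ph' y * deriv th (u y)) *\<^sub>R G y) \<in> borel_measurable M" by measurable
 have meas2: "(%y. ta' y * th (t y)) \<in> borel_measurable B" by measurable
 have C0: "C >= 0" using th(2)[of 0] by linarith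
 have bnd: "\<bar>ph k y * th (w k y)\<bar> <= \<bar>m\<bar> * C" if "y \<in> closure \<Omega>" for k y
  using ph(3)[OF that, of k] th(2) by (auto simp: abs_mult intro!: mult_mono)
 obtain H1 where H1: "integrable M H1" "dominated_M H1 ph (%k. grad (ph k)) ph' D'" by (rule pdom_M[OF ph(2)])
 obtain H2 where H2: "integrable M H2" "dominated_M H2 w (%k. grad (w k)) u G" by (rule pdom_M[OF w(2)])
 obtain K1 where K1: "integrable B K1" "dominated_B K1 ph ta'" by (rule pdom_B[OF ph(2)])
 obtain K2 where K2: "integrable B K2" "dominated_B K2 w t" by (rule pdom_B[OF w(2)])
 let ?H = "%y. (\<bar>m\<bar> * C) powr p + 2 powr p * (C powr p * H1 y + (\<bar>m\<bar> * C) powr p * H2 y)"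
 have "integrable M ?H" using H1(1) H2(1) by auto
 moreover have "AE y in M. (ALL k. \<bar>ph k y * th (w k y)\<bar> powr p <= ?H y \<and> norm (grad (%x. ph k x * th (w k x)) y) powr p <= ?H y) \<and>
   (%k. ph k y * th (w k y)) ----> ph' y * th (u y) \<and>
   (%k. grad (%x. ph k x * th (w k x)) y) ----> th (u y) *\<^sub>R D' y + (ph' y * deriv th (u y)) *\<^sub>R G y"
  using H1(2) H2(2) AE_space
 proof eventually_elim
  case (elim y)
  have y: "y \<in> closure \<Omega>" using elim closure_points by simp
  have h0: "0 <= H1 y" "0 <= H2 y" using elim order_trans[OF powr_ge_zero] by blast+
  have 1: "\<bar>ph k y * th (w k y)\<bar> powr p <= ?H y" for k
  proof -
   have "\<bar>ph k y * th (w k y)\<bar> powr p <= (\<bar>m\<bar> * C) powr p" using bnd[OF y] p1 by (intro powr_mono2) auto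
   moreover have "0 <= 2 powr p * (C powr p * H1 y + (\<bar>m\<bar> * C) powr p * H2 y)" using h0 by auto
   ultimately show ?thesis by linarith
  qed
  have 2: "norm (grad (%x. ph k x * th (w k x)) y) powr p <= ?H y" for k
  proof -
   have "norm (grad (%x. ph k x * th (w k x)) y) powr p <= 2 powr p * (\<bar>th (w k y)\<bar> powr p * H1 y + \<bar>ph k y * deriv th (w k y)\<bar> powr p * H2 y)"
    unfolding gr using elim p1 by (intro norm_combination_powr_le) auto
   also have "... <= 2 powr p * (C powr p * H1 y + (\<bar>m\<bar> * C) powr p * H2 y)"
   proof (intro mult_left_mono add_mono mult_right_mono powr_mono2)
    show "\<bar>ph k y * deriv th (w k y)\<bar> <= \<bar>m\<bar> * C" using ph(3)[OF y, of k] th(3) by (auto simp: abs_mult intro!: mult_mono)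
   qed (use th(2) h0 p1 in auto)
   finally show ?thesis using powr_ge_zero[of "\<bar>m\<bar> * C" p] by linarith
  qed
  have 3: "(%k. th (w k y)) ----> th (u y)" "(%k. deriv th (w k y)) ----> deriv th (u y)"
   by (rule isCont_tendsto_compose[OF cth(1)] isCont_tendsto_compose[OF cth(2)], use elim in blast)+
  have 4: "(%k. grad (%x. ph k x * th (w k x)) y) ----> th (u y) *\<^sub>R D' y + (ph' y * deriv th (u y)) *\<^sub>R G y"
   unfolding gr using elim 3 by (intro tendsto_add tendsto_scaleR tendsto_mult) auto
  have 5: "(%k. ph k y * th (w k y)) ----> ph' y * th (u y)" using elim 3 by (intro tendsto_mult) auto
  show ?case using 1 2 4 5 by blast
 qed
 moreover have "AE y in B. (ALL k. \<bar>ph k y * th (w k y)\<bar> powr p <= (\<bar>m\<bar> * C) powr p) \<and> (%k. ph k y * th (w k y)) ----> ta' y * th (t y)"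
  using K1(2) K2(2) AE_space
 proof eventually_elim
  case (elim y)
  have y: "y \<in> closure \<Omega>" using elim closure_points by simp
  have 1: "\<bar>ph k y * th (w k y)\<bar> powr p <= (\<bar>m\<bar> * C) powr p" for k using bnd[OF y] p1 by (intro powr_mono2) auto
  have "(%k. th (w k y)) ----> th (t y)" by (rule isCont_tendsto_compose[OF cth(1)]) (use elim in blast)
  then have "(%k. ph k y * th (w k y)) ----> ta' y * th (t y)" using elim by (intro tendsto_mult) auto
  then show ?case using 1 by blast
 qed
 ultimately have "pdom (%k x. ph k x * th (w k x)) (%k. grad (%x. ph k x * th (w k x))) (%k x. ph k x * th (w k x)) (%y. ph' y * th (u y))
   (%y. th (u y) *\<^sub>R D' y + (ph' y * deriv th (u y)) *\<^sub>R G y) (%y. ta' y * th (t y))"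
  using cpt_measurable[OF cs] meas1 meas2 by (intro pdomI[of _ _ _ _ _ _ ?H "%_. (\<bar>m\<bar> * C) powr p"]) auto
 moreover have "qdom (%k x. ph k x * th (w k x)) (%k x. ph k x * th (w k x))"
 proof (rule bounded_qdom[of _ "\<bar>m\<bar> * C"])
  show "AE y in M. ALL k. \<bar>ph k y * th (w k y)\<bar> <= \<bar>m\<bar> * C" using AE_space by eventually_elim (use bnd closure_points in auto)
  show "AE y in B. ALL k. \<bar>ph k y * th (w k y)\<bar> <= \<bar>m\<bar> * C" using AE_space by eventually_elim (use bnd closure_points in auto)
 qed
 ultimately show ?thesis using cs by (simp add: good_def tdom_def)
qed

text \<open>The left side minus the right side of the weak formulation: the operator at the first
  triple, applied to the second. A full triple is passed for each argument, since a limit is not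
  smooth and has no gradient in the sense of \<open>grad\<close>.\<close>

definition TT where
 "TT v V sg ph D ta = (LINT y|M. A y (V y) \<bullet> D y) + (LINT y|B. bdry y (sg y) * ta y)
   - (LINT y|M. f y * v y powr (- \<gamma>) * ph y) - (LINT y|B. g y * sg y powr (- \<eta>) * ta y)"

lemma TT_tendsto:
 assumes v: "tdom v V sg v' V' sg'" and ph: "tdom ph D ta ph' D' ta'"
  and c: "c > 0" "AE y in M. ALL k. v k y >= c" "AE y in B. ALL k. sg k y >= c"
 shows "(%k. TT (v k) (V k) (sg k) (ph k) (D k) (ta k)) ----> TT v' V' sg' ph' D' ta'"
proof -
 have p: "pdom v V sg v' V' sg'" "pdom ph D ta ph' D' ta'" using v ph by (auto simp: tdom_def)
 show ?thesis unfolding TT_def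
  by (intro tendsto_diff tendsto_add A_tendsto(3)[OF p] bdry_tendsto(3)[OF v ph] f_tendsto(3)[OF v ph c(1,2)] g_tendsto(3)[OF v ph c(1,3)])
qed

text \<open>On these functions the singular factors are bounded, so \<open>TT\<close> is finite and
  continuous in the direction.\<close>

definition S0 where "S0 = {z. cpt_smooth z \<and> (\<exists>c>0. \<forall>y\<in>closure \<Omega>. z y >= c)}"

lemma S0_integrable:
 assumes z: "z \<in> S0" and ph: "tdom_const ph D ta"
 shows "integrable M (%y. A y (grad z y) \<bullet> D y)" "integrable B (%y. bdry y (z y) * ta y)"
  "integrable M (%y. f y * z y powr (- \<gamma>) * ph y)" "integrable B (%y. g y * z y powr (- \<eta>) * ta y)"
proof -
 obtain c where c: "c > 0" "\<forall>y\<in>closure \<Omega>. z y >= c" and cz: "cpt_smooth z" using z by (auto simp: S0_def)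
 note v = cpt_tdom[OF cz]
 have p: "pdom (%_. z) (%_. grad z) (%_. z) z (grad z) z" "pdom (%_. ph) (%_. D) (%_. ta) ph D ta" using v ph by (auto simp: tdom_def)
 have c1: "AE y in M. \<forall>k::nat. z y >= c" using AE_space by eventually_elim (use c closure_points in auto)
 have c2: "AE y in B. \<forall>k::nat. z y >= c" using AE_space by eventually_elim (use c closure_points in auto)
 show "integrable M (%y. A y (grad z y) \<bullet> D y)" by (rule A_tendsto(1)[OF p])
 show "integrable B (%y. bdry y (z y) * ta y)" by (rule bdry_tendsto(1)[OF v ph])
 show "integrable M (%y. f y * z y powr (- \<gamma>) * ph y)" by (rule f_tendsto(1)[OF v ph c(1) c1])
 show "integrable B (%y. g y * z y powr (- \<eta>) * ta y)" by (rule g_tendsto(1)[OF v ph c(1) c2])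
qed

lemma TT_combination:
 assumes "integrable M (%y. A y (V y) \<bullet> D y)" "integrable B (%y. bdry y (sg' y) * ta y)"
  "integrable M (%y. f y * v y powr (- \<gamma>) * ph y)" "integrable B (%y. g y * sg' y powr (- \<eta>) * ta y)"
  and "integrable M (%y. A y (V y) \<bullet> E y)" "integrable B (%y. bdry y (sg' y) * sg y)"
  "integrable M (%y. f y * v y powr (- \<gamma>) * ps y)" "integrable B (%y. g y * sg' y powr (- \<eta>) * sg y)"
 shows "TT v V sg' (%y. a * ph y + b * ps y) (%y. a *\<^sub>R D y + b *\<^sub>R E y) (%y. a * ta y + b * sg y)
   = a * TT v V sg' ph D ta + b * TT v V sg' ps E sg"
proof -
 have "(LINT y|N. h y * (a * r y + b * r' y)) = a * (LINT y|N. h y * r y) + b * (LINT y|N. h y * r' y)"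
  if "integrable N (%y. h y * r y)" "integrable N (%y. h y * r' y)" for N :: "'a measure" and h r r' :: "'a => real"
  using that by (simp add: distrib_left mult.left_commute[of _ a] mult.left_commute[of _ b])
 note lin = this[OF assms(2,6)] this[OF assms(3,7)] this[OF assms(4,8)]
 have "(LINT y|M. A y (V y) \<bullet> (a *\<^sub>R D y + b *\<^sub>R E y)) = a * (LINT y|M. A y (V y) \<bullet> D y) + b * (LINT y|M. A y (V y) \<bullet> E y)"
  using assms(1,5) by (simp add: inner_add_right)
 then show ?thesis unfolding TT_def lin by (simp add: algebra_simps)
qed

lemma TT_lin:
 assumes z: "z \<in> S0" and ph: "tdom_const ph D ta" and ps: "tdom_const ps E sg"
 shows "TT z (grad z) z (%y. a * ph y + b * ps y) (%y. a *\<^sub>R D y + b *\<^sub>R E y) (%y. a * ta y + b * sg y)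
   = a * TT z (grad z) z ph D ta + b * TT z (grad z) z ps E sg"
 by (rule TT_combination[OF S0_integrable[OF z ph] S0_integrable[OF z ps]])

end

section \<open>Convexity of the energy and continuity of the operator with respect to it\<close>

lemma norm_powr_convex_le:
 fixes a b :: "'b::real_normed_vector"
 assumes q: "q >= 1" and t: "0 <= t" "t <= 1"
 shows "norm ((1 - t) *\<^sub>R a + t *\<^sub>R b) powr q <= (1 - t) * norm a powr q + t * norm b powr q"
proof -
 let ?m = "(1 - t) * norm a + t * norm b"
 have m0: "?m >= 0" using t by simp
 have "norm ((1 - t) *\<^sub>R a + t *\<^sub>R b) <= ?m" using norm_triangle_ineq[of "(1 - t) *\<^sub>R a" "t *\<^sub>R b"] t by simp
 then have "norm ((1 - t) *\<^sub>R a + t *\<^sub>R b) powr q <= ?m powr q" using q by (intro powr_mono2) auto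
 \<comment> \<open>Written this way, the last factor m can be expanded as a convex combination and
   the tangent inequality at m applied to each part.\<close>
 also have "?m powr q = q * (?m powr (q - 1) * ?m) - (q - 1) * ?m powr q"
 proof -
  have "?m powr (q - 1) * ?m = ?m powr q" using m0 by (cases "?m = 0") (auto simp: powr_diff)
  then show ?thesis by (simp add: algebra_simps)
 qed
 also have "... = (1 - t) * (q * (?m powr (q - 1) * norm a)) + t * (q * (?m powr (q - 1) * norm b)) - (q - 1) * ?m powr q"
  by (simp add: algebra_simps)
 also have "... <= (1 - t) * (norm a powr q + (q - 1) * ?m powr q) + t * (norm b powr q + (q - 1) * ?m powr q) - (q - 1) * ?m powr q"
  using q t m0 by (intro diff_right_mono add_mono mult_left_mono powr_tangent) auto
 also have "... = (1 - t) * norm a powr q + t * norm b powr q" by (simp add: algebra_simps)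
 finally show ?thesis .
qed

lemma cpt_smooth_lin:
 assumes "cpt_smooth u" "cpt_smooth v"
 shows "cpt_smooth (%x. a * u x + b * v x)" "grad (%x. a * u x + b * v x) x = a *\<^sub>R grad u x + b *\<^sub>R grad v x"
proof -
 have s: "smooth_on u UNIV" "smooth_on v UNIV" "smooth_on (%x. a * u x) UNIV" "smooth_on (%x. b * v x) UNIV"
  using assms cpt_smooth_scale[OF assms(1), of a] cpt_smooth_scale[OF assms(2), of b] by (auto simp: cpt_smooth_def)
 show "cpt_smooth (%x. a * u x + b * v x)" using assms by (intro cpt_smooth_add cpt_smooth_scale)
 show "grad (%x. a * u x + b * v x) x = a *\<^sub>R grad u x + b *\<^sub>R grad v x"
  using s by (simp add: grad_add grad_scale)
qed

lemma cpt_smooth_diff_grad: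
 assumes "cpt_smooth u" "cpt_smooth v" shows "grad (%x. u x - v x) x = grad u x - grad v x"
 using cpt_smooth_lin(2)[OF assms, of 1 "-1" x] by simp

text \<open>From f k = (f k - g) - (f 0 - g) + f 0 one sees that integrability of the first member
  alone, with a bound on the distances to g, dominates the whole sequence; g need not be known to be
  integrable beforehand.\<close>

lemma Lp_fast_dominated_around:
 fixes f :: "nat => 'x => 'b::euclidean_space"
 assumes q: "q > 0" and [measurable]: "!!k. f k \<in> borel_measurable M" "g \<in> borel_measurable M"
  and i0: "integrable M (%x. norm (f 0 x) powr q)"
  and le: "!!k. (\<integral>\<^sup>+x. ennreal (norm (f k x - g x) powr q) \<partial>M) <= ennreal ((1/2) ^ k)"
 shows "EX H. integrable M H \<and> (AE x in M. (ALL k. norm (f k x) powr q <= H x) \<and> (%k. f k x) ----> g x)"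
proof -
 obtain H where H: "integrable M H" "AE x in M. (ALL k. norm (f k x - g x) powr q <= H x) \<and> (%k. f k x) ----> g x"
  using Lp_fast_convergence[OF q assms(2,3) le] by blast
 let ?H = "%x. 2 powr q * (2 powr q * (H x + H x) + norm (f 0 x) powr q)"
 have "integrable M ?H" using H(1) i0 by auto
 moreover have "AE x in M. (ALL k. norm (f k x) powr q <= ?H x) \<and> (%k. f k x) ----> g x"
  using H(2)
 proof eventually_elim
  case (elim x)
  have "norm (f k x) powr q <= ?H x" for k
  proof -
   have "norm (1 *\<^sub>R (f k x - g x) + (-1) *\<^sub>R (f 0 x - g x)) powr q <= 2 powr q * (\<bar>1\<bar> powr q * H x + \<bar>-1\<bar> powr q * H x)"
    using elim q by (intro norm_combination_powr_le) auto
   then have "norm (f k x - f 0 x) powr q <= 2 powr q * (H x + H x)" by simp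
   then have "norm (1 *\<^sub>R (f k x - f 0 x) + 1 *\<^sub>R f 0 x) powr q <= 2 powr q * (\<bar>1\<bar> powr q * (2 powr q * (H x + H x)) + \<bar>1\<bar> powr q * norm (f 0 x) powr q)"
    using q by (intro norm_combination_powr_le) auto
   then show ?thesis by simp
  qed
  then show ?case using elim by blast
 qed
 ultimately show ?thesis by blast
qed

lemma Lp_fast_dominated:
 fixes f :: "nat => 'x => 'b::euclidean_space"
 assumes q: "q > 0" and [measurable]: "!!k. f k \<in> borel_measurable M" and i0: "integrable M (%x. norm (f 0 x) powr q)"
  and le: "!!k l. k <= l ==> (\<integral>\<^sup>+x. ennreal (norm (f k x - f l x) powr q) \<partial>M) <= ennreal (((1/2) powr (q + 1)) ^ k)"
 shows "\<exists>g\<in>borel_measurable M. EX H. integrable M H \<and> (AE x in M. (ALL k. norm (f k x) powr q <= H x) \<and> (%k. f k x) ----> g x)"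
proof -
 obtain g where g[measurable]: "g \<in> borel_measurable M"
  and gl: "!!k. (\<integral>\<^sup>+x. ennreal (norm (f k x - g x) powr q) \<partial>M) <= ennreal ((1/2) ^ k)"
  using Lp_fast_cauchy_limit[OF q assms(2) le] by blast
 show ?thesis using Lp_fast_dominated_around[OF q assms(2) g i0 gl] g by blast
qed

context singular_problem
begin

lemma energy_convex:
 assumes u: "cpt_smooth u" and v: "cpt_smooth v" and t: "0 <= t" "t <= 1"
 shows "energy (cmb t u v) <= (1 - t) * energy u + t * energy v"
proof -
 have c: "cpt_smooth (cmb t u v)" "!!x. grad (cmb t u v) x = (1 - t) *\<^sub>R grad u x + t *\<^sub>R grad v x"
  using cpt_smooth_lin[OF u v] by (auto simp: cmb_def)
 have p0: "p >= 0" "s + 1 >= 0" using p1 s1 by auto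
 note iu = cpt_integrable[OF u p0(1)] cpt_integrable(3)[OF u p0(2)]
 note iv = cpt_integrable[OF v p0(1)] cpt_integrable(3)[OF v p0(2)]
 note ic = cpt_integrable[OF c(1) p0(1)] cpt_integrable(3)[OF c(1) p0(2)]
 have "(LINT y|M. norm (grad (cmb t u v) y) powr p) <= (LINT y|M. (1 - t) * norm (grad u y) powr p + t * norm (grad v y) powr p)"
 proof (rule integral_mono)
  show "norm (grad (cmb t u v) y) powr p <= (1 - t) * norm (grad u y) powr p + t * norm (grad v y) powr p" for y
   unfolding c using p1 t by (intro norm_powr_convex_le) auto
 qed (use iu iv ic in auto)
 moreover have "(LINT y|B. \<bar>cmb t u v y\<bar> powr (s + 1)) <= (LINT y|B. (1 - t) * \<bar>u y\<bar> powr (s + 1) + t * \<bar>v y\<bar> powr (s + 1))"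
 proof (rule integral_mono)
  show "\<bar>cmb t u v y\<bar> powr (s + 1) <= (1 - t) * \<bar>u y\<bar> powr (s + 1) + t * \<bar>v y\<bar> powr (s + 1)" for y
   using norm_powr_convex_le[of "s + 1" t "u y" "v y"] s1 t by (simp add: cmb_def)
 qed (use iu iv ic in auto)
 ultimately show ?thesis using iu iv by (simp add: energy_def algebra_simps)
qed

text \<open>The two parts of the energy have different degrees p and s + 1, so enlarging costs the
  larger exponent and shrinking gains only the smaller one.\<close>

lemma energy_scale:
 assumes w: "cpt_smooth w" and a: "a >= 1"
 shows "energy (%x. a * w x) <= a powr (max p (s + 1)) * energy w"
  "energy (%x. inverse a * w x) <= inverse a powr (min p (s + 1)) * energy w"
proof -
 have e: "energy (%x. b * w x) = b powr p * (LINT y|M. norm (grad w y) powr p) + b powr (s + 1) * (LINT y|B. \<bar>w y\<bar> powr (s + 1))"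
  if "b >= 0" for b
 proof -
  have "smooth_on w UNIV" using w by (simp add: cpt_smooth_def)
  then show ?thesis using that by (simp add: energy_def grad_scale abs_mult powr_mult)
 qed
 have 1: "a powr p <= a powr (max p (s + 1))" "a powr (s + 1) <= a powr (max p (s + 1))" using a by (auto intro: powr_mono)
 have 2: "inverse a powr p <= inverse a powr (min p (s + 1))" "inverse a powr (s + 1) <= inverse a powr (min p (s + 1))"
  using a by (auto intro!: powr_mono' simp: inverse_le_1_iff)
 show "energy (%x. a * w x) <= a powr (max p (s + 1)) * energy w"
  using a 1 unfolding e[OF order_trans[OF zero_le_one a]] energy_def distrib_left
  by (intro add_mono mult_right_mono) auto
 have "energy (%x. inverse a * w x) = inverse a powr p * (LINT y|M. norm (grad w y) powr p) + inverse a powr (s + 1) * (LINT y|B. \<bar>w y\<bar> powr (s + 1))"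
  by (rule e) (use a in auto)
 then show "energy (%x. inverse a * w x) <= inverse a powr (min p (s + 1)) * energy w"
  using 2 unfolding energy_def distrib_left by (simp only:) (intro add_mono mult_right_mono, auto)
qed

lemma cpt_pair_tdom:
 assumes u: "cpt_smooth u" and v: "cpt_smooth v"
 shows "tdom (%_ y. u y - v y) (%_ y. grad u y - grad v y) (%_ y. u y - v y) (%y. u y - v y) (%y. grad u y - grad v y) (%y. u y - v y)"
 using tdom_lin[OF cpt_tdom[OF u] cpt_tdom[OF v], of 1 "-1"] by simp

text \<open>The Minty form: the operator at the test point z, applied to z - u.\<close>

definition LL where "LL z u = TT z (grad z) z (%y. z y - u y) (%y. grad z y - grad u y) (%y. z y - u y)"

lemma S0_cpt: "z \<in> S0 ==> cpt_smooth z" by (simp add: S0_def)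

lemma LL_aff:
 assumes z: "z \<in> S0" and u: "cpt_smooth u" and v: "cpt_smooth v"
 shows "LL z (cmb t u v) = (1 - t) * LL z u + t * LL z v"
proof -
 note cz = S0_cpt[OF z]
 have g: "grad (cmb t u v) x = (1 - t) *\<^sub>R grad u x + t *\<^sub>R grad v x" for x
  using cpt_smooth_lin(2)[OF u v] by (simp add: cmb_def)
 have e: "z y - cmb t u v y = (1 - t) * (z y - u y) + t * (z y - v y)"
  "grad z y - grad (cmb t u v) y = (1 - t) *\<^sub>R (grad z y - grad u y) + t *\<^sub>R (grad z y - grad v y)" for y
  by (simp add: cmb_def algebra_simps) (simp only: g, simp add: algebra_simps)
 show ?thesis unfolding LL_def e by (rule TT_lin[OF z cpt_pair_tdom[OF cz u] cpt_pair_tdom[OF cz v]])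
qed

lemma LL_diff:
 assumes z: "z \<in> S0" and u: "cpt_smooth u" and v: "cpt_smooth v"
 shows "LL z u - LL z v = TT z (grad z) z (%y. v y - u y) (%y. grad v y - grad u y) (%y. v y - u y)"
proof -
 note cz = S0_cpt[OF z]
 have "TT z (grad z) z (%y. 1 * (z y - u y) + (-1) * (z y - v y)) (%y. 1 *\<^sub>R (grad z y - grad u y) + (-1) *\<^sub>R (grad z y - grad v y))
   (%y. 1 * (z y - u y) + (-1) * (z y - v y)) = 1 * LL z u + (-1) * LL z v"
  unfolding LL_def by (rule TT_lin[OF z cpt_pair_tdom[OF cz u] cpt_pair_tdom[OF cz v]])
 moreover have "1 * (z y - u y) + (-1) * (z y - v y) = v y - u y" "1 *\<^sub>R (grad z y - grad u y) + (-1) *\<^sub>R (grad z y - grad v y) = grad v y - grad u y" for y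
  by simp_all
 ultimately show ?thesis by simp
qed

text \<open>All four terms have the same sign: A is monotone, the boundary function is increasing,
  and the singular terms are decreasing powers with nonnegative coefficients that enter with a minus
  sign.\<close>

lemma LL_mono:
 assumes u: "u \<in> S0" and v: "v \<in> S0"
 shows "LL u v + LL v u >= 0"
proof -
 note cu = S0_cpt[OF u] and cv = S0_cpt[OF v]
 note d = cpt_pair_tdom[OF cu cv] and d' = cpt_pair_tdom[OF cv cu]
 let ?d = "%y. u y - v y" and ?D = "%y. grad u y - grad v y"
 note iu = S0_integrable[OF u d] and iv = S0_integrable[OF v d]
 have pos: "y \<in> closure \<Omega> ==> u y > 0" "y \<in> closure \<Omega> ==> v y > 0" for y
  using u v by (auto simp: S0_def intro: less_le_trans)
 have "LL v u = TT v (grad v) v (%y. (-1) * ?d y + 0 * ?d y) (%y. (-1) *\<^sub>R ?D y + 0 *\<^sub>R ?D y) (%y. (-1) * ?d y + 0 * ?d y)"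
  by (simp add: LL_def)
 also have "... = - TT v (grad v) v ?d ?D ?d" using TT_lin[OF v d d, of "-1" 0] by simp
 finally have "LL u v + LL v u = TT u (grad u) u ?d ?D ?d - TT v (grad v) v ?d ?D ?d" by (simp add: LL_def)
 also have "... = (LINT y|M. A y (grad u y) \<bullet> ?D y - A y (grad v y) \<bullet> ?D y) + (LINT y|B. bdry y (u y) * ?d y - bdry y (v y) * ?d y)
   + (LINT y|M. f y * v y powr (- \<gamma>) * ?d y - f y * u y powr (- \<gamma>) * ?d y)
   + (LINT y|B. g y * v y powr (- \<eta>) * ?d y - g y * u y powr (- \<eta>) * ?d y)"
  using iu iv by (simp add: TT_def)
 also have "... >= 0"
 proof (intro add_nonneg_nonneg integral_nonneg_AE)
  have *: "0 <= A y (grad u y) \<bullet> ?D y - A y (grad v y) \<bullet> ?D y" if "y \<in> \<Omega>" for y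
  proof (cases "grad u y = grad v y")
   case False
   then show ?thesis using mono[OF that False] by (simp add: inner_diff_left)
  qed simp
  show "AE y in M. 0 <= A y (grad u y) \<bullet> ?D y - A y (grad v y) \<bullet> ?D y" using AE_space by eventually_elim (rule *, simp)
  show "AE y in B. 0 <= bdry y (u y) * ?d y - bdry y (v y) * ?d y"
   using lam(2)
  proof eventually_elim
   case (elim y)
   have b: "bdry y a <= bdry y b" if "a <= b" for a b
    unfolding bdry_def using elim that p1 s1 by (intro add_mono mult_left_mono opow_mono) auto
   have "0 <= (bdry y (u y) - bdry y (v y)) * (u y - v y)"
    using b[of "u y" "v y"] b[of "v y" "u y"] by (cases "u y <= v y") (auto intro: mult_nonpos_nonpos)
   then show ?case by (simp add: algebra_simps)
  qed
  have neg: "0 <= c * v y powr (- q) * ?d y - c * u y powr (- q) * ?d y" if "y \<in> closure \<Omega>" "c >= 0" "q > 0" for y c q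
  proof -
   have d: "b powr (- q) <= a powr (- q)" if "0 < a" "a <= b" for a b using that \<open>q > 0\<close> by (intro powr_mono2') auto
   have "0 <= (v y powr (- q) - u y powr (- q)) * (u y - v y)"
    using d[of "u y" "v y"] d[of "v y" "u y"] pos[OF that(1)] by (cases "u y <= v y") (auto intro: mult_nonpos_nonpos)
   then have "0 <= c * ((v y powr (- q) - u y powr (- q)) * (u y - v y))" by (rule mult_nonneg_nonneg[OF that(2)])
   then show ?thesis by (simp add: algebra_simps)
  qed
  show "AE y in M. 0 <= f y * v y powr (- \<gamma>) * ?d y - f y * u y powr (- \<gamma>) * ?d y"
   using f(2) AE_space by eventually_elim (use neg[OF closure_points(1)] \<gamma> in auto)
  show "AE y in B. 0 <= g y * v y powr (- \<eta>) * ?d y - g y * u y powr (- \<eta>) * ?d y"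
   using g(2) AE_space by eventually_elim (use neg[OF closure_points(2)] \<eta> in auto)
 qed
 finally show ?thesis .
qed

text \<open>For fixed z the operator is a linear functional bounded on the unit ball of the energy.
  Together with scaling this gives the continuity condition required by
  \<open>minty_limit\<close>.\<close>

lemma TT_unit_bound:
 assumes z: "z \<in> S0"
 shows "\<exists>C>0. ALL w. cpt_smooth w --> energy w <= 1 --> \<bar>TT z (grad z) z w (grad w) w\<bar> <= C"
proof -
 obtain c where c: "c > 0" "!!y. y \<in> closure \<Omega> ==> z y >= c" and cz: "cpt_smooth z" using z by (auto simp: S0_def)
 obtain C where C: "C > 0" "!!w. cpt_smooth w ==> energy w <= 1 ==>
   (LINT y|M. \<bar>w y\<bar> powr p) <= C \<and> (LINT y|B. \<bar>w y\<bar> powr p) <= C \<and> integrable M (%y. \<bar>f y\<bar> * \<bar>w y\<bar>) \<and> (LINT y|M. \<bar>f y\<bar> * \<bar>w y\<bar>) <= C"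
  using unit_energy_bounds[OF f(1)] by blast
 have p0: "p >= 0" "s + 1 >= 0" using p1 s1 by auto
 note iz = cpt_integrable[OF cz p0(1)] cpt_integrable(3)[OF cz p0(2)]
 have il: "integrable M (%y. \<bar>l y\<bar> powr (p / (p - 1)))" using growth(2) by (simp add: Lp_def)
 define C1 where "C1 = (LINT y|M. \<bar>l y\<bar> powr (p / (p - 1))) + \<omega> * (LINT y|M. norm (grad z y) powr p) + (1 + \<omega>)"
 define C2 where "C2 = \<Lambda> * ((LINT y|B. \<bar>z y\<bar> powr p) + C) + ((LINT y|B. \<bar>z y\<bar> powr (s + 1)) + 1)"
 define C3 where "C3 = c powr (- \<gamma>) * C"
 define C4 where "C4 = c powr (- \<eta>) * \<Lambda> * (measure B (space B) + C)"
 have nn: "C1 >= 0" "C2 >= 0" "C3 >= 0" "C4 >= 0"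
  unfolding C1_def C2_def C3_def C4_def using growth(1) Lambda(1) C(1) by auto
 have "\<bar>TT z (grad z) z w (grad w) w\<bar> <= 1 + C1 + C2 + C3 + C4" if w: "cpt_smooth w" and e: "energy w <= 1" for w
 proof -
  note Cw = C(2)[OF w e]
  note i = S0_integrable[OF z cpt_tdom[OF w]]
  note iw = cpt_integrable[OF w p0(1)] cpt_integrable(3)[OF w p0(2)]
  have e1: "(LINT y|M. norm (grad w y) powr p) <= 1" "(LINT y|B. \<bar>w y\<bar> powr (s + 1)) <= 1"
  proof -
   have "0 <= (LINT y|M. norm (grad w y) powr p)" "0 <= (LINT y|B. \<bar>w y\<bar> powr (s + 1))" by auto
   then show "(LINT y|M. norm (grad w y) powr p) <= 1" "(LINT y|B. \<bar>w y\<bar> powr (s + 1)) <= 1" using e unfolding energy_def by linarith+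
  qed
  have 1: "\<bar>\<integral>y. A y (grad z y) \<bullet> grad w y \<partial>M\<bar> <= C1"
  proof -
   have "\<bar>\<integral>y. A y (grad z y) \<bullet> grad w y \<partial>M\<bar> <= (LINT y|M. \<bar>A y (grad z y) \<bullet> grad w y\<bar>)" by (rule integral_abs_bound)
   also have "... <= (LINT y|M. \<bar>l y\<bar> powr (p / (p - 1)) + \<omega> * norm (grad z y) powr p + (1 + \<omega>) * norm (grad w y) powr p)"
    by (rule integral_mono) (use i il iz iw A_bound in auto)
   also have "... = (LINT y|M. \<bar>l y\<bar> powr (p / (p - 1))) + \<omega> * (LINT y|M. norm (grad z y) powr p) + (1 + \<omega>) * (LINT y|M. norm (grad w y) powr p)"
    using il iz iw by simp
   also have "... <= C1" unfolding C1_def using e1(1) growth(1) mult_left_mono[OF e1(1), of "1 + \<omega>"] by simp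
   finally show ?thesis .
  qed
  have 2: "\<bar>\<integral>y. bdry y (z y) * w y \<partial>B\<bar> <= C2"
  proof -
   have "\<bar>\<integral>y. bdry y (z y) * w y \<partial>B\<bar> <= (LINT y|B. \<bar>bdry y (z y) * w y\<bar>)" by (rule integral_abs_bound)
   also have "... <= (LINT y|B. \<Lambda> * (\<bar>z y\<bar> powr p + \<bar>w y\<bar> powr p) + (\<bar>z y\<bar> powr (s + 1) + \<bar>w y\<bar> powr (s + 1)))"
   proof (rule integral_mono_AE)
    show "AE y in B. \<bar>bdry y (z y) * w y\<bar> <= \<Lambda> * (\<bar>z y\<bar> powr p + \<bar>w y\<bar> powr p) + (\<bar>z y\<bar> powr (s + 1) + \<bar>w y\<bar> powr (s + 1))"
     using Lambda(2) by eventually_elim (rule bdry_bound, blast)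
   qed (use i iz iw in auto)
   also have "... = \<Lambda> * ((LINT y|B. \<bar>z y\<bar> powr p) + (LINT y|B. \<bar>w y\<bar> powr p)) + ((LINT y|B. \<bar>z y\<bar> powr (s + 1)) + (LINT y|B. \<bar>w y\<bar> powr (s + 1)))"
    using iz iw by simp
   also have "... <= C2" unfolding C2_def using Cw e1(2) Lambda(1) by (intro add_mono mult_left_mono) auto
   finally show ?thesis .
  qed
  have 3: "\<bar>\<integral>y. f y * z y powr (- \<gamma>) * w y \<partial>M\<bar> <= C3"
  proof -
   have "\<bar>\<integral>y. f y * z y powr (- \<gamma>) * w y \<partial>M\<bar> <= (LINT y|M. \<bar>f y * z y powr (- \<gamma>) * w y\<bar>)" by (rule integral_abs_bound)
   also have "... <= (LINT y|M. c powr (- \<gamma>) * (\<bar>f y\<bar> * \<bar>w y\<bar>))"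
   proof (rule integral_mono)
    show "integrable M (%y. \<bar>f y * z y powr (- \<gamma>) * w y\<bar>)" using i(3) by (rule integrable_abs)
    show "integrable M (%y. c powr (- \<gamma>) * (\<bar>f y\<bar> * \<bar>w y\<bar>))" using Cw by auto
    fix y assume "y \<in> space M"
    then have "c <= z y" using c(2) closure_points by simp
    then have "z y powr (- \<gamma>) <= c powr (- \<gamma>)" using c(1) \<gamma> by (intro powr_mono2') auto
    then have "z y powr (- \<gamma>) * (\<bar>f y\<bar> * \<bar>w y\<bar>) <= c powr (- \<gamma>) * (\<bar>f y\<bar> * \<bar>w y\<bar>)" by (rule mult_right_mono) simp
    then show "\<bar>f y * z y powr (- \<gamma>) * w y\<bar> <= c powr (- \<gamma>) * (\<bar>f y\<bar> * \<bar>w y\<bar>)" by (simp add: abs_mult mult_ac)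
   qed
   also have "... <= C3" unfolding C3_def using Cw by (simp add: mult_left_mono)
   finally show ?thesis .
  qed
  have 4: "\<bar>\<integral>y. g y * z y powr (- \<eta>) * w y \<partial>B\<bar> <= C4"
  proof -
   have "\<bar>\<integral>y. g y * z y powr (- \<eta>) * w y \<partial>B\<bar> <= (LINT y|B. \<bar>g y * z y powr (- \<eta>) * w y\<bar>)" by (rule integral_abs_bound)
   also have "... <= (LINT y|B. c powr (- \<eta>) * \<Lambda> * (1 + \<bar>w y\<bar> powr p))"
   proof (rule integral_mono_AE)
    show "integrable B (%y. \<bar>g y * z y powr (- \<eta>) * w y\<bar>)" using i(4) by (rule integrable_abs)
    show "integrable B (%y. c powr (- \<eta>) * \<Lambda> * (1 + \<bar>w y\<bar> powr p))" using iw by auto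
    show "AE y in B. \<bar>g y * z y powr (- \<eta>) * w y\<bar> <= c powr (- \<eta>) * \<Lambda> * (1 + \<bar>w y\<bar> powr p)"
     using Lambda(2) AE_space
    proof eventually_elim
     case (elim y)
     then have "c <= z y" using c(2) closure_points by simp
     then have "z y powr (- \<eta>) <= c powr (- \<eta>)" using c(1) \<eta> by (intro powr_mono2') auto
     moreover have "\<bar>w y\<bar> <= 1 + \<bar>w y\<bar> powr p" using powr_le_one_add[of "\<bar>w y\<bar>" 1 p] p1 by simp
     ultimately have "z y powr (- \<eta>) * \<bar>g y\<bar> * \<bar>w y\<bar> <= c powr (- \<eta>) * \<Lambda> * (1 + \<bar>w y\<bar> powr p)"
      using elim Lambda(1) by (intro mult_mono) auto
     then show ?case by (simp add: abs_mult mult_ac)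
    qed
   qed
   also have "... = c powr (- \<eta>) * \<Lambda> * (measure B (space B) + (LINT y|B. \<bar>w y\<bar> powr p))" using iw by simp
   also have "... <= C4" unfolding C4_def using Cw Lambda(1) by (intro mult_left_mono add_mono) auto
   finally show ?thesis .
  qed
  show ?thesis using 1 2 3 4 unfolding TT_def by linarith
 qed
 moreover have "1 + C1 + C2 + C3 + C4 > 0" using nn by linarith
 ultimately show ?thesis by blast
qed

definition rr where "rr = max p (s + 1)"

lemma rr: "rr > 1" "rr >= p" "rr >= s + 1" using p1 by (auto simp: rr_def)

lemma small_energy_scaled:
 assumes w: "cpt_smooth w" and a: "a >= 1" and e: "energy w <= a powr (- rr)"
 shows "energy (%x. a * w x) <= 1"
proof -
 have "energy (%x. a * w x) <= a powr rr * energy w" using energy_scale(1)[OF w a] by (simp add: rr_def)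
 also have "... <= a powr rr * a powr (- rr)" using e by (intro mult_left_mono) auto
 also have "... = 1" using a by (simp add: powr_minus)
 finally show ?thesis .
qed

text \<open>The energy is not homogeneous, so smallness is expressed by a scale: a w still has
  energy at most 1, and dividing the unit bounds by a, or by a^p \<ge> a, gives C/a. The last two
  bounds come directly from energy at most a^(-rr) \<le> 1/a, which is why C + 1 is used.\<close>

lemma small_energy_bounds:
 "\<exists>C>0. ALL w a. cpt_smooth w --> a >= 1 --> energy w <= a powr (- rr) -->
   (LINT y|M. \<bar>w y\<bar> powr p) <= C / a \<and> (LINT y|B. \<bar>w y\<bar> powr p) <= C / a \<and> integrable M (%y. \<bar>f y\<bar> * \<bar>w y\<bar>) \<and> (LINT y|M. \<bar>f y\<bar> * \<bar>w y\<bar>) <= C / a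
   \<and> (LINT y|M. norm (grad w y) powr p) <= C / a \<and> (LINT y|B. \<bar>w y\<bar> powr (s + 1)) <= C / a"
proof -
 obtain C where C: "C > 0" "!!w. cpt_smooth w ==> energy w <= 1 ==>
   (LINT y|M. \<bar>w y\<bar> powr p) <= C \<and> (LINT y|B. \<bar>w y\<bar> powr p) <= C \<and> integrable M (%y. \<bar>f y\<bar> * \<bar>w y\<bar>) \<and> (LINT y|M. \<bar>f y\<bar> * \<bar>w y\<bar>) <= C"
  using unit_energy_bounds[OF f(1)] by blast
 have "(LINT y|M. \<bar>w y\<bar> powr p) <= (C + 1) / a \<and> (LINT y|B. \<bar>w y\<bar> powr p) <= (C + 1) / a \<and> integrable M (%y. \<bar>f y\<bar> * \<bar>w y\<bar>) \<and> (LINT y|M. \<bar>f y\<bar> * \<bar>w y\<bar>) <= (C + 1) / a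
   \<and> (LINT y|M. norm (grad w y) powr p) <= (C + 1) / a \<and> (LINT y|B. \<bar>w y\<bar> powr (s + 1)) <= (C + 1) / a"
  if w: "cpt_smooth w" and a: "a >= 1" and e: "energy w <= a powr (- rr)" for w a
 proof -
  have a0: "a > 0" using a by simp
  note K = C(2)[OF cpt_smooth_scale[OF w] small_energy_scaled[OF w a e]]
  have ap: "a <= a powr p" using powr_mono[of 1 p a] p1 a by simp
  have p: "x <= (C + 1) / a" if "a powr p * x <= C" "x >= 0" for x
  proof -
   have "a * x <= a powr p * x" using ap that by (intro mult_right_mono) auto
   then have "a * x <= C + 1" using that by linarith
   then show ?thesis using a0 by (simp add: pos_le_divide_eq mult.commute)
  qed
  have 1: "(LINT y|M. \<bar>w y\<bar> powr p) <= (C + 1) / a" using K a0 by (intro p) (auto simp: abs_mult powr_mult)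
  have 2: "(LINT y|B. \<bar>w y\<bar> powr p) <= (C + 1) / a" using K a0 by (intro p) (auto simp: abs_mult powr_mult)
  have eq: "(%y. \<bar>f y\<bar> * \<bar>w y\<bar>) = (%y. inverse a * (\<bar>f y\<bar> * \<bar>a * w y\<bar>))" using a0 by (intro ext) (simp add: abs_mult)
  have 3: "integrable M (%y. \<bar>f y\<bar> * \<bar>w y\<bar>)" unfolding eq using K by (intro integrable_mult_right) blast
  have 5: "(LINT y|M. \<bar>f y\<bar> * \<bar>w y\<bar>) = inverse a * (LINT y|M. \<bar>f y\<bar> * \<bar>a * w y\<bar>)" unfolding eq by simp
  have "inverse a * (LINT y|M. \<bar>f y\<bar> * \<bar>a * w y\<bar>) <= inverse a * (C + 1)" using K a0 by (intro mult_left_mono) auto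
  then have 4: "(LINT y|M. \<bar>f y\<bar> * \<bar>w y\<bar>) <= (C + 1) / a" using 5 by (simp add: divide_inverse mult.commute)
  have "a powr (- rr) <= a powr (- 1)" using a rr(1) by (intro powr_mono) auto
  moreover have "a powr (- 1) = 1 / a" using a0 by (simp add: powr_minus divide_inverse)
  ultimately have "energy w <= 1 / a" using e by linarith
  moreover have "1 / a <= (C + 1) / a" using C(1) a0 by (intro divide_right_mono) auto
  moreover have "0 <= (LINT y|M. norm (grad w y) powr p)" "0 <= (LINT y|B. \<bar>w y\<bar> powr (s + 1))" by auto
  ultimately have "(LINT y|M. norm (grad w y) powr p) <= (C + 1) / a" "(LINT y|B. \<bar>w y\<bar> powr (s + 1)) <= (C + 1) / a"
   unfolding energy_def by linarith+
  then show ?thesis using 1 2 3 4 by blast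
 qed
 then show ?thesis using C(1) by (intro exI[of _ "C + 1"]) auto
qed

text \<open>The pointwise uniform convexity estimates for the exponents p and s + 1 are integrated
  over the domain and its boundary. Since the pointwise defects are nonnegative, the larger of the
  two constants may be used in both.\<close>

lemma energy_uniform_convexity:
 assumes R: "R > 0" and e: "ep > 0"
 shows "\<exists>dl>0. ALL u v. cpt_smooth u --> cpt_smooth v --> energy u <= R --> energy v <= R -->
  energy u + energy v - 2 * energy (cmb (1/2) u v) <= dl --> energy (%x. u x - v x) <= ep"
proof -
 \<comment> \<open>With energies at most R the first term contributes at most ep/2; the bound
   ep/(2C) on the defect contributes the other half.\<close>
 define e' where "e' = ep / (4 * R)"
 have e': "e' > 0" using R e by (simp add: e'_def)
 obtain C1 where C1: "C1 > 0" "!!a b::'a. norm (a - b) powr p <= e' * (norm a powr p + norm b powr p) + C1 * (norm a powr p + norm b powr p - 2 * norm ((1/2) *\<^sub>R (a + b)) powr p)"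
  using norm_powr_uniform_convexity[OF p1 e', where 'b='a] by blast
 obtain C2 where C2: "C2 > 0" "!!a b::real. norm (a - b) powr (s + 1) <= e' * (norm a powr (s + 1) + norm b powr (s + 1)) + C2 * (norm a powr (s + 1) + norm b powr (s + 1) - 2 * norm ((1/2) *\<^sub>R (a + b)) powr (s + 1))"
  using norm_powr_uniform_convexity[of "s + 1" e', where 'b=real] e' s1 by auto
 define C where "C = max C1 C2"
 have C: "C > 0" "C1 <= C" "C2 <= C" using C1 by (auto simp: C_def)
 have main: "energy (%x. u x - v x) <= e' * (energy u + energy v) + C * (energy u + energy v - 2 * energy (cmb (1/2) u v))"
  if u: "cpt_smooth u" and v: "cpt_smooth v" for u v
 proof -
  have d: "cpt_smooth (%x. u x - v x)" by (rule cpt_smooth_diff[OF u v])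
  have c: "cpt_smooth (cmb (1/2) u v)" "!!x. grad (cmb (1/2) u v) x = (1/2) *\<^sub>R (grad u x + grad v x)"
   using cpt_smooth_lin[OF u v, of "1/2" "1/2"] by (auto simp: cmb_def scaleR_add_right)
  have p0: "p >= 0" "s + 1 >= 0" using p1 s1 by auto
  note iu = cpt_integrable[OF u p0(1)] cpt_integrable(3)[OF u p0(2)]
  note iv = cpt_integrable[OF v p0(1)] cpt_integrable(3)[OF v p0(2)]
  note ic = cpt_integrable[OF c(1) p0(1)] cpt_integrable(3)[OF c(1) p0(2)]
  note id = cpt_integrable[OF d p0(1)] cpt_integrable(3)[OF d p0(2)]
  have "(LINT y|M. norm (grad (%x. u x - v x) y) powr p) <= (\<integral>y. e' * (norm (grad u y) powr p + norm (grad v y) powr p) +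
    C * (norm (grad u y) powr p + norm (grad v y) powr p - 2 * norm (grad (cmb (1/2) u v) y) powr p) \<partial>M)"
  proof (rule integral_mono)
   fix y
   have "2 * norm (grad (cmb (1/2) u v) y) powr p <= norm (grad u y) powr p + norm (grad v y) powr p"
    using norm_powr_convex_le[of p "1/2" "grad u y" "grad v y"] p1 by (simp add: c scaleR_add_right)
   then have "C1 * (norm (grad u y) powr p + norm (grad v y) powr p - 2 * norm (grad (cmb (1/2) u v) y) powr p)
    <= C * (norm (grad u y) powr p + norm (grad v y) powr p - 2 * norm (grad (cmb (1/2) u v) y) powr p)"
    using C by (intro mult_right_mono) auto
   then show "norm (grad (%x. u x - v x) y) powr p <= e' * (norm (grad u y) powr p + norm (grad v y) powr p) +
    C * (norm (grad u y) powr p + norm (grad v y) powr p - 2 * norm (grad (cmb (1/2) u v) y) powr p)"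
    using C1(2)[of "grad u y" "grad v y"] unfolding c(2) cpt_smooth_diff_grad[OF u v] by linarith
  qed (use iu iv ic id in auto)
  then have 1: "(LINT y|M. norm (grad (%x. u x - v x) y) powr p) <= e' * ((LINT y|M. norm (grad u y) powr p) + (LINT y|M. norm (grad v y) powr p)) +
    C * ((LINT y|M. norm (grad u y) powr p) + (LINT y|M. norm (grad v y) powr p) - 2 * (LINT y|M. norm (grad (cmb (1/2) u v) y) powr p))"
   using iu iv ic by simp
  have "(LINT y|B. \<bar>u y - v y\<bar> powr (s + 1)) <= (\<integral>y. e' * (\<bar>u y\<bar> powr (s + 1) + \<bar>v y\<bar> powr (s + 1)) +
    C * (\<bar>u y\<bar> powr (s + 1) + \<bar>v y\<bar> powr (s + 1) - 2 * \<bar>cmb (1/2) u v y\<bar> powr (s + 1)) \<partial>B)"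
  proof (rule integral_mono)
   fix y
   have ce: "cmb (1/2) u v y = (1/2) *\<^sub>R (u y + v y)" by (simp add: cmb_def distrib_left)
   have "2 * \<bar>cmb (1/2) u v y\<bar> powr (s + 1) <= \<bar>u y\<bar> powr (s + 1) + \<bar>v y\<bar> powr (s + 1)"
    using norm_powr_convex_le[of "s + 1" "1/2" "u y" "v y"] s1 by (simp add: cmb_def)
   then have "C2 * (\<bar>u y\<bar> powr (s + 1) + \<bar>v y\<bar> powr (s + 1) - 2 * \<bar>cmb (1/2) u v y\<bar> powr (s + 1))
    <= C * (\<bar>u y\<bar> powr (s + 1) + \<bar>v y\<bar> powr (s + 1) - 2 * \<bar>cmb (1/2) u v y\<bar> powr (s + 1))"
    using C by (intro mult_right_mono) auto
   then show "\<bar>u y - v y\<bar> powr (s + 1) <= e' * (\<bar>u y\<bar> powr (s + 1) + \<bar>v y\<bar> powr (s + 1)) +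
    C * (\<bar>u y\<bar> powr (s + 1) + \<bar>v y\<bar> powr (s + 1) - 2 * \<bar>cmb (1/2) u v y\<bar> powr (s + 1))"
    using C2(2)[of "u y" "v y"] unfolding ce real_norm_def by linarith
  qed (use iu iv ic id in auto)
  then have 2: "(LINT y|B. \<bar>u y - v y\<bar> powr (s + 1)) <= e' * ((LINT y|B. \<bar>u y\<bar> powr (s + 1)) + (LINT y|B. \<bar>v y\<bar> powr (s + 1))) +
    C * ((LINT y|B. \<bar>u y\<bar> powr (s + 1)) + (LINT y|B. \<bar>v y\<bar> powr (s + 1)) - 2 * (LINT y|B. \<bar>cmb (1/2) u v y\<bar> powr (s + 1)))"
   using iu iv ic by simp
  have id: "e' * (a + b) + C * (a + b - 2 * c) + (e' * (a' + b') + C * (a' + b' - 2 * c')) =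
    e' * ((a + a') + (b + b')) + C * ((a + a') + (b + b') - 2 * (c + c'))" for a b c a' b' c' by (simp add: algebra_simps)
  show ?thesis using add_mono[OF 1 2] unfolding id energy_def .
 qed
 show ?thesis
 proof (intro exI[of _ "ep / (2 * C)"] conjI allI impI)
  show "0 < ep / (2 * C)" using e C by simp
  fix u v assume a: "cpt_smooth u" "cpt_smooth v" "energy u <= R" "energy v <= R" "energy u + energy v - 2 * energy (cmb (1/2) u v) <= ep / (2 * C)"
  have "energy (%x. u x - v x) <= e' * (energy u + energy v) + C * (energy u + energy v - 2 * energy (cmb (1/2) u v))" by (rule main[OF a(1,2)])
  also have "... <= e' * (R + R) + C * (ep / (2 * C))" using a e' C by (intro add_mono mult_left_mono) auto
  also have "... = ep" using R C by (simp add: e'_def field_simps)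
  finally show "energy (%x. u x - v x) <= ep" .
 qed
qed

end

section \<open>Minty solutions on a ball of the energy\<close>

context singular_problem
begin

lemma TT_scale:
 assumes z: "z \<in> S0" and ph: "tdom_const ph D ta"
 shows "TT z (grad z) z (%y. a * ph y) (%y. a *\<^sub>R D y) (%y. a * ta y) = a * TT z (grad z) z ph D ta"
 using TT_lin[OF z ph ph, of a 0] by simp

definition EE where "EE G t = (LINT y|M. norm (G y) powr p) + (LINT y|B. \<bar>t y\<bar> powr (s + 1))"

lemma good_energy_tendsto:
 assumes "good w u G t"
 shows "(%k. energy (w k)) ----> EE G t" "integrable M (%y. norm (G y) powr p)" "integrable B (%y. \<bar>t y\<bar> powr (s + 1))"
proof -
 have a: "pdom w (%k. grad (w k)) w u G t" "qdom w w" and cw: "!!k. cpt_smooth (w k)" using assms by (auto simp: good_def tdom_def)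
 note [measurable] = pdom_measurable[OF a(1)]
 obtain H where H: "integrable M H" "dominated_M H w (%k. grad (w k)) u G" by (rule pdom_M[OF a(1)])
 obtain K1 where K1: "integrable B K1" "dominated_B K1 w t" by (rule pdom_B[OF a(1)])
 obtain H2 K2 where 2: "integrable B K2" "AE y in B. ALL k. \<bar>w k y\<bar> powr (s + 1) <= K2 y"
  using a(2) unfolding qdom_def by blast
 have A1: "AE y in M. (ALL k. norm (grad (w k) y) powr p <= H y) \<and> (%k. grad (w k) y) ----> G y"
  using H(2) by eventually_elim simp
 have A2: "AE y in B. (ALL k. norm (w k y) powr (s + 1) <= K2 y) \<and> (%k. w k y) ----> t y"
  using K1(2) 2(2) by eventually_elim simp
 have q: "p > 0" "s + 1 > 0" using p1 s1 by auto
 note m = pdom_measurable[OF a(1)]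
 note c = dominated_powr_tendsto[OF q(1) m(2,5) H(1) A1] and d = dominated_powr_tendsto[OF q(2) m(3,6) 2(1) A2, unfolded real_norm_def]
 show "(%k. energy (w k)) ----> EE G t" unfolding energy_def EE_def by (intro tendsto_add c(3) d(3))
 show "integrable M (%y. norm (G y) powr p)" "integrable B (%y. \<bar>t y\<bar> powr (s + 1))" by (rule c(1) d(1))+
qed

definition CR where "CR R = {z \<in> S0. energy z <= R}"

lemma CR_convex:
 assumes u: "u \<in> CR R" and v: "v \<in> CR R" and t: "0 <= t" "t <= 1"
 shows "cmb t u v \<in> CR R"
proof -
 obtain c d where c: "c > 0" "!!y. y \<in> closure \<Omega> ==> u y >= c" and d: "d > 0" "!!y. y \<in> closure \<Omega> ==> v y >= d"
  and s: "cpt_smooth u" "cpt_smooth v" "energy u <= R" "energy v <= R" using u v unfolding CR_def S0_def by blast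
 have "min c d <= cmb t u v y" if y: "y \<in> closure \<Omega>" for y
 proof -
  have "min c d = (1 - t) * min c d + t * min c d" by (simp add: algebra_simps)
  also have "... <= (1 - t) * u y + t * v y" using t c(2)[OF y] d(2)[OF y] by (intro add_mono mult_left_mono) auto
  finally show ?thesis by (simp add: cmb_def)
 qed
 moreover have "cpt_smooth (cmb t u v)" using cpt_smooth_lin(1)[OF s(1,2)] by (simp add: cmb_def)
 moreover have "energy (cmb t u v) <= R"
 proof -
  have "energy (cmb t u v) <= (1 - t) * energy u + t * energy v" by (rule energy_convex[OF s(1,2) t])
  also have "... <= (1 - t) * R + t * R" using s t by (intro add_mono mult_left_mono) auto
  finally show ?thesis by (simp add: algebra_simps)
 qed
 ultimately show ?thesis using c(1) d(1) by (auto simp: CR_def S0_def intro!: exI[of _ "min c d"])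
qed

lemma minty_CR: "minty_setup (CR R) LL"
proof
 fix u v z :: "'a => real" and t :: real
 assume t: "0 <= t" "t <= 1"
 show "cmb t u v \<in> CR R" if "u \<in> CR R" "v \<in> CR R" using CR_convex that t by blast
 show "LL z (cmb t u v) = (1 - t) * LL z u + t * LL z v" if "z \<in> CR R" "u \<in> CR R" "v \<in> CR R"
  using that by (intro LL_aff) (auto simp: CR_def S0_cpt)
qed (auto simp: CR_def LL_mono)

text \<open>An instance of \<open>minty_limit\<close> in which the energy is the convex function and
  the energy of the difference measures distance.\<close>

lemma cauchy_minty_sequence:
 assumes R: "R > 0" and ne: "CR R ~= {}"
 shows "\<exists>x::nat => 'a => real. (ALL k. x k \<in> CR R) \<and> (\<forall>ep>0. EX K. \<forall>k\<ge>K. \<forall>l\<ge>k. energy (%y. x k y - x l y) <= ep) \<and>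
   (\<forall>z\<in>CR R. \<forall>ep>0. EX K. \<forall>k\<ge>K. LL z (x k) >= - ep)"
proof (rule minty_setup.minty_limit[OF minty_CR ne, where J = energy and R = R and N = "%u v. energy (%y. u y - v y)"])
 show "0 <= energy u" for u by (rule energy_nonneg)
 show "energy u <= R" if "u \<in> CR R" for u using that by (simp add: CR_def)
 show "\<exists>dl>0. \<forall>u\<in>CR R. \<forall>v\<in>CR R. energy u + energy v - 2 * energy (cmb (1/2) u v) <= dl --> energy (%y. u y - v y) <= ep"
  if "ep > 0" for ep
  using energy_uniform_convexity[OF R that] S0_cpt unfolding CR_def by blast
 show "\<exists>dl>0. \<forall>u\<in>CR R. \<forall>v\<in>CR R. energy (%y. u y - v y) <= dl --> \<bar>LL z u - LL z v\<bar> <= ep"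
  if z: "z \<in> CR R" and e: "ep > 0" for z ep
 proof -
  have z0: "z \<in> S0" using z by (simp add: CR_def)
  obtain C where C: "C > 0" "!!w. cpt_smooth w ==> energy w <= 1 ==> \<bar>TT z (grad z) z w (grad w) w\<bar> <= C"
   using TT_unit_bound[OF z0] by blast
  \<comment> \<open>A difference of energy at most a^(-rr) can be multiplied by a without leaving
    the unit ball, so the functional is at most C/a on it.\<close>
  define a where "a = max 1 (C / ep)"
  have a: "a >= 1" "a > 0" "C / a <= ep" using e C(1) by (auto simp: a_def max_def field_simps)
  have "\<bar>LL z u - LL z v\<bar> <= ep" if u: "u \<in> CR R" and v: "v \<in> CR R" and en: "energy (%y. u y - v y) <= a powr (- rr)" for u v
  proof -
   have c: "cpt_smooth u" "cpt_smooth v" using u v by (auto simp: CR_def S0_cpt)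
   let ?d = "%y. u y - v y"
   have d: "cpt_smooth ?d" by (rule cpt_smooth_diff[OF c])
   have sd: "smooth_on ?d UNIV" using d by (simp add: cpt_smooth_def)
   note td = cpt_tdom[OF d]
   have "\<bar>TT z (grad z) z (%y. a * ?d y) (grad (%y. a * ?d y)) (%y. a * ?d y)\<bar> <= C"
    by (rule C(2)[OF cpt_smooth_scale[OF d] small_energy_scaled[OF d a(1) en]])
   also have "TT z (grad z) z (%y. a * ?d y) (grad (%y. a * ?d y)) (%y. a * ?d y) = a * TT z (grad z) z ?d (grad ?d) ?d"
   proof -
    have gs: "grad (%y. a * ?d y) = (%y. a *\<^sub>R grad ?d y)" by (rule ext) (rule grad_scale[OF sd])
    show ?thesis unfolding gs by (rule TT_scale[OF z0 td])
   qed
   finally have "a * \<bar>TT z (grad z) z ?d (grad ?d) ?d\<bar> <= C" using a by (simp add: abs_mult)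
   then have "\<bar>TT z (grad z) z ?d (grad ?d) ?d\<bar> <= C / a" using a by (simp add: pos_le_divide_eq mult.commute)
   moreover have "LL z v - LL z u = TT z (grad z) z ?d (grad ?d) ?d"
   proof -
    have gd: "grad ?d = (%y. grad u y - grad v y)" by (rule ext) (rule cpt_smooth_diff_grad[OF c])
    show ?thesis unfolding gd by (rule LL_diff[OF z0 c(2,1)])
   qed
   ultimately show ?thesis using a by linarith
  qed
  then show ?thesis using a(2) by (intro exI[of _ "a powr (- rr)"]) auto
 qed
qed

text \<open>A subsequence converging fast in every norm at once yields almost everywhere limits with
  dominating functions, that is a \<open>good\<close> triple. The Minty inequality passes to the
  limit because it is continuous in its second argument for fixed z.\<close>

lemma approximate_solution:
 assumes R: "R > 0" and ne: "CR R ~= {}"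
 shows "EX w u G t. good w u G t \<and> (ALL k. w k \<in> CR R) \<and>
  (\<forall>z\<in>CR R. TT z (grad z) z (%y. z y - u y) (%y. grad z y - G y) (%y. z y - t y) >= 0)"
proof -
 from cauchy_minty_sequence[OF R ne] obtain x :: "nat => 'a => real" where
  x: "(ALL k. x k \<in> CR R) \<and> (\<forall>ep>0. EX K. \<forall>k\<ge>K. \<forall>l\<ge>k. energy (%y. x k y - x l y) <= ep) \<and>
   (\<forall>z\<in>CR R. \<forall>ep>0. EX K. \<forall>k\<ge>K. LL z (x k) >= - ep)" ..
 note x1 = x[THEN conjunct1, rule_format] and x2 = x[THEN conjunct2, THEN conjunct1, THEN spec, THEN mp]
  and x3 = x[THEN conjunct2, THEN conjunct2, THEN bspec, THEN spec, THEN mp]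
 obtain C where C: "C > 0" "!!w a. cpt_smooth w ==> a >= 1 ==> energy w <= a powr (- rr) ==>
   (LINT y|M. \<bar>w y\<bar> powr p) <= C / a \<and> (LINT y|B. \<bar>w y\<bar> powr p) <= C / a \<and> integrable M (%y. \<bar>f y\<bar> * \<bar>w y\<bar>) \<and> (LINT y|M. \<bar>f y\<bar> * \<bar>w y\<bar>) <= C / a
   \<and> (LINT y|M. norm (grad w y) powr p) <= C / a \<and> (LINT y|B. \<bar>w y\<bar> powr (s + 1)) <= C / a"
  using small_energy_bounds by blast
 \<comment> \<open>The exponents p, s + 1 and 1 each require their own rate ((1/2)^(q+1))^j. All
   three are at most \<open>rr\<close>, so this single rate is fast enough for all of them.\<close>
 define dl where "dl j = ((1/2) powr (rr + 1)) ^ j" for j :: nat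
 define a where "a j = max 1 (C / dl j)" for j
 have dl0: "dl j > 0" for j by (simp add: dl_def)
 have a: "a j >= 1" "a j > 0" "C / a j <= dl j" for j using C(1) dl0[of j] by (auto simp: a_def max_def field_simps)
 have dlq: "dl j <= ((1/2) powr (q + 1)) ^ j" if "q <= rr" for q j
  unfolding dl_def using that by (intro power_mono powr_mono') auto
 have Kex: "EX K. \<forall>k\<ge>K. \<forall>l\<ge>k. energy (%y. x k y - x l y) <= a j powr (- rr)" for j
  by (rule x2) (use a(2)[of j] in simp)
 have "EX K. ALL j. \<forall>k\<ge>K j. \<forall>l\<ge>k. energy (%y. x k y - x l y) <= a j powr (- rr)"
  by (rule choice) (rule allI, rule Kex)
 then obtain K where K0: "ALL j. \<forall>k\<ge>K j. \<forall>l\<ge>k. energy (%y. x k y - x l y) <= a j powr (- rr)" ..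
 have K: "energy (%y. x k y - x l y) <= a j powr (- rr)" if "k >= K j" "l >= k" for j k l using K0 that by simp
 \<comment> \<open>The sum makes the index increasing, at least K j, and at least j.\<close>
 define i where "i j = j + (\<Sum>n\<le>j. K n)" for j
 have iK: "i j >= K j" for j unfolding i_def using member_le_sum[of j "{..j}" K] by simp
 have im: "i j <= i k" if "j <= k" for j k unfolding i_def using that by (intro add_mono sum_mono2) auto
 have ij: "i j >= j" for j by (simp add: i_def)
 define w where "w j = x (i j)" for j
 have wC: "w k \<in> CR R" for k using x1 by (simp add: w_def)
 have cw: "cpt_smooth (w k)" for k using wC[of k] by (simp add: CR_def S0_cpt)
 have dif: "(LINT y|M. \<bar>w j y - w k y\<bar> powr p) <= dl j" "(LINT y|B. \<bar>w j y - w k y\<bar> powr p) <= dl j"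
   "integrable M (%y. \<bar>f y\<bar> * \<bar>w j y - w k y\<bar>)" "(LINT y|M. \<bar>f y\<bar> * \<bar>w j y - w k y\<bar>) <= dl j"
   "(LINT y|M. norm (grad (w j) y - grad (w k) y) powr p) <= dl j" "(LINT y|B. \<bar>w j y - w k y\<bar> powr (s + 1)) <= dl j" if "j <= k" for j k
 proof -
  have "energy (%y. w j y - w k y) <= a j powr (- rr)" unfolding w_def using iK im[OF that] by (intro K)
  then have "(LINT y|M. \<bar>w j y - w k y\<bar> powr p) <= C / a j \<and> (LINT y|B. \<bar>w j y - w k y\<bar> powr p) <= C / a j
   \<and> integrable M (%y. \<bar>f y\<bar> * \<bar>w j y - w k y\<bar>) \<and> (LINT y|M. \<bar>f y\<bar> * \<bar>w j y - w k y\<bar>) <= C / a j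
   \<and> (LINT y|M. norm (grad (%y. w j y - w k y) y) powr p) <= C / a j \<and> (LINT y|B. \<bar>w j y - w k y\<bar> powr (s + 1)) <= C / a j"
   using C(2)[OF cpt_smooth_diff[OF cw cw] a(1)] by blast
  then show "(LINT y|M. \<bar>w j y - w k y\<bar> powr p) <= dl j" "(LINT y|B. \<bar>w j y - w k y\<bar> powr p) <= dl j"
   "integrable M (%y. \<bar>f y\<bar> * \<bar>w j y - w k y\<bar>)" "(LINT y|M. \<bar>f y\<bar> * \<bar>w j y - w k y\<bar>) <= dl j"
   "(LINT y|M. norm (grad (w j) y - grad (w k) y) powr p) <= dl j" "(LINT y|B. \<bar>w j y - w k y\<bar> powr (s + 1)) <= dl j"
   unfolding cpt_smooth_diff_grad[OF cw cw] by (blast intro: order_trans[OF _ a(3)[of j]])+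
 qed
 have p0: "p >= 0" "s + 1 >= 0" using p1 s1 by auto
 note cm = cpt_measurable[OF cw]
 note ci = cpt_integrable[OF cw p0(1)] cpt_integrable(3)[OF cw p0(2)]
 note cd = cpt_integrable[OF cpt_smooth_diff[OF cw cw] p0(1)] cpt_integrable(3)[OF cpt_smooth_diff[OF cw cw] p0(2)]
 have nn: "(\<integral>\<^sup>+y. ennreal (h y) \<partial>N) <= ennreal (((1/2) powr (q + 1)) ^ j)"
  if "integrable N h" "integral\<^sup>L N h <= dl j" "q <= rr" "!!y. h y >= 0" for N :: "'a measure" and h q j
  using that dlq[OF that(3), of j] by (subst nn_integral_eq_integral) (auto intro: ennreal_leI)
 have q: "p > 0" "s + 1 > 0" "1 > (0::real)" using p1 s1 by auto
 have "\<exists>u\<in>borel_measurable M. EX H. integrable M H \<and> (AE y in M. (ALL k. norm (w k y) powr p <= H y) \<and> (%k. w k y) ----> u y)"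
 proof (rule Lp_fast_dominated[OF q(1) cm(1)])
  show "integrable M (%y. norm (w 0 y) powr p)" using ci(1) by simp
  show "(\<integral>\<^sup>+y. ennreal (norm (w k y - w l y) powr p) \<partial>M) <= ennreal (((1/2) powr (p + 1)) ^ k)" if "k <= l" for k l
   by (rule nn) (use cd(1) dif(1)[OF that] rr in auto)
 qed
 then obtain u H1 where 1: "u \<in> borel_measurable M" "integrable M H1" "AE y in M. (ALL k. norm (w k y) powr p <= H1 y) \<and> (%k. w k y) ----> u y" by blast
 have "\<exists>G\<in>borel_measurable M. EX H. integrable M H \<and> (AE y in M. (ALL k. norm (grad (w k) y) powr p <= H y) \<and> (%k. grad (w k) y) ----> G y)"
 proof (rule Lp_fast_dominated[OF q(1) cm(2)])
  show "integrable M (%y. norm (grad (w 0) y) powr p)" using ci(2) by simp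
  show "(\<integral>\<^sup>+y. ennreal (norm (grad (w k) y - grad (w l) y) powr p) \<partial>M) <= ennreal (((1/2) powr (p + 1)) ^ k)" if "k <= l" for k l
   by (rule nn) (use cd(2)[of k l] dif(5)[OF that] rr in "auto simp: cpt_smooth_diff_grad[OF cw cw]")
 qed
 then obtain G H2 where 2: "G \<in> borel_measurable M" "integrable M H2" "AE y in M. (ALL k. norm (grad (w k) y) powr p <= H2 y) \<and> (%k. grad (w k) y) ----> G y" by blast
 have "\<exists>t\<in>borel_measurable B. EX H. integrable B H \<and> (AE y in B. (ALL k. norm (w k y) powr p <= H y) \<and> (%k. w k y) ----> t y)"
 proof (rule Lp_fast_dominated[OF q(1) cm(3)])
  show "integrable B (%y. norm (w 0 y) powr p)" using ci(3) by simp
  show "(\<integral>\<^sup>+y. ennreal (norm (w k y - w l y) powr p) \<partial>B) <= ennreal (((1/2) powr (p + 1)) ^ k)" if "k <= l" for k l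
   by (rule nn) (use cd(3) dif(2)[OF that] rr in auto)
 qed
 then obtain t H3 where 3: "t \<in> borel_measurable B" "integrable B H3" "AE y in B. (ALL k. norm (w k y) powr p <= H3 y) \<and> (%k. w k y) ----> t y" by blast
 \<comment> \<open>Only the dominating function for the power s + 1 is kept from this
   application.\<close>
 have "\<exists>t\<in>borel_measurable B. EX H. integrable B H \<and> (AE y in B. (ALL k. norm (w k y) powr (s + 1) <= H y) \<and> (%k. w k y) ----> t y)"
 proof (rule Lp_fast_dominated[OF q(2) cm(3)])
  show "integrable B (%y. norm (w 0 y) powr (s + 1))" using ci(4) by simp
  show "(\<integral>\<^sup>+y. ennreal (norm (w k y - w l y) powr (s + 1)) \<partial>B) <= ennreal (((1/2) powr (s + 1 + 1)) ^ k)" if "k <= l" for k l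
   by (rule nn) (use cd(4) dif(6)[OF that] rr in auto)
 qed
 then obtain t' H4 where 4: "integrable B H4" "AE y in B. (ALL k. norm (w k y) powr (s + 1) <= H4 y) \<and> (%k. w k y) ----> t' y" by blast
 \<comment> \<open>Applied to f times the approximants with exponent 1, again to obtain a dominating
   function, here for \<open>qdom\<close>.\<close>
 have "\<exists>v\<in>borel_measurable M. EX H. integrable M H \<and> (AE y in M. (ALL k. norm (f y * w k y) powr 1 <= H y) \<and> (%k. f y * w k y) ----> v y)"
 proof (rule Lp_fast_dominated[OF q(3)])
  show "(%y. f y * w k y) \<in> borel_measurable M" for k using cm(1) by measurable
  obtain C0 where C0: "!!y. \<bar>w 0 y\<bar> <= C0" using cpt_smooth_bounded[OF cw] by blast
  have "integrable M (%y. f y * w 0 y)"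
  proof (rule Bochner_Integration.integrable_bound)
   show "integrable M (%y. f y * C0)" using f_integrable by simp
   show "(%y. f y * w 0 y) \<in> borel_measurable M" using cm(1) by measurable
   have "\<bar>w 0 y\<bar> <= \<bar>C0\<bar>" for y using C0[of y] by linarith
   then show "AE y in M. norm (f y * w 0 y) <= norm (f y * C0)" by (intro AE_I2) (simp add: abs_mult mult_left_mono)
  qed
  then have "integrable M (%y. \<bar>f y * w 0 y\<bar>)" by (rule integrable_abs)
  then show "integrable M (%y. norm (f y * w 0 y) powr 1)" by simp
  show "(\<integral>\<^sup>+y. ennreal (norm (f y * w k y - f y * w l y) powr 1) \<partial>M) <= ennreal (((1/2) powr (1 + 1)) ^ k)" if "k <= l" for k l
  proof (rule nn)
   have e: "norm (f y * w k y - f y * w l y) powr 1 = \<bar>f y\<bar> * \<bar>w k y - w l y\<bar>" for y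
    by (simp add: abs_mult[symmetric] right_diff_distrib)
   show "integrable M (%y. norm (f y * w k y - f y * w l y) powr 1)" "(LINT y|M. norm (f y * w k y - f y * w l y) powr 1) <= dl k"
    unfolding e using dif(3,4)[OF that] by auto
  qed (use rr in auto)
 qed
 then obtain H5 where 5: "integrable M H5" "AE y in M. ALL k. norm (f y * w k y) powr 1 <= H5 y" by (auto elim!: eventually_mono)
 have "pdom w (%k. grad (w k)) w u G t"
 proof (rule pdomI[of _ _ _ _ _ _ "%y. H1 y + H2 y" H3])
  show "AE y in M. (ALL k. \<bar>w k y\<bar> powr p <= H1 y + H2 y \<and> norm (grad (w k) y) powr p <= H1 y + H2 y) \<and> (%k. w k y) ----> u y \<and> (%k. grad (w k) y) ----> G y"
   using 1(3) 2(3)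
  proof eventually_elim
   case (elim y)
   have "0 <= H1 y" "0 <= H2 y" using elim order_trans[OF powr_ge_zero] by blast+
   then show ?case using elim by (auto intro: add_increasing add_increasing2)
  qed
 qed (use cm 1 2 3 in auto)
 moreover have "qdom w w" unfolding qdom_def
 proof (intro exI conjI)
  show "AE y in M. ALL k. \<bar>f y\<bar> * \<bar>w k y\<bar> <= H5 y" using 5(2) by eventually_elim (simp add: abs_mult)
  show "AE y in B. ALL k. \<bar>w k y\<bar> powr (s + 1) <= H4 y" using 4(2) by eventually_elim simp
 qed (rule 5(1) 4(1))+
 ultimately have gd: "good w u G t" using cw by (simp add: good_def tdom_def)
 have "TT z (grad z) z (%y. z y - u y) (%y. grad z y - G y) (%y. z y - t y) >= 0" if z: "z \<in> CR R" for z
 proof -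
  obtain c where c: "c > 0" "!!y. y \<in> closure \<Omega> ==> z y >= c" and cz: "cpt_smooth z" using z by (auto simp: S0_def CR_def)
  have tw: "tdom w (%k. grad (w k)) w u G t" using gd by (simp add: good_def)
  have "(%k. TT z (grad z) z (%y. 1 * z y + (-1) * w k y) (%y. 1 *\<^sub>R grad z y + (-1) *\<^sub>R grad (w k) y) (%y. 1 * z y + (-1) * w k y))
   ----> TT z (grad z) z (%y. 1 * z y + (-1) * u y) (%y. 1 *\<^sub>R grad z y + (-1) *\<^sub>R G y) (%y. 1 * z y + (-1) * t y)"
  proof (rule TT_tendsto[OF cpt_tdom[OF cz] tdom_lin[OF cpt_tdom[OF cz] tw] c(1)])
   show "AE y in M. \<forall>k::nat. c <= z y" using AE_space by eventually_elim (use c closure_points in auto)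
   show "AE y in B. \<forall>k::nat. c <= z y" using AE_space by eventually_elim (use c closure_points in auto)
  qed
  then have L: "(%k. LL z (w k)) ----> TT z (grad z) z (%y. z y - u y) (%y. grad z y - G y) (%y. z y - t y)" by (simp add: LL_def)
  have low: "- ep <= TT z (grad z) z (%y. z y - u y) (%y. grad z y - G y) (%y. z y - t y)" if "ep > 0" for ep
  proof (rule LIMSEQ_le_const[OF L])
   from x3[OF z that] obtain K where K: "\<forall>k\<ge>K. LL z (x k) >= - ep" ..
   then have "- ep <= LL z (w n)" if "n >= K" for n unfolding w_def using that ij[of n] K by simp
   then show "EX N. \<forall>n\<ge>N. - ep <= LL z (w n)" by blast
  qed
  show ?thesis
  proof (rule ccontr)
   assume "\<not> ?thesis"
   then show False using low[of "- TT z (grad z) z (%y. z y - u y) (%y. grad z y - G y) (%y. z y - t y) / 2"] by linarith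
  qed
 qed
 then show ?thesis using gd wC by blast
qed

end

section \<open>Absorbing the source term, Fatou for singular terms, and perturbed directions\<close>

lemma powr_sublinear:
 fixes dl th :: real
 assumes "0 < th" "th < 1" "dl > 0"
 shows "\<exists>C>0. \<forall>x\<ge>0. x powr th <= dl * x + C"
proof (intro exI[of _ "((1/dl) powr (1 / (1 - th))) powr th"] conjI allI impI)
 \<comment> \<open>The point where x^th equals dl x; beyond it the linear term dominates.\<close>
 let ?T = "(1/dl) powr (1 / (1 - th))"
 have T: "?T > 0" using assms by simp
 show "0 < ?T powr th" using T by simp
 fix x :: real assume x: "x >= 0"
 show "x powr th <= dl * x + ?T powr th"
 proof (cases "x <= ?T")
  case True
  then have "x powr th <= ?T powr th" using x assms by (intro powr_mono2) auto
  moreover have "0 <= dl * x" using x assms by simp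
  ultimately show ?thesis by linarith
 next
  case False
  then have xT: "?T < x" by simp
  then have x0: "x > 0" using T by linarith
  have "x powr th = x powr (- (1 - th)) * x" using powr_add[of x "- (1 - th)" 1] x0 by simp
  also have "... <= ?T powr (- (1 - th)) * x"
   by (intro mult_right_mono powr_mono2' less_imp_le[OF x0]) (use xT T assms in auto)
  also have "?T powr (- (1 - th)) = dl"
  proof -
   have e: "1 / (1 - th) * (- (1 - th)) = - 1" using assms by (simp add: field_simps)
   show ?thesis unfolding powr_powr e using assms by (simp add: powr_minus)
  qed
  finally show ?thesis using powr_ge_zero[of ?T th] by linarith
 qed
qed

text \<open>Fatou along a sequence of shifts tending to 0. Where h > 0 and v = 0 the shifted
  integrands blow up, so finiteness of the integral of the lower limit excludes such points almost
  everywhere.\<close>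

lemma singular_limit_integrable:
 fixes h v :: "'x => real"
 assumes [measurable]: "h \<in> borel_measurable N" "v \<in> borel_measurable N"
  and nn: "AE y in N. h y >= 0" "AE y in N. v y >= 0" and q: "q > 0" and e0: "e0 > 0"
  and le: "!!ep. 0 < ep ==> ep <= e0 ==> integrable N (%y. h y * (v y + ep) powr (- q))"
   "!!ep. 0 < ep ==> ep <= e0 ==> (LINT y|N. h y * (v y + ep) powr (- q)) <= K"
 shows "AE y in N. h y > 0 --> v y > 0" "integrable N (%y. h y * v y powr (- q))"
proof -
 define e where "e n = e0 / real (Suc n)" for n
 have e: "0 < e n" "e n <= e0" for n using e0 by (auto simp: e_def divide_simps mult_le_cancel_left1)
 have e_lim: "e ----> 0" unfolding e_def[abs_def] by (rule LIMSEQ_Suc[OF lim_const_over_n])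
 define F where "F n y = ennreal (h y * (v y + e n) powr (- q))" for n y
 have [measurable]: "F n \<in> borel_measurable N" for n unfolding F_def by measurable
 have Fi: "(\<integral>\<^sup>+y. F n y \<partial>N) <= ennreal K" for n
 proof -
  have "(\<integral>\<^sup>+y. F n y \<partial>N) = ennreal (LINT y|N. h y * (v y + e n) powr (- q))"
   unfolding F_def by (rule nn_integral_eq_integral[OF le(1)[OF e]]) (use nn(1) in "eventually_elim, simp")
  then show ?thesis using le(2)[OF e] by (simp add: ennreal_leI)
 qed
 have "(\<integral>\<^sup>+y. liminf (%n. F n y) \<partial>N) <= liminf (%n. \<integral>\<^sup>+y. F n y \<partial>N)" by (rule nn_integral_liminf) measurable
 also have "... <= liminf (%n::nat. ennreal K)" by (rule Liminf_mono) (simp add: Fi)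
 also have "... = ennreal K" by (simp add: Liminf_const)
 finally have I: "(\<integral>\<^sup>+y. liminf (%n. F n y) \<partial>N) <= ennreal K" .
 then have "(\<integral>\<^sup>+y. liminf (%n. F n y) \<partial>N) ~= \<infinity>" by (auto simp: top_unique)
 then have fin: "AE y in N. liminf (%n. F n y) ~= \<infinity>" by (intro nn_integral_PInf_AE) measurable
 have main: "AE y in N. (h y > 0 --> v y > 0) \<and> ennreal (h y * v y powr (- q)) <= liminf (%n. F n y)"
  using fin nn
 proof eventually_elim
  case (elim y)
  show ?case
  proof (cases "h y = 0")
   case False
   then have h: "h y > 0" using elim by simp
   have v: "v y > 0"
   proof (rule ccontr)
    assume "\<not> v y > 0"
    then have v0: "v y = 0" using elim by simp
    have "filterlim (%n. h y * (e n) powr (- q)) at_top sequentially"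
    proof (rule filterlim_tendsto_pos_mult_at_top[OF tendsto_const h])
     have "filterlim (%n. inverse (e n powr q)) at_top sequentially"
     proof (rule filterlim_compose[OF filterlim_inverse_at_top_right])
      have "(%n. e n powr q) ----> 0 powr q"
       by (intro tendsto_powr' e_lim tendsto_const) (use q less_imp_le[OF e(1)] in simp)
      then show "filterlim (%n. e n powr q) (at_right 0) sequentially"
       using less_imp_neq[OF e(1)] q by (auto simp: filterlim_at intro!: always_eventually)
     qed
     then show "filterlim (%n. e n powr (- q)) at_top sequentially" by (simp add: powr_minus)
    qed
    then have "(%n. F n y) ----> \<infinity>" unfolding F_def using v0
     by (simp add: ennreal_tendsto_top_eq_at_top)
    then have "liminf (%n. F n y) = \<infinity>" by (rule lim_imp_Liminf[OF sequentially_bot])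
    then show False using elim by simp
   qed
   have "(%n. h y * (v y + e n) powr (- q)) ----> h y * (v y + 0) powr (- q)"
    using v by (intro tendsto_mult tendsto_powr tendsto_add e_lim tendsto_const) auto
   then have "(%n. F n y) ----> ennreal (h y * v y powr (- q))" unfolding F_def by (intro tendsto_ennrealI) simp
   then have "liminf (%n. F n y) = ennreal (h y * v y powr (- q))" by (rule lim_imp_Liminf[OF sequentially_bot])
   then show ?thesis using v by simp
  qed simp
 qed
 then show "AE y in N. h y > 0 --> v y > 0" by eventually_elim blast
 show "integrable N (%y. h y * v y powr (- q))"
 proof (rule integrableI_nonneg)
  show "AE y in N. 0 <= h y * v y powr (- q)" using nn(1) by eventually_elim simp
  have "(\<integral>\<^sup>+y. ennreal (h y * v y powr (- q)) \<partial>N) <= (\<integral>\<^sup>+y. liminf (%n. F n y) \<partial>N)"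
   by (rule nn_integral_mono_AE) (use main in "eventually_elim, blast")
  also have "... <= ennreal K" by (rule I)
  finally show "(\<integral>\<^sup>+y. ennreal (h y * v y powr (- q)) \<partial>N) < \<infinity>" by (auto simp: less_top[symmetric] top_unique)
 qed measurable
qed

lemma norm_perturb_powr_le:
 fixes x z :: "'b::real_normed_vector"
 assumes e: "\<bar>e\<bar> <= 1" and "norm x powr q <= a" "norm z powr q <= b" "q > 0"
 shows "norm (x + e *\<^sub>R z) powr q <= 2 powr q * (a + b)"
proof -
 have "norm (1 *\<^sub>R x + e *\<^sub>R z) powr q <= 2 powr q * (\<bar>1\<bar> powr q * a + \<bar>e\<bar> powr q * b)"
  by (rule norm_combination_powr_le) (use assms in auto)
 also have "... <= 2 powr q * (a + b)"
 proof (intro mult_left_mono add_mono)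
  have "b >= 0" using assms(3) order_trans[OF powr_ge_zero] by blast
  moreover have "\<bar>e\<bar> powr q <= 1" using assms by (intro powr_le1) auto
  ultimately show "\<bar>e\<bar> powr q * b <= b" by (simp add: mult_left_le_one_le)
 qed auto
 finally show ?thesis by simp
qed

context singular_problem
begin

text \<open>The pairing with f grows at most like the energy to the power 1/q with q = min p (s+1) >
  1. Being sublinear, it is absorbed by an arbitrarily small multiple of the energy.\<close>

lemma f_energy_bound:
 assumes dl: "dl > 0"
 shows "\<exists>C>0. ALL w. cpt_smooth w --> (LINT y|M. \<bar>f y\<bar> * \<bar>w y\<bar>) <= dl * energy w + C"
proof -
 obtain C where C: "C > 0" "!!w. cpt_smooth w ==> energy w <= 1 ==>
   (LINT y|M. \<bar>w y\<bar> powr p) <= C \<and> (LINT y|B. \<bar>w y\<bar> powr p) <= C \<and> integrable M (%y. \<bar>f y\<bar> * \<bar>w y\<bar>) \<and> (LINT y|M. \<bar>f y\<bar> * \<bar>w y\<bar>) <= C"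
  using unit_energy_bounds[OF f(1)] by blast
 define q where "q = min p (s + 1)"
 have q: "q > 1" using p1 s1 by (simp add: q_def)
 obtain C' where C': "C' > 0" "!!x. x >= 0 ==> x powr (1 / q) <= dl / C * x + C'"
  using powr_sublinear[of "1 / q" "dl / C"] q dl C(1) by auto
 have "(LINT y|M. \<bar>f y\<bar> * \<bar>w y\<bar>) <= dl * energy w + (C + C * C')" if w: "cpt_smooth w" for w
 proof -
  \<comment> \<open>Chosen so that w/a has energy at most 1; the maximum with 1 is needed because
    \<open>energy_scale\<close> requires a \<ge> 1.\<close>
  define a where "a = max 1 (energy w powr (1 / q))"
  have a: "a >= 1" "a > 0" by (auto simp: a_def)
  have "energy w = (energy w powr (1 / q)) powr q" using q energy_nonneg[of w] by (simp add: powr_powr)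
  also have "... <= a powr q" using q by (intro powr_mono2) (auto simp: a_def)
  finally have "energy w <= a powr q" .
  then have "inverse a powr q * energy w <= inverse a powr q * a powr q" by (intro mult_left_mono) auto
  also have "... = 1" using a by (simp add: powr_mult[symmetric])
  finally have "energy (%x. inverse a * w x) <= 1" using energy_scale(2)[OF w a(1)] by (simp add: q_def)
  then have "(LINT y|M. \<bar>f y\<bar> * \<bar>inverse a * w y\<bar>) <= C" using C(2)[OF cpt_smooth_scale[OF w]] by blast
  moreover have "(%y. \<bar>f y\<bar> * \<bar>w y\<bar>) = (%y. a * (\<bar>f y\<bar> * \<bar>inverse a * w y\<bar>))"
   using a(2) by (intro ext) (simp add: abs_mult)
  ultimately have "(LINT y|M. \<bar>f y\<bar> * \<bar>w y\<bar>) <= a * C" using a(2) by (simp only: integral_mult_right_zero) simp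
  also have "... <= (1 + (dl / C * energy w + C')) * C"
  proof (rule mult_right_mono)
   show "a <= 1 + (dl / C * energy w + C')"
    using C'(2)[OF energy_nonneg[of w]] powr_ge_zero[of "energy w" "1 / q"] unfolding a_def by linarith
  qed (use C in simp)
  also have "... = dl * energy w + (C + C * C')" using C(1) by (simp add: field_simps)
  finally show ?thesis .
 qed
 moreover have "C + C * C' > 0" using C(1) C'(1) by (simp add: add_pos_pos)
 ultimately show ?thesis by blast
qed

lemma good_lin:
 assumes a: "good w u G t" and b: "good xi v D ta"
 shows "good (%k y. c * w k y + d * xi k y) (%y. c * u y + d * v y) (%y. c *\<^sub>R G y + d *\<^sub>R D y) (%y. c * t y + d * ta y)"
proof -
 have s: "!!k. cpt_smooth (w k)" "!!k. cpt_smooth (xi k)" using a b by (auto simp: good_def)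
 have g: "grad (%y. c * w k y + d * xi k y) = (%y. c *\<^sub>R grad (w k) y + d *\<^sub>R grad (xi k) y)" for k
  by (rule ext) (rule cpt_smooth_lin(2)[OF s(1)[of k] s(2)[of k]])
 show ?thesis unfolding good_def g using tdom_lin[of w "%k. grad (w k)" w u G t xi "%k. grad (xi k)" xi v D ta c d] a b cpt_smooth_lin(1)[OF s]
  by (simp add: good_def)
qed

lemma good_const: "cpt_smooth z ==> good (%k. z) z (grad z) z"
 using cpt_tdom by (simp add: good_def)

lemma tdom_perturb:
 assumes a: "tdom_const u G t" and b: "tdom_const v D ta"
  and e: "!!n. \<bar>e n\<bar> <= 1" "e ----> (0::real)"
 shows "tdom (%n y. u y + e n * v y) (%n y. G y + e n *\<^sub>R D y) (%n y. t y + e n * ta y) u G t"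
proof -
 have pa: "pdom (%_. u) (%_. G) (%_. t) u G t" and pb: "pdom (%_. v) (%_. D) (%_. ta) v D ta" using a b by (auto simp: tdom_def)
 note [measurable] = pdom_measurable(4-6)[OF pa] pdom_measurable(4-6)[OF pb]
 obtain H1 where H1: "integrable M H1" "AE y in M. (\<forall>k::nat. \<bar>u y\<bar> powr p <= H1 y \<and> norm (G y) powr p <= H1 y) \<and>
  (%k. u y) ----> u y \<and> (%k. G y) ----> G y" by (rule pdom_M[OF pa])
 obtain H2 where H2: "integrable M H2" "AE y in M. (\<forall>k::nat. \<bar>v y\<bar> powr p <= H2 y \<and> norm (D y) powr p <= H2 y) \<and>
  (%k. v y) ----> v y \<and> (%k. D y) ----> D y" by (rule pdom_M[OF pb])
 obtain K1 where K1: "integrable B K1" "AE y in B. (\<forall>k::nat. \<bar>t y\<bar> powr p <= K1 y) \<and> (%k. t y) ----> t y" by (rule pdom_B[OF pa])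
 obtain K2 where K2: "integrable B K2" "AE y in B. (\<forall>k::nat. \<bar>ta y\<bar> powr p <= K2 y) \<and> (%k. ta y) ----> ta y" by (rule pdom_B[OF pb])
 obtain H3 K3 where 3: "integrable M H3" "integrable B K3" "AE y in M. \<forall>k::nat. \<bar>f y\<bar> * \<bar>u y\<bar> <= H3 y" "AE y in B. \<forall>k::nat. \<bar>t y\<bar> powr (s + 1) <= K3 y"
  using a unfolding tdom_def qdom_def by blast
 obtain H4 K4 where 4: "integrable M H4" "integrable B K4" "AE y in M. \<forall>k::nat. \<bar>f y\<bar> * \<bar>v y\<bar> <= H4 y" "AE y in B. \<forall>k::nat. \<bar>ta y\<bar> powr (s + 1) <= K4 y"
  using b unfolding tdom_def qdom_def by blast
 note comb = norm_perturb_powr_le[OF e(1)]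
 have combr: "\<bar>x + e n * z\<bar> powr q <= 2 powr q * (a + b)" if "\<bar>x\<bar> powr q <= a" "\<bar>z\<bar> powr q <= b" "q > 0" for x z q a b n
  using comb[of x q a z b n] that by simp
 have "pdom (%n y. u y + e n * v y) (%n y. G y + e n *\<^sub>R D y) (%n y. t y + e n * ta y) u G t"
 proof (rule pdomI[of _ _ _ _ _ _ "%y. 2 powr p * (H1 y + H2 y)" "%y. 2 powr p * (K1 y + K2 y)"])
  show "AE y in M. (ALL k. \<bar>u y + e k * v y\<bar> powr p <= 2 powr p * (H1 y + H2 y) \<and> norm (G y + e k *\<^sub>R D y) powr p <= 2 powr p * (H1 y + H2 y)) \<and>
   (%k. u y + e k * v y) ----> u y \<and> (%k. G y + e k *\<^sub>R D y) ----> G y"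
   using H1(2) H2(2)
  proof eventually_elim
   case (elim y)
   have "(%k. u y + e k * v y) ----> u y + 0 * v y" "(%k. G y + e k *\<^sub>R D y) ----> G y + 0 *\<^sub>R D y" by (intro tendsto_intros e(2))+
   then show ?case using elim p1 by (auto intro!: combr comb)
  qed
  show "AE y in B. (ALL k. \<bar>t y + e k * ta y\<bar> powr p <= 2 powr p * (K1 y + K2 y)) \<and> (%k. t y + e k * ta y) ----> t y"
   using K1(2) K2(2)
  proof eventually_elim
   case (elim y)
   have "(%k. t y + e k * ta y) ----> t y + 0 * ta y" by (intro tendsto_intros e(2))
   then show ?case using elim p1 by (auto intro!: combr)
  qed
 qed (use H1(1) H2(1) K1(1) K2(1) in "auto intro: measurable")
 moreover have "qdom (%n y. u y + e n * v y) (%n y. t y + e n * ta y)" unfolding qdom_def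
 proof (intro exI conjI)
  show "integrable M (%y. H3 y + H4 y)" "integrable B (%y. 2 powr (s + 1) * (K3 y + K4 y))" using 3 4 by auto
  show "AE y in M. ALL k. \<bar>f y\<bar> * \<bar>u y + e k * v y\<bar> <= H3 y + H4 y"
   using 3(3) 4(3)
  proof eventually_elim
   case (elim y)
   have "\<bar>f y\<bar> * \<bar>u y + e k * v y\<bar> <= H3 y + H4 y" for k
   proof -
    have "\<bar>e k\<bar> * \<bar>v y\<bar> <= \<bar>v y\<bar>" using e(1)[of k] by (simp add: mult_left_le_one_le)
    then have "\<bar>u y + e k * v y\<bar> <= \<bar>u y\<bar> + \<bar>v y\<bar>" using abs_triangle_ineq[of "u y" "e k * v y"] by (simp add: abs_mult)
    then have "\<bar>f y\<bar> * \<bar>u y + e k * v y\<bar> <= \<bar>f y\<bar> * (\<bar>u y\<bar> + \<bar>v y\<bar>)" by (rule mult_left_mono) simp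
    also have "... <= H3 y + H4 y" using elim by (auto simp: distrib_left intro: add_mono)
    finally show ?thesis .
   qed
   then show ?case by blast
  qed
  show "AE y in B. ALL k. \<bar>t y + e k * ta y\<bar> powr (s + 1) <= 2 powr (s + 1) * (K3 y + K4 y)"
   using 3(4) 4(4) by eventually_elim (use s1 in "auto intro!: combr")
 qed
 ultimately show ?thesis by (simp add: tdom_def)
qed

end

section \<open>Properties of the limit\<close>

locale minty_point = singular_problem +
 fixes R :: real and w :: "nat => 'a => real" and u :: "'a => real" and G :: "'a => 'a" and t :: "'a => real"
 assumes gd: "good w u G t" and wC: "!!k. w k \<in> CR R"
  and mi: "!!z. z \<in> CR R ==> TT z (grad z) z (%y. z y - u y) (%y. grad z y - G y) (%y. z y - t y) >= 0"
begin

abbreviation (input) TT_shift where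
 "TT_shift ep xi' D ta \<equiv> TT (%y. u y + ep * xi' y) (%y. G y + ep *\<^sub>R D y) (%y. t y + ep * ta y)"

lemma w_pos: "y \<in> closure \<Omega> ==> w k y > 0" and w_cpt: "cpt_smooth (w k)" and w_energy: "energy (w k) <= R"
 using wC[of k] by (auto simp: CR_def S0_def intro: less_le_trans)

lemma wtdom: "tdom w (%k. grad (w k)) w u G t" using gd by (simp add: good_def)

lemma utdom: "tdom_const u G t" by (rule tdom_limit[OF wtdom])

lemma upd: "pdom (%_. u) (%_. G) (%_. t) u G t" using utdom by (simp add: tdom_def)

lemma ut_nonneg: "AE y in M. u y >= 0" "AE y in B. t y >= 0"
proof -
 have p: "pdom w (%k. grad (w k)) w u G t" using wtdom by (simp add: tdom_def)
 have c1: "AE y in M. (%k. w k y) ----> u y" by (rule pdom_M[OF p]) (auto elim!: eventually_mono)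
 have c2: "AE y in B. (%k. w k y) ----> t y" by (rule pdom_B[OF p]) (auto elim!: eventually_mono)
 show "AE y in M. u y >= 0" using c1 AE_space
 proof eventually_elim
  case (elim y)
  have "0 <= w k y" for k using w_pos[of y k] closure_points elim by simp
  then show ?case by (intro LIMSEQ_le_const[OF elim(1)]) simp
 qed
 show "AE y in B. t y >= 0" using c2 AE_space
 proof eventually_elim
  case (elim y)
  have "0 <= w k y" for k using w_pos[of y k] closure_points elim by simp
  then show ?case by (intro LIMSEQ_le_const[OF elim(1)]) simp
 qed
qed

text \<open>Minty's device: the inequality is tested at w k + ep xi k, passed to the limit, and
  divided by ep. Only directions are allowed for which w k + xi k is bounded below by a positive
  constant.\<close>

lemma variational_inequality:
 assumes xi: "good xi xi' D ta" and c: "c > 0" "!!k y. y \<in> closure \<Omega> ==> w k y + xi k y >= c" and e: "0 < ep" "ep <= 1"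
  and en: "eventually (%k. energy (%y. w k y + ep * xi k y) <= R) sequentially"
 shows "TT_shift ep xi' D ta xi' D ta >= 0"
proof -
 define v where "v k = (%y. w k y + ep * xi k y)" for k
 have gv: "good v (%y. u y + ep * xi' y) (%y. G y + ep *\<^sub>R D y) (%y. t y + ep * ta y)"
  using good_lin[OF gd xi, of 1 ep] by (simp add: v_def[abs_def])
 then have tv: "tdom v (%k. grad (v k)) v (%y. u y + ep * xi' y) (%y. G y + ep *\<^sub>R D y) (%y. t y + ep * ta y)" and cv: "!!k. cpt_smooth (v k)"
  by (auto simp: good_def)
 \<comment> \<open>The test point is the convex combination (1 - ep) w k + ep (w k + xi k), which is
   at least ep c.\<close>
 have low: "ep * c <= v k y" if y: "y \<in> closure \<Omega>" for k y
 proof -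
  have "ep * c <= ep * (w k y + xi k y)" using c(2)[OF y] e by (intro mult_left_mono) auto
  moreover have "0 <= (1 - ep) * w k y" using w_pos[OF y, of k] e by simp
  ultimately show ?thesis by (simp add: v_def algebra_simps)
 qed
 have c0: "ep * c > 0" using c e by simp
 have vS: "v k \<in> S0" for k using cv low c0 unfolding S0_def by blast
 let ?T = "%k. TT (v k) (grad (v k)) (v k) (%y. v k y - u y) (%y. grad (v k) y - G y) (%y. v k y - t y)"
 have ev: "eventually (%k. 0 <= ?T k) sequentially" using en
 proof eventually_elim
  case (elim k)
  then show ?case using vS[of k] by (intro mi) (simp add: CR_def v_def)
 qed
 have "(%k. TT (v k) (grad (v k)) (v k) (%y. 1 * v k y + (-1) * u y) (%y. 1 *\<^sub>R grad (v k) y + (-1) *\<^sub>R G y) (%y. 1 * v k y + (-1) * t y))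
  ----> TT_shift ep xi' D ta (%y. 1 * (u y + ep * xi' y) + (-1) * u y)
    (%y. 1 *\<^sub>R (G y + ep *\<^sub>R D y) + (-1) *\<^sub>R G y) (%y. 1 * (t y + ep * ta y) + (-1) * t y)"
 proof (rule TT_tendsto[OF tv tdom_lin[OF tv utdom] c0])
  show "AE y in M. ALL k. ep * c <= v k y" using AE_space by eventually_elim (use low closure_points in auto)
  show "AE y in B. ALL k. ep * c <= v k y" using AE_space by eventually_elim (use low closure_points in auto)
 qed
 then have "?T ----> TT_shift ep xi' D ta (%y. ep * xi' y) (%y. ep *\<^sub>R D y) (%y. ep * ta y)"
  by simp
 then have "0 <= TT_shift ep xi' D ta (%y. ep * xi' y) (%y. ep *\<^sub>R D y) (%y. ep * ta y)"
  by (rule tendsto_lowerbound[OF _ ev]) simp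
 also have "... = ep * TT_shift ep xi' D ta xi' D ta"
  unfolding TT_def by (simp add: mult.left_commute[of _ ep] right_diff_distrib distrib_left)
 finally show ?thesis using e by (simp add: zero_le_mult_iff)
qed

end

text \<open>Since v + e xi = (1 - e) v + e (v + xi), a shift with e \<le> 1/2 leaves at least v/2.
  The singular factor is then at most 2^q v^(-q), whose product with h is integrable.\<close>

lemma singular_term_tendsto:
 fixes h v xi :: "'x => real"
 assumes [measurable]: "h \<in> borel_measurable N" "v \<in> borel_measurable N" "xi \<in> borel_measurable N"
  and nn: "AE y in N. h y >= 0 \<and> (h y > 0 --> v y > 0)" and i: "integrable N (%y. h y * v y powr (- q))"
  and b: "AE y in N. \<bar>xi y\<bar> <= m \<and> v y + xi y >= 0" and q: "q > 0" and e: "!!n. 0 < e n" "!!n. e n <= 1/2" "e ----> (0::real)"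
 shows "(%n. \<integral>y. h y * (v y + e n * xi y) powr (- q) * xi y \<partial>N) ----> (LINT y|N. h y * v y powr (- q) * xi y)"
proof -
 let ?H = "%y. 2 powr q * m * (h y * v y powr (- q))"
 have H: "integrable N ?H" using i by simp
 have AE: "AE y in N. (ALL n. \<bar>h y * (v y + e n * xi y) powr (- q) * xi y\<bar> <= ?H y) \<and>
   (%n. h y * (v y + e n * xi y) powr (- q) * xi y) ----> h y * v y powr (- q) * xi y"
  using nn b
 proof eventually_elim
  case (elim y)
  show ?case
  proof (cases "h y = 0")
   case False
   then have h: "h y > 0" and v: "v y > 0" using elim by auto
   have "\<bar>h y * (v y + e n * xi y) powr (- q) * xi y\<bar> <= ?H y" for n
   proof -
    have "0 <= e n * (v y + xi y)" using e(1)[of n] elim by simp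
    moreover have "e n * v y <= 1/2 * v y" using e(2)[of n] v by (intro mult_right_mono) auto
    ultimately have l: "v y / 2 <= v y + e n * xi y" by (simp add: distrib_left)
    have "(v y + e n * xi y) powr (- q) <= (v y / 2) powr (- q)" using l v q by (intro powr_mono2') auto
    also have "... = 2 powr q * v y powr (- q)"
    proof -
     have pd: "(v y / 2) powr q = v y powr q / 2 powr q" using v by (simp add: powr_divide)
     show ?thesis by (simp only: powr_minus pd inverse_divide) (simp only: divide_inverse)
    qed
    finally have "h y * (v y + e n * xi y) powr (- q) * \<bar>xi y\<bar> <= h y * (2 powr q * v y powr (- q)) * m"
     using elim h by (intro mult_mono) auto
    then show ?thesis using h by (simp add: abs_mult mult_ac)
   qed
   moreover have "(%n. h y * (v y + e n * xi y) powr (- q) * xi y) ----> h y * (v y + 0 * xi y) powr (- q) * xi y"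
    using v by (intro tendsto_mult tendsto_powr tendsto_add tendsto_const e(3)) auto
   ultimately show ?thesis by simp
  qed simp
 qed
 show ?thesis by (rule dominated_tendsto(3)[OF _ _ H AE]) measurable
qed

section \<open>The a priori bound on the energy\<close>

context singular_problem
begin

text \<open>A fixed stand-in for the constant 1: it equals 1 with vanishing gradient on the closure,
  and it is compactly supported.\<close>

definition ct where "ct = (SOME z. cpt_smooth z \<and> (\<forall>x\<in>closure \<Omega>. z x = 1 \<and> grad z x = 0))"

lemma ct: "cpt_smooth ct" "x \<in> closure \<Omega> ==> ct x = 1" "x \<in> closure \<Omega> ==> grad ct x = 0"
proof -
 have "EX z. cpt_smooth z \<and> (\<forall>x\<in>closure \<Omega>. z x = 1 \<and> grad z x = 0)" using bd by (intro smooth_cutoff bounded_closure)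
 from someI_ex[OF this] show "cpt_smooth ct" "x \<in> closure \<Omega> ==> ct x = 1" "x \<in> closure \<Omega> ==> grad ct x = 0" by (auto simp: ct_def)
qed

lemma ct_AE: "AE y in M. ct y = 1 \<and> grad ct y = 0" "AE y in B. ct y = 1"
proof -
 show "AE y in M. ct y = 1 \<and> grad ct y = 0" using AE_space by eventually_elim (use ct closure_points in auto)
 show "AE y in B. ct y = 1" using AE_space by eventually_elim (use ct closure_points in auto)
qed

text \<open>The smaller of the coercivity factors for the gradient and the boundary part when the
  operator at (1 + u)/2 is applied to 1 - u. The powers of 1/2 come from the halving of u.\<close>

definition kp0 where "kp0 = min (2 * \<alpha> * (1/2) powr p) (1/2 * (1/2) powr (s + 1))"
text \<open>Collects the additive constants of \<open>boundary_coercive\<close>: 2 \<Lambda> from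
  the Robin term, 2 * 2^s from the power term, and the rest from the term with g.\<close>

definition CB where "CB = 2 * \<Lambda> + 2 * 2 powr s + 1/2 + 2 * \<Lambda>\<^sup>2"

lemma kp0: "kp0 > 0" using coerc(1) by (simp add: kp0_def)

text \<open>With r = (1 + t)/2 one has 1 - t = 2(1 - r). The power term contributes -r^(s+1) plus a
  constant; half of it absorbs the linear growth of the term with g, and the other half is the
  coercive part.\<close>

lemma boundary_coercive:
 assumes t: "t >= 0" and lam: "0 <= lam y" "\<bar>lam y\<bar> <= \<Lambda>" and g: "0 <= g y" "\<bar>g y\<bar> <= \<Lambda>"
 shows "bdry y ((1 + t) / 2) * (1 - t) - g y * ((1 + t) / 2) powr (- \<eta>) * (1 - t) <= CB - 1/2 * (1/2) powr (s + 1) * t powr (s + 1)"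
proof -
 define r where "r = (1 + t) / 2"
 have r: "r > 0" "1 - t = 2 * (1 - r)" "t <= 2 * r" using t by (auto simp: r_def field_simps)
 have 1: "lam y * (r powr (p - 1) * (1 - r)) <= \<Lambda>"
 proof (cases "r >= 1")
  case True
  then have "lam y * (r powr (p - 1) * (1 - r)) <= 0" using lam by (intro mult_nonneg_nonpos) auto
  then show ?thesis using Lambda(1) by linarith
 next
  case False
  then have "r powr (p - 1) * (1 - r) <= 1 * 1" using r p1 by (intro mult_mono powr_le1) auto
  then have "lam y * (r powr (p - 1) * (1 - r)) <= lam y * 1" using lam by (intro mult_left_mono) auto
  then show ?thesis using lam by linarith
 qed
 have rs: "r powr s * r = r powr (s + 1)" using r by (simp add: powr_add)
 \<comment> \<open>Equivalent to r^s (1 - r/2) \<le> 2^s: for r \<le> 2 the bracket is at most 1,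
   beyond that it is negative.\<close>
 have 2: "r powr s * (1 - r) <= 2 powr s - 1/2 * r powr (s + 1)"
 proof -
  have "r powr s * (1 - r / 2) <= 2 powr s"
  proof (cases "r <= 2")
   case True
   then have "r powr s * (1 - r / 2) <= 2 powr s * 1" using r s1 by (intro mult_mono powr_mono2) auto
   then show ?thesis by simp
  next
   case False
   then have "r powr s * (1 - r / 2) <= 0" by (intro mult_nonneg_nonpos) auto
   then show ?thesis by (rule order_trans) simp
  qed
  then show ?thesis using rs by (simp add: algebra_simps)
 qed
 have b: "bdry y r * (1 - t) = 2 * (lam y * (r powr (p - 1) * (1 - r))) + 2 * (r powr s * (1 - r))"
  unfolding r(2) using r(1) by (simp add: bdry_def opow_nonneg algebra_simps)
 \<comment> \<open>For t \<ge> 1 the singular factor is at most 1; for t < 1 the term has the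
   favourable sign.\<close>
 have 3: "- (g y * r powr (- \<eta>) * (1 - t)) <= \<Lambda> * t"
 proof (cases "t >= 1")
  case True
  then have "r >= 1" by (simp add: r_def)
  then have "r powr (- \<eta>) <= 1 powr (- \<eta>)" using \<eta> by (intro powr_mono2') auto
  then have "g y * r powr (- \<eta>) * (t - 1) <= g y * 1 * t" using True g by (intro mult_mono) auto
  also have "... <= \<Lambda> * t" using g t by (simp add: mult_right_mono)
  finally show ?thesis by (simp add: algebra_simps)
 next
  case False
  then have "0 <= g y * r powr (- \<eta>) * (1 - t)" using g by simp
  moreover have "0 <= \<Lambda> * t" using Lambda(1) t by simp
  ultimately show ?thesis by linarith
 qed
 \<comment> \<open>Completing the square in r - 2 \<Lambda>; then r^2 \<le> 1 + r^(s+1) because s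
   \<ge> 1.\<close>
 have 4: "\<Lambda> * t <= 1/2 * r powr (s + 1) + 1/2 + 2 * \<Lambda>\<^sup>2"
 proof -
  have "\<Lambda> * t <= \<Lambda> * (2 * r)" using r Lambda(1) by (intro mult_left_mono) auto
  also have "... <= 1/2 * r\<^sup>2 + 2 * \<Lambda>\<^sup>2"
   using zero_le_power2[of "r - 2 * \<Lambda>"] by (simp add: power2_eq_square algebra_simps)
  also have "r\<^sup>2 <= 1 + r powr (s + 1)" using powr_le_one_add[of r 2 "s + 1"] r s1 by simp
  finally show ?thesis by (simp add: add_divide_distrib)
 qed
 have 5: "(1/2) powr (s + 1) * t powr (s + 1) <= r powr (s + 1)"
 proof -
  have "(1/2 * t) powr (s + 1) <= r powr (s + 1)" using t s1 r by (intro powr_mono2) auto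
  then show ?thesis by (simp add: powr_mult powr_divide)
 qed
 show ?thesis using 1 2 3 4 5 b unfolding r_def[symmetric] CB_def by linarith
qed

lemma good_cong:
 assumes "good w u G t" "AE y in M. u y = u' y" "AE y in M. G y = G' y" "AE y in B. t y = t' y"
  "u' \<in> borel_measurable M" "G' \<in> borel_measurable M" "t' \<in> borel_measurable B"
 shows "good w u' G' t'"
proof -
 have a: "pdom w (%k. grad (w k)) w u G t" "qdom w w" "!!k. cpt_smooth (w k)" using assms by (auto simp: good_def tdom_def)
 obtain H where H: "integrable M H" "dominated_M H w (%k. grad (w k)) u G" by (rule pdom_M[OF a(1)])
 obtain K where K: "integrable B K" "dominated_B K w t" by (rule pdom_B[OF a(1)])
 have "pdom w (%k. grad (w k)) w u' G' t'"
 proof (rule pdomI[of _ _ _ _ _ _ H K])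
  show "dominated_M H w (%k. grad (w k)) u' G'"
   using H(2) assms(2,3) by eventually_elim simp
  show "dominated_B K w t'" using K(2) assms(4) by eventually_elim simp
 qed (use assms H(1) K(1) pdom_measurable[OF a(1)] in auto)
 then show ?thesis using a by (simp add: good_def tdom_def)
qed

end

context minty_point
begin

lemma umeas [measurable]: "u \<in> borel_measurable M" "G \<in> borel_measurable M" "t \<in> borel_measurable B"
 using pdom_measurable(4-6)[OF upd] by auto

lemma fu_tendsto: "integrable M (%y. \<bar>f y\<bar> * \<bar>u y\<bar>)" "(%k. \<integral>y. \<bar>f y\<bar> * \<bar>w k y\<bar> \<partial>M) ----> (LINT y|M. \<bar>f y\<bar> * \<bar>u y\<bar>)"
proof -
 have p: "pdom w (%k. grad (w k)) w u G t" "qdom w w" using wtdom by (auto simp: tdom_def)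
 have c1: "AE y in M. (%k. w k y) ----> u y" by (rule pdom_M[OF p(1)]) (auto elim!: eventually_mono)
 obtain H where H: "integrable M H" "AE y in M. ALL k. \<bar>f y\<bar> * \<bar>w k y\<bar> <= H y" using p(2) unfolding qdom_def by blast
 note [measurable] = pdom_measurable[OF p(1)]
 have AE: "AE y in M. (ALL k. \<bar>\<bar>f y\<bar> * \<bar>w k y\<bar>\<bar> <= H y) \<and> (%k. \<bar>f y\<bar> * \<bar>w k y\<bar>) ----> \<bar>f y\<bar> * \<bar>u y\<bar>"
  using H(2) c1
 proof eventually_elim
  case (elim y)
  have "(%k. \<bar>f y\<bar> * \<bar>w k y\<bar>) ----> \<bar>f y\<bar> * \<bar>u y\<bar>" using elim by (intro tendsto_intros)
  then show ?case using elim by simp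
 qed
 show "integrable M (%y. \<bar>f y\<bar> * \<bar>u y\<bar>)" by (rule dominated_tendsto(1)[OF _ _ H(1) AE]) measurable
 show "(%k. \<integral>y. \<bar>f y\<bar> * \<bar>w k y\<bar> \<partial>M) ----> (LINT y|M. \<bar>f y\<bar> * \<bar>u y\<bar>)" by (rule dominated_tendsto(3)[OF _ _ H(1) AE]) measurable
qed

text \<open>Testing with 1 - u at the step 1/2 puts the operator at the point (1 + u)/2. It is at
  least 1/2, so the singular terms are harmless, and its gradient is G/2 while the direction has
  gradient -G, so coercivity applies. The bound does not depend on R.\<close>

lemma energy_apriori:
 assumes R: "energy ct <= R" and Cf: "!!w. cpt_smooth w ==> (LINT y|M. \<bar>f y\<bar> * \<bar>w y\<bar>) <= kp0 / 2 * energy w + Cf"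
 shows "EE G t <= 2 * (Cf + CB * measure B (space B)) / kp0"
proof -
 let ?xi = "%y. 1 * ct y + (-1) * u y" and ?D = "%y. 1 *\<^sub>R grad ct y + (-1) *\<^sub>R G y" and ?ta = "%y. 1 * ct y + (-1) * t y"
 let ?v = "%y. u y + 1/2 * ?xi y" and ?V = "%y. G y + (1/2) *\<^sub>R ?D y" and ?sg = "%y. t y + 1/2 * ?ta y"
 have gx: "good (%k y. 1 * ct y + (-1) * w k y) ?xi ?D ?ta" by (rule good_lin[OF good_const[OF ct(1)] gd])
 have T: "0 <= TT ?v ?V ?sg ?xi ?D ?ta"
 \<comment> \<open>The large step 1/2 is allowed because the shifted approximant is the midpoint of
   w k and \<open>ct\<close>, both of energy at most R. No strict bound on the energy of the limit
   is available yet.\<close>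
 proof (rule variational_inequality[OF gx, of 1 "1/2"])
  show "1 <= w k y + (1 * ct y + - 1 * w k y)" if "y \<in> closure \<Omega>" for k y using ct(2)[OF that] by simp
  have "energy (%y. w k y + 1 / 2 * (1 * ct y + - 1 * w k y)) <= R" for k
  proof -
   have "(%y. w k y + 1 / 2 * (1 * ct y + - 1 * w k y)) = cmb (1/2) (w k) ct" by (rule ext) (simp add: cmb_def algebra_simps)
   moreover have "energy (cmb (1/2) (w k) ct) <= (1 - 1/2) * energy (w k) + 1/2 * energy ct" by (rule energy_convex[OF w_cpt ct(1)]) auto
   ultimately show ?thesis using R w_energy[of k] by simp
  qed
  then show "\<forall>\<^sub>F k in sequentially. energy (%y. w k y + 1 / 2 * (1 * ct y + - 1 * w k y)) <= R" by simp
 qed auto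
 note cc = cpt_tdom[OF ct(1)]
 have tx: "tdom_const ?xi ?D ?ta" by (rule tdom_lin[OF cc utdom])
 have tv: "tdom_const ?v ?V ?sg" using tdom_lin[OF utdom tx, of 1 "1/2"] by (simp only: mult_1 scaleR_one)
 have c1: "AE y in M. \<forall>k::nat. 1/2 <= ?v y" using ct_AE(1) ut_nonneg(1) by eventually_elim (simp add: field_simps)
 have c2: "AE y in B. \<forall>k::nat. 1/2 <= ?sg y" using ct_AE(2) ut_nonneg(2) by eventually_elim (simp add: field_simps)
 have pv: "pdom (%_. ?v) (%_. ?V) (%_. ?sg) ?v ?V ?sg" "pdom (%_. ?xi) (%_. ?D) (%_. ?ta) ?xi ?D ?ta" using tv tx by (auto simp: tdom_def)
 note iA = A_tendsto(1)[OF pv] and iB = bdry_tendsto(1)[OF tv tx]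
 have iF: "integrable M (%y. f y * ?v y powr (- \<gamma>) * ?xi y)" by (rule f_tendsto(1)[OF tv tx _ c1]) simp
 have iG: "integrable B (%y. g y * ?sg y powr (- \<eta>) * ?ta y)" by (rule g_tendsto(1)[OF tv tx _ c2]) simp
 note iE = good_energy_tendsto(2,3)[OF gd]
 have 1: "(LINT y|M. A y (?V y) \<bullet> ?D y) <= (LINT y|M. - (2 * \<alpha> * (1/2) powr p) * norm (G y) powr p)"
 proof (rule integral_mono_AE[OF iA])
  show "integrable M (%y. - (2 * \<alpha> * (1/2) powr p) * norm (G y) powr p)" using iE by simp
  show "AE y in M. A y (?V y) \<bullet> ?D y <= - (2 * \<alpha> * (1/2) powr p) * norm (G y) powr p"
   using ct_AE(1) AE_space
  proof eventually_elim
   case (elim y)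
   \<comment> \<open>The direction is -2 times the base gradient, which makes the term -2 A(V)
     \<bullet> V.\<close>
   have V: "?V y = (1/2) *\<^sub>R G y" "?D y = - (2 *\<^sub>R ((1/2) *\<^sub>R G y))" using elim scaleR_left_diff_distrib[of 1 "1/2" "G y"] by simp_all
   have "\<alpha> * norm ((1/2) *\<^sub>R G y) powr p <= A y ((1/2) *\<^sub>R G y) \<bullet> ((1/2) *\<^sub>R G y)" using elim by (intro coerc(2)) simp
   moreover have "norm ((1/2) *\<^sub>R G y) powr p = (1/2) powr p * norm (G y) powr p" using powr_mult[of "1/2" "norm (G y)" p] by simp
   ultimately show ?case unfolding V(1) unfolding V(2) inner_minus_right inner_scaleR_right[of _ 2] by simp
  qed
 qed
 have 2: "- (LINT y|M. f y * ?v y powr (- \<gamma>) * ?xi y) <= (LINT y|M. \<bar>f y\<bar> * \<bar>u y\<bar>)"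
  unfolding integral_minus[symmetric]
 proof (rule integral_mono_AE[OF _ fu_tendsto(1)])
  show "integrable M (%y. - (f y * ?v y powr (- \<gamma>) * ?xi y))" using iF by simp
  show "AE y in M. - (f y * ?v y powr (- \<gamma>) * ?xi y) <= \<bar>f y\<bar> * \<bar>u y\<bar>"
   using ct_AE(1) ut_nonneg(1) f(2)
  \<comment> \<open>Where u \<ge> 1 the singular factor is at most 1 and the term is bounded by f u;
    where u < 1 it has the favourable sign.\<close>
  proof eventually_elim
   case (elim y)
   have x: "?xi y = 1 - u y" "?v y = (1 + u y) / 2" using elim by (simp_all add: field_simps)
   show ?case
   proof (cases "u y >= 1")
    case True
    then have "((1 + u y) / 2) powr (- \<gamma>) <= 1 powr (- \<gamma>)" using \<gamma> by (intro powr_mono2') auto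
    then have "f y * ((1 + u y) / 2) powr (- \<gamma>) * (u y - 1) <= f y * 1 * u y" using True elim by (intro mult_mono) auto
    then show ?thesis unfolding x(2) unfolding x(1) using elim by (simp add: algebra_simps)
   next
    case False
    then have "0 <= f y * ((1 + u y) / 2) powr (- \<gamma>) * (1 - u y)" using elim by simp
    moreover have "0 <= \<bar>f y\<bar> * \<bar>u y\<bar>" by simp
    ultimately show ?thesis unfolding x(2) unfolding x(1) by linarith
   qed
  qed
 qed
 have 3: "(LINT y|B. bdry y (?sg y) * ?ta y) - (LINT y|B. g y * ?sg y powr (- \<eta>) * ?ta y) <= (LINT y|B. CB - 1/2 * (1/2) powr (s + 1) * \<bar>t y\<bar> powr (s + 1))"
  unfolding Bochner_Integration.integral_diff[OF iB iG, symmetric]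
 proof (rule integral_mono_AE)
  show "integrable B (%y. bdry y (?sg y) * ?ta y - g y * ?sg y powr (- \<eta>) * ?ta y)" using iB iG by (rule Bochner_Integration.integrable_diff)
  show "integrable B (%y. CB - 1/2 * (1/2) powr (s + 1) * \<bar>t y\<bar> powr (s + 1))" using iE by simp
  show "AE y in B. bdry y (?sg y) * ?ta y - g y * ?sg y powr (- \<eta>) * ?ta y <= CB - 1/2 * (1/2) powr (s + 1) * \<bar>t y\<bar> powr (s + 1)"
   using ct_AE(2) ut_nonneg(2) lam(2) g(2) Lambda(2)
  proof eventually_elim
   case (elim y)
   have x: "?ta y = 1 - t y" "?sg y = (1 + t y) / 2" "\<bar>t y\<bar> = t y" using elim by (simp_all add: field_simps)
   show ?case unfolding x(2) unfolding x(1,3) using elim by (intro boundary_coercive) auto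
  qed
 qed
 \<comment> \<open>The source term costs only half of the coercivity constant, so it can be absorbed
   on the left.\<close>
 have "(LINT y|M. \<bar>f y\<bar> * \<bar>u y\<bar>) <= kp0 / 2 * EE G t + Cf"
 proof (rule LIMSEQ_le[OF fu_tendsto(2)])
  show "(%k. kp0 / 2 * energy (w k) + Cf) ----> kp0 / 2 * EE G t + Cf" by (intro tendsto_intros good_energy_tendsto(1)[OF gd])
  show "EX N. \<forall>n\<ge>N. (LINT y|M. \<bar>f y\<bar> * \<bar>w n y\<bar>) <= kp0 / 2 * energy (w n) + Cf" using Cf[OF w_cpt] by blast
 qed
 moreover have "0 <= - (2 * \<alpha> * (1/2) powr p) * (LINT y|M. norm (G y) powr p) + (LINT y|M. \<bar>f y\<bar> * \<bar>u y\<bar>) +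
   (CB * measure B (space B) - 1/2 * (1/2) powr (s + 1) * (LINT y|B. \<bar>t y\<bar> powr (s + 1)))"
 proof -
  have "(LINT y|B. CB - 1/2 * (1/2) powr (s + 1) * \<bar>t y\<bar> powr (s + 1)) = CB * measure B (space B) - 1/2 * (1/2) powr (s + 1) * (LINT y|B. \<bar>t y\<bar> powr (s + 1))"
   using iE by simp
  moreover have "(LINT y|M. - (2 * \<alpha> * (1/2) powr p) * norm (G y) powr p) = - (2 * \<alpha> * (1/2) powr p) * (LINT y|M. norm (G y) powr p)" by simp
  ultimately show ?thesis using T 1 2 3 unfolding TT_def by linarith
 qed
 moreover have "kp0 * (LINT y|M. norm (G y) powr p) <= (2 * \<alpha> * (1/2) powr p) * (LINT y|M. norm (G y) powr p)"
  by (intro mult_right_mono) (auto simp: kp0_def)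
 moreover have "kp0 * (LINT y|B. \<bar>t y\<bar> powr (s + 1)) <= 1/2 * (1/2) powr (s + 1) * (LINT y|B. \<bar>t y\<bar> powr (s + 1))"
  by (intro mult_right_mono) (auto simp: kp0_def)
 moreover have "kp0 * EE G t = kp0 * (LINT y|M. norm (G y) powr p) + kp0 * (LINT y|B. \<bar>t y\<bar> powr (s + 1))" by (simp add: EE_def distrib_left)
 ultimately have "kp0 * EE G t <= 2 * (Cf + CB * measure B (space B))" by (simp add: field_simps)
 then show ?thesis using kp0 by (simp add: pos_le_divide_eq mult.commute)
qed

end

section \<open>The variational inequality at the limit, free of the energy constraint\<close>

lemma bounded_integrable:
 fixes h ph :: "'x => real"
 assumes i: "integrable N h" and [measurable]: "ph \<in> borel_measurable N" and m: "AE y in N. \<bar>ph y\<bar> <= m"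
 shows "integrable N (%y. h y * ph y)"
proof (rule Bochner_Integration.integrable_bound)
 show "integrable N (%y. m * h y)" using i by simp
 have [measurable]: "h \<in> borel_measurable N" using i by (rule borel_measurable_integrable)
 show "(%y. h y * ph y) \<in> borel_measurable N" by measurable
 show "AE y in N. norm (h y * ph y) <= norm (m * h y)" using m
 proof eventually_elim
  case (elim y)
  then have "\<bar>ph y\<bar> * \<bar>h y\<bar> <= \<bar>m\<bar> * \<bar>h y\<bar>" by (intro mult_right_mono) auto
  then show ?case by (simp add: abs_mult mult.commute)
 qed
qed

locale solution_point = minty_point +
 assumes Elt: "EE G t < R"
begin

lemma EE_nonneg: "0 <= EE G t" by (simp add: EE_def)

text \<open>The energies of w k tend to a value strictly below R, and the energy is convex along the
  segment from w k to w k + xi k. Hence sufficiently small steps eventually stay in the ball,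
  whatever the direction.\<close>

lemma variational_inequality_small:
 assumes xi: "good xi xi' D ta" and c: "c > 0" "!!k y. y \<in> closure \<Omega> ==> w k y + xi k y >= c"
 shows "\<exists>e0>0. e0 <= 1/2 \<and> (\<forall>ep. 0 < ep --> ep <= e0 -->
   TT_shift ep xi' D ta xi' D ta >= 0)"
proof -
 define z where "z k = (%y. w k y + xi k y)" for k
 have "good z (%y. u y + xi' y) (%y. G y + D y) (%y. t y + ta y)"
  using good_lin[OF gd xi, of 1 1] by (simp add: z_def[abs_def])
 then have zE: "(%k. energy (z k)) ----> EE (%y. G y + D y) (%y. t y + ta y)" and cz: "!!k. cpt_smooth (z k)"
  using good_energy_tendsto(1) by (auto simp: good_def)
 define E where "E = EE G t"
 define E1 where "E1 = EE (%y. G y + D y) (%y. t y + ta y)"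
 have E1: "E1 >= 0" and E: "E >= 0" "E < R" using Elt EE_nonneg by (auto simp: E1_def E_def EE_def)
 \<comment> \<open>Makes ep times the limiting energy at the far end of the segment at most half of
   the room R - E.\<close>
 define e0 where "e0 = min (1/2) ((R - E) / (2 * (E1 + 1)))"
 have e0: "e0 > 0" "e0 <= 1/2"
 proof -
  show "e0 > 0" using E E1 by (simp add: e0_def)
  show "e0 <= 1/2" unfolding e0_def by (rule min.cobounded1)
 qed
 have "TT_shift ep xi' D ta xi' D ta >= 0" if e: "0 < ep" "ep <= e0" for ep
 proof (rule variational_inequality[OF xi c e(1)])
  show "ep <= 1" using e e0 by simp
  have lim: "(%k. (1 - ep) * energy (w k) + ep * energy (z k)) ----> (1 - ep) * E + ep * E1"
   unfolding E_def E1_def by (intro tendsto_intros zE good_energy_tendsto(1)[OF gd])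
  have "ep * (E1 + 1) <= (R - E) / (2 * (E1 + 1)) * (E1 + 1)" using e E1 by (intro mult_right_mono) (auto simp: e0_def)
  also have "... = (R - E) / 2" using E1 by (simp add: field_simps)
  finally have "ep * E1 + ep <= (R - E) / 2" by (simp add: distrib_left)
  moreover have "0 <= ep * E" using e E by simp
  moreover have "(E - y) + x < R" if "x + e <= (R - E) / 2" "0 <= y" "0 < e" "E < R" for x y e :: real using that by (simp add: field_simps)
  ultimately have "(E - ep * E) + ep * E1 < R" using e(1) E(2) by blast
  then have "(1 - ep) * E + ep * E1 < R" by (simp add: left_diff_distrib)
  then have "eventually (%k. (1 - ep) * energy (w k) + ep * energy (z k) < R) sequentially" by (rule order_tendstoD(2)[OF lim])
  then show "\<forall>\<^sub>F k in sequentially. energy (%y. w k y + ep * xi k y) <= R"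
  proof eventually_elim
   case (elim k)
   have "(%y. w k y + ep * xi k y) = cmb ep (w k) (z k)" by (rule ext) (simp add: cmb_def z_def algebra_simps)
   moreover have "energy (cmb ep (w k) (z k)) <= (1 - ep) * energy (w k) + ep * energy (z k)"
    by (rule energy_convex[OF w_cpt cz]) (use e e0 in auto)
   ultimately show ?case using elim by simp
  qed
 qed
 then show ?thesis using e0 by blast
qed

text \<open>In the direction 1 the diffusion term disappears, so both singular integrals at u + ep
  are bounded by a boundary integral that is bounded uniformly in ep. Fatou as ep tends to 0 gives
  integrability and positivity where the data are positive.\<close>

lemma singular_terms:
 shows "AE y in M. f y > 0 --> u y > 0" "integrable M (%y. f y * u y powr (- \<gamma>))"
  "AE y in B. g y > 0 --> t y > 0" "integrable B (%y. g y * t y powr (- \<eta>))"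
proof -
 have low: "1 <= w k y + ct y" if "y \<in> closure \<Omega>" for k y using ct(2)[OF that] w_pos[OF that, of k] by simp
 from variational_inequality_small[OF good_const[OF ct(1)] zero_less_one low]
 obtain e0 where e0: "e0 > 0" "e0 <= 1/2" and T: "!!ep. 0 < ep ==> ep <= e0 ==>
   TT (%y. u y + ep * ct y) (%y. G y + ep *\<^sub>R grad ct y) (%y. t y + ep * ct y) ct (grad ct) ct >= 0" by auto
 have iB: "integrable B (%y. \<bar>t y\<bar> powr (s + 1))" by (rule good_energy_tendsto(3)[OF gd])
 have iBp: "integrable B (%y. \<bar>t y\<bar> powr p)"
 proof -
  obtain K where K: "integrable B K" "AE y in B. (\<forall>k::nat. \<bar>t y\<bar> powr p <= K y) \<and> (%k. t y) ----> t y" by (rule pdom_B[OF upd])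
  show ?thesis by (rule Bochner_Integration.integrable_bound[OF K(1)]) (measurable, use K(2) in "eventually_elim, auto")
 qed
 \<comment> \<open>An integrable bound for the boundary nonlinearity at t + ep in the direction 1,
   valid for all ep \<le> 1, hence a constant K independent of ep.\<close>
 let ?Q = "%y. \<Lambda> * (2 powr p * (\<bar>t y\<bar> powr p + 1) + 1) + (2 powr (s + 1) * (\<bar>t y\<bar> powr (s + 1) + 1) + 1)"
 define K where "K = (LINT y|B. ?Q y)"
 have main: "integrable M (%y. f y * (u y + ep) powr (- \<gamma>)) \<and> (LINT y|M. f y * (u y + ep) powr (- \<gamma>)) <= K \<and>
   integrable B (%y. g y * (t y + ep) powr (- \<eta>)) \<and> (LINT y|B. g y * (t y + ep) powr (- \<eta>)) <= K" if e: "0 < ep" "ep <= e0" for ep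
 proof -
  note cc = cpt_tdom[OF ct(1)]
  let ?v = "%y. u y + ep * ct y" and ?V = "%y. G y + ep *\<^sub>R grad ct y" and ?sg = "%y. t y + ep * ct y"
  have tv: "tdom_const ?v ?V ?sg" using tdom_lin[OF utdom cc, of 1 ep] by (simp only: mult_1 scaleR_one)
  have c1: "AE y in M. \<forall>k::nat. ep <= ?v y" using ct_AE(1) ut_nonneg(1) by eventually_elim simp
  have c2: "AE y in B. \<forall>k::nat. ep <= ?sg y" using ct_AE(2) ut_nonneg(2) by eventually_elim simp
  have iF: "integrable M (%y. f y * ?v y powr (- \<gamma>) * ct y)" by (rule f_tendsto(1)[OF tv cc e(1) c1])
  have iG: "integrable B (%y. g y * ?sg y powr (- \<eta>) * ct y)" by (rule g_tendsto(1)[OF tv cc e(1) c2])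
  have eF: "f y * ?v y powr (- \<gamma>) * ct y = f y * (u y + ep) powr (- \<gamma>)" if "y \<in> space M" for y
   using that ct(2)[of y] closure_points by simp
  have eG: "g y * ?sg y powr (- \<eta>) * ct y = g y * (t y + ep) powr (- \<eta>)" if "y \<in> space B" for y
   using that ct(2)[of y] closure_points by simp
  have iF': "integrable M (%y. f y * (u y + ep) powr (- \<gamma>))" by (rule iffD1[OF Bochner_Integration.integrable_cong[OF refl eF] iF])
  have iG': "integrable B (%y. g y * (t y + ep) powr (- \<eta>))" by (rule iffD1[OF Bochner_Integration.integrable_cong[OF refl eG] iG])
  have IF: "(LINT y|M. f y * ?v y powr (- \<gamma>) * ct y) = (LINT y|M. f y * (u y + ep) powr (- \<gamma>))" by (rule Bochner_Integration.integral_cong[OF refl eF])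
  have IG: "(LINT y|B. g y * ?sg y powr (- \<eta>) * ct y) = (LINT y|B. g y * (t y + ep) powr (- \<eta>))" by (rule Bochner_Integration.integral_cong[OF refl eG])
  have "(LINT y|M. A y (?V y) \<bullet> grad ct y) = (LINT y|M. 0)"
   by (rule Bochner_Integration.integral_cong) (use ct(3) closure_points in auto)
  then have IA: "(LINT y|M. A y (?V y) \<bullet> grad ct y) = 0" by simp
  have IB: "(LINT y|B. bdry y (?sg y) * ct y) <= K" unfolding K_def
  proof (rule integral_mono_AE)
   show "integrable B (%y. bdry y (?sg y) * ct y)" by (rule bdry_tendsto(1)[OF tv cc])
   show "integrable B ?Q" using iB iBp by auto
   show "AE y in B. bdry y (?sg y) * ct y <= ?Q y"
    using Lambda(2) ct_AE(2)
   proof eventually_elim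
    case (elim y)
    have "\<bar>ep\<bar> <= 1" using e e0 by simp
    then have "\<bar>t y + ep * 1\<bar> powr q <= 2 powr q * (\<bar>t y\<bar> powr q + 1)" if "q > 0" for q
     using norm_perturb_powr_le[of ep "t y" q "\<bar>t y\<bar> powr q" 1 1] that by simp
    then have 1: "\<bar>t y + ep * 1\<bar> powr p <= 2 powr p * (\<bar>t y\<bar> powr p + 1)" "\<bar>t y + ep * 1\<bar> powr (s + 1) <= 2 powr (s + 1) * (\<bar>t y\<bar> powr (s + 1) + 1)"
     using p1 s1 by auto
    have "bdry y (t y + ep * 1) * 1 <= \<bar>bdry y (t y + ep * 1) * 1\<bar>" by (rule abs_ge_self)
    also have "... <= \<Lambda> * (\<bar>t y + ep * 1\<bar> powr p + \<bar>1\<bar> powr p) + (\<bar>t y + ep * 1\<bar> powr (s + 1) + \<bar>1\<bar> powr (s + 1))"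
     using elim by (intro bdry_bound) auto
    also have "... <= ?Q y" using 1 Lambda(1) by (intro add_mono mult_left_mono) auto
    finally show ?case using elim by simp
   qed
  qed
  have "0 <= (LINT y|M. f y * (u y + ep) powr (- \<gamma>))" by (rule integral_nonneg_AE) (use f(2) in "eventually_elim, simp")
  moreover have "0 <= (LINT y|B. g y * (t y + ep) powr (- \<eta>))" by (rule integral_nonneg_AE) (use g(2) in "eventually_elim, simp")
  ultimately show ?thesis using T[OF e] IA IB iF' iG' unfolding TT_def IF IG by auto
 qed
 show "AE y in M. f y > 0 --> u y > 0" "integrable M (%y. f y * u y powr (- \<gamma>))"
  using singular_limit_integrable[of f M u \<gamma> e0 K] main f(2) ut_nonneg(1) \<gamma> e0(1) by auto
 show "AE y in B. g y > 0 --> t y > 0" "integrable B (%y. g y * t y powr (- \<eta>))"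
  using singular_limit_integrable[of g B t \<eta> e0 K] main g(2) ut_nonneg(2) \<eta> e0(1) by auto
qed

definition RR where "RR ph D ta = TT u G t ph D ta"

text \<open>Lets the step tend to 0 in the variational inequality. Boundedness of the direction is
  what allows dominated convergence in the singular terms, whose limits are already known to be
  integrable.\<close>

lemma RR_nonneg:
 assumes xi: "good xi xi' D ta" and c: "c > 0" "!!k y. y \<in> closure \<Omega> ==> w k y + xi k y >= c"
  and m: "AE y in M. \<bar>xi' y\<bar> <= m" "AE y in B. \<bar>ta y\<bar> <= m"
 shows "RR xi' D ta >= 0"
proof -
 obtain e0 where e0: "e0 > 0" "e0 <= 1/2" and T: "!!ep. 0 < ep ==> ep <= e0 ==>
   TT_shift ep xi' D ta xi' D ta >= 0"
  using variational_inequality_small[OF xi c] by blast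
 define e where "e n = e0 / real (Suc n)" for n
 have e: "0 < e n" "e n <= e0" for n using e0 by (auto simp: e_def divide_simps mult_le_cancel_left1)
 have e_lim: "e ----> 0" unfolding e_def[abs_def] by (rule LIMSEQ_Suc[OF lim_const_over_n])
 have eh: "e n <= 1/2" for n using e(2) e0(2) by (rule order_trans)
 have ea: "\<bar>e n\<bar> <= 1" for n using e(1)[of n] eh[of n] by simp
 have tx0: "tdom xi (%k. grad (xi k)) xi xi' D ta" using xi by (simp add: good_def)
 have tx: "tdom_const xi' D ta" by (rule tdom_limit[OF tx0])
 have tv: "tdom (%n y. u y + e n * xi' y) (%n y. G y + e n *\<^sub>R D y) (%n y. t y + e n * ta y) u G t"
  by (rule tdom_perturb[OF utdom tx ea e_lim])
 have pv: "pdom (%n y. u y + e n * xi' y) (%n y. G y + e n *\<^sub>R D y) (%n y. t y + e n * ta y) u G t" "pdom (%_. xi') (%_. D) (%_. ta) xi' D ta"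
  using tv tx by (auto simp: tdom_def)
 have px: "pdom xi (%k. grad (xi k)) xi xi' D ta" "pdom w (%k. grad (w k)) w u G t" using tx0 wtdom by (auto simp: tdom_def)
 note [measurable] = pdom_measurable(4-6)[OF px(1)]
 have l1: "AE y in M. (%k. xi k y) ----> xi' y" by (rule pdom_M[OF px(1)]) (auto elim!: eventually_mono)
 have l2: "AE y in M. (%k. w k y) ----> u y" by (rule pdom_M[OF px(2)]) (auto elim!: eventually_mono)
 have l3: "AE y in B. (%k. xi k y) ----> ta y" by (rule pdom_B[OF px(1)]) (auto elim!: eventually_mono)
 have l4: "AE y in B. (%k. w k y) ----> t y" by (rule pdom_B[OF px(2)]) (auto elim!: eventually_mono)
 have b1: "AE y in M. \<bar>xi' y\<bar> <= m \<and> u y + xi' y >= 0"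
  using l1 l2 m(1) AE_space
 proof eventually_elim
  case (elim y)
  have "(%k. w k y + xi k y) ----> u y + xi' y" using elim by (intro tendsto_add)
  moreover have "0 <= w k y + xi k y" for k using c(2)[of y k] c(1) closure_points elim by simp
  ultimately have "0 <= u y + xi' y" by (intro LIMSEQ_le_const) auto
  then show ?case using elim by simp
 qed
 have b2: "AE y in B. \<bar>ta y\<bar> <= m \<and> t y + ta y >= 0"
  using l3 l4 m(2) AE_space
 proof eventually_elim
  case (elim y)
  have "(%k. w k y + xi k y) ----> t y + ta y" using elim by (intro tendsto_add)
  moreover have "0 <= w k y + xi k y" for k using c(2)[of y k] c(1) closure_points elim by simp
  ultimately have "0 <= t y + ta y" by (intro LIMSEQ_le_const) auto
  then show ?case using elim by simp
 qed
 have n1: "AE y in M. 0 <= f y \<and> (0 < f y --> 0 < u y)" using f(2) singular_terms(1) by eventually_elim simp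
 have n2: "AE y in B. 0 <= g y \<and> (0 < g y --> 0 < t y)" using g(2) singular_terms(3) by eventually_elim simp
 have L: "(%n. TT (%y. u y + e n * xi' y) (%y. G y + e n *\<^sub>R D y) (%y. t y + e n * ta y) xi' D ta) ----> RR xi' D ta"
  unfolding RR_def TT_def
  by (intro tendsto_diff tendsto_add A_tendsto(3)[OF pv] bdry_tendsto(3)[OF tv tx]
   singular_term_tendsto[OF _ _ _ n1 singular_terms(2) b1 \<gamma> e(1) eh e_lim]
   singular_term_tendsto[OF _ _ _ n2 singular_terms(4) b2 \<eta> e(1) eh e_lim]) measurable
 show ?thesis by (rule LIMSEQ_le_const[OF L]) (use T e in auto)
qed

lemma RR_integrable:
 assumes ph: "tdom_const ph D ta" and m: "AE y in M. \<bar>ph y\<bar> <= m" "AE y in B. \<bar>ta y\<bar> <= m"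
 shows "integrable M (%y. A y (G y) \<bullet> D y)" "integrable B (%y. bdry y (t y) * ta y)"
  "integrable M (%y. f y * u y powr (- \<gamma>) * ph y)" "integrable B (%y. g y * t y powr (- \<eta>) * ta y)"
proof -
 have p: "pdom (%_. ph) (%_. D) (%_. ta) ph D ta" using ph by (simp add: tdom_def)
 note pm = pdom_measurable(4-6)[OF p]
 show "integrable M (%y. A y (G y) \<bullet> D y)" by (rule A_tendsto(1)[OF upd p])
 show "integrable B (%y. bdry y (t y) * ta y)" by (rule bdry_tendsto(1)[OF utdom ph])
 show "integrable M (%y. f y * u y powr (- \<gamma>) * ph y)" by (rule bounded_integrable[OF singular_terms(2) pm(1) m(1)])
 show "integrable B (%y. g y * t y powr (- \<eta>) * ta y)" by (rule bounded_integrable[OF singular_terms(4) pm(3) m(2)])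
qed

lemma RR_lin:
 assumes ph: "tdom_const ph D ta" and m: "AE y in M. \<bar>ph y\<bar> <= m" "AE y in B. \<bar>ta y\<bar> <= m"
  and ps: "tdom_const ps E sg" and m': "AE y in M. \<bar>ps y\<bar> <= m'" "AE y in B. \<bar>sg y\<bar> <= m'"
 shows "RR (%y. a * ph y + b * ps y) (%y. a *\<^sub>R D y + b *\<^sub>R E y) (%y. a * ta y + b * sg y) = a * RR ph D ta + b * RR ps E sg"
 unfolding RR_def by (rule TT_combination[OF RR_integrable[OF ph m] RR_integrable[OF ps m']])

definition R1 where "R1 = RR ct (grad ct) ct"

text \<open>Weakens the strictly positive lower bound to a nonnegative one: adding c times
  \<open>ct\<close> restores the bound c, and by linearity this changes the residual by c times the
  fixed number \<open>R1\<close>, which is made negligible.\<close>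

lemma RR_perturbed_nonneg:
 assumes xi: "good xi xi' D ta" and low: "!!k y. y \<in> closure \<Omega> ==> w k y + xi k y >= 0"
  and m: "AE y in M. \<bar>xi' y\<bar> <= m" "AE y in B. \<bar>ta y\<bar> <= m"
 shows "RR xi' D ta >= 0"
proof -
 have tx0: "tdom xi (%k. grad (xi k)) xi xi' D ta" using xi by (simp add: good_def)
 have tx: "tdom_const xi' D ta" by (rule tdom_limit[OF tx0])
 have c1: "AE y in M. \<bar>ct y\<bar> <= 1" "AE y in B. \<bar>ct y\<bar> <= 1" using ct_AE by (auto elim!: eventually_mono)
 have ge: "c * R1 + RR xi' D ta >= 0" if c: "c > 0" for c
 proof -
  have "0 <= RR (%y. c * ct y + 1 * xi' y) (%y. c *\<^sub>R grad ct y + 1 *\<^sub>R D y) (%y. c * ct y + 1 * ta y)"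
  proof (rule RR_nonneg[OF good_lin[OF good_const[OF ct(1)] xi] c, where m = "c + m"])
   show "c <= w k y + (c * ct y + 1 * xi k y)" if "y \<in> closure \<Omega>" for k y using low[OF that, of k] ct(2)[OF that] by simp
   show "AE y in M. \<bar>c * ct y + 1 * xi' y\<bar> <= c + m" using ct_AE(1) m(1) by eventually_elim (use c in "simp add: abs_le_iff")
   show "AE y in B. \<bar>c * ct y + 1 * ta y\<bar> <= c + m" using ct_AE(2) m(2) by eventually_elim (use c in "simp add: abs_le_iff")
  qed
  also have "... = c * R1 + 1 * RR xi' D ta" unfolding R1_def by (rule RR_lin[OF cpt_tdom[OF ct(1)] c1 tx m])
  finally show ?thesis by simp
 qed
 show ?thesis
 proof (rule ccontr)
  assume "\<not> ?thesis"
  then have neg: "RR xi' D ta < 0" by simp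
  define r where "r = \<bar>R1\<bar> + 1"
  have r: "r > 0" "R1 <= r" by (auto simp: r_def)
  define c where "c = - RR xi' D ta / (2 * r)"
  have c: "c > 0" using neg r by (simp add: c_def divide_neg_pos)
  have "c * R1 <= c * r" using c r by (intro mult_left_mono) auto
  also have "... = - RR xi' D ta / 2" using r by (simp add: c_def)
  finally show False using ge[OF c] neg by linarith
 qed
qed

end

text \<open>\<open>damp a\<close> decreases to the indicator of 0 as \<open>a\<close> grows; it serves as a smooth substitute for
 that indicator in test functions.\<close>

definition damp :: "real => real => real" where
 "damp a t = inverse (1 + (a * t) * (a * t))"

lemma damp_pos: "1 + (a * t) * (a * t) > (0::real)"
proof -
 have "0 <= (a * t) * (a * t)" by (rule zero_le_square)
 then show ?thesis by linarith
qed

lemma damp_bounds: "damp a t > 0" "damp a t <= 1" "damp a 0 = 1"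
 "\<bar>a * t\<bar> * damp a t <= 1" "2 * \<bar>a * t\<bar> * damp a t <= 1" "(a * t) * (a * t) * damp a t <= 1" "1 - damp a t = (a * t) * (a * t) * damp a t"
proof -
 note p = damp_pos[of a t]
 have sq: "0 <= (a * t) * (a * t)" by (rule zero_le_square)
 show "damp a t > 0" using p by (simp add: damp_def)
 show "damp a 0 = 1" by (simp add: damp_def)
 have 1: "damp a t = 1 / (1 + (a * t) * (a * t))" by (simp add: damp_def divide_inverse)
 have "2 * \<bar>z\<bar> <= 1 + z * z" for z :: real
  using zero_le_square[of "z - 1"] zero_le_square[of "z + 1"] by (auto simp: algebra_simps abs_if)
 then have 2: "2 * \<bar>a * t\<bar> <= 1 + (a * t) * (a * t)" .
 show "damp a t <= 1" unfolding 1 using sq p by (subst pos_divide_le_eq) auto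
 show d2: "2 * \<bar>a * t\<bar> * damp a t <= 1" unfolding 1 using 2 p by (simp add: pos_divide_le_eq)
 have "0 <= \<bar>a * t\<bar> * damp a t" using \<open>damp a t > 0\<close> by simp
 then show "\<bar>a * t\<bar> * damp a t <= 1" using d2 by linarith
 show e: "1 - damp a t = (a * t) * (a * t) * damp a t" unfolding 1 using p by (simp add: field_simps)
 show "(a * t) * (a * t) * damp a t <= 1" unfolding e[symmetric] using \<open>damp a t > 0\<close> by simp
qed

lemma damp_smooth: "smooth_on (damp a) UNIV"
proof -
 have "smooth_on (%t::real. 1 + (a * t) * (a * t)) UNIV"
  by (intro smooth_on_simps smooth_on_ident_real)
 from smooth_on_inverse[OF _ this] show ?thesis unfolding damp_def[abs_def] using damp_pos[of a] by (auto simp: less_le)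
qed

lemma damp_deriv: "(damp a has_real_derivative - (2 * a * (a * t) * (damp a t * damp a t))) (at t)"
 unfolding damp_def[abs_def] using damp_pos[of a t]
 by (auto intro!: derivative_eq_intros simp: power2_eq_square)

lemma damp_tendsto: "(%n. damp (real (Suc n)) t) ----> (if t = 0 then 1 else 0)"
proof (cases "t = 0")
 case True
 then show ?thesis by (simp add: damp_bounds)
next
 case False
 have "filterlim (%n. (t * t) * real n) at_top sequentially"
  by (rule filterlim_tendsto_pos_mult_at_top[OF tendsto_const _ filterlim_real_sequentially]) (use False in "auto simp: zero_less_mult_iff")
 then have "filterlim (%n. 1 + (real (Suc n) * t) * (real (Suc n) * t)) at_top sequentially"
 proof (rule filterlim_at_top_mono)
  show "\<forall>\<^sub>F n in sequentially. (t * t) * real n <= 1 + (real (Suc n) * t) * (real (Suc n) * t)"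
  proof (intro always_eventually allI)
   fix n
   have "real n <= real (Suc n) * real (Suc n)" by (simp add: distrib_left distrib_right)
   then have "(t * t) * real n <= (t * t) * (real (Suc n) * real (Suc n))" by (rule mult_left_mono) simp
   also have "... = (real (Suc n) * t) * (real (Suc n) * t)" by (simp only: mult_ac)
   finally show "(t * t) * real n <= 1 + (real (Suc n) * t) * (real (Suc n) * t)" by linarith
  qed
 qed
 then have "(%n. damp (real (Suc n)) t) ----> 0" unfolding damp_def by (rule tendsto_inverse_0_at_top)
 then show ?thesis using False by simp
qed

lemma damp_measurable [measurable]: "damp a \<in> borel_measurable borel"
 unfolding damp_def[abs_def] by measurable

lemma damp_integral_tendsto:
 fixes h v :: "'x => real"
 assumes h: "integrable N h" and [measurable]: "v \<in> borel_measurable N"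
 shows "(%n. \<integral>y. h y * (1 - damp (real (Suc n)) (v y)) \<partial>N) ----> (LINT y|N. (if v y = 0 then 0 else h y))"
  "integrable N (%y. h y * (1 - damp (real (Suc n)) (v y)))"
proof -
 have [measurable]: "h \<in> borel_measurable N" using h by (rule borel_measurable_integrable)
 have H: "integrable N (%y. \<bar>h y\<bar>)" using h by (rule integrable_abs)
 have AE: "AE y in N. (ALL n. \<bar>h y * (1 - damp (real (Suc n)) (v y))\<bar> <= \<bar>h y\<bar>) \<and>
   (%n. h y * (1 - damp (real (Suc n)) (v y))) ----> (if v y = 0 then 0 else h y)"
 proof (rule AE_I2)
  fix y
  have "\<bar>h y * (1 - damp (real (Suc n)) (v y))\<bar> <= \<bar>h y\<bar>" for n
   using damp_bounds(1,2)[of "real (Suc n)" "v y"] by (simp add: abs_mult mult_left_le)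
  moreover have "(%n. h y * (1 - damp (real (Suc n)) (v y))) ----> h y * (1 - (if v y = 0 then 1 else 0))"
   by (intro tendsto_intros damp_tendsto)
  ultimately show "(ALL n. \<bar>h y * (1 - damp (real (Suc n)) (v y))\<bar> <= \<bar>h y\<bar>) \<and>
   (%n. h y * (1 - damp (real (Suc n)) (v y))) ----> (if v y = 0 then 0 else h y)" by (simp split: if_splits)
 qed
 show "(%n. \<integral>y. h y * (1 - damp (real (Suc n)) (v y)) \<partial>N) ----> (LINT y|N. (if v y = 0 then 0 else h y))"
  by (rule dominated_tendsto(3)[OF _ _ H AE]) measurable
 show "integrable N (%y. h y * (1 - damp (real (Suc n)) (v y)))"
  by (rule dominated_tendsto(2)[OF _ _ H AE]) measurable
qed

context solution_point
begin

lemma bdry_sign: "AE y in B. 0 <= bdry y (t y) \<and> (t y = 0 --> bdry y (t y) = 0)"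
 using lam(2) ut_nonneg(2)
proof eventually_elim
 case (elim y)
 then have "0 <= opow (p - 2) (t y)" "0 <= opow (s - 1) (t y)" by (simp_all add: opow_nonneg)
 then show ?case using elim by (simp add: bdry_def opow_def)
qed

text \<open>Testing with \<open>-u damp a u\<close> shows that the gradient vanishes on the zero set of the solution.\<close>

lemma gradient_zero: "AE y in M. u y = 0 --> G y = 0"
proof -
 let ?I = "%y. A y (G y) \<bullet> G y"
 have iI: "integrable M ?I" by (rule A_tendsto(1)[OF upd upd])
 define F0 where "F0 = (LINT y|M. f y * u y powr (- \<gamma>)) + (LINT y|B. g y * t y powr (- \<eta>))"
 \<comment> \<open>The derivative of \<open>x * damp a x\<close>. It is bounded by 1 and tends to
   the indicator of 0 as a grows, so it localises the gradient term on the zero set.\<close>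
 define \<rho>' where "\<rho>' a x = damp a x - 2 * ((a * x) * (a * x)) * (damp a x * damp a x)" for a x
 have \<rho>b: "\<bar>\<rho>' a x\<bar> <= 1" for a x
 proof -
  let ?d = "damp a x" and ?s = "(a * x) * (a * x) * damp a x"
  have s: "0 <= ?s" "?s <= 1" using damp_bounds(1,6)[of a x] by auto
  have "\<rho>' a x = ?d * (1 - 2 * ?s)" by (simp add: \<rho>'_def algebra_simps)
  moreover have "\<bar>1 - 2 * z\<bar> <= 1" if "0 <= z" "z <= 1" for z :: real using that by auto
  then have "\<bar>1 - 2 * ?s\<bar> <= 1" using s by blast
  then have "\<bar>?d\<bar> * \<bar>1 - 2 * ?s\<bar> <= 1 * 1" using damp_bounds(1,2)[of a x] by (intro mult_mono) auto
  ultimately show ?thesis by (simp add: abs_mult)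
 qed
 have \<rho>m: "\<rho>' a \<in> borel_measurable borel" for a unfolding \<rho>'_def[abs_def] by measurable
 have \<rho>l: "(%n. \<rho>' (real (Suc n)) x) ----> (if x = 0 then 1 else 0)" for x
 proof -
  have e: "\<rho>' a x = damp a x * (2 * damp a x - 1)" for a
  proof -
   have "\<rho>' a x = damp a x - 2 * ((a * x) * (a * x) * damp a x) * damp a x" by (simp add: \<rho>'_def)
   then show ?thesis unfolding damp_bounds(7)[symmetric] by (simp add: algebra_simps)
  qed
  have "(%n. \<rho>' (real (Suc n)) x) ----> (if x = 0 then 1 else 0) * (2 * (if x = 0 then 1 else 0) - 1)"
   unfolding e by (intro tendsto_intros damp_tendsto)
  then show ?thesis by (simp split: if_splits)
 qed
 have bound: "(LINT y|M. \<rho>' a (u y) * ?I y) <= F0 / a" if a: "a >= 1" for a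
 proof -
  let ?th = "%x. (-1) * (x * damp a x)"
  have sm: "smooth_on ?th UNIV" by (intro smooth_on_simps smooth_on_ident_real damp_smooth)
  have dr: "(?th has_real_derivative - \<rho>' a x) (at x)" for x
   by (auto intro!: derivative_eq_intros damp_deriv simp: \<rho>'_def algebra_simps)
  then have d: "deriv ?th x = - \<rho>' a x" for x by (rule DERIV_imp_deriv)
  \<comment> \<open>The amplitude 1/a of the test function bounds the singular contributions by
    F0/a, with F0 finite by \<open>singular_terms\<close>.\<close>
  have thb: "\<bar>?th x\<bar> <= 1 / a" for x
  proof -
   have "a * \<bar>x * damp a x\<bar> <= 1" using damp_bounds(1,4)[of a x] a by (simp add: abs_mult mult_ac)
   then show ?thesis using a by (simp add: pos_le_divide_eq mult.commute)
  qed
  have a1: "1 / a <= 1" using a by simp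
  have th1: "\<bar>?th x\<bar> <= 1" "\<bar>deriv ?th x\<bar> <= 1" for x
  proof -
   show "\<bar>?th x\<bar> <= 1" by (rule order_trans[OF thb a1])
   show "\<bar>deriv ?th x\<bar> <= 1" unfolding d using \<rho>b[of a x] by simp
  qed
  have gc: "good (%k. ct) ct (grad ct) ct" by (rule good_const[OF ct(1)])
  have pc: "pdom (%k. ct) (%k. grad ct) (%k. ct) ct (grad ct) ct" using gc by (simp add: good_def tdom_def)
  have pw: "pdom w (%k. grad (w k)) w u G t" using wtdom by (simp add: tdom_def)
  have c1: "\<bar>ct y\<bar> <= 1" if "y \<in> closure \<Omega>" for y using ct(2)[OF that] by simp
  note gx = good_prod_compose[OF ct(1) pc c1 w_cpt pw sm th1]
  let ?xi = "%y. ct y * ?th (u y)" and ?D = "%y. ?th (u y) *\<^sub>R grad ct y + (ct y * deriv ?th (u y)) *\<^sub>R G y" and ?ta = "%y. ct y * ?th (t y)"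
  have m: "AE y in M. \<bar>?xi y\<bar> <= 1 / a" "AE y in B. \<bar>?ta y\<bar> <= 1 / a"
   using ct_AE thb by (auto elim!: eventually_mono)
  have R: "0 <= RR ?xi ?D ?ta"
  proof (rule RR_perturbed_nonneg[OF gx _ m])
   fix k y assume y: "y \<in> closure \<Omega>"
   have "w k y * damp a (w k y) <= w k y * 1" using damp_bounds(2)[of a "w k y"] w_pos[OF y, of k] by (intro mult_left_mono) auto
   then show "0 <= w k y + ct y * ?th (w k y)" using ct(2)[OF y] by simp
  qed
  have tx0: "tdom (%k x. ct x * ?th (w k x)) (%k. grad (%x. ct x * ?th (w k x))) (%k x. ct x * ?th (w k x)) ?xi ?D ?ta" using gx by (simp only: good_def)
  note i = RR_integrable[OF tdom_limit[OF tx0] m]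
  have i\<rho>: "integrable M (%y. ?I y * \<rho>' a (u y))"
   by (rule bounded_integrable[OF iI measurable_compose[OF umeas(1) \<rho>m]]) (use \<rho>b in auto)
  have 1: "(LINT y|M. A y (G y) \<bullet> ?D y) <= (LINT y|M. - (?I y * \<rho>' a (u y)))"
  proof (rule integral_mono_AE[OF i(1)])
   show "AE y in M. A y (G y) \<bullet> ?D y <= - (?I y * \<rho>' a (u y))"
    unfolding d using ct_AE(1) by eventually_elim (simp add: mult.commute)
  qed (use i\<rho> in simp)
  have 2: "(LINT y|B. bdry y (t y) * ?ta y) <= (LINT y|B. 0)"
  proof (rule integral_mono_AE[OF i(2)])
   show "AE y in B. bdry y (t y) * ?ta y <= 0"
    using ct_AE(2) ut_nonneg(2) bdry_sign
   proof eventually_elim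
    case (elim y)
    then have "0 <= bdry y (t y) * (t y * damp a (t y))" using damp_bounds(1)[of a "t y"] by simp
    then show ?case using elim by simp
   qed
  qed simp
  have 3: "(LINT y|M. - (f y * u y powr (- \<gamma>) * ?xi y)) <= (LINT y|M. f y * u y powr (- \<gamma>) * (1 / a))"
  proof (rule integral_mono_AE)
   show "integrable M (%y. - (f y * u y powr (- \<gamma>) * ?xi y))" using i(3) by (rule integrable_minus)
   show "integrable M (%y. f y * u y powr (- \<gamma>) * (1 / a))" using singular_terms(2) by simp
   show "AE y in M. - (f y * u y powr (- \<gamma>) * ?xi y) <= f y * u y powr (- \<gamma>) * (1 / a)"
    using m(1) f(2)
   proof eventually_elim
    case (elim y)
    then have "f y * u y powr (- \<gamma>) * (- ?xi y) <= f y * u y powr (- \<gamma>) * (1 / a)" by (intro mult_left_mono) auto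
    then show ?case by simp
   qed
  qed
  have 4: "(LINT y|B. - (g y * t y powr (- \<eta>) * ?ta y)) <= (LINT y|B. g y * t y powr (- \<eta>) * (1 / a))"
  proof (rule integral_mono_AE)
   show "integrable B (%y. - (g y * t y powr (- \<eta>) * ?ta y))" using i(4) by (rule integrable_minus)
   show "integrable B (%y. g y * t y powr (- \<eta>) * (1 / a))" using singular_terms(4) by simp
   show "AE y in B. - (g y * t y powr (- \<eta>) * ?ta y) <= g y * t y powr (- \<eta>) * (1 / a)"
    using m(2) g(2)
   proof eventually_elim
    case (elim y)
    then have "g y * t y powr (- \<eta>) * (- ?ta y) <= g y * t y powr (- \<eta>) * (1 / a)" by (intro mult_left_mono) auto
    then show ?case by simp
   qed
  qed
  have F: "F0 / a = (LINT y|M. f y * u y powr (- \<gamma>) * (1 / a)) + (LINT y|B. g y * t y powr (- \<eta>) * (1 / a))"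
   unfolding integral_mult_left_zero F0_def by (simp add: add_divide_distrib)
  have "(LINT y|M. \<rho>' a (u y) * ?I y) = (LINT y|M. ?I y * \<rho>' a (u y))" by (simp only: mult.commute)
  then show ?thesis using R 1 2 3 4 F unfolding RR_def TT_def integral_minus by simp
 qed
 have AE: "AE y in M. (ALL n. \<bar>\<rho>' (real (Suc n)) (u y) * ?I y\<bar> <= \<bar>?I y\<bar>) \<and>
  (%n. \<rho>' (real (Suc n)) (u y) * ?I y) ----> (if u y = 0 then 1 else 0) * ?I y"
 proof (rule AE_I2, intro conjI allI)
  fix y n
  show "\<bar>\<rho>' (real (Suc n)) (u y) * ?I y\<bar> <= \<bar>?I y\<bar>" using \<rho>b by (simp add: abs_mult mult_left_le_one_le)
  show "(%n. \<rho>' (real (Suc n)) (u y) * ?I y) ----> (if u y = 0 then 1 else 0) * ?I y" by (intro tendsto_mult \<rho>l tendsto_const)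
 qed
 have [measurable]: "\<rho>' a \<in> borel_measurable borel" for a by (rule \<rho>m)
 have m1: "(%y. \<rho>' a (u y) * ?I y) \<in> borel_measurable M" for a by measurable
 have m2: "(%y. (if u y = 0 then 1 else 0) * ?I y) \<in> borel_measurable M" by measurable
 note dt = dominated_tendsto[OF m1 m2 integrable_abs[OF iI] AE]
 \<comment> \<open>In the limit the integral of A(G) \<bullet> G over the zero set is at most 0. Its
   integrand is nonnegative by coercivity, hence zero almost everywhere there, and coercivity once
   more gives G = 0.\<close>
 have "(LINT y|M. (if u y = 0 then 1 else 0) * ?I y) <= 0"
 proof (rule LIMSEQ_le[OF dt(3)])
  show "(%n. F0 / real (Suc n)) ----> 0" by (rule LIMSEQ_Suc[OF lim_const_over_n])
  show "EX N. \<forall>n\<ge>N. (LINT y|M. \<rho>' (real (Suc n)) (u y) * ?I y) <= F0 / real (Suc n)" using bound by (intro exI[of _ 0]) auto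
 qed
 moreover have nn: "AE y in M. 0 <= (if u y = 0 then 1 else 0) * ?I y"
  using AE_space
 proof eventually_elim
  case (elim y)
  have "0 <= \<alpha> * norm (G y) powr p" using coerc(1) by simp
  then have "0 <= ?I y" using coerc(2)[of y "G y"] elim by simp
  then show ?case by simp
 qed
 moreover have "0 <= (LINT y|M. (if u y = 0 then 1 else 0) * ?I y)" by (rule integral_nonneg_AE[OF nn])
 ultimately have "(LINT y|M. (if u y = 0 then 1 else 0) * ?I y) = 0" by linarith
 then have "AE y in M. (if u y = 0 then 1 else 0) * ?I y = 0" using integral_nonneg_eq_0_iff_AE[OF dt(1) nn] by simp
 then show ?thesis using AE_space
 proof eventually_elim
  case (elim y)
  show ?case
  proof
   assume "u y = 0"
   then have "?I y = 0" using elim by simp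
   then have "\<alpha> * norm (G y) powr p <= 0" using coerc(2)[of y "G y"] elim by simp
   then have "norm (G y) powr p <= 0" using coerc(1) by (simp add: mult_le_0_iff)
   then show "G y = 0" by simp
  qed
 qed
qed

text \<open>A nonnegative direction is admissible, which gives one inequality. Its negative is not,
  but -kp ph (1 - damp a u) is for a suitable kp > 0, because the factor vanishes with u. Letting a
  grow recovers the opposite inequality up to the zero set, where every integrand vanishes.\<close>

lemma RR_bounded_nonneg_zero:
 assumes ph: "good ph ph' D ta" and b: "!!k y. y \<in> closure \<Omega> ==> 0 <= ph k y \<and> ph k y <= m" and m0: "m > 0"
 shows "RR ph' D ta = 0"
proof -
 have cph: "!!k. cpt_smooth (ph k)" and tph: "tdom ph (%k. grad (ph k)) ph ph' D ta" using ph by (auto simp: good_def)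
 have pph: "pdom ph (%k. grad (ph k)) ph ph' D ta" using tph by (simp add: tdom_def)
 have pw: "pdom w (%k. grad (w k)) w u G t" using wtdom by (simp add: tdom_def)
 have l1: "AE y in M. (%k. ph k y) ----> ph' y" by (rule pdom_M[OF pph]) (auto elim!: eventually_mono)
 have l2: "AE y in B. (%k. ph k y) ----> ta y" by (rule pdom_B[OF pph]) (auto elim!: eventually_mono)
 have b1: "AE y in M. 0 <= ph' y \<and> ph' y <= m" using l1 AE_space
 proof eventually_elim
  case (elim y)
  then have "ALL k. 0 <= ph k y \<and> ph k y <= m" using b closure_points by simp
  then show ?case using LIMSEQ_le_const[OF elim(1), of 0] LIMSEQ_le_const2[OF elim(1), of m] by auto
 qed
 have b2: "AE y in B. 0 <= ta y \<and> ta y <= m" using l2 AE_space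
 proof eventually_elim
  case (elim y)
  then have "ALL k. 0 <= ph k y \<and> ph k y <= m" using b closure_points by simp
  then show ?case using LIMSEQ_le_const[OF elim(1), of 0] LIMSEQ_le_const2[OF elim(1), of m] by auto
 qed
 have ab: "AE y in M. \<bar>ph' y\<bar> <= m" using b1 by eventually_elim simp
 have ab': "AE y in B. \<bar>ta y\<bar> <= m" using b2 by eventually_elim simp
 note ab = ab ab'
 have babs: "\<bar>ph k y\<bar> <= m" if "y \<in> closure \<Omega>" for k y using b[OF that, of k] by simp
 have ge: "RR ph' D ta >= 0"
 proof (rule RR_perturbed_nonneg[OF ph _ ab])
  show "0 <= w k y + ph k y" if "y \<in> closure \<Omega>" for k y using b[OF that, of k] w_pos[OF that, of k] by simp
 qed
 note i = RR_integrable[OF tdom_limit[OF tph] ab]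
 define X where "X n = (LINT y|M. A y (G y) \<bullet> D y * (1 - damp (real (Suc n)) (u y))) + (LINT y|B. bdry y (t y) * ta y * (1 - damp (real (Suc n)) (t y)))
   - (LINT y|M. f y * u y powr (- \<gamma>) * ph' y * (1 - damp (real (Suc n)) (u y))) - (LINT y|B. g y * t y powr (- \<eta>) * ta y * (1 - damp (real (Suc n)) (t y)))" for n
 have X: "X n <= 0" for n
 proof -
  define a where "a = real (Suc n)"
  have a: "a > 0" by (simp add: a_def)
  \<comment> \<open>Since 1 - damp a w \<le> a w/2 and ph \<le> m, this factor makes the subtracted
    quantity at most w, so the approximant stays nonnegative.\<close>
  define kp where "kp = 2 / (a * m)"
  have kp: "kp > 0" using a m0 by (simp add: kp_def)
  let ?th = "%x. (- kp) * (1 + (-1) * damp a x)"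
  have sm: "smooth_on ?th UNIV" by (intro smooth_on_simps damp_smooth)
  have dr: "(?th has_real_derivative (- kp) * (2 * a * (a * x) * (damp a x * damp a x))) (at x)" for x
   by (auto intro!: derivative_eq_intros damp_deriv)
  then have d: "deriv ?th x = (- kp) * (2 * a * (a * x) * (damp a x * damp a x))" for x by (rule DERIV_imp_deriv)
  have thb: "\<bar>?th x\<bar> <= kp * (1 + a)" "\<bar>deriv ?th x\<bar> <= kp * (1 + a)" for x
  proof -
   have "\<bar>?th x\<bar> = kp * (1 - damp a x)" using kp damp_bounds(2)[of a x] by (simp add: abs_mult)
   also have "... <= kp * (1 + a)" using kp a damp_bounds(1)[of a x] by (intro mult_left_mono) auto
   finally show "\<bar>?th x\<bar> <= kp * (1 + a)" .
   have "\<bar>deriv ?th x\<bar> = kp * (a * ((2 * \<bar>a * x\<bar> * damp a x) * damp a x))"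
    unfolding d using kp a damp_bounds(1)[of a x] by (simp add: abs_mult mult_ac)
   also have "... <= kp * (a * (1 * 1))"
    using kp a damp_bounds(1,2,5)[of a x] by (intro mult_left_mono mult_mono) auto
   also have "... <= kp * (1 + a)" using kp by simp
   finally show "\<bar>deriv ?th x\<bar> <= kp * (1 + a)" .
  qed
  note gx = good_prod_compose[OF cph pph babs w_cpt pw sm thb]
  let ?xi = "%y. ph' y * ?th (u y)" and ?D = "%y. ?th (u y) *\<^sub>R D y + (ph' y * deriv ?th (u y)) *\<^sub>R G y" and ?ta = "%y. ta y * ?th (t y)"
  have m: "AE y in M. \<bar>?xi y\<bar> <= m * (kp * (1 + a))"
   using ab(1)
  proof eventually_elim
   case (elim y)
   show ?case unfolding abs_mult[of "ph' y"] by (rule mult_mono[OF elim thb(1)]) (use m0 in auto)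
  qed
  have m': "AE y in B. \<bar>?ta y\<bar> <= m * (kp * (1 + a))"
   using ab(2)
  proof eventually_elim
   case (elim y)
   show ?case unfolding abs_mult[of "ta y"] by (rule mult_mono[OF elim thb(1)]) (use m0 in auto)
  qed
  have R: "0 <= RR ?xi ?D ?ta"
  proof (rule RR_perturbed_nonneg[OF gx _ m m'])
   fix k y assume y: "y \<in> closure \<Omega>"
   have w0: "w k y > 0" by (rule w_pos[OF y])
   have "1 - damp a (w k y) = (a * w k y) * (\<bar>a * w k y\<bar> * damp a (w k y))" using damp_bounds(7)[of a "w k y"] a w0 by simp
   also have "... <= (a * w k y) * (1/2)" using damp_bounds(5)[of a "w k y"] a w0 by (intro mult_left_mono) auto
   finally have 1: "1 - damp a (w k y) <= a * w k y / 2" by simp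
   have "ph k y * (kp * (1 - damp a (w k y))) <= m * (kp * (a * w k y / 2))"
    using b[OF y, of k] 1 kp m0 damp_bounds(2)[of a "w k y"] by (intro mult_mono) auto
   also have "... = w k y" using a m0 by (simp add: kp_def)
   finally show "0 <= w k y + ph k y * ?th (w k y)" by (simp add: algebra_simps)
  qed
  have tx0: "tdom (%k x. ph k x * ?th (w k x)) (%k. grad (%x. ph k x * ?th (w k x))) (%k x. ph k x * ?th (w k x)) ?xi ?D ?ta" using gx by (simp only: good_def)
  note j = RR_integrable[OF tdom_limit[OF tx0] m m']
  note dI = damp_integral_tendsto(2)[OF i(1) umeas(1), of n, folded a_def]
  have 1: "(LINT y|M. A y (G y) \<bullet> ?D y) <= (LINT y|M. - kp * (A y (G y) \<bullet> D y * (1 - damp a (u y))))"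
  proof (rule integral_mono_AE[OF j(1)])
   show "integrable M (%y. - kp * (A y (G y) \<bullet> D y * (1 - damp a (u y))))" using dI by (rule integrable_mult_right)
   show "AE y in M. A y (G y) \<bullet> ?D y <= - kp * (A y (G y) \<bullet> D y * (1 - damp a (u y)))"
    using b1 ut_nonneg(1) AE_space
   proof eventually_elim
    case (elim y)
    have "0 <= \<alpha> * norm (G y) powr p" using coerc(1) by simp
    then have "0 <= A y (G y) \<bullet> G y" using coerc(2)[of y "G y"] elim by simp
    \<comment> \<open>Differentiating the damping factor produces an additional multiple of A(G)
      \<bullet> G. It enters with a minus sign and can therefore be dropped from an upper
      bound.\<close>
    then have "0 <= (ph' y * (kp * (2 * a * (a * u y) * (damp a (u y) * damp a (u y))))) * (A y (G y) \<bullet> G y)"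
     using elim kp a damp_bounds(1)[of a "u y"] by (intro mult_nonneg_nonneg) auto
    then show ?case unfolding d by (simp add: inner_add_right algebra_simps)
   qed
  qed
  have e: "- kp * (x * (1 - damp a z)) = x * ?th z" for x z by (simp add: algebra_simps)
  have "RR ?xi ?D ?ta <= - kp * X n"
  proof -
   have e1: "(LINT y|B. bdry y (t y) * ?ta y) = - kp * (LINT y|B. bdry y (t y) * ta y * (1 - damp a (t y)))"
    "(LINT y|M. f y * u y powr (- \<gamma>) * ?xi y) = - kp * (LINT y|M. f y * u y powr (- \<gamma>) * ph' y * (1 - damp a (u y)))"
    "(LINT y|B. g y * t y powr (- \<eta>) * ?ta y) = - kp * (LINT y|B. g y * t y powr (- \<eta>) * ta y * (1 - damp a (t y)))"
    unfolding integral_mult_right_zero[symmetric] e by (simp_all only: mult.assoc)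
   have "- kp * X n = (LINT y|M. - kp * (A y (G y) \<bullet> D y * (1 - damp a (u y)))) + - kp * (LINT y|B. bdry y (t y) * ta y * (1 - damp a (t y)))
    - - kp * (LINT y|M. f y * u y powr (- \<gamma>) * ph' y * (1 - damp a (u y))) - - kp * (LINT y|B. g y * t y powr (- \<eta>) * ta y * (1 - damp a (t y)))"
    unfolding X_def a_def[symmetric] integral_mult_right_zero by (simp only: right_diff_distrib distrib_left)
   then show ?thesis using 1 unfolding RR_def TT_def e1 by linarith
  qed
  then have "0 <= - kp * X n" using R by linarith
  then show ?thesis using kp by (simp add: mult_le_0_iff)
 qed
 \<comment> \<open>On the zero set G = 0 by \<open>gradient_zero\<close> and A vanishes at 0, so
   excluding that set does not change the integral.\<close>
 have z1: "(LINT y|M. (if u y = 0 then 0 else A y (G y) \<bullet> D y)) = (LINT y|M. A y (G y) \<bullet> D y)"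
 proof (rule integral_cong_AE)
  show "(%y. if u y = 0 then 0 else A y (G y) \<bullet> D y) \<in> borel_measurable M" using borel_measurable_integrable[OF i(1)] by measurable
  show "AE y in M. (if u y = 0 then 0 else A y (G y) \<bullet> D y) = A y (G y) \<bullet> D y"
   using gradient_zero A_zero by eventually_elim auto
 qed (rule borel_measurable_integrable[OF i(1)])
 have z2: "(LINT y|B. (if t y = 0 then 0 else bdry y (t y) * ta y)) = (LINT y|B. bdry y (t y) * ta y)"
 proof (rule integral_cong_AE)
  show "(%y. if t y = 0 then 0 else bdry y (t y) * ta y) \<in> borel_measurable B" using borel_measurable_integrable[OF i(2)] by measurable
  show "AE y in B. (if t y = 0 then 0 else bdry y (t y) * ta y) = bdry y (t y) * ta y"
   using bdry_sign by eventually_elim auto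
 qed (rule borel_measurable_integrable[OF i(2)])
 \<comment> \<open>The value of \<open>0 powr\<close> any exponent is 0, so the singular integrands
   already vanish on the zero set.\<close>
 have z3: "(%y. if u y = 0 then 0 else f y * u y powr (- \<gamma>) * ph' y) = (%y. f y * u y powr (- \<gamma>) * ph' y)"
  "(%y. if t y = 0 then 0 else g y * t y powr (- \<eta>) * ta y) = (%y. g y * t y powr (- \<eta>) * ta y)" by auto
 have "X ----> RR ph' D ta"
  using tendsto_diff[OF tendsto_diff[OF tendsto_add[OF damp_integral_tendsto(1)[OF i(1) umeas(1)] damp_integral_tendsto(1)[OF i(2) umeas(3)]]
   damp_integral_tendsto(1)[OF i(3) umeas(1)]] damp_integral_tendsto(1)[OF i(4) umeas(3)]]
  unfolding z1 z2 z3 RR_def TT_def X_def[abs_def] .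
 then have "RR ph' D ta <= 0" by (rule LIMSEQ_le_const2) (use X in auto)
 then show ?thesis using ge by simp
qed

text \<open>Adding m times \<open>ct\<close> makes a direction bounded by m nonnegative; the
  residual is linear in the direction and vanishes at \<open>ct\<close> itself.\<close>

lemma RR_bounded_zero:
 assumes ph: "good ph ph' D ta" and b: "!!k y. y \<in> closure \<Omega> ==> \<bar>ph k y\<bar> <= m" and m0: "m > 0"
  and ab: "AE y in M. \<bar>ph' y\<bar> <= m" "AE y in B. \<bar>ta y\<bar> <= m"
 shows "RR ph' D ta = 0"
proof -
 have R1: "R1 = 0" unfolding R1_def
  by (rule RR_bounded_nonneg_zero[OF good_const[OF ct(1)], where m = 1]) (simp_all add: ct(2))
 have tx0: "tdom ph (%k. grad (ph k)) ph ph' D ta" using ph by (simp add: good_def)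
 have c1: "AE y in M. \<bar>ct y\<bar> <= 1" "AE y in B. \<bar>ct y\<bar> <= 1" using ct_AE by (auto elim!: eventually_mono)
 have "RR (%y. m * ct y + 1 * ph' y) (%y. m *\<^sub>R grad ct y + 1 *\<^sub>R D y) (%y. m * ct y + 1 * ta y) = 0"
 proof (rule RR_bounded_nonneg_zero[OF good_lin[OF good_const[OF ct(1)] ph], where m = "2 * m"])
  fix k y assume y: "y \<in> closure \<Omega>"
  show "0 <= m * ct y + 1 * ph k y \<and> m * ct y + 1 * ph k y <= 2 * m" using b[OF y, of k] ct(2)[OF y] by (simp add: abs_le_iff)
 qed (use m0 in simp)
 moreover have "RR (%y. m * ct y + 1 * ph' y) (%y. m *\<^sub>R grad ct y + 1 *\<^sub>R D y) (%y. m * ct y + 1 * ta y) = m * R1 + 1 * RR ph' D ta"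
  unfolding R1_def by (rule RR_lin[OF cpt_tdom[OF ct(1)] c1 tdom_limit[OF tx0] ab])
 ultimately show ?thesis using R1 by simp
qed

end

section \<open>Traces, weak gradients and admissible test functions\<close>

lemma sing_quot_eq: "sing_quot c x e = c * x powr (- e)"
 by (simp add: sing_quot_def powr_minus divide_inverse)

context singular_problem
begin

lemma pdom_powr_tendsto:
 assumes a: "pdom ph D ta ph' D' ta'"
 shows "integrable M (%y. \<bar>ph' y\<bar> powr p)" "!!k. integrable M (%y. \<bar>ph k y\<bar> powr p)" "(%k. \<integral>y. \<bar>ph k y\<bar> powr p \<partial>M) ----> (LINT y|M. \<bar>ph' y\<bar> powr p)"
  "integrable M (%y. norm (D' y) powr p)" "!!k. integrable M (%y. norm (D k y) powr p)" "(%k. \<integral>y. norm (D k y) powr p \<partial>M) ----> (LINT y|M. norm (D' y) powr p)"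
  "integrable B (%y. \<bar>ta' y\<bar> powr p)" "!!k. integrable B (%y. \<bar>ta k y\<bar> powr p)" "(%k. \<integral>y. \<bar>ta k y\<bar> powr p \<partial>B) ----> (LINT y|B. \<bar>ta' y\<bar> powr p)"
proof -
 obtain H where H: "integrable M H" "dominated_M H ph D ph' D'" by (rule pdom_M[OF a])
 obtain K where K: "integrable B K" "dominated_B K ta ta'" by (rule pdom_B[OF a])
 have p0: "p > 0" using p1 by simp
 note m = pdom_measurable[OF a]
 have 1: "AE y in M. (ALL k. norm (ph k y) powr p <= H y) \<and> (%k. ph k y) ----> ph' y" using H(2) by eventually_elim simp
 have 2: "AE y in M. (ALL k. norm (D k y) powr p <= H y) \<and> (%k. D k y) ----> D' y" using H(2) by eventually_elim simp
 have 3: "AE y in B. (ALL k. norm (ta k y) powr p <= K y) \<and> (%k. ta k y) ----> ta' y" using K(2) by eventually_elim simp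
 note c1 = dominated_powr_tendsto[OF p0 m(1,4) H(1) 1, unfolded real_norm_def]
 note c2 = dominated_powr_tendsto[OF p0 m(2,5) H(1) 2]
 note c3 = dominated_powr_tendsto[OF p0 m(3,6) K(1) 3, unfolded real_norm_def]
 show "integrable M (%y. \<bar>ph' y\<bar> powr p)" "integrable M (%y. \<bar>ph k y\<bar> powr p)" "(%k. \<integral>y. \<bar>ph k y\<bar> powr p \<partial>M) ----> (LINT y|M. \<bar>ph' y\<bar> powr p)" for k
  by (rule c1)+
 show "integrable M (%y. norm (D' y) powr p)" "integrable M (%y. norm (D k y) powr p)" "(%k. \<integral>y. norm (D k y) powr p \<partial>M) ----> (LINT y|M. norm (D' y) powr p)" for k
  by (rule c2)+
 show "integrable B (%y. \<bar>ta' y\<bar> powr p)" "integrable B (%y. \<bar>ta k y\<bar> powr p)" "(%k. \<integral>y. \<bar>ta k y\<bar> powr p \<partial>B) ----> (LINT y|B. \<bar>ta' y\<bar> powr p)" for k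
  by (rule c3)+
qed

text \<open>Uniqueness of the trace: the trace inequality holds with one constant along the
  approximants, so if function and gradient tend to 0 in the interior, the boundary limit must
  vanish too.\<close>

lemma trace_zero:
 assumes c: "!!k. cpt_smooth (ze k)" and a: "pdom ze (%k. grad (ze k)) ze ze' D' ta" and z: "AE y in M. ze' y = 0" "AE y in M. D' y = 0"
 shows "AE y in B. ta y = 0"
proof -
 note T = pdom_powr_tendsto[OF a]
 note m = pdom_measurable[OF a]
 obtain C where C: "C >= 0" "!!w. smooth_on w UNIV ==> (\<integral>\<^sup>+y. ennreal (\<bar>w y\<bar> powr p) \<partial>B) \<le>
   ennreal C * ((powr_int \<Omega> w p) + (grad_int \<Omega> w p))"
  using trace_inequality[OF op bd smb dim, of p] p1 by auto
 have le: "(LINT y|B. \<bar>ze k y\<bar> powr p) <= C * ((LINT y|M. \<bar>ze k y\<bar> powr p) + (LINT y|M. norm (grad (ze k) y) powr p))" for k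
 proof -
  have s: "smooth_on (ze k) UNIV" using c by (simp add: cpt_smooth_def)
  note [measurable] = smooth_on_measurable[OF s]
  have e1: "(\<integral>\<^sup>+z\<in>\<Omega>. ennreal (\<bar>ze k z\<bar> powr p) \<partial>lborel) = ennreal (LINT y|M. \<bar>ze k y\<bar> powr p)"
   using nn_integral_eq_integral[OF T(2)] nn_integral_M[of "%y. ennreal (\<bar>ze k y\<bar> powr p)"] by simp
  have e2: "(\<integral>\<^sup>+z\<in>\<Omega>. ennreal (norm (grad (ze k) z) powr p) \<partial>lborel) = ennreal (LINT y|M. norm (grad (ze k) y) powr p)"
   using nn_integral_eq_integral[OF T(5)] nn_integral_M[of "%y. ennreal (norm (grad (ze k) y) powr p)"] by simp
  have e3: "(\<integral>\<^sup>+y. ennreal (\<bar>ze k y\<bar> powr p) \<partial>B) = ennreal (LINT y|B. \<bar>ze k y\<bar> powr p)"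
   using nn_integral_eq_integral[OF T(8)] by simp
  have n: "0 <= (LINT y|M. \<bar>ze k y\<bar> powr p)" "0 <= (LINT y|M. norm (grad (ze k) y) powr p)" by auto
  have "ennreal (LINT y|B. \<bar>ze k y\<bar> powr p) <= ennreal (C * ((LINT y|M. \<bar>ze k y\<bar> powr p) + (LINT y|M. norm (grad (ze k) y) powr p)))"
   using C(2)[OF s] unfolding e1 e2 e3 ennreal_mult'[OF C(1)] ennreal_plus[OF n] .
  then show ?thesis using C(1) n by (subst (asm) ennreal_le_iff) auto
 qed
 have "(LINT y|M. \<bar>ze' y\<bar> powr p) = (LINT y|M. 0)"
  by (rule integral_cong_AE) (use z(1) borel_measurable_integrable[OF T(1)] in "auto elim!: eventually_mono")
 moreover have "(LINT y|M. norm (D' y) powr p) = (LINT y|M. 0)"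
  by (rule integral_cong_AE) (use z(2) borel_measurable_integrable[OF T(4)] in "auto elim!: eventually_mono")
 moreover have "(%k. C * ((LINT y|M. \<bar>ze k y\<bar> powr p) + (LINT y|M. norm (grad (ze k) y) powr p))) ----> C * ((LINT y|M. \<bar>ze' y\<bar> powr p) + (LINT y|M. norm (D' y) powr p))"
  by (intro tendsto_mult tendsto_add T(3,6) tendsto_const)
 ultimately have l: "(%k. C * ((LINT y|M. \<bar>ze k y\<bar> powr p) + (LINT y|M. norm (grad (ze k) y) powr p))) ----> 0" by simp
 have "(LINT y|B. \<bar>ta y\<bar> powr p) <= 0" by (rule LIMSEQ_le[OF T(9) l]) (use le in blast)
 moreover have "0 <= (LINT y|B. \<bar>ta y\<bar> powr p)" by simp
 ultimately have "(LINT y|B. \<bar>ta y\<bar> powr p) = 0" by linarith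
 then have "AE y in B. \<bar>ta y\<bar> powr p = 0" using integral_nonneg_eq_0_iff_AE[OF T(7)] by simp
 then show ?thesis by eventually_elim simp
qed

lemma is_trace_good:
 assumes "good w u G t" shows "is_trace \<Omega> p u G t"
proof -
 have a: "pdom w (%k. grad (w k)) w u G t" and c: "!!k. cpt_smooth (w k)" using assms by (auto simp: good_def tdom_def)
 note T = pdom_powr_tendsto[OF pdom_lin[OF a pdom_limit_bounds[OF a], of 1 "-1"]]
 have e0: "(%k. ennreal (x k)) ----> 0" if "x ----> 0" for x using tendsto_ennrealI[OF that] by simp
 have e: "1 * x + - 1 * z = x - z" "1 *\<^sub>R X + - 1 *\<^sub>R Z = X - Z" for x z :: real and X Z :: 'a by simp_all
 note T' = T[unfolded e]
 have 1: "(\<integral>\<^sup>+ y. ennreal (\<bar>w k y - u y\<bar> powr p) \<partial>M) = ennreal (LINT y|M. \<bar>w k y - u y\<bar> powr p)" for k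
  using nn_integral_eq_integral[OF T'(2)] by simp
 have 2: "(\<integral>\<^sup>+ y. ennreal (norm (grad (w k) y - G y) powr p) \<partial>M) = ennreal (LINT y|M. norm (grad (w k) y - G y) powr p)" for k
  using nn_integral_eq_integral[OF T'(5)] by simp
 have 3: "(\<integral>\<^sup>+ y. ennreal (\<bar>w k y - t y\<bar> powr p) \<partial>B) = ennreal (LINT y|B. \<bar>w k y - t y\<bar> powr p)" for k
  using nn_integral_eq_integral[OF T'(8)] by simp
 have l: "(%k. \<integral>y. \<bar>w k y - u y\<bar> powr p \<partial>M) ----> 0" "(%k. \<integral>y. norm (grad (w k) y - G y) powr p \<partial>M) ----> 0"
  "(%k. \<integral>y. \<bar>w k y - t y\<bar> powr p \<partial>B) ----> 0" using T'(3,6,9) by simp_all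
 show ?thesis unfolding is_trace_def
 proof (intro conjI exI[of _ w] allI)
  show "t \<in> borel_measurable B" by (rule pdom_measurable(6)[OF a])
  show "smooth_on (w k) UNIV" "compact (closure {x. w k x ~= 0})" for k using c[of k] by (auto simp: cpt_smooth_def)
 qed (unfold 1 2 3, (rule e0 l)+)
qed

text \<open>Integration by parts holds for each approximant because its product with a test function
  is compactly supported in the domain; both sides then converge by domination.\<close>

lemma weak_grad_good:
 assumes "good w u G t" shows "W1p \<Omega> p u G"
proof -
 have a: "pdom w (%k. grad (w k)) w u G t" and c: "!!k. cpt_smooth (w k)" using assms by (auto simp: good_def tdom_def)
 note T = pdom_powr_tendsto[OF a]
 note m = pdom_measurable[OF a]
 obtain H where H: "integrable M H" "dominated_M H w (%k. grad (w k)) u G" by (rule pdom_M[OF a])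
 have "(LINT y|M. u y * (grad ph y \<bullet> i)) = - (LINT y|M. (G y \<bullet> i) * ph y)" if t: "test_fun \<Omega> ph" and i: "i \<in> Basis" for ph i
 proof -
  have cp: "cpt_smooth ph" using t by (simp add: test_fun_def cpt_smooth_def)
  obtain C where C: "C > 0" "!!x. \<bar>ph x\<bar> <= C" "!!x. norm (grad ph x) <= C" using cpt_smooth_bounded[OF cp] by blast
  note pm = cpt_measurable[OF cp]
  note [measurable] = m pm(1,2)
  have one: "x <= 1 + z" if "0 <= x" "x powr p <= z" for x z using powr_le_one_add[of x 1 p] p1 that by simp
  let ?H = "%y. (1 + H y) * C"
  have Hi: "integrable M ?H" using H(1) by simp
  have A1: "AE y in M. (ALL k. \<bar>w k y * (grad ph y \<bullet> i)\<bar> <= ?H y) \<and> (%k. w k y * (grad ph y \<bullet> i)) ----> u y * (grad ph y \<bullet> i)"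
   using H(2)
  proof eventually_elim
   case (elim y)
   have g: "\<bar>grad ph y \<bullet> i\<bar> <= C" using Basis_le_norm[OF i, of "grad ph y"] C(3)[of y] by simp
   have "\<bar>w k y * (grad ph y \<bullet> i)\<bar> <= ?H y" for k
   proof -
    have "\<bar>w k y\<bar> <= 1 + H y" using elim by (intro one) auto
    then show ?thesis unfolding abs_mult using g by (intro mult_mono) auto
   qed
   moreover have "(%k. w k y * (grad ph y \<bullet> i)) ----> u y * (grad ph y \<bullet> i)" using elim by (intro tendsto_intros) auto
   ultimately show ?case by blast
  qed
  have A2: "AE y in M. (ALL k. \<bar>(grad (w k) y \<bullet> i) * ph y\<bar> <= ?H y) \<and> (%k. (grad (w k) y \<bullet> i) * ph y) ----> (G y \<bullet> i) * ph y"
   using H(2)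
  proof eventually_elim
   case (elim y)
   have "\<bar>(grad (w k) y \<bullet> i) * ph y\<bar> <= ?H y" for k
   proof -
    have "norm (grad (w k) y) <= 1 + H y" using elim by (intro one) auto
    then have "\<bar>grad (w k) y \<bullet> i\<bar> <= 1 + H y" using Basis_le_norm[OF i, of "grad (w k) y"] by linarith
    then show ?thesis unfolding abs_mult using C(2)[of y] by (intro mult_mono) auto
   qed
   moreover have "(%k. (grad (w k) y \<bullet> i) * ph y) ----> (G y \<bullet> i) * ph y" using elim by (intro tendsto_intros) auto
   ultimately show ?case by blast
  qed
  have m1: "(%y. w k y * (grad ph y \<bullet> i)) \<in> borel_measurable M" "(%y. (grad (w k) y \<bullet> i) * ph y) \<in> borel_measurable M" for k by measurable
  have m2: "(%y. u y * (grad ph y \<bullet> i)) \<in> borel_measurable M" "(%y. (G y \<bullet> i) * ph y) \<in> borel_measurable M" by measurable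
  note D1 = dominated_tendsto[OF m1(1) m2(1) Hi A1] and D2 = dominated_tendsto[OF m1(2) m2(2) Hi A2]
  have parts: "(LINT y|M. w k y * (grad ph y \<bullet> i)) + (LINT y|M. (grad (w k) y \<bullet> i) * ph y) = 0" for k
  proof -
   have s: "smooth_on (w k) UNIV" "smooth_on ph UNIV" using c[of k] cp by (auto simp: cpt_smooth_def)
   let ?F = "%x. w k x * ph x"
   have F: "cpt_smooth ?F" by (rule cpt_smooth_mult[OF s(1) cp])
   have [measurable]: "grad ?F \<in> borel_measurable borel" using F smooth_on_measurable(2)[of ?F] by (simp add: cpt_smooth_def)
   have g: "grad ?F y \<bullet> i = w k y * (grad ph y \<bullet> i) + (grad (w k) y \<bullet> i) * ph y" for y
    unfolding grad_mult[OF s] by (simp add: inner_add_left mult.commute)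
   \<comment> \<open>This permits replacing the integral over the domain by one over the whole
     space, where the integral of a derivative vanishes.\<close>
   have zero: "grad ?F y = 0" if "y \<notin> \<Omega>" for y
   proof (rule grad_eq_0_outside)
    have "closure {x. ?F x ~= 0} <= closure {x. ph x ~= 0}" by (intro closure_mono) auto
    then show "y \<notin> closure {x. ?F x ~= 0}" using that t by (auto simp: test_fun_def)
   qed
   have "(LINT y|M. w k y * (grad ph y \<bullet> i)) + (LINT y|M. (grad (w k) y \<bullet> i) * ph y) = (LINT y|M. grad ?F y \<bullet> i)"
    unfolding g by (rule Bochner_Integration.integral_add[symmetric]) (rule D1(2), rule D2(2))
   also have "... = (LINT y|lebesgue. indicator \<Omega> y *\<^sub>R (grad ?F y \<bullet> i))"
    by (subst integral_restrict_space) (auto simp: set_lebesgue_integral_def)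
   also have "... = (LINT y|lebesgue. grad ?F y \<bullet> i)"
    by (rule Bochner_Integration.integral_cong) (use zero in "auto simp: indicator_def")
   also have "... = (LINT y|lborel. grad ?F y \<bullet> i)" by (rule integral_completion) measurable
   also have "... = 0" by (rule integral_partial_cpt_smooth(2)[OF F])
   finally show ?thesis .
  qed
  have "(%k::nat. 0::real) ----> (LINT y|M. u y * (grad ph y \<bullet> i)) + (LINT y|M. (G y \<bullet> i) * ph y)"
   using tendsto_add[OF D1(3) D2(3)] unfolding parts .
  then have "(LINT y|M. u y * (grad ph y \<bullet> i)) + (LINT y|M. (G y \<bullet> i) * ph y) = 0" by (rule LIMSEQ_unique[OF _ tendsto_const])
  then show ?thesis by linarith
 qed
 then show ?thesis unfolding W1p_def Lp_def weak_grad_def using T(1,4) m(4,5) by blast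
qed

text \<open>An abstract bounded test function comes with approximants that need not be uniformly
  bounded. A fast subsequence is truncated by a smooth function that is the identity on the range of
  the test function, so the interior limit is unchanged, and \<open>trace_zero\<close> shows that
  the trace is unchanged as well.\<close>

lemma test_good:
 assumes W: "W1p \<Omega> p ph D" and Li: "Linf M ph" and tr: "is_trace \<Omega> p ph D ta"
 shows "\<exists>ze m. good ze ph D ta \<and> m > 0 \<and> (ALL k. \<forall>y\<in>closure \<Omega>. \<bar>ze k y\<bar> <= m) \<and> (AE y in M. \<bar>ph y\<bar> <= m) \<and> (AE y in B. \<bar>ta y\<bar> <= m)"
proof -
 obtain z :: "nat => 'a => real" where z: "!!k. smooth_on (z k) UNIV \<and> compact (closure {x. z k x ~= 0})"
  and l1: "(%k. \<integral>\<^sup>+ y. ennreal (\<bar>z k y - ph y\<bar> powr p) \<partial>M) ----> 0"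
  and l2: "(%k. \<integral>\<^sup>+ y. ennreal (norm (grad (z k) y - D y) powr p) \<partial>M) ----> 0"
  and l3: "(%k. \<integral>\<^sup>+ y. ennreal (\<bar>z k y - ta y\<bar> powr p) \<partial>B) ----> 0" using tr unfolding is_trace_def by blast
 have ex: "EX k. (\<integral>\<^sup>+ y. ennreal (\<bar>z k y - ph y\<bar> powr p) \<partial>M) < ennreal ((1/2) ^ j) \<and>
   (\<integral>\<^sup>+ y. ennreal (norm (grad (z k) y - D y) powr p) \<partial>M) < ennreal ((1/2) ^ j) \<and>
   (\<integral>\<^sup>+ y. ennreal (\<bar>z k y - ta y\<bar> powr p) \<partial>B) < ennreal ((1/2) ^ j)" for j :: nat
 proof -
  have "0 < ennreal ((1/2) ^ j)" by simp
  then have "eventually (%k. (\<integral>\<^sup>+ y. ennreal (\<bar>z k y - ph y\<bar> powr p) \<partial>M) < ennreal ((1/2) ^ j) \<and>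
   (\<integral>\<^sup>+ y. ennreal (norm (grad (z k) y - D y) powr p) \<partial>M) < ennreal ((1/2) ^ j) \<and>
   (\<integral>\<^sup>+ y. ennreal (\<bar>z k y - ta y\<bar> powr p) \<partial>B) < ennreal ((1/2) ^ j)) sequentially"
   by (intro eventually_conj order_tendstoD(2)[OF l1] order_tendstoD(2)[OF l2] order_tendstoD(2)[OF l3])
  then show ?thesis by (rule eventually_happens'[OF sequentially_bot])
 qed
 from choice[OF allI, OF ex] obtain kp where kp: "ALL j. (\<integral>\<^sup>+ y. ennreal (\<bar>z (kp j) y - ph y\<bar> powr p) \<partial>M) < ennreal ((1/2) ^ j) \<and>
   (\<integral>\<^sup>+ y. ennreal (norm (grad (z (kp j)) y - D y) powr p) \<partial>M) < ennreal ((1/2) ^ j) \<and>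
   (\<integral>\<^sup>+ y. ennreal (\<bar>z (kp j) y - ta y\<bar> powr p) \<partial>B) < ennreal ((1/2) ^ j)" ..
 define ps where "ps j = z (kp j)" for j
 have cp: "cpt_smooth (ps j)" for j using z by (simp add: ps_def cpt_smooth_def)
 have pm: "ph \<in> borel_measurable M" "D \<in> borel_measurable M" "ta \<in> borel_measurable B"
  using W tr by (auto simp: W1p_def Lp_def is_trace_def)
 have p0: "p > 0" "p >= 0" using p1 by auto
 note cm = cpt_measurable[OF cp] and ci = cpt_integrable[OF cp p0(2)]
 have n1: "(\<integral>\<^sup>+ y. ennreal (norm (ps j y - ph y) powr p) \<partial>M) <= ennreal ((1/2) ^ j)" for j using kp by (simp add: ps_def less_imp_le)
 have n2: "(\<integral>\<^sup>+ y. ennreal (norm (grad (ps j) y - D y) powr p) \<partial>M) <= ennreal ((1/2) ^ j)" for j using kp by (simp add: ps_def less_imp_le)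
 have n3: "(\<integral>\<^sup>+ y. ennreal (norm (ps j y - ta y) powr p) \<partial>B) <= ennreal ((1/2) ^ j)" for j using kp by (simp add: ps_def less_imp_le)
 obtain H1 where H1: "integrable M H1" "AE y in M. (ALL k. norm (ps k y) powr p <= H1 y) \<and> (%k. ps k y) ----> ph y"
  using Lp_fast_dominated_around[OF p0(1) cm(1) pm(1) _ n1] ci(1) by auto
 obtain H2 where H2: "integrable M H2" "AE y in M. (ALL k. norm (grad (ps k) y) powr p <= H2 y) \<and> (%k. grad (ps k) y) ----> D y"
  using Lp_fast_dominated_around[OF p0(1) cm(2) pm(2) _ n2] ci(2) by auto
 obtain H3 where H3: "integrable B H3" "AE y in B. (ALL k. norm (ps k y) powr p <= H3 y) \<and> (%k. ps k y) ----> ta y"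
  using Lp_fast_dominated_around[OF p0(1) cm(3) pm(3) _ n3] ci(3) by auto
 have pd: "pdom ps (%k. grad (ps k)) ps ph D ta"
 proof (rule pdomI[of _ _ _ _ _ _ "%y. H1 y + H2 y" H3])
  show "AE y in M. (ALL k. \<bar>ps k y\<bar> powr p <= H1 y + H2 y \<and> norm (grad (ps k) y) powr p <= H1 y + H2 y) \<and> (%k. ps k y) ----> ph y \<and> (%k. grad (ps k) y) ----> D y"
   using H1(2) H2(2)
  proof eventually_elim
   case (elim y)
   have "0 <= H1 y" "0 <= H2 y" using elim order_trans[OF powr_ge_zero] by blast+
   then show ?case using elim by (auto intro: add_increasing add_increasing2)
  qed
 qed (use cm pm H1 H2 H3 in auto)
 obtain C0 where C0: "AE y in M. \<bar>ph y\<bar> <= C0" using Li by (auto simp: Linf_def)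
 have "max 1 C0 > 0" by (simp add: max_def)
 \<comment> \<open>The maximum with 1 only ensures a positive truncation level.\<close>
 from smooth_truncation[OF this] obtain th C where T: "smooth_on th UNIV \<and> th 0 = 0 \<and> (ALL t. \<bar>th t\<bar> <= C \<and> \<bar>deriv th t\<bar> <= C) \<and>
  (ALL t. \<bar>t\<bar> <= max 1 C0 --> th t = t \<and> deriv th t = 1)" by blast
 then have th: "smooth_on th UNIV" "!!t. \<bar>th t\<bar> <= C" "!!t. \<bar>deriv th t\<bar> <= C"
  "!!t. \<bar>t\<bar> <= max 1 C0 ==> th t = t \<and> deriv th t = 1" by blast+
 have pc: "pdom (%k. ct) (%k. grad ct) (%k. ct) ct (grad ct) ct" using cpt_tdom[OF ct(1)] by (simp add: tdom_def)
 have c1: "\<bar>ct y\<bar> <= 1" if "y \<in> closure \<Omega>" for y using ct(2)[OF that] by simp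
 note gx = good_prod_compose[OF ct(1) pc c1 cp pd th(1-3)]
 let ?xi = "%y. ct y * th (ph y)" and ?D = "%y. th (ph y) *\<^sub>R grad ct y + (ct y * deriv th (ph y)) *\<^sub>R D y" and ?ta = "%y. ct y * th (ta y)"
 have e1: "AE y in M. ?xi y = ph y" using C0 ct_AE(1) by eventually_elim (use th(4) in simp)
 have e2: "AE y in M. ?D y = D y" using C0 ct_AE(1) by eventually_elim (use th(4) in simp)
 have gxp: "pdom (%k x. ct x * th (ps k x)) (%k. grad (%x. ct x * th (ps k x))) (%k x. ct x * th (ps k x)) ?xi ?D ?ta"
  and gxc: "!!k. cpt_smooth (%x. ct x * th (ps k x))" using gx by (auto simp: good_def tdom_def)
 \<comment> \<open>No bound on the given trace is known at this point. The differences between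
   truncated and original approximants tend to 0 in the interior together with their gradients,
   hence also on the boundary; this yields the bound on the trace as well.\<close>
 have e3: "AE y in B. 1 * ?ta y + (-1) * ta y = 0"
 proof (rule trace_zero)
  let ?ze = "%k y. 1 * (ct y * th (ps k y)) + (-1) * ps k y"
  show "cpt_smooth (?ze k)" for k by (rule cpt_smooth_lin(1)[OF gxc cp])
  have g: "grad (?ze k) = (%y. 1 *\<^sub>R grad (%x. ct x * th (ps k x)) y + (-1) *\<^sub>R grad (ps k) y)" for k
   by (rule ext) (rule cpt_smooth_lin(2)[OF gxc cp])
  show "pdom ?ze (%k. grad (?ze k)) ?ze (%y. 1 * ?xi y + (-1) * ph y) (%y. 1 *\<^sub>R ?D y + (-1) *\<^sub>R D y) (%y. 1 * ?ta y + (-1) * ta y)"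
   unfolding g by (rule pdom_lin[OF gxp pd])
  show "AE y in M. 1 * ?xi y + (-1) * ph y = 0" using e1 by eventually_elim simp
  show "AE y in M. 1 *\<^sub>R ?D y + (-1) *\<^sub>R D y = 0" using e2 by eventually_elim simp
 qed
 then have e3: "AE y in B. ?ta y = ta y" by eventually_elim simp
 have gd: "good (%k x. ct x * th (ps k x)) ph D ta" by (rule good_cong[OF gx e1 e2 e3 pm])
 have C: "C + 1 > 0" using th(2)[of 0] by linarith
 have b: "\<bar>th x\<bar> <= C + 1" for x using th(2)[of x] by linarith
 have "ALL k. \<forall>y\<in>closure \<Omega>. \<bar>ct y * th (ps k y)\<bar> <= C + 1" using b ct(2) by simp
 moreover have "AE y in M. \<bar>ph y\<bar> <= C + 1" using e1 ct_AE(1)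
 proof eventually_elim
  case (elim y)
  then show ?case using b[of "ph y"] by simp
 qed
 moreover have "AE y in B. \<bar>ta y\<bar> <= C + 1" using e3 ct_AE(2)
 proof eventually_elim
  case (elim y)
  then show ?case using b[of "ta y"] by simp
 qed
 ultimately show ?thesis using gd C by blast
qed

end

context solution_point
begin

lemma opow_integrable: "integrable B (%y. opow (s - 1) (t y))"
proof (rule Bochner_Integration.integrable_bound)
 show "integrable B (%y. 1 + \<bar>t y\<bar> powr (s + 1))" using good_energy_tendsto(3)[OF gd] by simp
 show "(%y. opow (s - 1) (t y)) \<in> borel_measurable B" by (rule measurable_compose[OF umeas(3) opow_measurable])
 have "\<bar>opow (s - 1) (t y)\<bar> <= 1 + \<bar>t y\<bar> powr (s + 1)" for y
  using powr_le_one_add[of "\<bar>t y\<bar>" s "s + 1"] s1 by (simp add: opow_abs)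
 moreover have "0 <= 1 + \<bar>t y\<bar> powr (s + 1)" for y by (simp add: add_nonneg_nonneg)
 ultimately show "AE y in B. norm (opow (s - 1) (t y)) <= norm (1 + \<bar>t y\<bar> powr (s + 1))" by (intro AE_I2) simp
qed

lemma weak_formulation:
 assumes W: "W1p \<Omega> p ph D" and Li: "Linf M ph" and tr: "is_trace \<Omega> p ph D ta"
 shows "integrable M (%y. A y (G y) \<bullet> D y)" "integrable B (%y. lam y * opow (p - 2) (t y) * ta y)"
  "integrable B (%y. opow (s - 1) (t y) * ta y)" "integrable M (%y. sing_quot (f y) (u y) \<gamma> * ph y)"
  "integrable B (%y. sing_quot (g y) (t y) \<eta> * ta y)"
  "(LINT y|M. A y (G y) \<bullet> D y) + (LINT y|B. lam y * opow (p - 2) (t y) * ta y) + (LINT y|B. opow (s - 1) (t y) * ta y)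
   = (LINT y|M. sing_quot (f y) (u y) \<gamma> * ph y) + (LINT y|B. sing_quot (g y) (t y) \<eta> * ta y)"
proof -
 obtain ze m where z: "good ze ph D ta" "m > 0" "ALL k. \<forall>y\<in>closure \<Omega>. \<bar>ze k y\<bar> <= m" and m: "AE y in M. \<bar>ph y\<bar> <= m" "AE y in B. \<bar>ta y\<bar> <= m"
  using test_good[OF W Li tr] by blast
 have R: "RR ph D ta = 0" by (rule RR_bounded_zero[OF z(1) _ z(2) m]) (use z(3) in blast)
 have tz: "tdom ze (%k. grad (ze k)) ze ph D ta" using z(1) by (simp add: good_def)
 note i = RR_integrable[OF tdom_limit[OF tz] m]
 have tm: "ta \<in> borel_measurable B" using tr by (simp add: is_trace_def)
 show i1: "integrable M (%y. A y (G y) \<bullet> D y)" by (rule i(1))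
 show i3: "integrable B (%y. opow (s - 1) (t y) * ta y)" by (rule bounded_integrable[OF opow_integrable tm m(2)])
 have b: "lam y * opow (p - 2) (t y) * ta y = bdry y (t y) * ta y - opow (s - 1) (t y) * ta y" for y
  by (simp add: bdry_def algebra_simps)
 show "integrable B (%y. lam y * opow (p - 2) (t y) * ta y)" unfolding b by (rule Bochner_Integration.integrable_diff[OF i(2) i3])
 show "integrable M (%y. sing_quot (f y) (u y) \<gamma> * ph y)" unfolding sing_quot_eq by (rule i(3))
 show "integrable B (%y. sing_quot (g y) (t y) \<eta> * ta y)" unfolding sing_quot_eq by (rule i(4))
 show "(LINT y|M. A y (G y) \<bullet> D y) + (LINT y|B. lam y * opow (p - 2) (t y) * ta y) + (LINT y|B. opow (s - 1) (t y) * ta y)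
   = (LINT y|M. sing_quot (f y) (u y) \<gamma> * ph y) + (LINT y|B. sing_quot (g y) (t y) \<eta> * ta y)"
  using R unfolding b sing_quot_eq Bochner_Integration.integral_diff[OF i(2) i3] RR_def TT_def by linarith
qed

end

section \<open>Choice of the radius and conclusion\<close>

context singular_problem
begin

lemma solution_exists: "EX R w u G t. solution_point \<Omega> p s A l f lam g \<gamma> \<eta> \<alpha> \<omega> R w u G t"
proof -
 obtain Cf where Cf: "!!w. cpt_smooth w ==> (LINT y|M. \<bar>f y\<bar> * \<bar>w y\<bar>) <= kp0 / 2 * energy w + Cf"
  using f_energy_bound[of "kp0 / 2"] kp0 by auto
 define E0 where "E0 = 2 * (Cf + CB * measure B (space B)) / kp0"
 \<comment> \<open>R exceeds the energy of \<open>ct\<close>, so the ball contains a positive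
   function, and strictly exceeds the a priori bound \<open>E0\<close>. There is no circularity,
   since \<open>Cf\<close> and hence \<open>E0\<close> do not depend on R.\<close>
 define R where "R = max (energy ct) (max 0 E0) + 1"
 have R: "R > 0" "energy ct <= R" "E0 < R" by (auto simp: R_def)
 have "ct \<in> S0" unfolding S0_def using ct by (auto intro!: exI[of _ 1])
 then have ne: "CR R ~= {}" using R(2) by (auto simp: CR_def)
 obtain w u G t where s: "good w u G t" "ALL k. w k \<in> CR R"
  "\<forall>z\<in>CR R. TT z (grad z) z (%y. z y - u y) (%y. grad z y - G y) (%y. z y - t y) >= 0"
  using approximate_solution[OF R(1) ne] by blast
 interpret mp: minty_point \<Omega> p s A l f lam g \<gamma> \<eta> \<alpha> \<omega> R w u G t
  by unfold_locales (use s in auto)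
 have "EE G t < R" using mp.energy_apriori[OF R(2) Cf] R(3) by (simp add: E0_def)
 then have "solution_point \<Omega> p s A l f lam g \<gamma> \<eta> \<alpha> \<omega> R w u G t" by unfold_locales
 then show ?thesis by blast
qed

end

theorem theorem1:
  fixes \<Omega> :: "'a::euclidean_space set"
    and A :: "'a \<Rightarrow> 'a \<Rightarrow> 'a"
    and l f lam g :: "'a \<Rightarrow> real"
    and p s \<gamma> \<eta> \<alpha> \<omega> :: real
  assumes dim: "DIM('a) \<ge> 2"
    and \<Omega>: "open \<Omega>" "bounded \<Omega>" "smooth_boundary \<Omega>"
    and p: "1 < p" "p < real DIM('a)"
    and cara: "caratheodory \<Omega> A"
    and coerc: "\<alpha> > 0" "\<And>y h. y \<in> \<Omega> \<Longrightarrow> A y h \<bullet> h \<ge> \<alpha> * norm h powr p"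
    and growth: "\<omega> > 0" "Lp (lebesgue_on \<Omega>) (p / (p - 1)) l"
      "\<And>y h. y \<in> \<Omega> \<Longrightarrow> norm (A y h) \<le> l y + \<omega> * norm h powr (p - 1)"
    and mono: "\<And>y h k. y \<in> \<Omega> \<Longrightarrow> h \<noteq> k \<Longrightarrow> (A y h - A y k) \<bullet> (h - k) > 0"
    and f: "Lp (lebesgue_on \<Omega>) (real DIM('a) / p) f" "AE y in lebesgue_on \<Omega>. f y \<ge> 0"
    and lam: "Linf (boundary_measure \<Omega>) lam" "AE y in boundary_measure \<Omega>. lam y \<ge> 0"
    and g: "Linf (boundary_measure \<Omega>) g" "AE y in boundary_measure \<Omega>. g y \<ge> 0"
    and s: "s \<ge> 1"
    and \<gamma>: "0 < \<gamma>" "\<gamma> \<le> 1"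
    and \<eta>: "\<eta> > 0"
  shows "\<exists>u Du tu.
     W1p \<Omega> p u Du \<and> is_trace \<Omega> p u Du tu \<and>
     (AE y in lebesgue_on \<Omega>. f y > 0 \<longrightarrow> u y > 0) \<and>
     (AE y in boundary_measure \<Omega>. g y > 0 \<longrightarrow> tu y > 0) \<and>
     integrable (boundary_measure \<Omega>) (\<lambda>y. sing_quot (g y) (tu y) \<eta>) \<and>
     integrable (boundary_measure \<Omega>) (\<lambda>y. opow (s - 1) (tu y)) \<and>
     integrable (lebesgue_on \<Omega>) (\<lambda>y. sing_quot (f y) (u y) \<gamma>) \<and>
     (\<forall>\<phi> D\<phi> t\<phi>. W1p \<Omega> p \<phi> D\<phi> \<and> Linf (lebesgue_on \<Omega>) \<phi> \<and> is_trace \<Omega> p \<phi> D\<phi> t\<phi> \<longrightarrow>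
        integrable (lebesgue_on \<Omega>) (\<lambda>y. A y (Du y) \<bullet> D\<phi> y) \<and>
        integrable (boundary_measure \<Omega>) (\<lambda>y. lam y * opow (p - 2) (tu y) * t\<phi> y) \<and>
        integrable (boundary_measure \<Omega>) (\<lambda>y. opow (s - 1) (tu y) * t\<phi> y) \<and>
        integrable (lebesgue_on \<Omega>) (\<lambda>y. sing_quot (f y) (u y) \<gamma> * \<phi> y) \<and>
        integrable (boundary_measure \<Omega>) (\<lambda>y. sing_quot (g y) (tu y) \<eta> * t\<phi> y) \<and>
        (\<integral>y. A y (Du y) \<bullet> D\<phi> y \<partial>lebesgue_on \<Omega>)
        + (\<integral>y. lam y * opow (p - 2) (tu y) * t\<phi> y \<partial>boundary_measure \<Omega>)
        + (\<integral>y. opow (s - 1) (tu y) * t\<phi> y \<partial>boundary_measure \<Omega>)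
        = (\<integral>y. sing_quot (f y) (u y) \<gamma> * \<phi> y \<partial>lebesgue_on \<Omega>)
        + (\<integral>y. sing_quot (g y) (tu y) \<eta> * t\<phi> y \<partial>boundary_measure \<Omega>))"
proof -
 interpret singular_problem \<Omega> p s A l f lam g \<gamma> \<eta> \<alpha> \<omega>
  by unfold_locales (use assms in auto)
 obtain R w u G t where "solution_point \<Omega> p s A l f lam g \<gamma> \<eta> \<alpha> \<omega> R w u G t" using solution_exists by blast
 then interpret sp: solution_point \<Omega> p s A l f lam g \<gamma> \<eta> \<alpha> \<omega> R w u G t .
 show ?thesis
 proof (rule exI[of _ u], rule exI[of _ G], rule exI[of _ t], intro conjI allI impI)
  show "W1p \<Omega> p u G" by (rule weak_grad_good[OF sp.gd])
  show "is_trace \<Omega> p u G t" by (rule is_trace_good[OF sp.gd])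
  show "AE y in lebesgue_on \<Omega>. f y > 0 --> u y > 0" by (rule sp.singular_terms(1))
  show "AE y in boundary_measure \<Omega>. g y > 0 --> t y > 0" by (rule sp.singular_terms(3))
  show "integrable (boundary_measure \<Omega>) (%y. sing_quot (g y) (t y) \<eta>)" unfolding sing_quot_eq by (rule sp.singular_terms(4))
  show "integrable (boundary_measure \<Omega>) (%y. opow (s - 1) (t y))" by (rule sp.opow_integrable)
  show "integrable (lebesgue_on \<Omega>) (%y. sing_quot (f y) (u y) \<gamma>)" unfolding sing_quot_eq by (rule sp.singular_terms(2))
 qed (rule sp.weak_formulation; blast)+
qed

end
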